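(* Let $T>0$. Let $(u_0^\varepsilon)_{0<\varepsilon\le 1}$ be a family in $H^1(\mathbb{R}^n)$ with $\sup_{0<\varepsilon\le 1}\|u_0^\varepsilon\|_{H^1_\varepsilon}<\infty$ and $\limsup_{\varepsilon\to 0}\varepsilon^{n\sigma}\|u_0^\varepsilon\|_{L^{2\sigma+2}}^{2\sigma+2}=0$. Let $v^\varepsilon(t)=U_0^\varepsilon(t)u_0^\varepsilon$, and assume that $$\limsup_{\varepsilon\to0}\sup_{0\le t\le T}\varepsilon^{n\sigma}\|v^\varepsilon(t)\|_{L^{2\sigma+2}}^{2\sigma+2}>0 .$$ Then, up to the extraction of a subsequence (in $\varepsilon\to0$), there exist an orthogonal family $(t_j^\varepsilon,x_j^\varepsilon)_{j\in\mathbb{N}}$ in $\mathbb{R}_+\times\mathbb{R}^n$, a family $(\Psi_\ell^\varepsilon)_{\ell\in\mathbb{N}}$ bounded in $H^1_\varepsilon(\mathbb{R}^n)$, and a (nonempty) family $(\varphi_j)_{j\in\mathbb{N}}$ bounded in $\{\varphi\in L^2(\mathbb{R}^n)\,;\,|x|\varphi\in L^2(\mathbb{R}^n)\}$, such that, for all $\ell\in\mathbb{N}$, $$u_0^\varepsilon(x)=\Psi_\ell^\varepsilon(x)+r_\ell^\varepsilon(x),\qquad\text{with}\quad \limsup_{\varepsilon\to0}\|U_0^\varepsilon(t)r_\ell^\varepsilon\|_{L^\infty(\mathbb{R}_+,L^{2\sigma+2}_\varepsilon)}\xrightarrow[\ell\to\infty]{}0,$$ and, for every $\ell\in\mathbb{N}$,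 the following asymptotics holds in $L^2(\mathbb{R}^n)$ as $\varepsilon\to0$: $$\Psi_\ell^\varepsilon(x)=\sum_{j=0}^{\ell}\frac{1}{(t_j^\varepsilon)^{n/2}}\,\varphi_j\!\left(\frac{x-x_j^\varepsilon}{t_j^\varepsilon}\right)e^{-i\frac{|x-x_j^\varepsilon|^2}{2\varepsilon t_j^\varepsilon}}+o(1).$$ Moreover, $\limsup_{\varepsilon\to0}\frac{t_j^\varepsilon}{\varepsilon}=+\infty$ for all $j\in\mathbb{N}$, and there is a $j\in\mathbb{N}$ such that $\limsup_{\varepsilon\to0}t_j^\varepsilon\in[0,T]$.
   Context: Here $n\ge1$, $\varepsilon\in]0,1]$, $\sigma>2/n$, and $\sigma<2/(n-2)$ if $n\ge3$. Notation: $U_0^\varepsilon(t)=e^{i\varepsilon\frac t2\Delta}$ is the propagator of $i\varepsilon\partial_t v+\frac12\varepsilon^2\Delta v=0$ on $\mathbb{R}^n$. For functions $a^\varepsilon$ on $\mathbb{R}^n$, $\|a^\varepsilon\|_{H^1_\varepsilon}:=\|a^\varepsilon\|_{L^2}+\|\varepsilon\nabla a^\varepsilon\|_{L^2}$ and $\|a^\varepsilon\|_{L^{2\sigma+2}_\varepsilon}:=\varepsilon^{\frac{n\sigma}{2\sigma+2}}\|a^\varepsilon\|_{L^{2\sigma+2}}$; $a^\varepsilon$ is bounded in $H^1_\varepsilon$ if $\limsup_{\varepsilon\to0}\|a^\varepsilon\|_{H^1_\varepsilon}<\infty$. A family $(z_j^\varepsilon)_{j\in\mathbb{N}}$ of sequences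 in $\mathbb{R}^d$ is called orthogonal if for all $j\ne k$, $\limsup_{\varepsilon\to0}\frac{|z_j^\varepsilon-z_k^\varepsilon|}{\varepsilon}=\infty$. The space $\{\varphi\in L^2;|x|\varphi\in L^2\}$ carries the norm $\|\varphi\|_{L^2}+\||x|\varphi\|_{L^2}$. "Nonempty family" of profiles means that the $\varphi_j$ are not all identically zero. *)

theory Defs
  imports "HOL-Analysis.Analysis" "HOL-Probability.Essential_Supremum"
begin

text \<open>
  Elements of Lebesgue spaces are represented by Borel functions on \<open>real ^ 'n\<close>, with
  \<open>CARD('n)\<close> the dimension \<open>n \<ge> 1\<close>; identities between them are meant almost everywhere.
  All norms take values in \<open>[0, \<infinity>]\<close>.
\<close>

section \<open>Lebesgue norms\<close>

text \<open>Only used for exponents \<open>p > 0\<close>.\<close>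

definition ennreal_powr :: "ennreal \<Rightarrow> real \<Rightarrow> ennreal" where
  "ennreal_powr x p = (if x = \<infinity> then \<infinity> else ennreal (enn2real x powr p))"

definition Lp_norm :: "real \<Rightarrow> (real ^ 'n \<Rightarrow> 'b::real_normed_vector) \<Rightarrow> ennreal" where
  "Lp_norm p f = ennreal_powr (\<integral>\<^sup>+ x. ennreal (norm (f x) powr p) \<partial>lborel) (1 / p)"

definition in_L2 :: "(real ^ 'n \<Rightarrow> 'b::real_normed_vector) \<Rightarrow> bool" where
  "in_L2 f \<longleftrightarrow> f \<in> borel_measurable lborel \<and> Lp_norm 2 f < \<infinity>"

definition Lp_eps_norm :: "real \<Rightarrow> real \<Rightarrow> (real ^ 'n \<Rightarrow> complex) \<Rightarrow> ennreal" where
  "Lp_eps_norm \<sigma> \<epsilon> a =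
     ennreal (\<epsilon> powr (real CARD('n) * \<sigma> / (2 * \<sigma> + 2))) * Lp_norm (2 * \<sigma> + 2) a"

section \<open>Test functions and the Sobolev space\<close>

definition partial_deriv :: "'n \<Rightarrow> (real ^ 'n \<Rightarrow> complex) \<Rightarrow> real ^ 'n \<Rightarrow> complex" where
  "partial_deriv i f x = frechet_derivative f (at x) (axis i 1)"

definition laplacian :: "(real ^ 'n \<Rightarrow> complex) \<Rightarrow> real ^ 'n \<Rightarrow> complex" where
  "laplacian f x = (\<Sum>i\<in>UNIV. partial_deriv i (partial_deriv i f) x)"

primrec C_k :: "nat \<Rightarrow> (real ^ 'n \<Rightarrow> complex) \<Rightarrow> bool" where
  "C_k 0 f \<longleftrightarrow> continuous_on UNIV f"
| "C_k (Suc k) f \<longleftrightarrow> f differentiable_on UNIV \<and> (\<forall>i. C_k k (partial_deriv i f))"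

definition test_function :: "(real ^ 'n \<Rightarrow> complex) \<Rightarrow> bool" where
  "test_function \<phi> \<longleftrightarrow> (\<forall>k. C_k k \<phi>) \<and> compact (closure {x. \<phi> x \<noteq> 0})"

text \<open>\<open>G\<close> is a distributional gradient of \<open>f\<close> that lies in \<open>L\<^sup>2\<close>.\<close>

definition has_L2_gradient ::
    "(real ^ 'n \<Rightarrow> complex) \<Rightarrow> (real ^ 'n \<Rightarrow> complex ^ 'n) \<Rightarrow> bool" where
  "has_L2_gradient f G \<longleftrightarrow> in_L2 G \<and>
     (\<forall>\<phi> i. test_function \<phi> \<longrightarrow>
        (LINT x|lborel. f x * partial_deriv i \<phi> x) = - (LINT x|lborel. (G x $ i) * \<phi> x))"

definition in_H1 :: "(real ^ 'n \<Rightarrow> complex) \<Rightarrow> bool" where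
  "in_H1 f \<longleftrightarrow> in_L2 f \<and> (\<exists>G. has_L2_gradient f G)"

text \<open>The choice is unique almost everywhere, and only relevant when \<open>in_H1 f\<close> holds.\<close>

definition weak_gradient :: "(real ^ 'n \<Rightarrow> complex) \<Rightarrow> real ^ 'n \<Rightarrow> complex ^ 'n" where
  "weak_gradient f = (SOME G. has_L2_gradient f G)"

definition H1_eps_norm :: "real \<Rightarrow> (real ^ 'n \<Rightarrow> complex) \<Rightarrow> ennreal" where
  "H1_eps_norm \<epsilon> a = Lp_norm 2 a + Lp_norm 2 (\<lambda>x. \<epsilon> *\<^sub>R weak_gradient a x)"

section \<open>The free semiclassical Schroedinger propagator\<close>

text \<open>
  \<open>v\<close> is the solution in \<open>C(\<real>; L\<^sup>2)\<close> of
  \<open>\<i> \<epsilon> \<partial>\<^sub>t v + (\<epsilon>\<^sup>2 / 2) \<Delta> v = 0\<close>, \<open>v(0) = u\<close>, the equation being understood in the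
  sense of distributions in \<open>x\<close>.
\<close>

definition free_schroedinger_solution ::
    "real \<Rightarrow> (real ^ 'n \<Rightarrow> complex) \<Rightarrow> (real \<Rightarrow> real ^ 'n \<Rightarrow> complex) \<Rightarrow> bool" where
  "free_schroedinger_solution \<epsilon> u v \<longleftrightarrow>
     (\<forall>t. in_L2 (v t)) \<and>
     (\<forall>s. ((\<lambda>t. Lp_norm 2 (\<lambda>x. v t x - v s x)) \<longlongrightarrow> 0) (at s)) \<and>
     (AE x in lborel. v 0 x = u x) \<and>
     (\<forall>\<phi> t. test_function \<phi> \<longrightarrow>
        (\<exists>D. ((\<lambda>s. LINT x|lborel. v s x * \<phi> x) has_vector_derivative D) (at t) \<and>
             \<i> * complex_of_real \<epsilon> * D
               + complex_of_real (\<epsilon>\<^sup>2 / 2) * (LINT x|lborel. v t x * laplacian \<phi> x) = 0))"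

text \<open>
  The propagator \<open>exp (\<i> \<epsilon> (t/2) \<Delta>)\<close>. For \<open>u\<close> in \<open>L\<^sup>2\<close> and \<open>\<epsilon> > 0\<close> the solution exists, and
  at every time it is unique up to equality almost everywhere, so the choice only fixes a
  representative.
\<close>

definition free_propagator ::
    "real \<Rightarrow> real \<Rightarrow> (real ^ 'n \<Rightarrow> complex) \<Rightarrow> real ^ 'n \<Rightarrow> complex" where
  "free_propagator \<epsilon> t u = (SOME v. free_schroedinger_solution \<epsilon> u v) t"

section \<open>Profiles along a sequence of parameters\<close>

text \<open>Families indexed by \<open>\<epsilon>\<close> along a sequence \<open>e k \<rightarrow> 0\<close> are indexed by \<open>k\<close>.\<close>

definition orthogonal_family ::
    "(nat \<Rightarrow> real) \<Rightarrow> (nat \<Rightarrow> nat \<Rightarrow> 'b::real_normed_vector) \<Rightarrow> bool" where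
  "orthogonal_family e z \<longleftrightarrow>
     (\<forall>i j. i \<noteq> j \<longrightarrow> limsup (\<lambda>k. ereal (norm (z i k - z j k) / e k)) = \<infinity>)"

definition quadratic_profile ::
    "real \<Rightarrow> real \<Rightarrow> real ^ 'n \<Rightarrow> (real ^ 'n \<Rightarrow> complex) \<Rightarrow> real ^ 'n \<Rightarrow> complex" where
  "quadratic_profile \<epsilon> t y \<phi> x =
     complex_of_real (1 / t powr (real CARD('n) / 2)) * \<phi> ((x - y) /\<^sub>R t)
       * exp (- \<i> * complex_of_real ((norm (x - y))\<^sup>2 / (2 * \<epsilon> * t)))"

end

theory Submission
  imports Defs "HOL-Complex_Analysis.Complex_Analysis" "HOL-Probability.Distributions" "HOL-Real_Asymp.Real_Asymp"
begin

text \<open>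
  After rescaling by \<open>\<epsilon>\<close> the data are bounded in \<open>H\<^sup>1\<close>, and the unitary group generated by space
  translations and the free Schroedinger flow acts on them. This action is mixing, so profiles are
  extracted one at a time as weak limits along an ultrafilter, each time choosing parameters that nearly
  maximise the norm of the weak limit; orthogonality of the parameters gives Bessel's inequality, hence
  the profiles tend to zero. Convolution with the heat kernel tests against Gaussians, so the remainders
  are uniformly small after smoothing, and a telescoping sum over dyadic heat times, controlled by the
  \<open>H\<^sup>1\<close> bound, turns this into smallness in \<open>L\<^sup>p\<close>. Since the data are small in \<open>L\<^sup>p\<close> at time zero,
  the time parameters of nontrivial profiles tend to infinity, where the flow is asymptotically a dilation
  composed with a Fourier transform. All computations take place on the total set of complex Gaussians.
\<close>

section \<open>Ultrafilters and weak limits\<close>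

text \<open>In the extraction, one fixed ultrafilter makes every bounded sequence of vectors
  converge weakly and every sequence of parameters either converge or diverge, so the greedy choice
  ranges over all parameter sequences without thinning; a subsequence is taken only once, when
  countably many eventual properties must hold together. The upper bound on \<sigma> enters through
  the exponent \<sigma> + 1 - n \<sigma> / 2, whose positivity makes the dyadic sum geometric. The
  claim about [0, T] is obtained by imposing the first profile: its time parameter is the time at
  which the norm is large, and only the later profiles are chosen greedily. The weight |x| is the
  image of the derivative bound under the asymptotic Fourier transform, which turns translations
  into phases. That transform is never constructed by an integral: isometries come from equal Gram
  matrices of Gaussians or as strong limits of explicit operators. Since the propagator is a choice
  among weak solutions, their uniqueness is part of the proof; the obstacle is that Gaussians are
  not test functions and must be approximated together with their Laplacians.\<close>

definition ultra :: "'a filter => bool" where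
 "ultra F \<longleftrightarrow> F ~= bot & (\<forall>P. eventually P F \<or> eventually (%x. \<not> P x) F)"

lemma ultra_not_bot: "ultra F ==> F ~= bot"
 by (simp add: ultra_def)

lemma ultra_not: "ultra F ==> \<not> eventually P F ==> eventually (%x. \<not> P x) F"
 by (auto simp: ultra_def)

text \<open>Zorn's lemma for the proper filters finer than \<open>F\<close>, with the order
  reversed. An event of the infimum of a nonempty chain already belongs to one member, so the
  infimum stays proper. An extremal filter decides every predicate, for otherwise it could be
  refined by it.\<close>

lemma ultrafilter_exists:
 assumes "F ~= bot"
 obtains U where "U <= F" "ultra U"
proof -
 define A where "A = {G. G ~= bot & G <= F}"
 have "\<exists>m\<in>A. \<forall>a\<in>A. a <= m --> a = m"
 proof (rule predicate_Zorn[where P = "%a b. b <= a"])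
 show "partial_order_on A (relation_of (%a b. b <= a) A)"
 by (auto simp: partial_order_on_def preorder_on_def refl_on_def trans_def antisym_def relation_of_def)
 next
 fix C assume C: "C \<in> Chains (relation_of (%a b. b <= a) A)"
 show "\<exists>u\<in>A. \<forall>a\<in>C. u <= a"
 proof (cases "C = {}")
 case True then show ?thesis using assms by (auto simp: A_def)
 next
 case False
 have CA: "C \<subseteq> A" using C unfolding Chains_def relation_of_def by auto
 have ch: "a <= b \<or> b <= a" if "a \<in> C" "b \<in> C" for a b
 using C that unfolding Chains_def relation_of_def by auto
 have "eventually P (Inf C) \<longleftrightarrow> (\<exists>b\<in>C. eventually P b)" for P
 proof (rule eventually_Inf_base[OF False])
 fix a b assume "a \<in> C" "b \<in> C"
 then show "\<exists>x\<in>C. x <= inf a b" using ch[of a b] by (auto intro: bexI[of _ a] bexI[of _ b])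
 qed
 then have "Inf C ~= bot"
 using CA unfolding trivial_limit_def A_def by (auto simp: trivial_limit_def)
 moreover obtain c where "c \<in> C" using False by auto
 then have "Inf C <= F" using CA unfolding A_def by (auto intro: Inf_lower2)
 ultimately have "Inf C \<in> A" by (simp add: A_def)
 then show ?thesis by (auto intro: Inf_lower)
 qed
 qed
 then obtain m where m: "m \<in> A" "!!a. a \<in> A ==> a <= m ==> a = m" by blast
 have "ultra m"
 unfolding ultra_def
 proof (intro conjI allI)
 show "m ~= bot" using m by (simp add: A_def)
 fix P show "eventually P m \<or> eventually (%x. \<not> P x) m"
 proof (rule disjCI)
 assume n: "\<not> eventually (%x. \<not> P x) m"
 have "inf m (principal {x. P x}) \<in> A"
 using n m(1) by (auto simp: A_def trivial_limit_def eventually_inf_principal intro: le_infI1)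
 then have "inf m (principal {x. P x}) = m" by (rule m(2)) simp
 then have "eventually P (inf m (principal {x. P x})) = eventually P m" by simp
 then show "eventually P m" by (simp add: eventually_inf_principal)
 qed
 qed
 moreover have "m <= F" using m by (simp add: A_def)
 ultimately show ?thesis using that by blast
qed

text \<open>Compactness gives a cluster point; since an ultrafilter decides every neighbourhood, a
  cluster point is already a limit.\<close>

lemma ultra_compact_limit:
 fixes f :: "'a => 'b::topological_space"
 assumes U: "ultra U" and K: "compact K" and ev: "eventually (%x. f x \<in> K) U"
 shows "\<exists>l\<in>K. (f \<longlongrightarrow> l) U"
proof -
 have "filtermap f U ~= bot" using U by (simp add: ultra_def filtermap_bot_iff)
 moreover have "eventually (%x. x \<in> K) (filtermap f U)" using ev by (simp add: eventually_filtermap)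
 ultimately obtain l where l: "l \<in> K" "inf (nhds l) (filtermap f U) ~= bot"
 using K unfolding compact_filter by blast
 have "eventually (%x. f x \<in> S) U" if S: "open S" "l \<in> S" for S
 proof (rule ccontr)
 assume "\<not> ?thesis"
 then have 1: "eventually (%y. y \<notin> S) (filtermap f U)"
 using ultra_not[OF U] by (auto simp: eventually_filtermap)
 have 2: "eventually (%y. y \<in> S) (nhds l)" using S by (auto simp: eventually_nhds)
 have "eventually (%_. False) (inf (nhds l) (filtermap f U))"
 unfolding eventually_inf using 1 2 by blast
 then show False using l(2) by (simp add: trivial_limit_def)
 qed
 then have "(f \<longlongrightarrow> l) U" by (auto intro: topological_tendstoI)
 then show ?thesis using l(1) by blast
qed

lemma ultra_bounded_limit:
 fixes f :: "'a => 'b::euclidean_space"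
 assumes "ultra U" "eventually (%x. norm (f x) <= B) U"
 shows "\<exists>l. (f \<longlongrightarrow> l) U"
 using ultra_compact_limit[OF assms(1) compact_cball[of 0 B], of f] assms(2) by auto

subsection \<open>Orthogonal projection and the Riesz representation theorem\<close>

text \<open>A minimising sequence for the distance to \<open>K\<close> is Cauchy by the
  parallelogram law. The vector returned is the orthogonal component of \<open>x\<close>, the form
  used by the density criterion and by the Riesz theorem.\<close>

lemma orthogonal_projection:
 fixes K :: "'a::{real_inner,complete_space} set"
 assumes K: "subspace K" "closed K"
 obtains z where "x - z \<in> K" "!!k. k \<in> K ==> inner z k = 0"
proof -
 define d where "d = (INF k\<in>K. (norm (x - k))\<^sup>2)"
 have bdd: "bdd_below ((%k. (norm (x - k))\<^sup>2) ` K)" by (rule bdd_belowI[of _ 0]) auto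
 have ne: "K ~= {}" using subspace_0[OF K(1)] by auto
 have dle: "d <= (norm (x - k))\<^sup>2" if "k \<in> K" for k
 unfolding d_def using bdd that by (rule cINF_lower)
 have "\<exists>k\<in>K. (norm (x - k))\<^sup>2 < d + 1 / real (Suc n)" for n
 using cINF_less_iff[OF ne bdd, of "d + 1 / real (Suc n)"] by (simp add: d_def)
 then obtain k where k: "!!n. k n \<in> K" "!!n. (norm (x - k n))\<^sup>2 < d + 1 / real (Suc n)" by metis
 have par: "(norm (k m - k n))\<^sup>2 <= 2 / real (Suc m) + 2 / real (Suc n)" for m n
 proof -
 have "(1/2) *\<^sub>R (k m + k n) \<in> K" using k(1) K(1) by (auto intro!: subspace_scale subspace_add)
 from dle[OF this] have "4 * d <= (norm (2 *\<^sub>R (x - (1/2) *\<^sub>R (k m + k n))))\<^sup>2" by (simp add: power_mult_distrib)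
 also have "2 *\<^sub>R (x - (1/2) *\<^sub>R (k m + k n)) = (x - k m) + (x - k n)"
 by (simp add: algebra_simps scaleR_2)
 finally have "4 * d <= (norm ((x - k m) + (x - k n)))\<^sup>2" .
 moreover have "(norm ((x - k m) + (x - k n)))\<^sup>2 + (norm (k m - k n))\<^sup>2
 = 2 * (norm (x - k m))\<^sup>2 + 2 * (norm (x - k n))\<^sup>2"
 by (simp add: power2_norm_eq_inner inner_simps inner_commute)
 ultimately show ?thesis using k(2)[of m] k(2)[of n] by simp
 qed
 have "Cauchy k"
 proof (rule CauchyI)
 fix e :: real assume e: "e > 0"
 obtain N where N: "1 / real (Suc N) < e\<^sup>2 / 4"
 using nat_approx_posE[of "e\<^sup>2/4"] e by auto
 show "\<exists>M. \<forall>m\<ge>M. \<forall>n\<ge>M. norm (k m - k n) < e"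
 proof (intro exI allI impI)
 fix m n assume "N <= m" "N <= n"
 then have "2 / real (Suc m) + 2 / real (Suc n) <= 4 * (1 / real (Suc N))"
 using frac_le[of 2 2 "real (Suc N)" "real (Suc m)"] frac_le[of 2 2 "real (Suc N)" "real (Suc n)"] by simp
 with par[of m n] N have "(norm (k m - k n))\<^sup>2 < e\<^sup>2" by simp
 then show "norm (k m - k n) < e" using e by (meson norm_ge_zero not_less power2_less_imp_less less_imp_le)
 qed
 qed
 then obtain l where l: "k \<longlonglongrightarrow> l" using Cauchy_convergent convergent_def by blast
 have lK: "l \<in> K" using closed_sequentially[OF K(2)] k(1) l by blast
 have "(norm (x - l))\<^sup>2 <= d"
 proof (rule LIMSEQ_le)
 show "(%n. (norm (x - k n))\<^sup>2) \<longlonglongrightarrow> (norm (x - l))\<^sup>2" using l by (intro tendsto_intros)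
 show "(%n. d + 1 / real (Suc n)) \<longlonglongrightarrow> d"
 using LIMSEQ_inverse_real_of_nat[THEN tendsto_add[OF tendsto_const[of d]]] by (simp add: inverse_eq_divide)
 show "\<exists>N. \<forall>n\<ge>N. (norm (x - k n))\<^sup>2 <= d + 1 / real (Suc n)" using k(2) less_imp_le by blast
 qed
 then have min: "(norm (x - l))\<^sup>2 <= (norm (x - y))\<^sup>2" if "y \<in> K" for y
 by (rule order_trans[OF _ dle[OF that]])
 have "inner (x - l) y = 0" if y: "y \<in> K" for y
 proof (rule ccontr)
 assume nz: "inner (x - l) y ~= 0"
 then have ypos: "(norm y)\<^sup>2 > 0" by auto
 \<comment> \<open>The minimiser of the quadratic in \<open>t\<close>; a nonzero first variation in
   the direction \<open>y\<close> would beat the minimum there.\<close>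
 define t where "t = inner (x - l) y / (norm y)\<^sup>2"
 have "l + t *\<^sub>R y \<in> K" using lK y K(1) by (auto intro!: subspace_scale subspace_add)
 from min[OF this] have "(norm (x - l))\<^sup>2 <= (norm ((x - l) - t *\<^sub>R y))\<^sup>2" by (simp add: algebra_simps)
 also have "... = (norm (x - l))\<^sup>2 - 2 * t * inner (x - l) y + t\<^sup>2 * (norm y)\<^sup>2"
 using dot_norm_neg[of "x - l" "t *\<^sub>R y"] by (simp add: power_mult_distrib field_simps)
 also have "t\<^sup>2 * (norm y)\<^sup>2 = t * inner (x - l) y" using ypos by (simp add: t_def power2_eq_square)
 finally have "t * inner (x - l) y <= 0" by simp
 moreover have "t * inner (x - l) y = (inner (x - l) y)\<^sup>2 / (norm y)\<^sup>2" by (simp add: t_def power2_eq_square)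
 ultimately show False using nz ypos by (metis divide_pos_pos not_less zero_less_power2)
 qed
 then show ?thesis using that[of "x - l"] lK by simp
qed

lemma riesz_representation:
 fixes f :: "'a::{real_inner,complete_space} => real"
 assumes f: "bounded_linear f"
 obtains y where "!!x. f x = inner x y"
proof (cases "\<forall>x. f x = 0")
 case True then show ?thesis using that[of 0] by simp
next
 case False
 interpret bounded_linear f by fact
 obtain x where x: "f x ~= 0" using False by blast
 define K where "K = {x. f x = 0}"
 have "subspace K" unfolding K_def subspace_def by (auto simp: add scaleR zero)
 moreover have "closed K" unfolding K_def
 by (intro closed_Collect_eq continuous_on continuous_on_const continuous_on_id)
 ultimately obtain z where z: "x - z \<in> K" "!!k. k \<in> K ==> inner z k = 0" using orthogonal_projection by metis
 have fz: "f z = f x" using z(1) by (simp add: K_def diff)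
 have z0: "z ~= 0" using fz x zero by auto
 have "f u = inner u ((f z / (norm z)\<^sup>2) *\<^sub>R z)" for u
 proof -
 have "u - (f u / f z) *\<^sub>R z \<in> K" using fz x by (simp add: K_def diff scaleR)
 from z(2)[OF this] have "inner z u = (f u / f z) * (norm z)\<^sup>2" by (simp add: inner_simps power2_norm_eq_inner)
 then show ?thesis using fz x z0 by (simp add: inner_commute)
 qed
 then show ?thesis using that by blast
qed

subsection \<open>Weak convergence\<close>

definition wconv :: "'b filter => ('b => 'a::real_inner) => 'a => bool" where
 "wconv F x f \<longleftrightarrow> (\<forall>e. ((%k. inner (x k) e) \<longlongrightarrow> inner f e) F)"

lemma wconvD: "wconv F x f ==> ((%k. inner (x k) e) \<longlongrightarrow> inner f e) F"
 by (simp add: wconv_def)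

lemma wconv_unique: "F ~= bot ==> wconv F x f ==> wconv F x g ==> f = g"
 using tendsto_unique vector_eq_rdot unfolding wconv_def by metis

lemma wconv_add: "wconv F x f ==> wconv F y g ==> wconv F (%k. x k + y k) (f + g)"
 unfolding wconv_def by (auto simp: inner_add_left intro: tendsto_add)

lemma wconv_diff: "wconv F x f ==> wconv F y g ==> wconv F (%k. x k - y k) (f - g)"
 unfolding wconv_def by (auto simp: inner_diff_left intro: tendsto_diff)

lemma wconv_sum: "(!!i. i \<in> I ==> wconv F (x i) (f i)) ==> wconv F (%k. \<Sum>i\<in>I. x i k) (\<Sum>i\<in>I. f i)"
 unfolding wconv_def by (auto simp: inner_sum_left intro: tendsto_sum)

lemma tendsto_imp_wconv: "(x \<longlongrightarrow> f) F ==> wconv F x f"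
 unfolding wconv_def by (auto intro: tendsto_intros)

lemma tendsto_diff_zero_bounded:
 fixes x :: "'b => 'a::real_inner"
 assumes "((%k. e k) \<longlongrightarrow> (0::'a)) F" "eventually (%k. norm (x k) <= B) F"
 shows "((%k. inner (x k) (e k)) \<longlongrightarrow> 0) F"
proof (rule Lim_null_comparison)
 show "eventually (%k. norm (inner (x k) (e k)) <= B * norm (e k)) F"
 using assms(2) by eventually_elim (metis Cauchy_Schwarz_ineq2 dual_order.trans mult_right_mono norm_ge_zero real_norm_def)
 show "((%k. B * norm (e k)) \<longlongrightarrow> 0) F"
 using tendsto_mult_right_zero[OF tendsto_norm_zero[OF assms(1)]] by simp
qed

text \<open>Weak compactness of balls: every scalar pairing converges along the ultrafilter, the
  limits form a bounded functional, and Riesz represents it. The same \<open>U\<close> serves all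
  bounded families at once.\<close>

lemma ultra_weak_limit:
 fixes x :: "'b => 'a::{real_inner,complete_space}"
 assumes U: "ultra U" and B: "eventually (%k. norm (x k) <= B) U"
 obtains f where "wconv U x f" "norm f <= B"
proof -
 note nb = ultra_not_bot[OF U]
 have Bpos: "0 <= B" using eventually_happens[OF B] nb norm_ge_zero order_trans by blast
 have ev: "eventually (%k. norm (inner (x k) e) <= B * norm e) U" for e
 using B by eventually_elim (metis Cauchy_Schwarz_ineq2 dual_order.trans mult_right_mono norm_ge_zero real_norm_def)
 have "\<exists>l. ((%k. inner (x k) e) \<longlongrightarrow> l) U" for e
 by (rule ultra_bounded_limit[OF U ev])
 then obtain L where L: "!!e. ((%k. inner (x k) e) \<longlongrightarrow> L e) U" by metis
 have bl: "norm (L e) <= B * norm e" for e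
 by (rule tendsto_upperbound[OF tendsto_norm[OF L] ev nb])
 have "bounded_linear L"
 proof (rule bounded_linear_intro)
 show "L (e + e') = L e + L e'" for e e'
 using tendsto_unique[OF nb L[of "e + e'"], of "L e + L e'"] tendsto_add[OF L L] by (simp add: inner_add_right)
 show "L (r *\<^sub>R e) = r *\<^sub>R L e" for r e
 using tendsto_unique[OF nb L[of "r *\<^sub>R e"], of "r * L e"] tendsto_mult_left[OF L] by (simp)
 show "norm (L e) <= norm e * B" for e using bl[of e] by (simp add: mult.commute)
 qed
 then obtain f where f: "!!e. L e = inner e f" using riesz_representation by metis
 have "wconv U x f" unfolding wconv_def using L f by (simp add: inner_commute)
 moreover have "norm f <= B"
 proof (cases "f = 0")
 case False
 have "(norm f)\<^sup>2 <= B * norm f" using bl[of f] f[of f] by (simp add: power2_norm_eq_inner)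
 then show ?thesis using False by (simp add: power2_eq_square)
 qed (use Bpos in simp)
 ultimately show ?thesis using that by blast
qed

subsection \<open>Total sets\<close>

definition total_set :: "'a::real_normed_vector set => bool" where
 "total_set S \<longleftrightarrow> closure (span S) = UNIV"

lemma subspace_closure:
 fixes K :: "'a::real_normed_vector set"
 assumes "subspace K" shows "subspace (closure K)"
 unfolding subspace_def
proof (intro conjI ballI allI)
 show "0 \<in> closure K" using subspace_0[OF assms] closure_subset by blast
next
 fix x y assume "x \<in> closure K" "y \<in> closure K"
 then obtain a b where "!!n. a n \<in> K" "a \<longlonglongrightarrow> x" "!!n. b n \<in> K" "b \<longlonglongrightarrow> y"
 unfolding closure_sequential by blast
 then show "x + y \<in> closure K" unfolding closure_sequential
 using assms by (intro exI[of _ "%n. a n + b n"]) (auto intro: subspace_add tendsto_add)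
next
 fix c x assume "x \<in> closure K"
 then obtain a where "!!n. a n \<in> K" "a \<longlonglongrightarrow> x" unfolding closure_sequential by blast
 then show "c *\<^sub>R x \<in> closure K" unfolding closure_sequential
 using assms by (intro exI[of _ "%n. c *\<^sub>R a n"]) (auto intro: subspace_scale tendsto_scaleR tendsto_const)
qed

text \<open>The component of any \<open>x\<close> orthogonal to the closed span is orthogonal to
  \<open>S\<close>, hence zero by hypothesis.\<close>

lemma total_setI:
 fixes S :: "'a::{real_inner,complete_space} set"
 assumes "!!x. (!!s. s \<in> S ==> inner x s = 0) ==> x = 0"
 shows "total_set S"
proof -
 have "x \<in> closure (span S)" for x
 proof -
 obtain z where z: "x - z \<in> closure (span S)" "!!k. k \<in> closure (span S) ==> inner z k = 0"
 using orthogonal_projection[OF subspace_closure[OF subspace_span] closed_closure] by metis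
 have "z = 0"
 by (rule assms) (meson z(2) closure_subset span_superset subsetD)
 then show ?thesis using z(1) by simp
 qed
 then show ?thesis by (auto simp: total_set_def)
qed

lemma total_set_induct:
 assumes "total_set S" "subspace P" "closed P" "S \<subseteq> P"
 shows "x \<in> P"
proof -
 have "span S \<subseteq> P" using assms by (simp add: span_minimal)
 then have "closure (span S) \<subseteq> P" using assms(3) by (rule closure_minimal)
 then show ?thesis using assms(1) by (auto simp: total_set_def)
qed

lemma total_set_mono: 
 assumes "total_set S" "S \<subseteq> closure (span R)"
 shows "total_set R"
proof -
 have "x \<in> closure (span R)" for x
 by (rule total_set_induct[OF assms(1)]) (use assms(2) in \<open>auto intro: subspace_closure subspace_span\<close>)
 then show ?thesis by (auto simp: total_set_def)
qed

lemma total_set_linear_eq: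
 assumes S: "total_set S" and "bounded_linear A" "bounded_linear B" "!!s. s \<in> S ==> A s = B s"
 shows "A x = B x"
proof -
 interpret A: bounded_linear A by fact
 interpret B: bounded_linear B by fact
 have "x \<in> {x. A x = B x}"
 by (rule total_set_induct[OF S])
 (use assms(4) in \<open>auto simp: subspace_def A.add B.add A.scaleR B.scaleR A.zero B.zero
 intro!: closed_Collect_eq A.continuous_on B.continuous_on continuous_on_id\<close>)
 then show ?thesis by simp
qed

text \<open>The uniform bound carries convergence from the span to its closure: \<open>e/2\<close>
  is spent on replacing \<open>x\<close> by a nearby element, \<open>e/2\<close> on convergence
  there.\<close>

lemma total_set_tendsto:
 fixes A :: "'t => 'a::real_normed_vector => 'b::real_normed_vector"
 assumes S: "total_set S" and lin: "!!t. linear (A t)" and bd: "!!t x. norm (A t x) <= C * norm x"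
 and L: "bounded_linear L" and conv: "!!s. s \<in> S ==> ((%t. A t s) \<longlongrightarrow> L s) F"
 shows "((%t. A t x) \<longlongrightarrow> L x) F"
proof -
 interpret L: bounded_linear L by fact
 obtain K where K: "K > 0" "!!x. norm (L x) <= norm x * K" using L.pos_bounded by blast
 have C: "norm (A t x) <= max C 0 * norm x" for t x
 by (rule order_trans[OF bd]) (simp add: mult_right_mono)
 define P where "P = {x. ((%t. A t x) \<longlongrightarrow> L x) F}"
 have sub: "subspace P" unfolding subspace_def P_def
 by (auto simp: linear_0[OF lin] linear_add[OF lin] linear_scale[OF lin] L.zero L.add L.scaleR intro!: tendsto_intros)
 have "closed P"
 proof -
 have "x \<in> P" if x: "x \<in> closure P" for x
 unfolding P_def mem_Collect_eq
 proof (rule tendstoI)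
 fix e :: real assume e: "e > 0"
 define M where "M = max C 0 + K + 1"
 have M: "M > 0" using K by (simp add: M_def)
 obtain y where y: "y \<in> P" "dist y x < e / (2 * M)"
 using x e M unfolding closure_approachable by (metis divide_pos_pos mult_pos_pos zero_less_numeral)
 have "eventually (%t. dist (A t y) (L y) < e/2) F"
 using y(1) e unfolding P_def by (auto dest!: tendstoD[of _ _ _ "e/2"])
 then show "eventually (%t. dist (A t x) (L x) < e) F"
 proof eventually_elim
 case (elim t)
 have "A t x - L x = A t (x - y) + (A t y - L y) + L (y - x)"
 by (simp add: linear_diff[OF lin] L.diff)
 then have "norm (A t x - L x) <= norm (A t (x - y)) + norm (A t y - L y) + norm (L (y - x))"
 by (metis add_right_mono norm_triangle_ineq norm_triangle_le)
 also have "... <= max C 0 * norm (x - y) + norm (A t y - L y) + norm (y - x) * K"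
 using C[of t "x - y"] K(2)[of "y - x"] by linarith
 also have "... <= M * dist y x + norm (A t y - L y)"
 using norm_ge_zero[of "y - x"] by (simp add: M_def dist_norm norm_minus_commute algebra_simps)
 also have "M * dist y x <= e/2" using y(2) M by (simp add: field_simps)
 finally show ?case using elim by (simp add: dist_norm)
 qed
 qed
 then show ?thesis by (metis closure_subset subsetI subset_antisym closed_closure)
 qed
 then have "x \<in> P" using total_set_induct[OF S sub] conv by (auto simp: P_def)
 then show ?thesis by (simp add: P_def)
qed

text \<open>The variant of \<open>total_set_tendsto\<close> for an unknown limit: by the uniform
  bound the limits at approximants of \<open>x\<close> form a Cauchy sequence, whose limit is the
  one sought.\<close>

lemma total_set_convergent:
 fixes A :: "'t => 'a::real_normed_vector => 'b::banach"
 assumes S: "total_set S" and nb: "F ~= bot" and lin: "!!t. linear (A t)" and bd: "!!t x. norm (A t x) <= C * norm x"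
 and conv: "!!s. s \<in> S ==> \<exists>l. ((%t. A t s) \<longlongrightarrow> l) F"
 shows "\<exists>l. ((%t. A t x) \<longlongrightarrow> l) F"
proof -
 have C: "norm (A t x) <= max C 0 * norm x" for t x
 by (rule order_trans[OF bd]) (simp add: mult_right_mono)
 define P where "P = {x. \<exists>l. ((%t. A t x) \<longlongrightarrow> l) F}"
 have sub: "subspace P" unfolding subspace_def P_def
 proof (intro conjI ballI allI)
 show "0 \<in> {x. \<exists>l. ((%t. A t x) \<longlongrightarrow> l) F}"
 unfolding mem_Collect_eq linear_0[OF lin] by (rule exI, rule tendsto_const)
 next
 fix x y assume "x \<in> {x. \<exists>l. ((%t. A t x) \<longlongrightarrow> l) F}" "y \<in> {x. \<exists>l. ((%t. A t x) \<longlongrightarrow> l) F}"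
 then show "x + y \<in> {x. \<exists>l. ((%t. A t x) \<longlongrightarrow> l) F}"
 unfolding mem_Collect_eq linear_add[OF lin] by (metis tendsto_add)
 next
 fix c x assume "x \<in> {x. \<exists>l. ((%t. A t x) \<longlongrightarrow> l) F}"
 then obtain l where "((%t. A t x) \<longlongrightarrow> l) F" by blast
 then have "((%t. c *\<^sub>R A t x) \<longlongrightarrow> c *\<^sub>R l) F" by (intro tendsto_scaleR tendsto_const)
 then show "c *\<^sub>R x \<in> {x. \<exists>l. ((%t. A t x) \<longlongrightarrow> l) F}"
 unfolding mem_Collect_eq linear_scale[OF lin] by (rule exI)
 qed
 have "x \<in> P" if x: "x \<in> closure P" for x
 proof -
 obtain y where y: "!!n. y n \<in> P" "y \<longlonglongrightarrow> x" using x unfolding closure_sequential by blast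
 obtain l where l: "!!n. ((%t. A t (y n)) \<longlongrightarrow> l n) F" using y(1) unfolding P_def mem_Collect_eq by metis
 have ll: "norm (l m - l n) <= max C 0 * norm (y m - y n)" for m n
 proof (rule tendsto_upperbound[OF tendsto_norm[OF tendsto_diff[OF l l]] _ nb])
 show "\<forall>\<^sub>F t in F. norm (A t (y m) - A t (y n)) <= max C 0 * norm (y m - y n)"
 using C[of _ "y m - y n"] by (simp add: linear_diff[OF lin])
 qed
 have "Cauchy l"
 proof (rule CauchyI)
 fix e :: real assume e: "e > 0"
 have pos: "e / (max C 0 + 1) > 0" using e by (simp add: add_nonneg_pos)
 obtain N where N: "\<forall>m\<ge>N. \<forall>n\<ge>N. norm (y m - y n) < e / (max C 0 + 1)"
 using CauchyD[OF LIMSEQ_imp_Cauchy[OF y(2)] pos] by blast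
 show "\<exists>M. \<forall>m\<ge>M. \<forall>n\<ge>M. norm (l m - l n) < e"
 proof (intro exI[of _ N] allI impI)
 fix m n assume "N <= m" "N <= n"
 then have *: "norm (y m - y n) < e / (max C 0 + 1)" using N by blast
 have "norm (l m - l n) <= (max C 0 + 1) * norm (y m - y n)"
 using ll[of m n] norm_ge_zero[of "y m - y n"] unfolding distrib_right by linarith
 also have "... < e" using * by (simp add: pos_less_divide_eq add_nonneg_pos mult.commute)
 finally show "norm (l m - l n) < e" .
 qed
 qed
 then obtain l0 where l0: "l \<longlonglongrightarrow> l0" using Cauchy_convergent convergent_def by blast
 have "((%t. A t x) \<longlongrightarrow> l0) F"
 proof (rule tendstoI)
 fix e :: real assume e: "e > 0"
 have "eventually (%n. dist (l n) l0 < e/3) sequentially" by (rule tendstoD[OF l0]) (use e in simp)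
 moreover have "(%n. max C 0 * norm (y n - x)) \<longlonglongrightarrow> max C 0 * norm (x - x)"
 by (intro tendsto_intros y)
 then have "(%n. max C 0 * norm (y n - x)) \<longlonglongrightarrow> 0" by simp
 then have "eventually (%n. max C 0 * norm (y n - x) < e/3) sequentially"
 using e by (auto dest!: order_tendstoD(2)[of _ _ _ "e/3"])
 ultimately have "eventually (%n. dist (l n) l0 < e/3 & max C 0 * norm (y n - x) < e/3) sequentially"
 by eventually_elim simp
 then obtain n where n: "dist (l n) l0 < e/3" "max C 0 * norm (y n - x) < e/3"
 by (auto dest: eventually_happens)
 have "eventually (%t. dist (A t (y n)) (l n) < e/3) F" by (rule tendstoD[OF l]) (use e in simp)
 then show "eventually (%t. dist (A t x) l0 < e) F"
 proof eventually_elim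
 case (elim t)
 have "dist (A t x) l0 <= dist (A t x) (A t (y n)) + dist (A t (y n)) (l n) + dist (l n) l0"
 using dist_triangle[of "A t x" l0 "A t (y n)"] dist_triangle[of "A t (y n)" l0 "l n"] by linarith
 also have "dist (A t x) (A t (y n)) <= max C 0 * norm (y n - x)"
 using C[of t "y n - x"] by (simp add: dist_norm linear_diff[OF lin] norm_minus_commute)
 finally show ?case using elim n by linarith
 qed
 qed
 then show ?thesis by (auto simp: P_def)
 qed
 then have "closed P" by (metis closure_subset subsetI subset_antisym closed_closure)
 then have "x \<in> P" using total_set_induct[OF S sub] conv by (auto simp: P_def)
 then show ?thesis by (simp add: P_def)
qed

text \<open>Approximating \<open>x\<close> itself by elements of the span turns the hypothesis into
  \<open>inner x x <= C * norm x\<close>. Norm estimates can thus be checked by pairing with the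
  span.\<close>

lemma total_set_norm_le:
 fixes x :: "'a::real_inner"
 assumes S: "total_set S" and b: "!!y. y \<in> span S ==> inner x y <= C * norm y" and C: "C >= 0"
 shows "norm x <= C"
proof -
 have "x \<in> closure (span S)" using S by (simp add: total_set_def)
 then obtain y where y: "!!n. y n \<in> span S" "y \<longlonglongrightarrow> x" unfolding closure_sequential by blast
 have *: "inner x x <= C * norm x"
 by (rule LIMSEQ_le[of "%n. inner x (y n)" _ "%n. C * norm (y n)"]) (use y b in \<open>auto intro!: tendsto_intros\<close>)
 show ?thesis
 using * C by (cases "x = 0") (auto simp flip: power2_norm_eq_inner simp: power2_eq_square)
qed

subsection \<open>Isometries from Gram matrices\<close>

text \<open>The span of the pairs \<open>(g i, h i)\<close> is a graph on which both components have
  equal norm, because the Gram matrices agree. Its closure is therefore single-valued, and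
  completeness together with totality makes it defined everywhere. The Schroedinger flow is built
  this way from its formula on Gaussians.\<close>

lemma gram_isometry:
 fixes g h :: "'i => 'a::{real_inner,complete_space}"
 assumes tot: "total_set (range g)" and gram: "!!i j. inner (g i) (g j) = inner (h i) (h j)"
 obtains V where "bounded_linear V" "!!x. norm (V x) = norm x" "!!i. V (g i) = h i"
proof -
 define W where "W = span (range (%i. (g i, h i)))"
 define K where "K = closure W"
 have subK: "subspace K" unfolding K_def W_def by (intro subspace_closure subspace_span)
 have iso1: "inner (fst w) (fst w') = inner (snd w) (snd w')" if "w \<in> W" "w' \<in> W" for w w'
 proof -
 have *: "inner (fst w) (g j) = inner (snd w) (h j)" if "w \<in> W" for w j
 proof -
 show ?thesis using that unfolding W_def
 proof (induction rule: span_induct_alt)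
 case (step c x y)
 then obtain i where "x = (g i, h i)" by blast
 then show ?case using step by (simp add: inner_add_left gram)
 qed simp
 qed
 show ?thesis using that(2) unfolding W_def
 proof (induction rule: span_induct_alt)
 case (step c x y)
 then obtain i where "x = (g i, h i)" by blast
 then show ?case using step *[OF that(1)] by (simp add: inner_add_right)
 qed simp
 qed
 have nW: "norm (fst w) = norm (snd w)" if "w \<in> W" for w
 using iso1[OF that that] by (simp add: norm_eq_sqrt_inner)
 have nK: "norm (fst w) = norm (snd w)" if w: "w \<in> K" for w
 proof -
 obtain a where a: "!!n. a n \<in> W" "a \<longlonglongrightarrow> w" using w unfolding K_def closure_sequential by blast
 have "(%n. norm (fst (a n))) \<longlonglongrightarrow> norm (fst w)" "(%n. norm (snd (a n))) \<longlonglongrightarrow> norm (snd w)"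
 using a(2) by (auto intro!: tendsto_intros)
 then show ?thesis unfolding nW[OF a(1)] by (rule LIMSEQ_unique)
 qed
 have "\<exists>y. (x, y) \<in> K" for x
 proof -
 have fstW: "span (range g) \<subseteq> fst ` W"
 proof (rule span_minimal)
 show "range g \<subseteq> fst ` W"
 proof safe
 fix i have "(g i, h i) \<in> W" unfolding W_def by (rule span_base) auto
 then show "g i \<in> fst ` W" by (rule rev_image_eqI) simp
 qed
 show "subspace (fst ` W)" unfolding W_def by (intro linear_subspace_image subspace_span linear_fst)
 qed
 have "x \<in> closure (span (range g))" using tot by (simp add: total_set_def)
 then obtain a where a: "!!n. a n \<in> span (range g)" "a \<longlonglongrightarrow> x" unfolding closure_sequential by blast
 have "\<exists>b. (a n, b) \<in> W" for n
 proof -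
 have "a n \<in> fst ` W" using fstW a(1)[of n] by blast
 then obtain w where "w \<in> W" "a n = fst w" by blast
 then show ?thesis by (metis prod.collapse)
 qed
 then obtain b where b: "!!n. (a n, b n) \<in> W" by metis
 have nab: "norm (b m - b n) = norm (a m - a n)" for m n
 proof -
 have "(a m, b m) - (a n, b n) \<in> W" unfolding W_def by (intro span_diff b[unfolded W_def])
 then show ?thesis using nW[of "(a m, b m) - (a n, b n)"] by simp
 qed
 have "Cauchy a" using a(2) by (rule LIMSEQ_imp_Cauchy)
 then have "Cauchy b" by (simp add: Cauchy_iff nab)
 then obtain y where y: "b \<longlonglongrightarrow> y" using Cauchy_convergent convergent_def by blast
 have "(%n. (a n, b n)) \<longlonglongrightarrow> (x, y)" using a(2) y by (rule tendsto_Pair)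
 then have "(x, y) \<in> K" unfolding K_def closure_sequential using b by (intro exI[of _ "%n. (a n, b n)"]) simp
 then show ?thesis by (rule exI)
 qed
 then obtain V where V: "!!x. (x, V x) \<in> K" by metis
 have eqV: "y = V x" if "(x, y) \<in> K" for x y
 using nK[OF subspace_diff[OF subK that V[of x]]] by simp
 have nV: "norm (V x) = norm x" for x using nK[OF V[of x]] by simp
 have "bounded_linear V"
 proof (rule bounded_linear_intro)
 show "V (x + y) = V x + V y" for x y using eqV[of "x + y" "V x + V y"] subspace_add[OF subK V[of x] V[of y]] by simp
 show "V (r *\<^sub>R x) = r *\<^sub>R V x" for r x using eqV[of "r *\<^sub>R x" "r *\<^sub>R V x"] subspace_scale[OF subK V[of x], of r] by simp
 show "norm (V x) <= norm x * 1" for x by (simp add: nV)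
 qed
 moreover have "V (g i) = h i" for i
 proof -
 have "(g i, h i) \<in> W" unfolding W_def by (rule span_base) auto
 then have "(g i, h i) \<in> K" unfolding K_def using closure_subset by (rule rev_subsetD)
 then show ?thesis by (rule eqV[symmetric])
 qed
 ultimately show ?thesis using that nV by blast
qed

lemma isometry_inner:
 assumes "linear V" "!!x. norm (V x) = norm (x::'a::real_inner)"
 shows "inner (V x) (V y :: 'b::real_inner) = inner x y"
proof -
 show ?thesis unfolding dot_norm by (simp only: assms(2) flip: linear_add[OF assms(1)])
qed

subsection \<open>One-parameter groups of isometries\<close>

text \<open>The acting group is the additive group of a normed space: vectors for translations,
  reals for time evolution, pairs for both. Continuity is asked at \<open>0\<close> only, since the
  group law transports it.\<close>

locale isometry_group =
 fixes T :: "'g::real_normed_vector => 'h::{real_inner,complete_space} => 'h"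
 assumes T_blin: "bounded_linear (T g)"
 and T_norm [simp]: "norm (T g x) = norm x"
 and T_add: "T (g + g') x = T g (T g' x)"
 and T_0 [simp]: "T 0 x = x"
 and T_cont0: "((%g. T g x) \<longlongrightarrow> x) (at 0)"
begin

lemma T_linear: "linear (T g)"
 using T_blin by (rule bounded_linear.linear)

lemmas T_simps = linear_add[OF T_linear] linear_diff[OF T_linear] linear_scale[OF T_linear]
 linear_0[OF T_linear] linear_sum[OF T_linear] linear_neg[OF T_linear]

lemma T_minus [simp]: "T (- g) (T g x) = x" "T g (T (- g) x) = x"
 using T_add[of "- g" g x] T_add[of g "- g" x] by simp_all

lemma T_commute: "T g (T g' x) = T g' (T g x)"
 by (metis T_add add.commute)

lemma T_inner [simp]: "inner (T g x) (T g y) = inner x y"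
 by (rule isometry_inner) (simp_all add: T_linear)

lemma T_adjoint: "inner (T g x) y = inner x (T (- g) y)"
 by (metis T_inner T_minus(2))

lemma T_cont: "((%g. T g x) \<longlongrightarrow> T a x) (at a within A)"
proof -
 have "((%g. T a (T g x)) \<longlongrightarrow> T a x) (at 0)"
 by (intro bounded_linear.tendsto[OF T_blin] T_cont0)
 then have "((%g. T g x) \<longlongrightarrow> T a x) (at a)"
 using LIM_offset_zero_iff[of a "%g. T g x" "T a x"] by (simp add: T_add)
 then show ?thesis by (rule tendsto_within_subset) simp
qed

lemma T_tendsto:
 assumes "(x \<longlongrightarrow> y) F" "(g \<longlongrightarrow> a) F"
 shows "((%k. T (g k) (x k)) \<longlongrightarrow> T a y) F"
proof -
 have "isCont (%g. T g y) a" unfolding isCont_def by (rule T_cont)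
 then have 1: "((%k. T (g k) y) \<longlongrightarrow> T a y) F" using assms(2) by (rule isCont_tendsto_compose)
 have 2: "((%k. T (g k) (x k - y)) \<longlongrightarrow> 0) F"
 by (rule tendsto_norm_zero_cancel) (use assms(1) in \<open>simp add: tendsto_norm_zero_iff LIM_zero_iff\<close>)
 show ?thesis using tendsto_add[OF 2 1] by (simp add: T_simps)
qed

end

text \<open>A weak derivative against a total set is already a strong derivative.\<close>

lemma group_generator:
 fixes T :: "real => 'h::{real_inner,complete_space} => 'h"
 assumes "isometry_group T" and D: "total_set D"
 and der: "!!f s. f \<in> D ==> ((%s. inner f (T s phi)) has_real_derivative inner f (T s psi)) (at s)"
 shows "((%s. T s phi) has_vector_derivative T s psi) (at s)"
proof -
 interpret isometry_group T by fact
 have der': "((%s. inner f (T s phi)) has_real_derivative inner f (T s psi)) (at s)" if "f \<in> span D" for f s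
 using that by (induction rule: span_induct_alt) (auto simp: inner_simps intro!: derivative_eq_intros der)
 \<comment> \<open>The mean value inequality is applied to the scalar function obtained by pairing
   with one \<open>f\<close>. Its constant is proportional to \<open>norm f\<close>, so duality over
   the dense span gives the estimate in norm.\<close>
 have key: "norm (T h phi - phi - h *\<^sub>R psi) <= e * \<bar>h\<bar>"
 if e: "e > 0" and hs: "!!s. \<bar>s\<bar> <= \<bar>h\<bar> ==> norm (T s psi - psi) <= e" for h e
 proof (rule total_set_norm_le[OF D])
 fix f assume f: "f \<in> span D"
 define F where "F s = inner f (T s phi - phi - s *\<^sub>R psi)" for s
 have dF: "(F has_real_derivative inner f (T s psi - psi)) (at s)" for s
 unfolding F_def inner_simps by (auto intro!: derivative_eq_intros der' f)
 have "norm (F h - F 0) <= (norm f * e) * norm (h - 0)"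
 proof (rule field_differentiable_bound[where S = "closed_segment 0 h"])
 fix s assume "s \<in> closed_segment 0 h"
 then have "\<bar>s\<bar> <= \<bar>h\<bar>" using segment_bound(1)[of s 0 h] by simp
 then show "norm (inner f (T s psi - psi)) <= norm f * e"
 by (metis hs Cauchy_Schwarz_ineq2 mult_left_mono norm_ge_zero order_trans real_norm_def)
 qed (auto intro: has_field_derivative_at_within dF)
 then show "inner (T h phi - phi - h *\<^sub>R psi) f <= e * \<bar>h\<bar> * norm f"
 by (simp add: F_def inner_commute mult_ac)
 qed (use e in auto)
 have der0: "((%s. T s phi) has_vector_derivative psi) (at 0)"
 unfolding has_vector_derivative_def has_derivative_at_alt
 proof (intro conjI allI impI)
 fix e :: real assume e: "e > 0"
 obtain d where d: "d > 0" "!!s. s ~= 0 ==> \<bar>s\<bar> < d ==> norm (T s psi - psi) < e"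
 using T_cont0[of psi] e by (auto simp: LIM_def dist_norm)
 show "\<exists>d>0. \<forall>y. norm (y - 0) < d --> norm (T y phi - T 0 phi - (y - 0) *\<^sub>R psi) <= e * norm (y - 0)"
 proof (intro exI[of _ d] conjI allI impI d(1))
 fix y :: real assume y: "norm (y - 0) < d"
 have "norm (T s psi - psi) <= e" if "\<bar>s\<bar> <= \<bar>y\<bar>" for s
 using d(2)[of s] that y e by (cases "s = 0") auto
 from key[OF e this] show "norm (T y phi - T 0 phi - (y - 0) *\<^sub>R psi) <= e * norm (y - 0)" by simp
 qed
 qed (rule bounded_linear_scaleR_left)
 have "((%h. T (h - s) phi) has_vector_derivative psi) (at s)"
 proof -
 have "((%h. h - s) has_vector_derivative 1) (at s)" by (auto intro!: derivative_eq_intros)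
 then show ?thesis
 using vector_diff_chain_at[of "%h. h - s" 1 s "%s. T s phi" psi] der0 by (simp add: o_def)
 qed
 then have "((%h. T s (T (h - s) phi)) has_vector_derivative T s psi) (at s)"
 by (rule bounded_linear.has_vector_derivative[OF T_blin])
 then show ?thesis by (simp flip: T_add)
qed

section \<open>Profile decompositions for isometric representations\<close>

lemma wconv_bounded_linear:
 fixes D :: "'a::{real_inner,complete_space} => 'b::real_inner"
 assumes D: "bounded_linear D" and x: "wconv F x f"
 shows "wconv F (%k. D (x k)) (D f)"
 unfolding wconv_def
proof
 fix e
 have "bounded_linear (%x. inner (D x) e)"
 by (rule bounded_linear_compose[OF bounded_linear_inner_left D])
 then obtain y where "!!x. inner (D x) e = inner x y" using riesz_representation by blast
 then show "((%k. inner (D (x k)) e) \<longlongrightarrow> inner (D f) e) F" using wconvD[OF x] by simp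
qed

text \<open>Mixing means that matrix coefficients vanish at infinity. Vectors moved by diverging
  parameters become weakly null, and this is what separates different profiles.\<close>

locale mixing_group = isometry_group T for T :: "'g::euclidean_space => 'h::{real_inner,complete_space} => 'h" +
 assumes mixing: "((%g. inner (T g x) y) \<longlongrightarrow> 0) at_infinity"
begin

lemma mixing_wconv: "filterlim g at_infinity F ==> wconv F (%k. T (g k) x) 0"
 unfolding wconv_def by (auto intro: filterlim_compose[OF mixing])

lemma filterlim_at_infinity_minus:
 fixes g :: "'k => 'g"
 shows "filterlim g at_infinity F ==> filterlim (%k. - g k) at_infinity F"
 by (simp add: filterlim_at_infinity_conv_norm_at_top)

lemma filterlim_at_infinity_swap:
 fixes g :: "'k => 'g"
 shows "filterlim (%k. g k - h k) at_infinity F ==> filterlim (%k. h k - g k) at_infinity F"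
 by (drule filterlim_at_infinity_minus) simp

text \<open>Failure of divergence means boundedness on a set of the ultrafilter, and bounded
  parameters converge along it; no intermediate behaviour is left.\<close>

lemma ultra_dichotomy:
 fixes g :: "'k => 'g"
 assumes "ultra U" "\<not> filterlim g at_infinity U"
 obtains c where "(g \<longlongrightarrow> c) U"
proof -
 obtain B where "\<not> eventually (%k. B <= norm (g k)) U"
 using assms(2) unfolding filterlim_at_infinity[OF order_refl] by blast
 from ultra_not[OF assms(1) this] have "eventually (%k. norm (g k) <= B) U"
 by (auto elim: eventually_mono)
 from ultra_bounded_limit[OF assms(1) this] show ?thesis using that by blast
qed

text \<open>The convergent parameter is moved to the test vector, where strong continuity applies;
  the error then pairs a bounded factor with a vanishing one.\<close>

lemma wconv_T:
 assumes g: "(g \<longlongrightarrow> c) F" and x: "wconv F x f" and B: "!!k. norm (x k) <= B"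
 shows "wconv F (%k. T (g k) (x k)) (T c f)"
 unfolding wconv_def
proof
 fix e
 have "((%k. T (- g k) e) \<longlongrightarrow> T (- c) e) F" by (intro T_tendsto tendsto_const tendsto_minus g)
 then have "((%k. T (- g k) e - T (- c) e) \<longlongrightarrow> 0) F" by (simp add: LIM_zero_iff)
 then have "((%k. inner (x k) (T (- g k) e - T (- c) e)) \<longlongrightarrow> 0) F"
 by (rule tendsto_diff_zero_bounded[where B = B]) (simp add: B)
 from tendsto_add[OF wconvD[OF x, of "T (- c) e"] this]
 show "((%k. inner (T (g k) (x k)) e) \<longlongrightarrow> inner (T c f) e) F"
 by (simp add: T_adjoint inner_diff_right)
qed

text \<open>Asymptotic Pythagoras: a cross term is the matrix coefficient at
  \<open>g j k - g i k\<close>, which diverges.\<close>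

lemma orthogonal_sum_norm:
 fixes g :: "nat => 'k => 'g"
 assumes orth: "!!i j. i < l ==> j < l ==> i ~= j ==> filterlim (%k. g i k - g j k) at_infinity F"
 shows "((%k. (norm (\<Sum>j<l. T (- g j k) (h j)))\<^sup>2) \<longlongrightarrow> (\<Sum>j<l. (norm (h j))\<^sup>2)) F"
proof -
 have "((%k. inner (T (- g i k) (h i)) (T (- g j k) (h j))) \<longlongrightarrow> (if i = j then (norm (h i))\<^sup>2 else 0)) F"
 if "i < l" "j < l" for i j
 proof (cases "i = j")
 case True then show ?thesis by (simp add: power2_norm_eq_inner)
 next
 case False
 have "inner (T (- g i k) (h i)) (T (- g j k) (h j)) = inner (T (g j k - g i k) (h i)) (h j)" for k
 by (simp add: T_adjoint flip: T_add)
 moreover have "((%k. inner (T (g j k - g i k) (h i)) (h j)) \<longlongrightarrow> 0) F"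
 using wconvD[OF mixing_wconv[OF orth[OF that(2,1)]], of "h i" "h j"] False by simp
 ultimately show ?thesis using False by simp
 qed
 then have "((%k. \<Sum>i<l. \<Sum>j<l. inner (T (- g i k) (h i)) (T (- g j k) (h j)))
 \<longlongrightarrow> (\<Sum>i<l. \<Sum>j<l. (if i = j then (norm (h i))\<^sup>2 else 0))) F"
 by (intro tendsto_sum) auto
 moreover have "(\<Sum>i<l. \<Sum>j<l. inner (T (- g i k) (h i)) (T (- g j k) (h j))) = (norm (\<Sum>j<l. T (- g j k) (h j)))\<^sup>2" for k
 unfolding power2_norm_eq_inner by (subst inner_sum_left) (simp only: inner_sum_right)
 ultimately show ?thesis by simp
qed

text \<open>The square of the distance between \<open>D (w k)\<close> and the sum of the moved
  profiles is expanded and passed to the limit. The operator \<open>D\<close> commutes with the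
  group; besides the identity it will be a translation difference, which hands the derivative bounds
  of the data down to the profiles.\<close>

lemma bessel_profiles:
 fixes g :: "nat => 'k => 'g"
 assumes orth: "!!i j. i < l ==> j < l ==> i ~= j ==> filterlim (%k. g i k - g j k) at_infinity F"
 and lim: "!!j. j < l ==> wconv F (%k. T (g j k) (w k)) (f j)"
 and D: "bounded_linear D" "!!g x. D (T g x) = T g (D x)"
 and B: "eventually (%k. norm (D (w k)) <= B) F" and nb: "F ~= bot"
 shows "(\<Sum>j<l. (norm (D (f j)))\<^sup>2) <= B\<^sup>2"
proof -
 let ?S = "%k. \<Sum>j<l. T (- g j k) (D (f j))"
 have 1: "((%k. (norm (?S k))\<^sup>2) \<longlongrightarrow> (\<Sum>j<l. (norm (D (f j)))\<^sup>2)) F"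
 by (rule orthogonal_sum_norm[OF orth])
 have "((%k. \<Sum>j<l. inner (D (T (g j k) (w k))) (D (f j))) \<longlongrightarrow> (\<Sum>j<l. inner (D (f j)) (D (f j)))) F"
 by (intro tendsto_sum wconvD wconv_bounded_linear[OF D(1)] lim) auto
 moreover have "(\<Sum>j<l. inner (D (T (g j k) (w k))) (D (f j))) = inner (D (w k)) (?S k)" for k
 by (simp add: inner_sum_right D(2) T_adjoint)
 ultimately have 2: "((%k. inner (D (w k)) (?S k)) \<longlongrightarrow> (\<Sum>j<l. (norm (D (f j)))\<^sup>2)) F"
 by (simp add: power2_norm_eq_inner)
 have 3: "((%k. 2 * inner (D (w k)) (?S k) - (norm (?S k))\<^sup>2)
 \<longlongrightarrow> 2 * (\<Sum>j<l. (norm (D (f j)))\<^sup>2) - (\<Sum>j<l. (norm (D (f j)))\<^sup>2)) F"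
 by (intro tendsto_intros 1 2)
 have "2 * (\<Sum>j<l. (norm (D (f j)))\<^sup>2) - (\<Sum>j<l. (norm (D (f j)))\<^sup>2) <= B\<^sup>2"
 proof (rule tendsto_upperbound[OF 3 _ nb])
 show "\<forall>\<^sub>F k in F. 2 * inner (D (w k)) (?S k) - (norm (?S k))\<^sup>2 <= B\<^sup>2"
 using B
 proof eventually_elim
 case (elim k)
 have "0 <= (norm (D (w k) - ?S k))\<^sup>2" by simp
 also have "... = (norm (D (w k)))\<^sup>2 - 2 * inner (D (w k)) (?S k) + (norm (?S k))\<^sup>2"
 using dot_norm_neg[of "D (w k)" "?S k"] by (simp add: field_simps)
 moreover have "(norm (D (w k)))\<^sup>2 <= B\<^sup>2" using elim by (simp add: power_mono)
 ultimately show ?case by linarith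
 qed
 qed
 then show ?thesis by simp
qed

section \<open>Greedy extraction of profiles\<close>

definition remainder :: "(nat => 'h) => (nat => nat => 'g) => (nat => 'h) => nat => nat => 'h" where
 "remainder w g f l k = w k - (\<Sum>j<l. T (- g j k) (f j))"

lemma remainder_Suc: "remainder w g f (Suc l) k = remainder w g f l k - T (- g l k) (f l)"
 by (simp add: remainder_def)

lemma remainder_bounded:
 assumes "!!k. norm (w k) <= M"
 shows "norm (remainder w g f l k) <= M + (\<Sum>j<l. norm (f j))"
proof -
 have "norm (\<Sum>j<l. T (- g j k) (f j)) <= (\<Sum>j<l. norm (T (- g j k) (f j)))" by (rule norm_sum)
 then show ?thesis using assms[of k] norm_triangle_ineq4[of "w k" "\<Sum>j<l. T (- g j k) (f j)"]
 unfolding remainder_def by simp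
qed

text \<open>Near-maximisation, with ratio 2, among the weak limits along all admissible parameter
  sequences. If all these limits vanish, the norm gives no reason to prefer any parameters; then
  \<open>d\<close> is taken, because it carries the property \<open>Q\<close> that a zero profile
  cannot enforce by itself.\<close>

lemma greedy_step:
 fixes a :: "nat => 'h" and G :: "(nat => 'g) set"
 assumes U: "ultra U" and B: "!!k. norm (a k) <= B"
 and d: "!!k. d k \<in> A" "Q d"
 obtains g f where "!!k. g k \<in> A" "wconv U (%k. T (g k) (a k)) f" "f = 0 ==> Q g"
 "!!g' f'. (!!k. g' k \<in> A) ==> wconv U (%k. T (g' k) (a k)) f' ==> norm f' <= 2 * norm f"
proof -
 define V where "V = {f. \<exists>g. (\<forall>k. g k \<in> A) & wconv U (%k. T (g k) (a k)) f}"
 have ex: "\<exists>f. wconv U (%k. T (g k) (a k)) f & norm f <= B" for g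
 using ultra_weak_limit[OF U, of "%k. T (g k) (a k)" B] B by auto
 have VB: "norm f <= B" if "f \<in> V" for f
 using that ex wconv_unique[OF ultra_not_bot[OF U]] unfolding V_def by blast
 have bdd: "bdd_above (norm ` V)" using VB by (auto intro!: bdd_aboveI)
 obtain f0 where f0: "wconv U (%k. T (d k) (a k)) f0" using ex by blast
 then have f0V: "f0 \<in> V" using d(1) by (auto simp: V_def)
 have up: "norm f <= Sup (norm ` V)" if "f \<in> V" for f using bdd that by (auto intro: cSup_upper)
 show ?thesis
 proof (cases "Sup (norm ` V) > 0")
 case True
 obtain f where f: "f \<in> V" "Sup (norm ` V) / 2 < norm f"
 using less_cSup_iff[of "norm ` V" "Sup (norm ` V) / 2"] bdd f0V True by auto
 then obtain g where g: "!!k. g k \<in> A" "wconv U (%k. T (g k) (a k)) f" by (auto simp: V_def)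
 show ?thesis
 proof (rule that[OF g])
 show "f = 0 ==> Q g" using f True by auto
 fix g' f' assume "!!k. g' k \<in> A" "wconv U (%k. T (g' k) (a k)) f'"
 then have "f' \<in> V" by (auto simp: V_def)
 from up[OF this] show "norm f' <= 2 * norm f" using f(2) by simp
 qed
 next
 case False
 then have V0: "f = 0" if "f \<in> V" for f using up[OF that] norm_ge_zero[of f] by (simp add: order_antisym_conv)
 show ?thesis
 proof (rule that[of d f0])
 show "!!k. d k \<in> A" "wconv U (%k. T (d k) (a k)) f0" "Q d" by fact+
 fix g' f' assume "!!k. g' k \<in> A" "wconv U (%k. T (g' k) (a k)) f'"
 then have "f' \<in> V" by (auto simp: V_def)
 then show "norm f' <= 2 * norm f0" using V0[of f'] by simp
 qed
 qed
qed

text \<open>\<open>dummy\<close> provides admissible parameters far from any finite set, for stages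
  at which only zero profiles remain; \<open>esc\<close> says that nonzero weak limits force
  \<open>lev\<close> to infinity. The pair \<open>g0\<close>, \<open>f0\<close> is imposed as
  profile number 0 and is not chosen greedily, which is why the uniform estimate on remainders is
  stated for \<open>l > 0\<close>.\<close>

theorem profile_decomposition:
 fixes w :: "nat => 'h" and lev :: "'g => real"
 assumes U: "ultra U" "U <= sequentially" and M: "!!k. norm (w k) <= M"
 and dummy: "!!F R. finite F ==> \<exists>d\<in>A. lev d >= R & (\<forall>x\<in>F. norm (d - x) >= R)"
 and esc: "!!g f. (!!k. g k \<in> A) ==> wconv U (%k. T (g k) (w k)) f ==> f ~= 0 ==> filterlim (%k. lev (g k)) at_top U"
 and g0: "!!k. g0 k \<in> A" and f0: "wconv U (%k. T (g0 k) (w k)) f0" "f0 ~= 0"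
 obtains g f where "g 0 = g0" "f 0 = f0" "!!j k. g j k \<in> A"
 "!!j. wconv U (%k. T (g j k) (w k)) (f j)"
 "!!i j. i ~= j ==> filterlim (%k. g i k - g j k) at_infinity U"
 "!!j. filterlim (%k. lev (g j k)) at_top U"
 "!!l e kap. l > 0 ==> kap > 0 ==>
 eventually (%k. \<forall>d\<in>A. \<bar>inner (T d (remainder w g f l k)) e\<bar> <= (2 * norm (f l) + kap) * norm e) U"
 "f \<longlonglongrightarrow> 0"
proof -
 note nb = ultra_not_bot[OF U(1)]
 \<comment> \<open>The remainder as a function of the list of profiles found so far; the choice at
   each stage depends on this whole list.\<close>
 define rem :: "((nat => 'g) \<times> 'h) list => nat => 'h" where
 "rem ps k = w k - (\<Sum>p\<leftarrow>ps. T (- fst p k) (snd p))" for ps k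
 define Q where "Q ps g \<longleftrightarrow> filterlim (%k. lev (g k)) at_top U &
 (\<forall>p\<in>set ps. filterlim (%k. g k - fst p k) at_infinity U)" for ps :: "((nat => 'g) \<times> 'h) list" and g
 define good where "good ps p \<longleftrightarrow> (\<forall>k. fst p k \<in> A) & wconv U (%k. T (fst p k) (rem ps k)) (snd p) &
 (snd p = 0 --> Q ps (fst p)) &
 (\<forall>g' f'. (\<forall>k. g' k \<in> A) --> wconv U (%k. T (g' k) (rem ps k)) f' --> norm f' <= 2 * norm (snd p))" for ps p
 have "\<exists>p. good ps p" for ps
 proof -
 have "\<exists>d\<in>A. lev d >= real k & (\<forall>x\<in>(%p. fst p k) ` set ps. norm (d - x) >= real k)" for k
 by (rule dummy) simp
 then have "\<exists>d. \<forall>k. d k \<in> A & lev (d k) >= real k & (\<forall>p\<in>set ps. norm (d k - fst p k) >= real k)"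
 by (intro choice) auto
 then obtain d where d: "!!k. d k \<in> A" "!!k. lev (d k) >= real k"
 "!!k p. p \<in> set ps ==> norm (d k - fst p k) >= real k" by blast
 have rl: "filterlim real at_top U" using filterlim_real_sequentially U(2) by (rule filterlim_mono[OF _ order_refl])
 have Qd: "Q ps d" unfolding Q_def filterlim_at_infinity_conv_norm_at_top
 by (auto intro!: filterlim_at_top_mono[OF rl] always_eventually d)
 have bd: "norm (rem ps k) <= M + (\<Sum>p\<leftarrow>ps. norm (snd p))" for k
 proof -
 have "norm (\<Sum>p\<leftarrow>ps. T (- fst p k) (snd p)) <= (\<Sum>p\<leftarrow>ps. norm (snd p))"
 by (induction ps) (auto intro: norm_triangle_le)
 then show ?thesis using M[of k] norm_triangle_ineq4[of "w k" "\<Sum>p\<leftarrow>ps. T (- fst p k) (snd p)"]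
 unfolding rem_def by simp
 qed
 show ?thesis
 proof (rule greedy_step[OF U(1) bd d(1), of "Q ps", OF Qd])
 fix g f assume *: "!!k. g k \<in> A" "wconv U (%k. T (g k) (rem ps k)) f" "f = 0 ==> Q ps g"
 "!!g' f'. (!!k. g' k \<in> A) ==> wconv U (%k. T (g' k) (rem ps k)) f' ==> norm f' <= 2 * norm f"
 show "\<exists>p. good ps p"
 unfolding good_def using * by (intro exI[of _ "(g, f)"]) auto
 qed
 qed
 then obtain pick where pick: "!!ps. good ps (pick ps)" by metis
 \<comment> \<open>Keeping the complete history turns the dependent choice into the iteration of one
   selection function.\<close>
 define hist where "hist = rec_nat [(g0, f0)] (%_ ps. ps @ [pick ps])"
 have hist: "hist 0 = [(g0, f0)]" "hist (Suc l) = hist l @ [pick (hist l)]" for l by (simp_all add: hist_def)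
 define p where "p l = last (hist l)" for l
 have hmap: "hist l = map p [0..<Suc l]" for l
 by (induction l) (auto simp: hist p_def)
 have p0: "p 0 = (g0, f0)" by (simp add: p_def hist)
 have pS: "good (map p [0..<Suc l]) (p (Suc l))" for l
 proof -
 have "p (Suc l) = pick (hist l)" by (simp add: p_def hist)
 then show ?thesis using pick[of "hist l"] by (simp only: flip: hmap)
 qed
 define g where "g j = fst (p j)" for j
 define f where "f j = snd (p j)" for j
 have rem: "rem (map p [0..<l]) k = remainder w g f l k" for l k
 by (simp add: rem_def remainder_def g_def f_def interv_sum_list_conv_sum_set_nat atLeast0LessThan comp_def)
 have gd: "good (map p [0..<l]) (p l)" if "l > 0" for l using pS[of "l - 1"] that by simp
 have gA: "g j k \<in> A" for j k using gd[of j] g0 p0 by (cases j) (auto simp: good_def g_def)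
 have lim: "wconv U (%k. T (g l k) (remainder w g f l k)) (f l)" for l
 proof (cases l)
 case 0 then show ?thesis using f0(1) p0 by (simp add: remainder_def g_def f_def)
 next
 case (Suc m) then show ?thesis using gd[of l] unfolding good_def rem by (simp add: g_def f_def)
 qed
 have zero: "filterlim (%k. lev (g l k)) at_top U" "!!i. i < l ==> filterlim (%k. g l k - g i k) at_infinity U"
 if "f l = 0" for l
 proof -
 have "l > 0" using that f0(2) p0 by (cases l) (auto simp: f_def)
 from gd[OF this] that have "Q (map p [0..<l]) (g l)" by (simp add: good_def g_def f_def)
 then show "filterlim (%k. lev (g l k)) at_top U" "!!i. i < l ==> filterlim (%k. g l k - g i k) at_infinity U"
 by (auto simp: Q_def g_def)
 qed
 have bd: "norm (remainder w g f l k) <= M + (\<Sum>j<l. norm (f j))" for l k by (rule remainder_bounded[OF M])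
 \<comment> \<open>Two facts are carried together: the remainder has weak limit 0 along every
   earlier parameter, and the earlier parameters separate pairwise. The first forces the next
   parameter to separate as well, which in turn lets the first survive the subtraction of the next
   profile.\<close>
 have inv: "(\<forall>i<l. wconv U (%k. T (g i k) (remainder w g f l k)) 0) &
 (\<forall>i<l. \<forall>j<l. i ~= j --> filterlim (%k. g i k - g j k) at_infinity U)" for l
 proof (induction l)
 case (Suc l)
 then have IH: "!!i. i < l ==> wconv U (%k. T (g i k) (remainder w g f l k)) 0"
 "!!i j. i < l ==> j < l ==> i ~= j ==> filterlim (%k. g i k - g j k) at_infinity U" by blast+
 have new: "filterlim (%k. g l k - g i k) at_infinity U" if i: "i < l" for i
 proof (cases "f l = 0")
 case True then show ?thesis using zero i by blast
 next
 case False
 show ?thesis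
 proof (rule ccontr)
 assume "\<not> ?thesis"
 \<comment> \<open>A convergent difference would carry the weak limit 0 seen along
   \<open>g i\<close> over to \<open>g l\<close>, against \<open>f l ~= 0\<close>.\<close>
 then obtain c where c: "((%k. g l k - g i k) \<longlongrightarrow> c) U" using ultra_dichotomy[OF U(1)] by blast
 have "wconv U (%k. T (g l k - g i k) (T (g i k) (remainder w g f l k))) (T c 0)"
 by (rule wconv_T[OF c IH(1)[OF i]]) (use bd in simp)
 then have "wconv U (%k. T (g l k) (remainder w g f l k)) 0" by (simp add: T_simps flip: T_add)
 then show False using wconv_unique[OF nb lim[of l]] False by simp
 qed
 qed
 have orth: "filterlim (%k. g i k - g j k) at_infinity U" if "i < Suc l" "j < Suc l" "i ~= j" for i j
 using that IH(2) new filterlim_at_infinity_swap[OF new] by (cases "i = l"; cases "j = l") auto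
 have "wconv U (%k. T (g i k) (remainder w g f (Suc l) k)) 0" if i: "i < Suc l" for i
 proof (cases "i = l")
 case True
 have "wconv U (%k. T (g l k) (remainder w g f l k) - f l) (f l - f l)"
 by (intro wconv_diff lim tendsto_imp_wconv tendsto_const)
 then show ?thesis using True by (simp add: remainder_Suc T_simps)
 next
 case False
 then have il: "i < l" using i by simp
 have "wconv U (%k. T (g i k) (remainder w g f l k) - T (g i k - g l k) (f l)) (0 - 0)"
 by (intro wconv_diff IH il mixing_wconv orth) (use il in auto)
 then show ?thesis by (simp add: remainder_Suc T_simps flip: T_add)
 qed
 then show ?case using orth by blast
 qed simp
 have orth: "filterlim (%k. g i k - g j k) at_infinity U" if "i ~= j" for i j
 using inv[of "Suc (max i j)"] that by (auto simp: less_Suc_eq_le)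
 \<comment> \<open>The profiles subtracted earlier are weakly null along \<open>g j\<close>, so
   \<open>w\<close> and its remainder have the same weak limit there.\<close>
 have wl: "wconv U (%k. T (g j k) (w k)) (f j)" for j
 proof -
 have "wconv U (%k. T (g j k) (remainder w g f j k) + (\<Sum>i<j. T (g j k - g i k) (f i))) (f j + (\<Sum>i<j. 0))"
 by (intro wconv_add lim wconv_sum mixing_wconv orth) auto
 then show ?thesis by (simp add: remainder_def T_simps flip: T_add)
 qed
 have esc': "filterlim (%k. lev (g j k)) at_top U" for j
 using zero(1)[of j] esc[OF gA wl] by (cases "f j = 0") auto
 have "(\<Sum>j<l. (norm (f j))\<^sup>2) <= M\<^sup>2" for l
 using bessel_profiles[of l g U w f "%x. x" M] orth wl M nb by simp
 then have "summable (%j. (norm (f j))\<^sup>2)" by (intro summableI_nonneg_bounded[of _ "M\<^sup>2"]) auto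
 then have "(%j. (norm (f j))\<^sup>2) \<longlonglongrightarrow> 0" by (rule summable_LIMSEQ_zero)
 then have "(%j. sqrt ((norm (f j))\<^sup>2)) \<longlonglongrightarrow> sqrt 0" by (intro tendsto_intros)
 then have f0: "f \<longlonglongrightarrow> 0" by (simp add: tendsto_norm_zero_iff)
 have ev: "eventually (%k. \<forall>d\<in>A. \<bar>inner (T d (remainder w g f l k)) e\<bar> <= (2 * norm (f l) + kap) * norm e) U"
 if l: "l > 0" and kap: "kap > 0" for l e kap
 proof (rule ccontr)
 assume neg: "\<not> ?thesis"
 define P where "P k d \<longleftrightarrow> d \<in> A & \<bar>inner (T d (remainder w g f l k)) e\<bar> > (2 * norm (f l) + kap) * norm e" for k d
 \<comment> \<open>The estimate must be uniform in the parameter. Offending parameters are collected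
   into a single sequence, and the greedy choice bounds its weak limit by
   \<open>2 * norm (f l)\<close>.\<close>
 define d where "d k = (if \<exists>d. P k d then (SOME d. P k d) else g0 k)" for k
 have dA: "d k \<in> A" for k using g0 someI_ex[of "P k"] by (auto simp: d_def P_def)
 have "eventually (%k. \<exists>d. P k d) U"
 by (rule eventually_mono[OF ultra_not[OF U(1) neg]]) (auto simp: P_def not_le)
 then have evP: "eventually (%k. P k (d k)) U"
 by (rule eventually_mono) (auto simp: d_def intro: someI)
 have "eventually (%k. norm (T (d k) (remainder w g f l k)) <= M + (\<Sum>j<l. norm (f j))) U"
 using bd by simp
 then obtain f' where f': "wconv U (%k. T (d k) (remainder w g f l k)) f'"
 by (rule ultra_weak_limit[OF U(1)])
 have nf': "norm f' <= 2 * norm (f l)"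
 using gd[OF l] dA f' unfolding good_def rem f_def by blast
 have "(2 * norm (f l) + kap) * norm e <= \<bar>inner f' e\<bar>"
 proof (rule tendsto_lowerbound[OF _ _ nb])
 show "((%k. \<bar>inner (T (d k) (remainder w g f l k)) e\<bar>) \<longlongrightarrow> \<bar>inner f' e\<bar>) U"
 by (intro tendsto_rabs wconvD f')
 show "\<forall>\<^sub>F k in U. (2 * norm (f l) + kap) * norm e <= \<bar>inner (T (d k) (remainder w g f l k)) e\<bar>"
 using evP by eventually_elim (auto simp: P_def)
 qed
 also have "... <= norm f' * norm e" by (rule Cauchy_Schwarz_ineq2)
 also have "... <= 2 * norm (f l) * norm e" using nf' by (simp add: mult_right_mono)
 finally have "kap * norm e <= 0" by (simp add: distrib_right)
 then have "e = 0" using kap by (simp add: mult_le_0_iff)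
 moreover obtain k where "P k (d k)" using eventually_happens[OF evP] nb by blast
 ultimately show False by (simp add: P_def)
 qed
 show ?thesis
 proof (rule that[of g f])
 show "g 0 = g0" "f 0 = f0" using p0 by (simp_all add: g_def f_def)
 show "g j k \<in> A" for j k by (rule gA)
 show "wconv U (%k. T (g j k) (w k)) (f j)" for j by (rule wl)
 show "filterlim (%k. g i k - g j k) at_infinity U" if "i ~= j" for i j using that by (rule orth)
 show "filterlim (%k. lev (g j k)) at_top U" for j by (rule esc')
 show "eventually (%k. \<forall>d\<in>A. \<bar>inner (T d (remainder w g f l k)) e\<bar> <= (2 * norm (f l) + kap) * norm e) U"
 if "l > 0" "kap > 0" for l e kap using that by (rule ev)
 qed (rule f0)
qed

end

section \<open>The Hilbert space of square integrable functions\<close>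

lemma in_L2_iff:
 fixes f :: "real ^ 'n => 'b::{real_normed_vector}"
 shows "in_L2 f \<longleftrightarrow> f \<in> borel_measurable borel & integrable lborel (%x. (norm (f x))\<^sup>2)"
proof -
 have e: "ennreal (norm (f x) powr 2) = ennreal ((norm (f x))\<^sup>2)" for x by simp
 have "Lp_norm 2 f < \<infinity> \<longleftrightarrow> (\<integral>\<^sup>+x. ennreal ((norm (f x))\<^sup>2) \<partial>lborel) < \<infinity>"
 unfolding Lp_norm_def ennreal_powr_def e by (auto simp: less_top[symmetric])
 then show ?thesis
 unfolding in_L2_def by (auto simp: integrable_iff_bounded)
qed

lemma in_L2_measurable [measurable_dest]: "in_L2 f ==> f \<in> borel_measurable borel"
 by (simp add: in_L2_iff)

lemma in_L2_integrable: "in_L2 f ==> integrable lborel (%x. (norm (f x))\<^sup>2)"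
 by (simp add: in_L2_iff)

lemma Lp_norm_2:
 assumes "in_L2 f"
 shows "Lp_norm 2 f = ennreal (sqrt (\<integral>x. (norm (f x))\<^sup>2 \<partial>lborel))"
proof -
 have e: "ennreal (norm (f x) powr 2) = ennreal ((norm (f x))\<^sup>2)" for x by simp
 have "(\<integral>\<^sup>+x. ennreal ((norm (f x))\<^sup>2) \<partial>lborel) = ennreal (\<integral>x. (norm (f x))\<^sup>2 \<partial>lborel)"
 by (intro nn_integral_eq_integral in_L2_integrable assms) simp
 then show ?thesis unfolding Lp_norm_def ennreal_powr_def e by (simp add: powr_half_sqrt)
qed

lemma Lp_norm_cong_AE:
 assumes "AE x in lborel. norm (f x) = norm (g x)"
 shows "Lp_norm p f = Lp_norm p g"
proof -
 have "(\<integral>\<^sup>+x. ennreal (norm (f x) powr p) \<partial>lborel) = (\<integral>\<^sup>+x. ennreal (norm (g x) powr p) \<partial>lborel)"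
 by (rule nn_integral_cong_AE) (use assms in auto)
 then show ?thesis by (simp add: Lp_norm_def)
qed

lemma in_L2_bound:
 fixes f :: "real ^ 'n => 'b::{real_normed_vector}"
 assumes "f \<in> borel_measurable borel" "integrable lborel g" "!!x. (norm (f x))\<^sup>2 <= g x"
 shows "in_L2 f"
 unfolding in_L2_iff
proof
 show "integrable lborel (%x. (norm (f x))\<^sup>2)"
 by (rule Bochner_Integration.integrable_bound[OF assms(2)])
 (use assms(1) in measurable, auto intro!: AE_I2 order_trans[OF assms(3)])
qed (rule assms(1))

lemma in_L2_add:
 fixes f g :: "real ^ 'n => complex"
 assumes f: "in_L2 f" and g: "in_L2 g" shows "in_L2 (%x. f x + g x)"
proof (rule in_L2_bound)
 show "(%x. f x + g x) \<in> borel_measurable borel" using f g by measurable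
 show "integrable lborel (%x. 2 * (norm (f x))\<^sup>2 + 2 * (norm (g x))\<^sup>2)" 
 using in_L2_integrable[OF f] in_L2_integrable[OF g] by simp
 show "(norm (f x + g x))\<^sup>2 <= 2 * (norm (f x))\<^sup>2 + 2 * (norm (g x))\<^sup>2" for x
 proof -
 have "(norm (f x + g x))\<^sup>2 <= (norm (f x) + norm (g x))\<^sup>2" by (simp add: norm_triangle_ineq power_mono)
 also have "... <= 2 * (norm (f x))\<^sup>2 + 2 * (norm (g x))\<^sup>2"
 using sum_squares_bound[of "norm (f x)" "norm (g x)"] by (simp add: power2_sum)
 finally show ?thesis .
 qed
qed

lemma in_L2_cmult: "in_L2 f ==> in_L2 (%x. c * f x :: complex)"
 unfolding in_L2_iff by (auto simp: norm_mult power_mult_distrib)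

lemma in_L2_scaleR: "in_L2 f ==> in_L2 (%x. r *\<^sub>R (f x :: complex))"
 using in_L2_cmult[of f "of_real r"] by (simp add: scaleR_conv_of_real)

lemma in_L2_0 [simp]: "in_L2 (%x. 0)" by (simp add: in_L2_iff)

lemma in_L2_minus: "in_L2 f ==> in_L2 (%x. - f x :: complex)"
 using in_L2_cmult[of f "-1"] by simp

lemma in_L2_diff: "in_L2 f ==> in_L2 g ==> in_L2 (%x. f x - g x :: complex)"
 using in_L2_add[of f "%x. - g x"] in_L2_minus[of g] by simp

lemma cnj_measurable [measurable]: "cnj \<in> borel_measurable borel"
 by (intro borel_measurable_continuous_onI continuous_intros)

lemma in_L2_cnj: "in_L2 f ==> in_L2 (%x. cnj (f x))"
 unfolding in_L2_iff by auto

lemma in_L2_integrable_mult: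
 fixes f g :: "real ^ 'n => complex"
 assumes f: "in_L2 f" and g: "in_L2 g" shows "integrable lborel (%x. f x * g x)"
proof (rule Bochner_Integration.integrable_bound)
 show "integrable lborel (%x. (norm (f x))\<^sup>2 + (norm (g x))\<^sup>2)"
 using in_L2_integrable[OF f] in_L2_integrable[OF g] by simp
 show "(%x. f x * g x) \<in> borel_measurable lborel" using f g by measurable
 show "AE x in lborel. norm (f x * g x) <= norm ((norm (f x))\<^sup>2 + (norm (g x))\<^sup>2)"
 proof (intro AE_I2)
 fix x
 have "norm (f x) * norm (g x) <= (norm (f x))\<^sup>2 + (norm (g x))\<^sup>2"
 using sum_squares_bound[of "norm (f x)" "norm (g x)"] mult_nonneg_nonneg[OF norm_ge_zero norm_ge_zero, of "f x" "g x"] by linarith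
 then show "norm (f x * g x) <= norm ((norm (f x))\<^sup>2 + (norm (g x))\<^sup>2)" by (simp add: norm_mult)
 qed
qed

definition l2_canon :: "(real ^ 'n => complex) => real ^ 'n => complex" where
 "l2_canon f = (SOME g. in_L2 g & (AE x in lborel. f x = g x))"

lemma l2_canon: assumes "in_L2 f" shows "in_L2 (l2_canon f)" "AE x in lborel. f x = l2_canon f x"
 using someI[of "%g. in_L2 g & (AE x in lborel. f x = g x)" f] assms by (simp_all add: l2_canon_def)

lemma l2_canon_cong: assumes "AE x in lborel. f x = g x" shows "l2_canon f = l2_canon g"
proof -
 have "(AE x in lborel. f x = h x) = (AE x in lborel. g x = h x)" for h
 using assms by (auto elim: AE_mp)
 then show ?thesis by (simp add: l2_canon_def)
qed

text \<open>An element of \<open>L\<^sup>2\<close> is a square integrable function selected from its class modulo null sets.\<close>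

typedef ('n::finite) l2 = "{f :: real ^ 'n => complex. in_L2 f & l2_canon f = f}"
 morphisms l2_fun l2_abs
proof
 show "l2_canon (%x. 0) \<in> {f :: real ^ 'n => complex. in_L2 f & l2_canon f = f}"
 using l2_canon(1)[OF in_L2_0] l2_canon_cong[OF l2_canon(2)[OF in_L2_0], symmetric] by blast
qed

definition to_l2 :: "(real ^ 'n => complex) => 'n::finite l2" where
 "to_l2 f = l2_abs (l2_canon f)"

lemma in_L2_l2_fun [simp]: "in_L2 (l2_fun a)" using l2_fun[of a] by simp

lemma l2_fun_measurable [measurable]: "l2_fun a \<in> borel_measurable borel" by (rule in_L2_measurable) simp

lemma to_l2_l2_fun [simp]: "to_l2 (l2_fun a) = a"
 using l2_fun[of a] by (simp add: to_l2_def l2_fun_inverse)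

lemma l2_fun_to_l2: assumes "in_L2 f" shows "AE x in lborel. l2_fun (to_l2 f) x = f x"
proof -
 have "l2_canon f \<in> {f. in_L2 f & l2_canon f = f}"
 using l2_canon[OF assms] l2_canon_cong[of f "l2_canon f"] by simp
 then have "l2_fun (to_l2 f) = l2_canon f" by (simp add: to_l2_def l2_abs_inverse)
 then show ?thesis using l2_canon(2)[OF assms] by auto
qed

lemma to_l2_cong: "AE x in lborel. f x = g x ==> to_l2 f = to_l2 g"
 by (simp add: to_l2_def l2_canon_cong[of f g])

lemma l2_eqI: "AE x in lborel. l2_fun a x = l2_fun b x ==> a = b"
 using to_l2_cong[of "l2_fun a" "l2_fun b"] by simp

lemma l2_eqI2: "AE x in lborel. l2_fun a x = f x ==> a = to_l2 f"
 using to_l2_cong[of "l2_fun a" f] by simp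

text \<open>The scalar product is the real part of the complex one. Hilbert space arguments are
  carried out over the reals, and pairing with \<open>cmul \<i>\<close> supplies the imaginary part
  when it matters.\<close>

instantiation l2 :: (finite) real_inner
begin
definition "0 = to_l2 (%x. 0)"
definition "a + b = to_l2 (%x. l2_fun a x + l2_fun b x)"
definition "- a = to_l2 (%x. - l2_fun a x)"
definition "a - b = to_l2 (%x. l2_fun a x - l2_fun b x)"
definition "r *\<^sub>R a = to_l2 (%x. r *\<^sub>R l2_fun a x)"
definition "inner a b = (\<integral>x. Re (l2_fun a x * cnj (l2_fun b x)) \<partial>lborel)"
definition "norm a = sqrt (inner a (a :: 'a l2))"
definition "dist a b = norm (a - b :: 'a l2)"
definition "sgn a = inverse (norm a) *\<^sub>R (a :: 'a l2)"
definition [code del]: "(uniformity :: ('a l2 \<times> 'a l2) filter) = (INF e\<in>{0 <..}. principal {(x, y). dist x y < e})"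
definition [code del]: "open (S :: 'a l2 set) = (\<forall>x\<in>S. \<forall>\<^sub>F (x', y) in uniformity. x' = x --> y \<in> S)"

lemma l2_fun_0: "AE x in lborel. l2_fun 0 x = 0"
 unfolding zero_l2_def by (rule l2_fun_to_l2) simp

lemma l2_fun_add: "AE x in lborel. l2_fun (a + b) x = l2_fun a x + l2_fun b x"
 unfolding plus_l2_def by (rule l2_fun_to_l2) (simp add: in_L2_add)

lemma l2_fun_minus: "AE x in lborel. l2_fun (- a) x = - l2_fun a x"
 unfolding uminus_l2_def by (rule l2_fun_to_l2) (simp add: in_L2_minus)

lemma l2_fun_diff: "AE x in lborel. l2_fun (a - b) x = l2_fun a x - l2_fun b x"
 unfolding minus_l2_def by (rule l2_fun_to_l2) (simp add: in_L2_diff)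

lemma l2_fun_scaleR: "AE x in lborel. l2_fun (r *\<^sub>R a) x = r *\<^sub>R l2_fun a x"
 unfolding scaleR_l2_def by (rule l2_fun_to_l2) (simp add: in_L2_scaleR)

lemma l2_inner_integrable: "integrable lborel (%x. Re (l2_fun a x * cnj (l2_fun b x)))"
 by (intro integrable_Re in_L2_integrable_mult in_L2_cnj) simp_all

instance
proof
 fix a b c :: "'a l2" and r s :: real
 show "a + b + c = a + (b + c)"
 by (rule l2_eqI) (use l2_fun_add[of "a + b" c] l2_fun_add[of a b] l2_fun_add[of a "b + c"] l2_fun_add[of b c] in eventually_elim, simp)
 show "a + b = b + a" by (simp add: plus_l2_def add.commute)
 show "0 + a = a"
 by (rule l2_eqI) (use l2_fun_add[of 0 a] l2_fun_0 in eventually_elim, simp)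
 show "- a + a = 0"
 by (rule l2_eqI) (use l2_fun_add[of "- a" a] l2_fun_minus[of a] l2_fun_0 in eventually_elim, simp)
 show "a - b = a + - b"
 by (rule l2_eqI) (use l2_fun_add[of a "- b"] l2_fun_minus[of b] l2_fun_diff[of a b] in eventually_elim, simp)
 show "r *\<^sub>R (a + b) = r *\<^sub>R a + r *\<^sub>R b"
 by (rule l2_eqI) (use l2_fun_scaleR[of r "a + b"] l2_fun_add[of a b] l2_fun_add[of "r *\<^sub>R a" "r *\<^sub>R b"]
 l2_fun_scaleR[of r a] l2_fun_scaleR[of r b] in eventually_elim, simp add: scaleR_add_right)
 show "(r + s) *\<^sub>R a = r *\<^sub>R a + s *\<^sub>R a"
 by (rule l2_eqI) (use l2_fun_scaleR[of "r + s" a] l2_fun_add[of "r *\<^sub>R a" "s *\<^sub>R a"]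
 l2_fun_scaleR[of r a] l2_fun_scaleR[of s a] in eventually_elim, simp add: scaleR_add_left)
 show "r *\<^sub>R s *\<^sub>R a = (r * s) *\<^sub>R a"
 by (rule l2_eqI) (use l2_fun_scaleR[of "r * s" a] l2_fun_scaleR[of r "s *\<^sub>R a"]
 l2_fun_scaleR[of s a] in eventually_elim, simp)
 show "1 *\<^sub>R a = a"
 by (rule l2_eqI) (use l2_fun_scaleR[of 1 a] in eventually_elim, simp)
 show "sgn a = scaleR (inverse (norm a)) a" by (simp add: sgn_l2_def)
 show "dist a b = norm (a - b)" by (simp add: dist_l2_def)
 show "(uniformity :: ('a l2 \<times> 'a l2) filter) = (INF e\<in>{0 <..}. principal {(x, y). dist x y < e})"
 by (simp add: uniformity_l2_def)
 show "open U = (\<forall>x\<in>U. \<forall>\<^sub>F (x', y) in uniformity. x' = x --> y \<in> U)" for U :: "'a l2 set"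
 by (simp add: open_l2_def)
 have "Re (l2_fun a x * cnj (l2_fun b x)) = Re (l2_fun b x * cnj (l2_fun a x))" for x by (simp add: mult.commute)
 then show "inner a b = inner b a" by (simp only: inner_l2_def)
 have "inner (a + b) c = (\<integral>x. Re (l2_fun a x * cnj (l2_fun c x)) + Re (l2_fun b x * cnj (l2_fun c x)) \<partial>lborel)"
 unfolding inner_l2_def
 by (rule integral_cong_AE; (measurable; fail)?) (use l2_fun_add[of a b] in eventually_elim, simp add: distrib_right)
 also have "... = inner a c + inner b c"
 unfolding inner_l2_def by (intro Bochner_Integration.integral_add l2_inner_integrable)
 finally show "inner (a + b) c = inner a c + inner b c" .
 have "inner (r *\<^sub>R a) b = (\<integral>x. r * Re (l2_fun a x * cnj (l2_fun b x)) \<partial>lborel)"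
 unfolding inner_l2_def
 by (rule integral_cong_AE; (measurable; fail)?) (use l2_fun_scaleR[of r a] in eventually_elim, simp add: algebra_simps)
 then show "inner (r *\<^sub>R a) b = r * inner a b" by (simp add: inner_l2_def)
 have e: "Re (l2_fun a x * cnj (l2_fun a x)) = (norm (l2_fun a x))\<^sup>2" for x
 by (simp add: complex_norm_square[symmetric] del: complex_mult_cnj)
 show "0 <= inner a a" unfolding inner_l2_def e by simp
 show "inner a a = 0 \<longleftrightarrow> a = 0"
 proof
 assume "inner a a = 0"
 then have "AE x in lborel. (norm (l2_fun a x))\<^sup>2 = 0"
 unfolding inner_l2_def e by (subst (asm) integral_nonneg_eq_0_iff_AE) (auto intro: in_L2_integrable)
 then show "a = 0" using l2_fun_0 by (intro l2_eqI) (auto elim: AE_mp)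
 next
 assume "a = 0"
 then have "AE x in lborel. (norm (l2_fun a x))\<^sup>2 = 0" using l2_fun_0 by auto
 then show "inner a a = 0" unfolding inner_l2_def e by (rule integral_eq_zero_AE)
 qed
 show "norm a = sqrt (inner a a)" by (simp add: norm_l2_def)
qed

end

lemma inner_to_l2:
 assumes "in_L2 f" "in_L2 g"
 shows "inner (to_l2 f) (to_l2 g) = (\<integral>x. Re (f x * cnj (g x)) \<partial>lborel)"
 unfolding inner_l2_def
proof (rule integral_cong_AE)
 show "(%x. Re (l2_fun (to_l2 f) x * cnj (l2_fun (to_l2 g) x))) \<in> borel_measurable lborel" by measurable
 show "(%x. Re (f x * cnj (g x))) \<in> borel_measurable lborel" using assms by measurable
 show "AE x in lborel. Re (l2_fun (to_l2 f) x * cnj (l2_fun (to_l2 g) x)) = Re (f x * cnj (g x))"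
 using l2_fun_to_l2[OF assms(1)] l2_fun_to_l2[OF assms(2)] by eventually_elim simp
qed

lemma inner_l2_fun: "inner a b = (\<integral>x. Re (l2_fun a x * cnj (l2_fun b x)) \<partial>lborel)"
 by (simp add: inner_l2_def)

lemma norm_to_l2: assumes "in_L2 f" shows "(norm (to_l2 f))\<^sup>2 = (\<integral>x. (norm (f x))\<^sup>2 \<partial>lborel)"
proof -
 have e: "Re (f x * cnj (f x)) = (norm (f x))\<^sup>2" for x
 by (simp add: complex_norm_square[symmetric] del: complex_mult_cnj)
 show ?thesis using inner_to_l2[OF assms assms] by (simp only: power2_norm_eq_inner[of "to_l2 f"] e)
qed

lemma norm_l2_fun: "(norm a)\<^sup>2 = (\<integral>x. (norm (l2_fun a x))\<^sup>2 \<partial>lborel)"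
 using norm_to_l2[of "l2_fun a"] by simp

lemma Lp_norm_to_l2: "in_L2 f ==> Lp_norm 2 f = ennreal (norm (to_l2 f))"
 by (simp add: Lp_norm_2 flip: norm_to_l2)

lemma to_l2_add: "in_L2 f ==> in_L2 g ==> to_l2 (%x. f x + g x) = to_l2 f + to_l2 g"
 by (rule l2_eqI2[symmetric]) (use l2_fun_to_l2[of f] l2_fun_to_l2[of g] l2_fun_add[of "to_l2 f" "to_l2 g"] in \<open>auto elim: AE_mp\<close>)

lemma to_l2_diff: "in_L2 f ==> in_L2 g ==> to_l2 (%x. f x - g x) = to_l2 f - to_l2 g"
 by (rule l2_eqI2[symmetric]) (use l2_fun_to_l2[of f] l2_fun_to_l2[of g] l2_fun_diff[of "to_l2 f" "to_l2 g"] in \<open>auto elim: AE_mp\<close>)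

lemma to_l2_scaleR: "in_L2 f ==> to_l2 (%x. r *\<^sub>R f x) = r *\<^sub>R to_l2 f"
 by (rule l2_eqI2[symmetric]) (use l2_fun_to_l2[of f] l2_fun_scaleR[of r "to_l2 f"] in \<open>auto elim: AE_mp\<close>)

lemma to_l2_sum: "finite I ==> (!!i. i \<in> I ==> in_L2 (f i)) ==>
 in_L2 (%x. \<Sum>i\<in>I. f i x) & to_l2 (%x. \<Sum>i\<in>I. f i x) = (\<Sum>i\<in>I. to_l2 (f i))"
proof (induction I rule: finite_induct)
 case empty show ?case by (simp flip: zero_l2_def)
next
 case (insert i I) then show ?case by (simp add: to_l2_add in_L2_add)
qed

text \<open>Riesz-Fischer: a rapidly convergent subsequence converges almost everywhere, and Fatou's
  lemma shows that its pointwise limit is the norm limit of the whole sequence.\<close>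

instance l2 :: (finite) complete_space
proof
 fix X :: "nat => 'a l2" assume X: "Cauchy X"
 have "\<exists>r. strict_mono r & (\<forall>k. norm (X (r (Suc k)) - X (r k)) <= (1/2) ^ k)"
 proof -
 have "\<exists>N. \<forall>m\<ge>N. \<forall>n\<ge>N. norm (X m - X n) < (1/2) ^ k" for k using CauchyD[OF X] by simp
 then obtain N where N: "!!k m n. m >= N k ==> n >= N k ==> norm (X m - X n) < (1/2) ^ k" by metis
 \<comment> \<open>Summing the indices makes \<open>r\<close> strictly increasing while keeping
   \<open>r k >= N k\<close>.\<close>
 define r where "r k = (\<Sum>i\<le>k. N i + 1)" for k
 have "strict_mono r" by (rule strict_monoI_Suc) (simp add: r_def)
 moreover have rN: "r k >= N k" for k
 unfolding r_def by (rule order_trans[OF _ member_le_sum[of k "{..k}" "%i. N i + 1"]]) auto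
 have "norm (X (r (Suc k)) - X (r k)) <= (1/2) ^ k" for k
 by (intro less_imp_le N rN order_trans[OF rN[of k]]) (simp add: r_def)
 ultimately show ?thesis by blast
 qed
 then obtain r where r: "strict_mono r" "!!k. norm (X (r (Suc k)) - X (r k)) <= (1/2) ^ k" by blast
 define d where "d k x = l2_fun (X (r (Suc k))) x - l2_fun (X (r k)) x" for k x
 have [measurable]: "d k \<in> borel_measurable borel" for k unfolding d_def by measurable
 have dL: "in_L2 (d k)" for k unfolding d_def by (rule in_L2_diff) simp_all
 have nd: "(\<integral>x. (norm (d k x))\<^sup>2 \<partial>lborel) <= (1/4) ^ k" for k
 proof -
 have "to_l2 (d k) = X (r (Suc k)) - X (r k)" unfolding d_def by (subst to_l2_diff) simp_all
 then have "(\<integral>x. (norm (d k x))\<^sup>2 \<partial>lborel) = (norm (X (r (Suc k)) - X (r k)))\<^sup>2" using norm_to_l2[OF dL[of k]] by simp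
 also have "... <= ((1/2) ^ k)\<^sup>2" using r(2) by (intro power_mono) auto
 also have "((1/2 :: real) ^ k)\<^sup>2 = (1/4) ^ k" by (simp add: power2_eq_square flip: power_mult_distrib)
 finally show ?thesis .
 qed
 \<comment> \<open>The weight \<open>2 ^ k\<close> turns square integrability of the increments into geometric pointwise decay.\<close>
 have "(\<integral>\<^sup>+x. (\<Sum>k. ennreal (2 ^ k * (norm (d k x))\<^sup>2)) \<partial>lborel) = (\<Sum>k. \<integral>\<^sup>+x. ennreal (2 ^ k * (norm (d k x))\<^sup>2) \<partial>lborel)"
 by (rule nn_integral_suminf) measurable
 also have "... <= (\<Sum>k. ennreal ((1/2) ^ k))"
 proof (intro suminf_le)
 fix k
 have "(\<integral>\<^sup>+x. ennreal (2 ^ k * (norm (d k x))\<^sup>2) \<partial>lborel) = ennreal (\<integral>x. 2 ^ k * (norm (d k x))\<^sup>2 \<partial>lborel)"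
 using in_L2_integrable[OF dL] by (intro nn_integral_eq_integral) auto
 also have "... <= ennreal ((1/2) ^ k)"
 proof (rule ennreal_leI)
 have "(2::real) ^ k * (1/4) ^ k = (1/2) ^ k" by (subst power_mult_distrib[symmetric]) simp
 then show "(\<integral>x. 2 ^ k * (norm (d k x))\<^sup>2 \<partial>lborel) <= (1/2) ^ k"
 using mult_left_mono[OF nd[of k], of "2 ^ k"] by simp
 qed
 finally show "(\<integral>\<^sup>+x. ennreal (2 ^ k * (norm (d k x))\<^sup>2) \<partial>lborel) <= ennreal ((1/2) ^ k)" .
 qed auto
 also have "... < \<infinity>" by (subst suminf_ennreal_eq[OF _ geometric_sums]) auto
 finally have "AE x in lborel. (\<Sum>k. ennreal (2 ^ k * (norm (d k x))\<^sup>2)) ~= \<infinity>"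
 by (intro nn_integral_PInf_AE) auto
 then have conv: "AE x in lborel. convergent (%k. l2_fun (X (r k)) x)"
 proof eventually_elim
 case (elim x)
 then have "summable (%k. 2 ^ k * (norm (d k x))\<^sup>2)"
 by (intro summable_suminf_not_top) (auto simp: top_ennreal_def infinity_ennreal_def)
 then have "(%k. 2 ^ k * (norm (d k x))\<^sup>2) \<longlonglongrightarrow> 0" by (rule summable_LIMSEQ_zero)
 then have "Bseq (%k. 2 ^ k * (norm (d k x))\<^sup>2)" by (intro convergent_imp_Bseq) (auto simp: convergent_def)
 then obtain C where C: "C > 0" "!!k. norm (2 ^ k * (norm (d k x))\<^sup>2) <= C" by (auto simp: Bseq_def)
 have "norm (d k x) <= sqrt C * (sqrt (1/2)) ^ k" for k
 proof -
 have "(norm (d k x))\<^sup>2 <= C * (1/2) ^ k" using C(2)[of k] by (simp add: field_simps)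
 then have "norm (d k x) <= sqrt (C * (1/2) ^ k)" by (rule real_le_rsqrt)
 then show ?thesis by (simp add: real_sqrt_mult real_sqrt_power)
 qed
 then have "summable (%k. d k x)"
 by (rule summable_comparison_test'[OF summable_mult[OF summable_geometric], rotated]) (simp add: real_sqrt_lt_1_iff)
 then have "convergent (%n. \<Sum>k<n. d k x)" by (simp add: summable_iff_convergent)
 then have "convergent (%n. l2_fun (X (r n)) x - l2_fun (X (r 0)) x)"
 by (simp add: d_def sum_lessThan_telescope[of "%k. l2_fun (X (r k)) x"])
 then have "convergent (%n. (l2_fun (X (r n)) x - l2_fun (X (r 0)) x) + l2_fun (X (r 0)) x)"
 by (intro convergent_add convergent_const)
 then show ?case by simp
 qed
 define f where "f x = lim (%k. l2_fun (X (r k)) x)" for x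
 have fm[measurable]: "f \<in> borel_measurable borel" unfolding f_def by measurable
 have lim: "AE x in lborel. (%k. l2_fun (X (r k)) x) \<longlonglongrightarrow> f x"
 using conv by eventually_elim (simp add: f_def convergent_LIMSEQ_iff)
 have fat: "(\<integral>\<^sup>+x. ennreal ((norm (l2_fun (X m) x - f x))\<^sup>2) \<partial>lborel) <= ennreal (e\<^sup>2)"
 if e: "e >= 0" and N: "!!n. n >= N ==> norm (X m - X n) <= e" for m N e
 proof -
 have "(\<integral>\<^sup>+x. ennreal ((norm (l2_fun (X m) x - f x))\<^sup>2) \<partial>lborel)
 = (\<integral>\<^sup>+x. liminf (%k. ennreal ((norm (l2_fun (X m) x - l2_fun (X (r k)) x))\<^sup>2)) \<partial>lborel)"
 proof (rule nn_integral_cong_AE, use lim in eventually_elim)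
 case (elim x)
 then have "(%k. ennreal ((norm (l2_fun (X m) x - l2_fun (X (r k)) x))\<^sup>2)) \<longlonglongrightarrow> ennreal ((norm (l2_fun (X m) x - f x))\<^sup>2)"
 by (intro tendsto_ennrealI tendsto_intros)
 then show ?case by (rule lim_imp_Liminf[OF trivial_limit_sequentially, symmetric])
 qed
 also have "... <= liminf (%k. \<integral>\<^sup>+x. ennreal ((norm (l2_fun (X m) x - l2_fun (X (r k)) x))\<^sup>2) \<partial>lborel)"
 by (rule nn_integral_liminf) measurable
 also have "... <= limsup (%k. \<integral>\<^sup>+x. ennreal ((norm (l2_fun (X m) x - l2_fun (X (r k)) x))\<^sup>2) \<partial>lborel)"
 by (rule Liminf_le_Limsup) simp
 also have "... <= ennreal (e\<^sup>2)"
 proof (rule Limsup_bounded)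
 have "(\<integral>\<^sup>+x. ennreal ((norm (l2_fun (X m) x - l2_fun (X n) x))\<^sup>2) \<partial>lborel) = ennreal ((norm (X m - X n))\<^sup>2)" for n
 proof -
 have L: "in_L2 (%x. l2_fun (X m) x - l2_fun (X n) x)" by (rule in_L2_diff) simp_all
 have "to_l2 (%x. l2_fun (X m) x - l2_fun (X n) x) = X m - X n" by (subst to_l2_diff) simp_all
 then show ?thesis using norm_to_l2[OF L] in_L2_integrable[OF L] by (simp add: nn_integral_eq_integral)
 qed
 moreover have "eventually (%k. r k >= N) sequentially"
 using filterlim_subseq[OF r(1)] by (simp add: filterlim_at_top)
 ultimately show "\<forall>\<^sub>F k in sequentially. (\<integral>\<^sup>+x. ennreal ((norm (l2_fun (X m) x - l2_fun (X (r k)) x))\<^sup>2) \<partial>lborel) <= ennreal (e\<^sup>2)"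
 by (auto elim!: eventually_mono intro!: ennreal_leI power_mono N)
 qed
 finally show ?thesis .
 qed
 have Ne: "\<exists>N. \<forall>m\<ge>N. \<forall>n\<ge>N. norm (X m - X n) <= e" if "e > 0" for e
 using CauchyD[OF X that] less_imp_le by blast
 obtain N1 where N1: "!!m n. m >= N1 ==> n >= N1 ==> norm (X m - X n) <= 1" using Ne[of 1] by auto
 have dL: "in_L2 (%x. l2_fun (X m) x - f x)" if m: "m >= N1" for m
 proof -
 have "(\<integral>\<^sup>+x. ennreal ((norm (l2_fun (X m) x - f x))\<^sup>2) \<partial>lborel) <= ennreal (1\<^sup>2)" by (rule fat[of _ N1]) (use N1 m in auto)
 also have "... < \<infinity>" by simp
 finally show ?thesis unfolding in_L2_iff by (simp add: integrable_iff_bounded)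
 qed
 have fL: "in_L2 f" using in_L2_diff[OF in_L2_l2_fun dL[OF order_refl], of "X N1"] by simp
 have "X \<longlonglongrightarrow> to_l2 f"
 proof (rule metric_LIMSEQ_I)
 fix e :: real assume e: "e > 0"
 obtain N where N: "!!m n. m >= N ==> n >= N ==> norm (X m - X n) <= e / 2" using Ne[of "e/2"] e by auto
 show "\<exists>N. \<forall>n\<ge>N. dist (X n) (to_l2 f) < e"
 proof (intro exI[of _ "max N N1"] allI impI)
 fix m assume m: "max N N1 <= m"
 have "to_l2 (%x. l2_fun (X m) x - f x) = X m - to_l2 f" using fL by (subst to_l2_diff) simp_all
 then have n: "(norm (X m - to_l2 f))\<^sup>2 = (\<integral>x. (norm (l2_fun (X m) x - f x))\<^sup>2 \<partial>lborel)"
 using norm_to_l2[OF dL[of m]] m by simp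
 have "ennreal (\<integral>x. (norm (l2_fun (X m) x - f x))\<^sup>2 \<partial>lborel) = (\<integral>\<^sup>+x. ennreal ((norm (l2_fun (X m) x - f x))\<^sup>2) \<partial>lborel)"
 by (rule nn_integral_eq_integral[symmetric]) (use in_L2_integrable[OF dL[of m]] m in auto)
 also have "... <= ennreal ((e/2)\<^sup>2)" by (rule fat[of _ N]) (use N e m in auto)
 finally have "(norm (X m - to_l2 f))\<^sup>2 <= (e/2)\<^sup>2" unfolding n by (rule ennreal_le_iff[THEN iffD1, rotated]) simp
 then have "norm (X m - to_l2 f) <= e/2" by (rule power2_le_imp_le) (use e in simp)
 then show "dist (X m) (to_l2 f) < e" using e by (simp add: dist_norm)
 qed
 qed
 then show "convergent X" by (auto simp: convergent_def)
qed

text \<open>Norm convergence is mean convergence of the squared differences to 0. The purpose is to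
  make Fatou's lemma available for other Lebesgue exponents.\<close>

lemma l2_tendsto_AE_subseq:
 assumes "X \<longlonglongrightarrow> (a :: 'n::finite l2)"
 obtains r :: "nat => nat" where "strict_mono r" "AE x in lborel. (%k. l2_fun (X (r k)) x) \<longlonglongrightarrow> l2_fun a x"
proof -
 have L: "in_L2 (%x. l2_fun (X k) x - l2_fun a x)" for k by (rule in_L2_diff) simp_all
 have "(\<integral>x. norm ((norm (l2_fun (X k) x - l2_fun a x))\<^sup>2) \<partial>lborel) = (norm (X k - a))\<^sup>2" for k
 using norm_to_l2[OF L[of k]] by (simp add: to_l2_diff)
 moreover have "(%k. (norm (X k - a))\<^sup>2) \<longlonglongrightarrow> (norm (a - a))\<^sup>2" by (intro tendsto_intros assms)
 ultimately have "(%k. \<integral>x. norm ((norm (l2_fun (X k) x - l2_fun a x))\<^sup>2) \<partial>lborel) \<longlonglongrightarrow> 0" by simp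
 from tendsto_L1_AE_subseq[OF in_L2_integrable[OF L] this] obtain r :: "nat => nat" where r: "strict_mono r"
 "AE x in lborel. (%k. (norm (l2_fun (X (r k)) x - l2_fun a x))\<^sup>2) \<longlonglongrightarrow> 0" by blast
 have "AE x in lborel. (%k. l2_fun (X (r k)) x) \<longlonglongrightarrow> l2_fun a x"
 using r(2)
 proof eventually_elim
 case (elim x)
 then have "(%k. sqrt ((norm (l2_fun (X (r k)) x - l2_fun a x))\<^sup>2)) \<longlonglongrightarrow> sqrt 0" by (intro tendsto_intros)
 then show ?case by (simp add: tendsto_norm_zero_iff LIM_zero_iff)
 qed
 then show ?thesis using that r(1) by blast
qed

subsection \<open>Weighted affine changes of variables\<close>

lemma nn_integral_affine:
 fixes f :: "real ^ 'n => ennreal"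
 assumes [measurable]: "f \<in> borel_measurable borel" and c: "c ~= 0"
 shows "(\<integral>\<^sup>+x. f x \<partial>lborel) = ennreal (\<bar>c\<bar> ^ CARD('n)) * (\<integral>\<^sup>+x. f (c *\<^sub>R x + y) \<partial>lborel)"
proof -
 have "(\<integral>\<^sup>+x. f x \<partial>lborel) = (\<integral>\<^sup>+x. f x \<partial>density (distr lborel borel (%x. y + c *\<^sub>R x)) (%_. \<bar>c\<bar>^DIM(real ^ 'n)))"
 proof -
 have e: "(lborel :: (real ^ 'n) measure) = density (distr lborel borel (%x. y + c *\<^sub>R x)) (%_. \<bar>c\<bar>^DIM(real ^ 'n))"
 by (rule lborel_affine[OF c])
 show ?thesis by (subst e) (rule refl)
 qed
 also have "... = ennreal (\<bar>c\<bar> ^ CARD('n)) * (\<integral>\<^sup>+x. f (c *\<^sub>R x + y) \<partial>lborel)"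
 by (subst nn_integral_density) (simp_all add: nn_integral_distr nn_integral_cmult add.commute)
 finally show ?thesis .
qed

lemma AE_lborel_affine:
 fixes P :: "real ^ 'n => bool"
 assumes P: "AE x in lborel. P x" and c: "c ~= 0"
 shows "AE x in lborel. P (c *\<^sub>R x + y)"
proof -
 obtain N where N: "{x. \<not> P x} \<subseteq> N" "N \<in> sets borel" "emeasure lborel N = 0"
 using P by (auto elim!: AE_E)
 have "ennreal (\<bar>c\<bar> ^ CARD('n)) * (\<integral>\<^sup>+x. indicator N (c *\<^sub>R x + y) \<partial>lborel) = 0"
 using nn_integral_affine[of "indicator N" c y] N c by simp
 then have "(\<integral>\<^sup>+x. indicator N (c *\<^sub>R x + y) \<partial>lborel) = 0" using c by simp
 then have "AE x in lborel. indicator N (c *\<^sub>R x + y) = (0::ennreal)"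
 using N(2) by (subst (asm) nn_integral_0_iff_AE) auto
 then show ?thesis using N(1) by (auto simp: indicator_def elim!: eventually_mono split: if_splits)
qed

text \<open>Translations, dilations, modulations and the quadratic phases of the profiles all have
  this form, and the form is closed under composition, so one treatment of isometry and linearity
  serves them all.\<close>

definition wcomp :: "(real ^ 'n => complex) => real => real ^ 'n => (real ^ 'n => complex) => real ^ 'n => complex" where
 "wcomp m c y f = (%x. m x * f (c *\<^sub>R x + y))"

text \<open>The weights for which \<open>wcomp m c y\<close> preserves the \<open>L\<^sup>2\<close> norm.\<close>

definition iso_weight :: "(real ^ 'n => complex) => real => bool" where
 "iso_weight m c \<longleftrightarrow> c ~= 0 & m \<in> borel_measurable borel & (\<forall>x. (norm (m x))\<^sup>2 = \<bar>c\<bar> ^ CARD('n))"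

lemma iso_weight_1 [simp]: "iso_weight (%_. 1) 1"
 by (simp add: iso_weight_def)

lemma wcomp_in_L2:
 fixes f :: "real ^ 'n => complex"
 assumes m: "iso_weight m c" and f: "in_L2 f"
 shows "in_L2 (wcomp m c y f)" "(\<integral>x. (norm (wcomp m c y f x))\<^sup>2 \<partial>lborel) = (\<integral>x. (norm (f x))\<^sup>2 \<partial>lborel)"
proof -
 have [measurable]: "m \<in> borel_measurable borel" "f \<in> borel_measurable borel" and c: "c ~= 0"
 using m f by (auto simp: iso_weight_def)
 have meas: "wcomp m c y f \<in> borel_measurable borel" unfolding wcomp_def by measurable
 have eq: "(\<integral>\<^sup>+x. ennreal ((norm (wcomp m c y f x))\<^sup>2) \<partial>lborel) = (\<integral>\<^sup>+x. ennreal ((norm (f x))\<^sup>2) \<partial>lborel)"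
 proof -
 have "(\<integral>\<^sup>+x. ennreal ((norm (wcomp m c y f x))\<^sup>2) \<partial>lborel)
 = (\<integral>\<^sup>+x. ennreal (\<bar>c\<bar> ^ CARD('n)) * ennreal ((norm (f (c *\<^sub>R x + y)))\<^sup>2) \<partial>lborel)"
 using m by (intro nn_integral_cong) (simp add: wcomp_def iso_weight_def norm_mult power_mult_distrib ennreal_mult)
 also have "... = ennreal (\<bar>c\<bar> ^ CARD('n)) * (\<integral>\<^sup>+x. ennreal ((norm (f (c *\<^sub>R x + y)))\<^sup>2) \<partial>lborel)"
 by (rule nn_integral_cmult) measurable
 also have "... = (\<integral>\<^sup>+x. ennreal ((norm (f x))\<^sup>2) \<partial>lborel)"
 by (rule nn_integral_affine[OF _ c, symmetric]) measurable
 finally show ?thesis .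
 qed
 show "in_L2 (wcomp m c y f)"
 using f meas eq unfolding in_L2_iff integrable_iff_bounded by simp
 show "(\<integral>x. (norm (wcomp m c y f x))\<^sup>2 \<partial>lborel) = (\<integral>x. (norm (f x))\<^sup>2 \<partial>lborel)"
 using meas eq by (subst (1 2) integral_eq_nn_integral) auto
qed

lemma wcomp_cong_AE:
 assumes "iso_weight m c" "AE x in lborel. f x = g x"
 shows "AE x in lborel. wcomp m c y f x = wcomp m c y g x"
 using AE_lborel_affine[OF assms(2), of c y] assms(1)
 by (auto simp: wcomp_def iso_weight_def)

definition wop :: "(real ^ 'n => complex) => real => real ^ 'n => 'n::finite l2 => 'n l2" where
 "wop m c y a = to_l2 (wcomp m c y (l2_fun a))"

lemma wop_to_l2: "iso_weight m c ==> in_L2 f ==> wop m c y (to_l2 f) = to_l2 (wcomp m c y f)"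
 unfolding wop_def by (intro to_l2_cong wcomp_cong_AE l2_fun_to_l2)

lemma l2_fun_wop: "iso_weight m c ==> AE x in lborel. l2_fun (wop m c y a) x = m x * l2_fun a (c *\<^sub>R x + y)"
 using l2_fun_to_l2[OF wcomp_in_L2(1)[of m c "l2_fun a" y]] by (simp add: wop_def wcomp_def)

lemma norm_wop [simp]: "iso_weight m c ==> norm (wop m c y a) = norm a"
 by (rule power2_eq_imp_eq) (simp_all only: wop_def norm_to_l2[OF wcomp_in_L2(1)] wcomp_in_L2(2)
 norm_l2_fun[of a] in_L2_l2_fun norm_ge_zero)

lemma wop_bounded_linear: assumes m: "iso_weight m c" shows "bounded_linear (wop m c y)"
proof (rule bounded_linear_intro)
 show "wop m c y (a + b) = wop m c y a + wop m c y b" for a b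
 proof -
 have "wop m c y (a + b) = to_l2 (wcomp m c y (%x. l2_fun a x + l2_fun b x))"
 unfolding wop_def by (intro to_l2_cong wcomp_cong_AE m l2_fun_add)
 also have "... = wop m c y a + wop m c y b"
 using wcomp_in_L2(1)[OF m in_L2_l2_fun, of y] unfolding wop_def
 by (subst to_l2_add[symmetric]) (simp_all add: wcomp_def algebra_simps)
 finally show ?thesis .
 qed
 show "wop m c y (r *\<^sub>R a) = r *\<^sub>R wop m c y a" for r a
 proof -
 have "wop m c y (r *\<^sub>R a) = to_l2 (wcomp m c y (%x. r *\<^sub>R l2_fun a x))"
 unfolding wop_def by (intro to_l2_cong wcomp_cong_AE m l2_fun_scaleR)
 also have "... = r *\<^sub>R wop m c y a"
 using wcomp_in_L2(1)[OF m in_L2_l2_fun, of y] unfolding wop_def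
 by (subst to_l2_scaleR[symmetric]) (simp_all add: wcomp_def)
 finally show ?thesis .
 qed
 show "norm (wop m c y a) <= norm a * 1" for a using m by simp
qed

lemma wop_wop:
 assumes m: "iso_weight m c" "iso_weight m' c'"
 shows "wop m c y (wop m' c' y' a) = wop (%x. m x * m' (c *\<^sub>R x + y)) (c * c') (c' *\<^sub>R y + y') a"
proof -
 have "wop m c y (wop m' c' y' a) = to_l2 (wcomp m c y (wcomp m' c' y' (l2_fun a)))"
 unfolding wop_def[of m' c'] by (rule wop_to_l2[OF m(1) wcomp_in_L2(1)[OF m(2)]]) simp
 also have "wcomp m c y (wcomp m' c' y' (l2_fun a))
 = wcomp (%x. m x * m' (c *\<^sub>R x + y)) (c * c') (c' *\<^sub>R y + y') (l2_fun a)"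
 by (simp add: wcomp_def fun_eq_iff scaleR_add_right mult.commute add.assoc)
 finally show ?thesis by (simp add: wop_def)
qed

lemma wop_id: "wop (%_. 1) 1 0 a = a"
 by (simp add: wop_def wcomp_def)

definition cmul :: "complex => 'n::finite l2 => 'n l2" where
 "cmul c a = to_l2 (%x. c * l2_fun a x)"

lemma cmul_to_l2: "in_L2 f ==> cmul c (to_l2 f) = to_l2 (%x. c * f x)"
 unfolding cmul_def by (rule to_l2_cong) (use l2_fun_to_l2[of f] in auto)

lemma norm_cmul: "norm (cmul c a) = norm c * norm a"
proof (rule power2_eq_imp_eq)
 show "(norm (cmul c a))\<^sup>2 = (norm c * norm a)\<^sup>2"
 unfolding cmul_def by (subst norm_to_l2) (simp_all add: in_L2_cmult norm_mult power_mult_distrib norm_l2_fun)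
qed auto

lemma cmul_bounded_linear: "bounded_linear (cmul c)"
proof (rule bounded_linear_intro)
 show "cmul c (a + b) = cmul c a + cmul c b" for a b
 using l2_fun_add[of a b] unfolding cmul_def
 by (subst to_l2_add[symmetric]) (auto simp: in_L2_cmult distrib_left intro!: to_l2_cong)
 show "cmul c (r *\<^sub>R a) = r *\<^sub>R cmul c a" for r a
 using l2_fun_scaleR[of r a] unfolding cmul_def
 by (subst to_l2_scaleR[symmetric]) (auto simp: in_L2_cmult intro!: to_l2_cong)
 show "norm (cmul c a) <= norm a * norm c" for a by (simp add: norm_cmul mult.commute)
qed

lemma cmul_1 [simp]: "cmul 1 a = a" by (simp add: cmul_def)

lemma cmul_cmul: "cmul c (cmul d a) = cmul (c * d) a"
 unfolding cmul_def[of d a] by (subst cmul_to_l2) (simp_all add: in_L2_cmult cmul_def mult.assoc)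

lemma cmul_wop: "iso_weight m c ==> wop m c y (cmul d a) = cmul d (wop m c y a)"
 unfolding cmul_def[of d a] wop_def[of m c y a]
 by (subst wop_to_l2, simp, simp add: in_L2_cmult, subst cmul_to_l2) (simp_all add: wcomp_in_L2, simp add: wcomp_def mult.left_commute)

lemma cmul_of_real: "cmul (of_real r) a = r *\<^sub>R a"
 unfolding cmul_def using to_l2_scaleR[of "l2_fun a" r] by (simp add: scaleR_conv_of_real)

lemma inner_cmul_left: "inner (cmul c a) b = inner a (cmul (cnj c) b)"
proof -
 have "inner (cmul c a) b = (\<integral>x. Re (c * l2_fun a x * cnj (l2_fun b x)) \<partial>lborel)"
 using inner_to_l2[of "%x. c * l2_fun a x" "l2_fun b"] by (simp add: cmul_def in_L2_cmult)
 also have "... = inner a (cmul (cnj c) b)"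
 using inner_to_l2[of "l2_fun a" "%x. cnj c * l2_fun b x"] by (simp add: cmul_def in_L2_cmult mult.assoc mult.left_commute)
 finally show ?thesis .
qed

text \<open>The underlying complex inner product is recovered from the real one.\<close>

lemma complex_inner_l2_fun:
 "(\<integral>x. l2_fun a x * cnj (l2_fun b x) \<partial>lborel) = Complex (inner a b) (inner a (cmul \<i> b))"
proof -
 have i: "integrable lborel (%x. l2_fun a x * cnj (l2_fun b x))"
 by (intro in_L2_integrable_mult in_L2_cnj) simp_all
 have "inner a (cmul \<i> b) = (\<integral>x. Re (l2_fun a x * cnj (\<i> * l2_fun b x)) \<partial>lborel)"
 using inner_to_l2[of "l2_fun a" "%x. \<i> * l2_fun b x"] by (simp add: cmul_def in_L2_cmult)
 also have "(%x. Re (l2_fun a x * cnj (\<i> * l2_fun b x))) = (%x. Im (l2_fun a x * cnj (l2_fun b x)))"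
 by (simp add: fun_eq_iff algebra_simps)
 finally have "inner a (cmul \<i> b) = Im (\<integral>x. l2_fun a x * cnj (l2_fun b x) \<partial>lborel)" by (simp only: integral_Im[OF i])
 moreover have "inner a b = Re (\<integral>x. l2_fun a x * cnj (l2_fun b x) \<partial>lborel)" by (simp only: inner_l2_fun integral_Re[OF i])
 ultimately show ?thesis by (simp add: complex_eq_iff)
qed

section \<open>Gaussians\<close>

text \<open>Differentiation under the integral sign, stated so that it covers real and complex
  parameters. The mean value inequality on the ball bounds the difference quotients by
  \<open>B\<close>; the increments are shifted past an index \<open>N\<close> so that they stay in
  the ball.\<close>

lemma has_field_derivative_integral:
 fixes F F' :: "'p::{real_normed_field,banach,second_countable_topology} => 'a => 'p"
 assumes r: "r > 0"
 and int: "!!z. z \<in> ball z0 r ==> integrable M (F z)"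
 and meas: "F' z0 \<in> borel_measurable M"
 and der: "!!z x. z \<in> ball z0 r ==> ((%z. F z x) has_field_derivative F' z x) (at z)"
 and bd: "!!z x. z \<in> ball z0 r ==> norm (F' z x) <= B x" and B: "integrable M B"
 shows "((%z. \<integral>x. F z x \<partial>M) has_field_derivative (\<integral>x. F' z0 x \<partial>M)) (at z0)"
 unfolding DERIV_def tendsto_at_iff_sequentially
proof (intro allI impI)
 fix h :: "nat => 'p" assume h: "\<forall>i. h i \<in> UNIV - {0}" "h \<longlonglongrightarrow> 0"
 have z0: "z0 \<in> ball z0 r" using r by simp
 obtain N where N: "!!n. n >= N ==> norm (h n) < r"
 using LIMSEQ_D[OF h(2) r] by auto
 define k where "k n = h (n + N)" for n
 have k: "k n ~= 0" "norm (k n) < r" "z0 + k n \<in> ball z0 r" for n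
 using h(1) N[of "n + N"] by (auto simp: k_def dist_norm)
 have k0: "k \<longlonglongrightarrow> 0" unfolding k_def using h(2) by (rule LIMSEQ_ignore_initial_segment)
 have "(%n. \<integral>x. (F (z0 + k n) x - F z0 x) / k n \<partial>M) \<longlonglongrightarrow> (\<integral>x. F' z0 x \<partial>M)"
 proof (rule integral_dominated_convergence[where w = B])
 show "(%x. (F (z0 + k n) x - F z0 x) / k n) \<in> borel_measurable M" for n
 using int[OF k(3)[of n]] int[OF z0] by (intro borel_measurable_integrable) simp
 show "AE x in M. (%n. (F (z0 + k n) x - F z0 x) / k n) \<longlonglongrightarrow> F' z0 x"
 proof (rule AE_I2)
 fix x
 have "((%h. (F (z0 + h) x - F z0 x) / h) \<longlongrightarrow> F' z0 x) (at 0)"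
 using der[OF z0, of x] by (simp add: DERIV_def)
 then show "(%n. (F (z0 + k n) x - F z0 x) / k n) \<longlonglongrightarrow> F' z0 x"
 using k(1) k0 unfolding tendsto_at_iff_sequentially by (auto simp: comp_def)
 qed
 show "AE x in M. norm ((F (z0 + k n) x - F z0 x) / k n) <= B x" for n
 proof (rule AE_I2)
 fix x
 have "norm (F (z0 + k n) x - F z0 x) <= B x * norm (z0 + k n - z0)"
 by (rule field_differentiable_bound[of "ball z0 r" "%z. F z x" "%z. F' z x"])
 (use der bd k(3) z0 in \<open>auto intro: has_field_derivative_at_within simp del: mem_ball\<close>)
 then show "norm ((F (z0 + k n) x - F z0 x) / k n) <= B x"
 using k(1)[of n] by (simp add: norm_divide divide_le_eq)
 qed
 qed (use meas B in auto)
 also have "(%n. \<integral>x. (F (z0 + k n) x - F z0 x) / k n \<partial>M)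
 = (%n. ((\<integral>x. F (z0 + k n) x \<partial>M) - (\<integral>x. F z0 x \<partial>M)) / k n)"
 using int[OF k(3)] int[OF z0] by simp
 finally show "((%h. ((\<integral>x. F (z0 + h) x \<partial>M) - (\<integral>x. F z0 x \<partial>M)) / h) \<circ> h) \<longlonglongrightarrow> (\<integral>x. F' z0 x \<partial>M)"
 using LIMSEQ_offset[where k = N and f = "(%h. ((\<integral>x. F (z0 + h) x \<partial>M) - (\<integral>x. F z0 x \<partial>M)) / h) \<circ> h"]
 by (simp add: k_def comp_def)
qed

subsection \<open>Complex Gaussians on the line\<close>

text \<open>A Gaussian of complex variance \<open>z\<close>. The principal root makes it holomorphic
  in \<open>z\<close> on the right half plane, and with this normalisation convolution adds
  variances up to the factor \<open>sqrt (2 * pi)\<close>.\<close>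

definition gauss1 :: "complex => real => complex" where
 "gauss1 z x = exp (- of_real (x\<^sup>2) / (2 * z)) / csqrt z"

text \<open>The derivative in \<open>z\<close>. It is also half the second derivative in space: the
  heat equation in complex time, from which the Schroedinger equation is read off in the imaginary
  direction.\<close>

definition gauss1' :: "complex => real => complex" where
 "gauss1' z x = gauss1 z x * (of_real (x\<^sup>2) / (2 * z\<^sup>2) - 1 / (2 * z))"

lemma Re_pos_nonpos: "Re z > 0 ==> z \<notin> \<real>\<^sub>\<le>\<^sub>0" "Re z > 0 ==> z ~= 0"
 by (auto simp: complex_nonpos_Reals_iff)

lemma gauss1_deriv:
 assumes z: "Re z > 0"
 shows "((%z. gauss1 z x) has_field_derivative gauss1' z x) (at z)"
proof -
 have nz: "z ~= 0" "z \<notin> \<real>\<^sub>\<le>\<^sub>0" using Re_pos_nonpos z by auto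
 have cz: "csqrt z ~= 0" using nz by simp
 have s: "(csqrt z)\<^sup>2 = z" by simp
 have "((%z. exp (- of_real (x\<^sup>2) / (2 * z)) / csqrt z) has_field_derivative
 (exp (- of_real (x\<^sup>2) / (2 * z)) * (of_real (x\<^sup>2) * 2 / (2 * z)\<^sup>2) * csqrt z
 - exp (- of_real (x\<^sup>2) / (2 * z)) * (1 / (2 * csqrt z))) / (csqrt z)\<^sup>2) (at z)"
 using nz cz by (auto intro!: derivative_eq_intros simp: power2_eq_square field_simps)
 also have "(exp (- of_real (x\<^sup>2) / (2 * z)) * (of_real (x\<^sup>2) * 2 / (2 * z)\<^sup>2) * csqrt z
 - exp (- of_real (x\<^sup>2) / (2 * z)) * (1 / (2 * csqrt z))) / (csqrt z)\<^sup>2 = gauss1' z x"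
 proof -
 have "E * (X * 2 / (2 * z)\<^sup>2) * c - E * (1 / (2 * c)) = c\<^sup>2 * (E / c * (X / (2 * z\<^sup>2) - 1 / (2 * z)))"
 if "c\<^sup>2 = z" "c ~= 0" for E X c :: complex
 using that nz by (simp add: field_simps power2_eq_square)
 from this[OF s cz] show ?thesis using cz by (simp add: gauss1'_def gauss1_def)
 qed
 finally show ?thesis unfolding gauss1_def .
qed

lemma Re_inverse_pos: "Re z > 0 ==> Re (1 / z) > 0"
 by (auto simp: complex_eq_iff Re_divide divide_simps power2_eq_square add_pos_nonneg)

lemma norm_gauss1: assumes "Re z > 0"
 shows "norm (gauss1 z x) = exp (- x\<^sup>2 * Re (1 / z) / 2) / sqrt (norm z)"
proof -
 have "Re (- of_real (x\<^sup>2) / (2 * z)) = - x\<^sup>2 * Re (1 / z) / 2"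
 proof -
 have "- of_real (x\<^sup>2) / (2 * z) = of_real (- x\<^sup>2 / 2) * (1 / z)" by simp
 then show ?thesis by (simp only: Re_complex_of_real Im_complex_of_real times_complex.simps)
 qed
 then show ?thesis unfolding gauss1_def norm_divide norm_exp_eq_Re by simp
qed

lemma gauss1_measurable [measurable]: "gauss1 z \<in> borel_measurable borel"
 unfolding gauss1_def by measurable

lemma gauss1'_measurable [measurable]: "gauss1' z \<in> borel_measurable borel"
 unfolding gauss1'_def by measurable

lemma gauss1_minus: "gauss1 z (- x) = gauss1 z x" by (simp add: gauss1_def)

lemma cnj_gauss1: "Re z > 0 ==> cnj (gauss1 z x) = gauss1 (cnj z) x"
 by (simp add: gauss1_def cnj_csqrt Re_pos_nonpos exp_cnj)

lemma gauss1_of_real: assumes "t > 0"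
 shows "gauss1 (of_real t) x = of_real (sqrt (2 * pi) * normal_density 0 (sqrt t) x)"
proof -
 have "csqrt (of_real t) = of_real (sqrt t)" using assms by simp
 then have "gauss1 (of_real t) x = of_real (exp (- x\<^sup>2 / (2 * t)) / sqrt t)"
 by (simp add: gauss1_def exp_of_real[symmetric])
 also have "exp (- x\<^sup>2 / (2 * t)) / sqrt t = sqrt (2 * pi) * normal_density 0 (sqrt t) x"
 using assms by (simp add: normal_density_def real_sqrt_mult)
 finally show ?thesis .
qed

lemma exp_quadratic_integrable:
 assumes a: "(a::real) > 0" shows "integrable lborel (%x::real. exp (- x\<^sup>2 * a))"
proof -
 have "integrable lborel (%x. sqrt (pi / a) * normal_density 0 (sqrt (1 / (2 * a))) x)"
 by (intro integrable_mult_right integrable_normal_density) (use a in simp)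
 moreover have "sqrt (pi / a) * normal_density 0 (sqrt (1 / (2 * a))) x = exp (- x\<^sup>2 * a)" for x
 using a by (simp add: normal_density_def real_sqrt_divide field_simps)
 ultimately show ?thesis by simp
qed

lemma gauss1_integrable: assumes z: "Re z > 0"
 shows "integrable lborel (%x. gauss1 z (x - b))" "integrable lborel (%x. (norm (gauss1 z (x - b)))\<^sup>2)"
proof -
 note e = exp_quadratic_integrable[THEN lborel_integrable_real_affine[where t = "- b" and c = 1]]
 have p: "Re (1 / z) > 0" using Re_inverse_pos[OF z] .
 have "integrable lborel (%x. exp (- (- b + 1 * x)\<^sup>2 * (Re (1 / z) / 2)) / sqrt (norm z))"
 by (intro integrable_divide e) (use p in auto)
 then show "integrable lborel (%x. gauss1 z (x - b))"
 by (rule Bochner_Integration.integrable_bound) (use z in \<open>auto simp: norm_gauss1\<close>)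
 have "integrable lborel (%x. exp (- (- b + 1 * x)\<^sup>2 * Re (1 / z)) / norm z)"
 by (intro integrable_divide e) (use p in auto)
 then show "integrable lborel (%x. (norm (gauss1 z (x - b)))\<^sup>2)"
 using z by (simp add: norm_gauss1 power_divide exp_double[symmetric] algebra_simps)
qed

lemma gauss1_bounded: assumes z: "Re z > 0" shows "norm (gauss1 z x) <= 1 / sqrt (norm z)"
 using Re_inverse_pos[OF z] by (simp add: norm_gauss1[OF z] divide_right_mono)

text \<open>The bound is uniform in \<open>x\<close> and in \<open>z\<close> near \<open>z0\<close>,
  as a dominating function requires: with \<open>q\<close> the exponent of the Gaussian the
  quadratic factor becomes \<open>q / Re z\<close>, and \<open>q * exp (- q) <= 1\<close>.\<close>

lemma gauss1'_bounded:
 assumes z: "Re z0 > 0" "z \<in> ball z0 (Re z0 / 2)"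
 shows "Re z > 0" "\<exists>K. \<forall>z\<in>ball z0 (Re z0 / 2). \<forall>x. norm (gauss1' z x) <= K"
proof -
 have R: "Re z >= Re z0 / 2" "norm z >= Re z0 / 2" "Re (1 / z) * (norm z)\<^sup>2 = Re z" if "z \<in> ball z0 (Re z0 / 2)" for z
 proof -
 have "\<bar>Re (z0 - z)\<bar> <= norm (z0 - z)" by (rule abs_Re_le_cmod)
 moreover have "norm (z0 - z) < Re z0 / 2" using that by (simp add: dist_norm)
 ultimately show a: "Re z >= Re z0 / 2" by simp
 then show "norm z >= Re z0 / 2" using complex_Re_le_cmod[of z] by simp
 have "z ~= 0" using a assms(1) by auto
 then show "Re (1 / z) * (norm z)\<^sup>2 = Re z" by (simp add: Re_divide cmod_power2)
 qed
 show "Re z > 0" using R(1)[OF z(2)] z(1) by simp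
 define m where "m = Re z0 / 2"
 have m: "m > 0" using z by (simp add: m_def)
 show "\<exists>K. \<forall>z\<in>ball z0 (Re z0 / 2). \<forall>x. norm (gauss1' z x) <= K"
 proof (intro exI ballI allI)
 fix z x assume zb: "z \<in> ball z0 (Re z0 / 2)"
 have zp: "Re z > 0" "norm z >= m" "m > 0" "Re z >= m" using R[OF zb] m by (auto simp: m_def)
 define q where "q = x\<^sup>2 * Re (1 / z) / 2"
 have q0: "q >= 0" using Re_inverse_pos[OF zp(1)] by (simp add: q_def)
 have q1: "q * exp (- q) <= 1"
 proof -
 have "q <= exp q" using exp_ge_add_one_self[of q] by linarith
 then show ?thesis by (simp add: exp_minus field_simps)
 qed
 have xq: "x\<^sup>2 / (2 * (norm z)\<^sup>2) = q / Re z"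
 unfolding q_def R(3)[OF zb, symmetric] using zp Re_inverse_pos[OF zp(1)] by simp
 have "norm (gauss1' z x) <= exp (- q) / sqrt (norm z) * (x\<^sup>2 / (2 * (norm z)\<^sup>2) + 1 / (2 * norm z))"
 proof -
 have "norm (of_real (x\<^sup>2) / (2 * z\<^sup>2) - 1 / (2 * z)) <= x\<^sup>2 / (2 * (norm z)\<^sup>2) + 1 / (2 * norm z)"
 by (rule order_trans[OF norm_triangle_ineq4]) (simp add: norm_divide norm_mult norm_power)
 moreover have "norm (gauss1 z x) = exp (- q) / sqrt (norm z)" using norm_gauss1[OF zp(1)] by (simp add: q_def)
 ultimately show ?thesis unfolding gauss1'_def norm_mult by (metis mult_left_mono norm_ge_zero)
 qed
 also have "... = (q * exp (- q) / Re z + exp (- q) / (2 * norm z)) / sqrt (norm z)"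
 unfolding xq by (simp add: field_simps)
 also have "... <= (1 / m + 1 / (2 * m)) / sqrt m"
 proof (intro frac_le add_mono)
 show "exp (- q) <= 1" using q0 by simp
 qed (use zp q0 q1 in auto)
 finally show "norm (gauss1' z x) <= (1 / m + 1 / (2 * m)) / sqrt m" .
 qed
qed

definition gauss_conv :: "real => complex => complex => complex" where
 "gauss_conv b z w = (\<integral>x. gauss1 z (x - b) * gauss1 w x \<partial>lborel)"

lemma gauss_conv_integrable:
 assumes "Re z > 0" "Re w > 0" shows "integrable lborel (%x. gauss1 z (x - b) * gauss1 w (x - c))"
proof (rule Bochner_Integration.integrable_bound)
 show "integrable lborel (%x. (1 / sqrt (norm z)) * norm (gauss1 w (x - c)))"
 by (intro integrable_mult_right integrable_norm gauss1_integrable assms)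
 show "AE x in lborel. norm (gauss1 z (x - b) * gauss1 w (x - c)) <= norm ((1 / sqrt (norm z)) * norm (gauss1 w (x - c)))"
 using mult_right_mono[OF gauss1_bounded[OF assms(1)] norm_ge_zero] by (intro AE_I2) (simp add: norm_mult)
qed measurable

lemma gauss_conv_swap: "gauss_conv b z w = gauss_conv b w z"
proof -
 have "gauss_conv b z w = (\<integral>x. gauss1 z (b + -1 * x - b) * gauss1 w (b + -1 * x) \<partial>lborel)"
 unfolding gauss_conv_def by (subst lborel_integral_real_affine[where c = "-1" and t = b]) simp_all
 also have "... = gauss_conv b w z"
 unfolding gauss_conv_def
 by (intro Bochner_Integration.integral_cong refl)
 (use gauss1_minus[of w "b - _"] in \<open>simp add: gauss1_minus mult.commute\<close>)
 finally show ?thesis .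
qed

lemma gauss_conv_holomorphic:
 assumes w: "Re w > 0" shows "(%z. gauss_conv b z w) holomorphic_on {z. Re z > 0}"
 unfolding holomorphic_on_def
proof
 fix z0 assume "z0 \<in> {z. Re z > 0}"
 then have z0: "Re z0 > 0" by simp
 obtain K where K: "!!z x. z \<in> ball z0 (Re z0 / 2) ==> norm (gauss1' z x) <= K"
 using gauss1'_bounded(2)[OF z0, of z0] z0 by (metis centre_in_ball half_gt_zero)
 have "((%z. \<integral>x. gauss1 z (x - b) * gauss1 w x \<partial>lborel) has_field_derivative
 (\<integral>x. gauss1' z0 (x - b) * gauss1 w x \<partial>lborel)) (at z0)"
 proof (rule has_field_derivative_integral[where r = "Re z0 / 2" and B = "%x. K * norm (gauss1 w x)"])
 show "integrable lborel (%x. gauss1 z (x - b) * gauss1 w x)" if "z \<in> ball z0 (Re z0 / 2)" for z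
 using gauss_conv_integrable[of z w b 0] gauss1'_bounded(1)[OF z0 that] w by simp
 show "((%z. gauss1 z (x - b) * gauss1 w x) has_field_derivative gauss1' z (x - b) * gauss1 w x) (at z)"
 if "z \<in> ball z0 (Re z0 / 2)" for z x
 using gauss1'_bounded(1)[OF z0 that] by (intro DERIV_cmult_right gauss1_deriv)
 show "norm (gauss1' z (x - b) * gauss1 w x) <= K * norm (gauss1 w x)" if "z \<in> ball z0 (Re z0 / 2)" for z x
 using K[OF that] by (simp add: norm_mult mult_right_mono)
 show "integrable lborel (%x. K * norm (gauss1 w x))"
 using gauss1_integrable(1)[OF w, of 0] by simp
 qed (use z0 in auto)
 then show "(%z. gauss_conv b z w) field_differentiable at z0 within {z. 0 < Re z}"
 unfolding gauss_conv_def field_differentiable_def by (blast intro: has_field_derivative_at_within)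
qed

lemma gauss1_holomorphic: "(%z. gauss1 (z + w) b) holomorphic_on {z. Re z > 0}" if "Re w >= 0"
 unfolding holomorphic_on_def field_differentiable_def
proof
 fix z assume "z \<in> {z. Re z > 0}"
 then have "Re (z + w) > 0" using that by simp
 then have "((%z. gauss1 z b) has_field_derivative gauss1' (z + w) b) (at (z + w))" by (rule gauss1_deriv)
 then have "((%z. gauss1 (z + w) b) has_field_derivative gauss1' (z + w) b) (at z)"
 by (simp only: DERIV_shift)
 then show "\<exists>f'. ((%z. gauss1 (z + w) b) has_field_derivative f') (at z within {z. 0 < Re z})"
 by (blast intro: has_field_derivative_at_within)
qed

lemma gauss_conv_real:
 assumes s: "s > 0" and t: "t > 0"
 shows "gauss_conv b (of_real s) (of_real t) = of_real (sqrt (2 * pi)) * gauss1 (of_real s + of_real t) b"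
proof -
 let ?n = "%y::real. normal_density 0 (sqrt s) (b - y) * normal_density 0 (sqrt t) y"
 have 1: "(\<integral>\<^sup>+y. ennreal (?n y) \<partial>lborel) = ennreal (normal_density 0 (sqrt (s + t)) b)"
 using fun_cong[OF conv_normal_density_zero_mean[of "sqrt s" "sqrt t"], of b] s t by simp
 have "(\<integral>y. ?n y \<partial>lborel) = normal_density 0 (sqrt (s + t)) b"
 by (rule integral_eq_nn_integral[THEN trans]) (auto simp: 1)
 then have "(\<integral>y. complex_of_real (2 * pi * ?n y) \<partial>lborel) = of_real (2 * pi * normal_density 0 (sqrt (s + t)) b)"
 by (subst integral_complex_of_real) simp
 moreover have "gauss1 (of_real s) (x - b) * gauss1 (of_real t) x = complex_of_real (2 * pi * ?n x)" for x
 proof -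
 have "gauss1 (of_real s) (x - b) = gauss1 (of_real s) (b - x)" using gauss1_minus[of _ "b - x"] by simp
 then show ?thesis using s t by (simp add: gauss1_of_real flip: of_real_mult)
 qed
 moreover have "gauss1 (of_real s + of_real t) b = of_real (sqrt (2 * pi) * normal_density 0 (sqrt (s + t)) b)"
 using gauss1_of_real[of "s + t" b] s t by simp
 ultimately show ?thesis unfolding gauss_conv_def by (simp flip: of_real_mult add: mult.assoc[symmetric])
qed

text \<open>For real variances this is the convolution of normal densities. Both sides are
  holomorphic in each variance, so the identity theorem extends the formula in one variance while
  the other is real, and then in the other.\<close>

lemma gauss_conv_eq:
 assumes z: "Re z > 0" and w: "Re w > 0"
 shows "gauss_conv b z w = of_real (sqrt (2 * pi)) * gauss1 (z + w) b"
proof -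
 define S where "S = {z::complex. Re z > 0}"
 have S: "open S" "connected S" unfolding S_def
 by (auto intro: open_halfspace_Re_gt convex_connected convex_halfspace_Re_gt)
 have lim: "1 islimpt (complex_of_real ` {0<..})"
 unfolding islimpt_sequential
 proof (intro exI[of _ "%n. complex_of_real (1 + 1 / real (Suc n))"] conjI allI)
 show "(%n. complex_of_real (1 + 1 / real (Suc n))) \<longlonglongrightarrow> 1"
 using tendsto_of_real[OF tendsto_add[OF tendsto_const[of 1] LIMSEQ_inverse_real_of_nat], where 'a = complex]
 by (simp add: inverse_eq_divide)
 qed (auto simp: complex_eq_iff add_pos_nonneg)
 have ext: "f z = 0" if hol: "f holomorphic_on S" and z: "z \<in> S" and f0: "!!t. t > 0 ==> f (complex_of_real t) = 0" for f z
 proof (rule analytic_continuation[OF hol S _ _ lim _ z])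
 show "complex_of_real ` {0<..} \<subseteq> S" "1 \<in> S" by (auto simp: S_def)
 qed (use f0 in auto)
 have 1: "gauss_conv b z (of_real t) - of_real (sqrt (2 * pi)) * gauss1 (z + of_real t) b = 0" if t: "t > 0" and z: "z \<in> S" for z t
 by (rule ext[where f = "%z. gauss_conv b z (of_real t) - of_real (sqrt (2 * pi)) * gauss1 (z + of_real t) b"])
 (use t z gauss_conv_real[OF _ t] in \<open>auto simp: S_def intro!: holomorphic_intros gauss_conv_holomorphic gauss1_holomorphic\<close>)
 have "gauss_conv b w z - of_real (sqrt (2 * pi)) * gauss1 (w + z) b = 0"
 by (rule ext[where f = "%w. gauss_conv b w z - of_real (sqrt (2 * pi)) * gauss1 (w + z) b"])
 (use z w 1[of _ z] in \<open>auto simp: S_def gauss_conv_swap[of b "of_real _" z] add.commute[of "of_real _" z]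
 intro!: holomorphic_intros gauss_conv_holomorphic gauss1_holomorphic\<close>)
 then show ?thesis by (simp add: gauss_conv_swap[of b z w] add.commute)
qed

subsection \<open>Integrals of products of functions of the coordinates\<close>

lemma vec_lambda_measurable:
 "(%f. \<chi> i. f i) \<in> (\<Pi>\<^sub>M (i::'n::finite)\<in>UNIV. lborel) \<rightarrow>\<^sub>M (borel :: (real ^ 'n) measure)"
proof -
 have "(%f. (\<chi> i. f i) \<bullet> (axis j 1 :: real ^ 'n)) \<in> borel_measurable (\<Pi>\<^sub>M (i::'n)\<in>UNIV. lborel)" for j
 by (simp add: inner_axis) measurable
 then show ?thesis by (subst borel_measurable_euclidean_space) (auto simp: Basis_vec_def)
qed

text \<open>Lebesgue measure is characterised by the volumes of boxes, and the product measure gives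
  a box the product of its edge lengths. Integrals of products of coordinate functions thereby
  reduce to one dimension.\<close>

lemma lborel_vec_eq:
 "(lborel :: (real ^ 'n) measure) = distr (\<Pi>\<^sub>M i\<in>UNIV. lborel) borel (%f. \<chi> i. f i)"
proof -
 define A :: "real ^ 'n => 'n" where "A = inv (%i. axis i 1)"
 have inj: "inj (%i::'n. axis i (1::real))" by (auto simp: inj_on_def axis_eq_axis)
 have B: "(Basis :: (real ^ 'n) set) = range (%i. axis i 1)" by (auto simp: Basis_vec_def)
 have A[simp]: "A (axis i 1) = i" for i unfolding A_def by (rule inv_f_f[OF inj])
 have bij: "bij_betw A Basis UNIV" unfolding B by (rule bij_betwI[of _ _ _ "%i. axis i 1"]) auto
 interpret p: product_sigma_finite "%_::'n. lborel :: real measure" ..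
 show ?thesis
 proof (rule lborel_eqI)
 fix l u :: "real ^ 'n" assume le: "!!b. b \<in> Basis ==> l \<bullet> b <= u \<bullet> b"
 then have le': "l $ i <= u $ i" for i using le[of "axis i 1"] B by (auto simp: inner_axis)
 have "emeasure (distr (\<Pi>\<^sub>M i\<in>UNIV. lborel) borel (%f. \<chi> i. f i)) (box l u)
 = emeasure (\<Pi>\<^sub>M i\<in>UNIV. lborel) (\<Pi>\<^sub>E i\<in>UNIV. {l $ i <..< u $ i})"
 proof (subst emeasure_distr)
 show "(%f. \<chi> i. f i) \<in> (\<Pi>\<^sub>M (i::'n)\<in>UNIV. lborel) \<rightarrow>\<^sub>M (borel :: (real ^ 'n) measure)"
 by (rule vec_lambda_measurable)
 have "(%f. \<chi> i. f i) -` box l u \<inter> space (\<Pi>\<^sub>M (i::'n)\<in>UNIV. lborel) = (\<Pi>\<^sub>E i\<in>UNIV. {l $ i <..< u $ i})"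
 by (auto simp: space_PiM mem_box_cart PiE_iff)
 then show "emeasure (\<Pi>\<^sub>M i\<in>UNIV. lborel) ((%f. \<chi> i. f i) -` box l u \<inter> space (\<Pi>\<^sub>M i\<in>UNIV. lborel))
 = emeasure (\<Pi>\<^sub>M i\<in>UNIV. lborel) (\<Pi>\<^sub>E i\<in>UNIV. {l $ i <..< u $ i})" by simp
 qed simp
 also have "... = (\<Prod>i\<in>UNIV. emeasure lborel {l $ i <..< u $ i})" by (rule p.emeasure_PiM) auto
 also have "... = ennreal (\<Prod>i\<in>UNIV. u $ i - l $ i)" using le' by (simp add: prod_ennreal)
 also have "(\<Prod>i\<in>UNIV. u $ i - l $ i) = (\<Prod>b\<in>Basis. (u - l) \<bullet> b)"
 by (subst prod.reindex_bij_betw[OF bij, symmetric]) (auto simp: B inner_axis intro!: prod.cong)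
 finally show "emeasure (distr (\<Pi>\<^sub>M i\<in>UNIV. lborel) borel (%f. \<chi> i. f i)) (box l u) = (\<Prod>b\<in>Basis. (u - l) \<bullet> b)" .
 qed simp
qed

lemma integral_prod_coords:
 fixes f :: "'n::finite => real => 'b::{real_normed_field,banach,second_countable_topology}"
 assumes f: "!!i. integrable lborel (f i)"
 shows "integrable lborel (%x::real ^ 'n. \<Prod>i\<in>UNIV. f i (x $ i))"
 and "(\<integral>x. (\<Prod>i\<in>UNIV. f i ((x :: real ^ 'n) $ i)) \<partial>lborel) = (\<Prod>i\<in>UNIV. (\<integral>x. f i x \<partial>lborel))"
proof -
 interpret p: product_sigma_finite "%_::'n. lborel :: real measure" ..
 have m: "(%f. \<chi> i. f i) \<in> (\<Pi>\<^sub>M (i::'n)\<in>UNIV. lborel) \<rightarrow>\<^sub>M (borel :: (real ^ 'n) measure)"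
 by (rule vec_lambda_measurable)
 have fm[measurable]: "f i \<in> borel_measurable borel" for i using f[of i] by (simp add: borel_measurable_integrable[of lborel, simplified])
 have m2: "(%x::real ^ 'n. \<Prod>i\<in>UNIV. f i (x $ i)) \<in> borel_measurable borel" by measurable
 show "integrable lborel (%x::real ^ 'n. \<Prod>i\<in>UNIV. f i (x $ i))"
 unfolding lborel_vec_eq using p.product_integrable_prod[OF finite[of UNIV] f] m2
 by (subst integrable_distr_eq[OF m]) simp_all
 show "(\<integral>x. (\<Prod>i\<in>UNIV. f i ((x :: real ^ 'n) $ i)) \<partial>lborel) = (\<Prod>i\<in>UNIV. (\<integral>x. f i x \<partial>lborel))"
 unfolding lborel_vec_eq using p.product_integral_prod[OF finite[of UNIV] f] m2
 by (subst integral_distr[OF m]) simp_all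
qed

subsection \<open>Gaussians in several variables\<close>

definition gauss :: "complex => real ^ 'n => real ^ 'n => complex" where
 "gauss z b x = (\<Prod>i\<in>UNIV. gauss1 z (x $ i - b $ i))"

definition gauss_const :: "'n itself => real" where "gauss_const _ = sqrt (2 * pi) ^ CARD('n)"

lemma gauss_const_pos: "gauss_const TYPE('n) > 0" by (simp add: gauss_const_def)

lemma gauss_measurable [measurable]: "gauss z b \<in> borel_measurable borel"
 unfolding gauss_def by measurable

lemma gauss_in_L2: assumes "Re z > 0" shows "in_L2 (gauss z b)"
proof -
 have "integrable lborel (%x. \<Prod>i\<in>UNIV. (norm (gauss1 z (x $ i - b $ i)))\<^sup>2)"
 by (rule integral_prod_coords(1)[where f = "%i x. (norm (gauss1 z (x - b $ i)))\<^sup>2"]) (rule gauss1_integrable(2)[OF assms])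
 then show ?thesis unfolding in_L2_iff by (simp add: gauss_def prod_norm[symmetric] prod_power_distrib[symmetric] gauss_measurable[unfolded gauss_def])
qed

lemma cnj_gauss: "Re z > 0 ==> cnj (gauss z b x) = gauss (cnj z) b x"
 by (simp add: gauss_def cnj_gauss1)

lemma gauss_shift: "gauss z b (x + y) = gauss z (b - y) x"
 by (simp add: gauss_def algebra_simps)

lemma gauss_mult_integral:
 fixes b c :: "real ^ 'n"
 assumes z: "Re z > 0" and w: "Re w > 0"
 shows "(\<integral>x. gauss z b x * gauss w c x \<partial>lborel) = of_real (gauss_const TYPE('n)) * gauss (z + w) c b"
proof -
 have "(\<integral>x. gauss z b x * gauss w c x \<partial>lborel) = (\<Prod>i\<in>UNIV. (\<integral>x. gauss1 z (x - b $ i) * gauss1 w (x - c $ i) \<partial>lborel))"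
 unfolding gauss_def prod.distrib[symmetric]
 by (rule integral_prod_coords(2)[where f = "%i x. gauss1 z (x - b $ i) * gauss1 w (x - c $ i)"]) (rule gauss_conv_integrable[OF z w])
 also have "... = (\<Prod>i\<in>UNIV. of_real (sqrt (2 * pi)) * gauss1 (z + w) (b $ i - c $ i))"
 proof (rule prod.cong[OF refl])
 fix i
 have "(\<integral>x. gauss1 z (x - b $ i) * gauss1 w (x - c $ i) \<partial>lborel)
 = (\<integral>x. gauss1 z (c $ i + 1 * x - b $ i) * gauss1 w (c $ i + 1 * x - c $ i) \<partial>lborel)"
 by (subst lborel_integral_real_affine[where c = 1 and t = "c $ i"]) simp_all
 also have "... = gauss_conv (b $ i - c $ i) z w" unfolding gauss_conv_def by (simp add: algebra_simps)
 finally show "(\<integral>x. gauss1 z (x - b $ i) * gauss1 w (x - c $ i) \<partial>lborel)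
 = of_real (sqrt (2 * pi)) * gauss1 (z + w) (b $ i - c $ i)" using gauss_conv_eq[OF z w] by simp
 qed
 finally show ?thesis by (simp add: prod.distrib gauss_const_def gauss_def)
qed

text \<open>The triple is amplitude, variance and centre. The value 0 outside the half plane gives a
  family over the whole index type, as \<open>gram_isometry\<close> expects.\<close>

definition gvec :: "complex \<times> complex \<times> (real ^ 'n) => 'n::finite l2" where
 "gvec = (%(c, z, b). if Re z > 0 then to_l2 (%x. c * gauss z b x) else 0)"

lemma gvec_eq: "Re z > 0 ==> gvec (c, z, b) = to_l2 (%x. c * gauss z b x)"
 by (simp add: gvec_def)

lemma cmul_gvec: "cmul d (gvec (c, z, b)) = gvec (d * c, z, b)"
proof (cases "Re z > 0")
 case True then show ?thesis by (simp add: gvec_eq cmul_to_l2 in_L2_cmult gauss_in_L2 mult.assoc)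
next
 case False then show ?thesis using linear_0[OF bounded_linear.linear[OF cmul_bounded_linear]] by (simp add: gvec_def)
qed

text \<open>The variances enter the Gram matrix only through \<open>z + cnj w\<close>, which does
  not change when both are shifted by the same imaginary number. This is the isometry of the
  Schroedinger flow in disguise.\<close>

lemma gvec_inner:
 fixes b e :: "real ^ 'n"
 assumes z: "Re z > 0" and w: "Re w > 0"
 shows "inner (gvec (c, z, b)) (gvec (d, w, e)) = Re (c * cnj d * of_real (gauss_const TYPE('n)) * gauss (z + cnj w) e b)"
proof -
 have "inner (gvec (c, z, b)) (gvec (d, w, e)) = (\<integral>x. Re ((c * cnj d) * (gauss z b x * gauss (cnj w) e x)) \<partial>lborel)"
 using z w by (simp add: gvec_eq inner_to_l2 in_L2_cmult gauss_in_L2 cnj_gauss mult_ac)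
 also have "... = Re (\<integral>x. (c * cnj d) * (gauss z b x * gauss (cnj w) e x) \<partial>lborel)"
 using w z by (intro integral_Re integrable_mult_right in_L2_integrable_mult gauss_in_L2) auto
 also have "(\<integral>x. (c * cnj d) * (gauss z b x * gauss (cnj w) e x) \<partial>lborel) = c * cnj d * of_real (gauss_const TYPE('n)) * gauss (z + cnj w) e b"
 using gauss_mult_integral[of z "cnj w" b e] z w by simp
 finally show ?thesis .
qed

subsection \<open>Translations and boxes\<close>

abbreviation tr :: "real ^ 'n => 'n::finite l2 => 'n l2" where "tr y \<equiv> wop (%_. 1) 1 y"

lemma tr_to_l2: "in_L2 f ==> tr y (to_l2 f) = to_l2 (%x. f (x + y))"
 by (simp add: wop_to_l2) (simp add: wcomp_def)

lemma in_L2_shift: "in_L2 f ==> in_L2 (%x. f (x + y) :: complex)"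
 using wcomp_in_L2(1)[of "%_. 1" 1 f y] by (simp add: wcomp_def)

lemma tr_add: "tr (a + b) x = tr a (tr b x)"
 by (simp add: wop_wop)

lemma tr_gvec: "tr y (gvec (c, z, b)) = gvec (c, z, b - y)"
proof (cases "Re z > 0")
 case True then show ?thesis by (simp add: gvec_eq tr_to_l2 in_L2_cmult gauss_in_L2 gauss_shift)
next
 case False then show ?thesis
 using linear_0[OF bounded_linear.linear[OF wop_bounded_linear[OF iso_weight_1]]] by (simp add: gvec_def)
qed

lemma enn2real_inj: "X ~= \<infinity> ==> Y ~= \<infinity> ==> enn2real X = enn2real Y ==> X = Y"
 by (metis ennreal_enn2real infinity_ennreal_def less_top)

text \<open>The densities of the positive and the negative part give the same finite mass to every
  box. Boxes generate the Borel sets and are stable under intersection, so the two measures agree,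
  and then so do their densities.\<close>

lemma AE_zero_of_box_integrals:
 fixes h :: "real ^ 'n => real"
 assumes int: "!!a b. integrable lborel (%x. indicator (box a b) x * h x)"
 and zero: "!!a b. (\<integral>x. indicator (box a b) x * h x \<partial>lborel) = 0" and m[measurable]: "h \<in> borel_measurable borel"
 shows "AE x in lborel. h x = 0"
proof -
 let ?P = "density lborel (%x. ennreal (h x))" and ?N = "density lborel (%x. ennreal (- h x))"
 have *: "emeasure ?P (box a b) = emeasure ?N (box a b)" "emeasure ?P (box a b) ~= \<infinity>" for a b
 proof -
 let ?g = "%x. indicator (box a b) x * h x"
 have P: "emeasure ?P (box a b) = (\<integral>\<^sup>+x. ennreal (?g x) \<partial>lborel)"
 by (subst emeasure_density) (auto intro!: nn_integral_cong simp: indicator_def)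
 have N: "emeasure ?N (box a b) = (\<integral>\<^sup>+x. ennreal (- ?g x) \<partial>lborel)"
 by (subst emeasure_density) (auto intro!: nn_integral_cong simp: indicator_def)
 have fin: "(\<integral>\<^sup>+x. ennreal (?g x) \<partial>lborel) ~= \<infinity>" "(\<integral>\<^sup>+x. ennreal (- ?g x) \<partial>lborel) ~= \<infinity>"
 using int[of a b] by (auto simp: real_integrable_def)
 have "enn2real (\<integral>\<^sup>+x. ennreal (?g x) \<partial>lborel) - enn2real (\<integral>\<^sup>+x. ennreal (- ?g x) \<partial>lborel) = 0"
 using real_lebesgue_integral_def[OF int[of a b]] zero[of a b] by simp
 then show "emeasure ?P (box a b) = emeasure ?N (box a b)"
 unfolding P N by (intro enn2real_inj fin) linarith
 show "emeasure ?P (box a b) ~= \<infinity>" using fin unfolding P by simp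
 qed
 have "?P = ?N"
 proof (rule measure_eqI_generator_eq[where E = "range (%(a, b). box a b)" and \<Omega> = UNIV
 and A = "%i. box (- (real i *\<^sub>R One)) (real i *\<^sub>R One)"])
 show "Int_stable (range (%(a, b). box a b :: (real ^ 'n) set))"
 by (auto simp: Int_stable_def box_Int_box)
 show "sets ?P = sigma_sets UNIV (range (%(a, b). box a b))" "sets ?N = sigma_sets UNIV (range (%(a, b). box a b))"
 by (simp_all add: borel_eq_box)
 show "range (%i. box (- (real i *\<^sub>R One)) (real i *\<^sub>R One)) \<subseteq> range (%(a, b). box a b :: (real ^ 'n) set)" by auto
 show "(\<Union>i. box (- (real i *\<^sub>R One)) (real i *\<^sub>R One)) = (UNIV :: (real ^ 'n) set)" by (rule UN_box_eq_UNIV)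
 qed (use * in auto)
 then have "AE x in lborel. ennreal (h x) = ennreal (- h x)"
 by (intro sigma_finite_measure.density_unique[OF sigma_finite_lborel]) auto
 then show ?thesis
 proof eventually_elim
 case (elim x)
 then show ?case by (cases "h x >= 0") (auto simp: ennreal_neg ennreal_eq_0_iff)
 qed
qed

definition boxvec :: "complex \<times> (real ^ 'n) \<times> (real ^ 'n) => 'n::finite l2" where
 "boxvec = (%(c, a, b). to_l2 (%x. c * indicator (box a b) x))"

lemma box_in_L2: "in_L2 (%x. c * indicator (box a b) x :: complex)"
proof (rule in_L2_bound)
 show "integrable lborel (%x. (norm c)\<^sup>2 * indicator (box a b) x)"
 by (intro integrable_mult_right integrable_real_indicator) (use emeasure_lborel_box_finite[of a b] in simp_all)
qed (auto simp: norm_mult power_mult_distrib indicator_def)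

text \<open>The amplitudes \<open>1\<close> and \<open>\<i>\<close> test the real and the imaginary
  part. Box indicators come before Gaussians because strong continuity of translations is elementary
  on them, and totality of Gaussians will be deduced from that continuity.\<close>

lemma boxvec_total: "total_set (range (boxvec :: _ => 'n::finite l2))"
proof (rule total_setI)
 fix f :: "'n l2" assume f: "!!s. s \<in> range boxvec ==> inner f s = 0"
 have int: "integrable lborel (%x. l2_fun f x * indicator (box a b) x)" for a b
 using in_L2_integrable_mult[OF in_L2_l2_fun box_in_L2[of 1 a b], of f] by simp
 have z: "(\<integral>x. Re (l2_fun f x * cnj c * indicator (box a b) x) \<partial>lborel) = 0" for c a b
 proof -
 have e: "(%x. Re (l2_fun f x * cnj (c * indicator (box a b) x))) = (%x. Re (l2_fun f x * cnj c * indicator (box a b) x))"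
 by (auto simp: indicator_def)
 have "inner f (boxvec (c, a, b)) = (\<integral>x. Re (l2_fun f x * cnj c * indicator (box a b) x) \<partial>lborel)"
 using inner_to_l2[OF in_L2_l2_fun box_in_L2, of f c a b] unfolding e to_l2_l2_fun by (simp only: boxvec_def prod.case)
 moreover have "inner f (boxvec (c, a, b)) = 0" by (rule f) simp
 ultimately show ?thesis by (simp only:)
 qed
 have "AE x in lborel. Re (l2_fun f x) = 0"
 proof (rule AE_zero_of_box_integrals)
 fix a b
 have e: "(%x. indicator (box a b) x * Re (l2_fun f x)) = (%x. Re (l2_fun f x * indicator (box a b) x))"
 by (auto simp: indicator_def)
 show "integrable lborel (%x. indicator (box a b) x * Re (l2_fun f x))" unfolding e by (intro integrable_Re int)
 show "(\<integral>x. indicator (box a b) x * Re (l2_fun f x) \<partial>lborel) = 0" unfolding e using z[of 1 a b] by simp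
 qed measurable
 moreover have "AE x in lborel. Im (l2_fun f x) = 0"
 proof (rule AE_zero_of_box_integrals)
 fix a b
 have e: "(%x. indicator (box a b) x * Im (l2_fun f x)) = (%x. Im (l2_fun f x * indicator (box a b) x))"
 by (auto simp: indicator_def)
 have e': "(%x. indicator (box a b) x * Im (l2_fun f x)) = (%x. Re (l2_fun f x * cnj \<i> * indicator (box a b) x))"
 by (auto simp: indicator_def)
 show "integrable lborel (%x. indicator (box a b) x * Im (l2_fun f x))" unfolding e by (intro integrable_Im int)
 show "(\<integral>x. indicator (box a b) x * Im (l2_fun f x) \<partial>lborel) = 0" unfolding e' by (rule z)
 qed measurable
 ultimately show "f = 0" using l2_fun_0 by (intro l2_eqI) (auto simp: complex_eq_iff elim: AE_mp)
qed

text \<open>Small translates of a box indicator agree with it eventually at each point off the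
  boundary of the box, a null set. Shifts bounded by \<open>R\<close> stay in the box enlarged by
  \<open>R\<close>, which supplies the dominating function.\<close>

lemma tr_isometry_group: "isometry_group (tr :: real ^ 'n => 'n::finite l2 => 'n l2)"
proof (rule isometry_group.intro)
 fix x :: "'n l2"
 show "((%g. tr g x) \<longlongrightarrow> x) (at 0)"
 proof (rule total_set_tendsto[OF boxvec_total, where C = 1 and L = "%x. x"])
 fix s :: "'n l2" assume "s \<in> range boxvec"
 then obtain c a b where s: "s = to_l2 (%x. c * indicator (box a b) x)" by (auto simp: boxvec_def)
 let ?f = "%x. c * indicator (box a b) x :: complex"
 note L = in_L2_diff[OF in_L2_shift[OF box_in_L2] box_in_L2]
 have fr: "AE x in lborel. x \<notin> cbox a b - box a b"
 proof (rule AE_not_in)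
 have "emeasure lborel (cbox a b - box a b) = emeasure lborel (cbox a b) - emeasure lborel (box a b)"
 using emeasure_lborel_box_finite[of a b] by (intro emeasure_Diff) (auto simp: box_subset_cbox)
 also have "... = 0" by (simp add: emeasure_lborel_cbox_eq emeasure_lborel_box_eq)
 finally show "cbox a b - box a b \<in> null_sets lborel" by (auto simp: null_sets_def)
 qed
 have "((%g. (norm (tr g s - s))\<^sup>2) \<longlongrightarrow> 0) (at 0)"
 unfolding tendsto_at_iff_sequentially
 proof (intro allI impI)
 fix g :: "nat => real ^ 'n" assume g: "\<forall>i. g i \<in> UNIV - {0}" "g \<longlonglongrightarrow> 0"
 have "bounded (range g)" using g(2) by (intro convergent_imp_bounded) auto
 then obtain R where R: "!!n. norm (g n) <= R" by (auto simp: bounded_iff)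
 have "(%n. \<integral>x. (norm (?f (x + g n) - ?f x))\<^sup>2 \<partial>lborel) \<longlonglongrightarrow> integral\<^sup>L lborel (%x :: real ^ 'n. 0)"
 proof (rule integral_dominated_convergence[where w = "%x. (norm c)\<^sup>2 * indicator (cbox (a - (\<chi> i. R)) (b + (\<chi> i. R))) x"])
 show "AE x in lborel. (%n. (norm (?f (x + g n) - ?f x))\<^sup>2) \<longlonglongrightarrow> 0"
 using fr
 proof eventually_elim
 case (elim x)
 have gx: "(%n. x + g n) \<longlonglongrightarrow> x" using tendsto_add[OF tendsto_const[of x] g(2)] by simp
 have "eventually (%n. x + g n \<in> box a b \<longleftrightarrow> x \<in> box a b) sequentially"
 proof (cases "x \<in> box a b")
 case True then show ?thesis using topological_tendstoD[OF gx open_box] by (auto elim: eventually_mono)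
 next
 case False
 then have "x \<in> - cbox a b" using elim by auto
 then have "eventually (%n. x + g n \<in> - cbox a b) sequentially"
 by (intro topological_tendstoD[OF gx]) (auto simp: open_Compl closed_cbox)
 then show ?thesis by eventually_elim (use False box_subset_cbox[of a b] in auto)
 qed
 then have "eventually (%n. (norm (?f (x + g n) - ?f x))\<^sup>2 = 0) sequentially"
 by eventually_elim (auto simp: indicator_def)
 then show ?case by (rule tendsto_eventually)
 qed
 show "AE x in lborel. norm ((norm (?f (x + g n) - ?f x))\<^sup>2) <= (norm c)\<^sup>2 * indicator (cbox (a - (\<chi> i. R)) (b + (\<chi> i. R))) x" for n
 proof (rule AE_I2)
 fix x
 have gi: "\<bar>g n $ i\<bar> <= R" for i using component_le_norm_cart[of "g n" i] R[of n] by linarith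
 have R0: "R >= 0" using R[of 0] norm_ge_zero order_trans by blast
 have "x \<in> cbox (a - (\<chi> i. R)) (b + (\<chi> i. R))" if "x + g n \<in> box a b \<or> x \<in> box a b"
 unfolding mem_box_cart
 proof (intro allI conjI)
 fix i
 show "(a - (\<chi> i. R)) $ i <= x $ i" "x $ i <= (b + (\<chi> i. R)) $ i"
 using that gi[of i] R0 unfolding mem_box_cart by (auto dest!: spec[of _ i])
 qed
 then show "norm ((norm (?f (x + g n) - ?f x))\<^sup>2) <= (norm c)\<^sup>2 * indicator (cbox (a - (\<chi> i. R)) (b + (\<chi> i. R))) x"
 by (auto simp: indicator_def norm_minus_commute)
 qed
 show "integrable lborel (%x. (norm c)\<^sup>2 * indicator (cbox (a - (\<chi> i. R)) (b + (\<chi> i. R))) x)"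
 using emeasure_lborel_cbox_finite[of "a - (\<chi> i. R)" "b + (\<chi> i. R)"]
 by (intro integrable_mult_right integrable_real_indicator) simp_all
 qed auto
 moreover have "(norm (tr y s - s))\<^sup>2 = (\<integral>x. (norm (?f (x + y) - ?f x))\<^sup>2 \<partial>lborel)" for y
 using norm_to_l2[OF L, of c a b y c a b] by (simp add: s tr_to_l2 box_in_L2 to_l2_diff in_L2_shift[OF box_in_L2])
 ultimately show "((%g. (norm (tr g s - s))\<^sup>2) \<circ> g) \<longlonglongrightarrow> 0" by (simp add: comp_def)
 qed
 then have "((%g. sqrt ((norm (tr g s - s))\<^sup>2)) \<longlongrightarrow> sqrt 0) (at 0)" by (rule tendsto_real_sqrt)
 then show "((%g. tr g s) \<longlongrightarrow> s) (at 0)" by (simp add: tendsto_norm_zero_iff LIM_zero_iff)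
 next
 show "linear (tr g)" for g :: "real ^ 'n" by (rule bounded_linear.linear[OF wop_bounded_linear[OF iso_weight_1]])
 qed (simp_all add: bounded_linear_ident)
qed (auto simp: wop_bounded_linear tr_add wop_id)

subsection \<open>Heat regularization\<close>

definition heat :: "real => real ^ 'n => real" where
 "heat t x = (\<Prod>i\<in>UNIV. normal_density 0 (sqrt t) (x $ i))"

lemma heat_nonneg [simp]: "heat t x >= 0"
 unfolding heat_def by (intro prod_nonneg) simp

lemma heat_measurable [measurable]: "heat t \<in> borel_measurable borel"
 unfolding heat_def by measurable

lemma gauss_heat:
 fixes b x :: "real ^ 'n"
 shows "t > 0 ==> gauss (of_real t) b x = of_real (gauss_const TYPE('n) * heat t (x - b))"
 by (simp add: gauss_def heat_def gauss1_of_real gauss_const_def prod.distrib)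

lemma heat_integral:
 assumes "t > 0"
 shows "integrable lborel (heat t :: real ^ 'n => real)" "(\<integral>x. heat t (x :: real ^ 'n) \<partial>lborel) = 1"
 using integral_prod_coords[where f = "%i::'n. normal_density 0 (sqrt t)"] assms unfolding heat_def by simp_all

lemma heat_second_moment:
 assumes t: "t > 0"
 shows "integrable lborel (%x :: real ^ 'n. heat t x * (norm x)\<^sup>2)"
 "(\<integral>x. heat t x * (norm (x :: real ^ 'n))\<^sup>2 \<partial>lborel) = real CARD('n) * t"
proof -
 define F where "F i j y = normal_density 0 (sqrt t) y * (if i = j then y\<^sup>2 else 1)" for i j :: 'n and y
 have s: "sqrt t > 0" using t by simp
 have m2: "integrable lborel (%y. normal_density 0 (sqrt t) y * y\<^sup>2)"
 using integrable_normal_moment[OF s, of 0 2] by simp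
 have m2': "(\<integral>y. normal_density 0 (sqrt t) y * y\<^sup>2 \<partial>lborel) = t"
 using integral_normal_moment_even[OF s, of 0 1] t by (simp add: power2_eq_square)
 have Fi: "integrable lborel (F i j)" "(\<integral>y. F i j y \<partial>lborel) = (if i = j then t else 1)" for i j
 using m2 m2' s by (cases "i = j"; simp add: F_def[abs_def])+
 have P: "(\<Prod>j\<in>UNIV. F i j (x $ j)) = heat t x * (x $ i)\<^sup>2" for i and x :: "real ^ 'n"
 by (simp add: F_def heat_def prod.distrib)
 have I: "integrable lborel (%x :: real ^ 'n. heat t x * (x $ i)\<^sup>2)"
 "(\<integral>x. heat t x * ((x :: real ^ 'n) $ i)\<^sup>2 \<partial>lborel) = t" for i
 using integral_prod_coords[where f = "F i", OF Fi(1)] unfolding P by (simp_all add: Fi(2))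
 have N: "heat t x * (norm x)\<^sup>2 = (\<Sum>i\<in>UNIV. heat t x * (x $ i)\<^sup>2)" for x :: "real ^ 'n"
 unfolding power2_norm_eq_inner inner_vec_def by (simp add: sum_distrib_left power2_eq_square)
 show "integrable lborel (%x :: real ^ 'n. heat t x * (norm x)\<^sup>2)"
 "(\<integral>x. heat t x * (norm (x :: real ^ 'n))\<^sup>2 \<partial>lborel) = real CARD('n) * t"
 unfolding N using I by simp_all
qed

lemma integral_shift:
 fixes f :: "real ^ 'n => 'b::{banach,second_countable_topology}"
 assumes "f \<in> borel_measurable borel"
 shows "(\<integral>x. f x \<partial>lborel) = (\<integral>x. f (x + y) \<partial>lborel)"
proof -
 have "(\<integral>x. f x \<partial>lborel) = (\<integral>x. f x \<partial>distr lborel borel ((+) y))" by (simp add: lborel_distr_plus)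
 also have "... = (\<integral>x. f (y + x) \<partial>lborel)" using assms by (subst integral_distr) auto
 finally show ?thesis by (simp add: add.commute)
qed

definition heat_ev :: "real => 'n::finite l2 => real ^ 'n => complex" where
 "heat_ev t a y = (\<integral>x. of_real (heat t (x - y)) * l2_fun a x \<partial>lborel)"

lemma heat_ev_measurable [measurable]: "heat_ev t a \<in> borel_measurable borel"
 unfolding heat_ev_def by measurable

lemma heat_in_L2:
 fixes y :: "real ^ 'n"
 assumes "t > 0" shows "in_L2 (%x. complex_of_real (heat t (x - y)))"
proof -
 have "in_L2 (%x. of_real (1 / gauss_const TYPE('n)) * gauss (of_real t) y x)"
 by (intro in_L2_cmult gauss_in_L2) (simp add: assms)
 then show ?thesis using gauss_const_pos[where 'n = 'n] by (simp add: gauss_heat assms)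
qed

text \<open>Point evaluation after smoothing is a pairing with a Gaussian, the amplitude
  \<open>\<i>\<close> giving the imaginary part. This is what makes weak convergence visible
  pointwise.\<close>

lemma heat_ev_inner:
 fixes a :: "'n::finite l2"
 assumes t: "t > 0"
 shows "of_real (gauss_const TYPE('n)) * heat_ev t a y
 = Complex (inner a (gvec (1, of_real t, y))) (inner a (gvec (\<i>, of_real t, y)))"
proof -
 have "Complex (inner a (gvec (1, of_real t, y))) (inner a (gvec (\<i>, of_real t, y)))
 = (\<integral>x. l2_fun a x * cnj (l2_fun (gvec (1, of_real t, y)) x) \<partial>lborel)"
 using cmul_gvec[of \<i> 1 "of_real t" y] by (simp add: complex_inner_l2_fun)
 also have "... = (\<integral>x. of_real (gauss_const TYPE('n)) * (of_real (heat t (x - y)) * l2_fun a x) \<partial>lborel)"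
 proof (rule integral_cong_AE)
 have "AE x in lborel. l2_fun (gvec (1, of_real t, y)) x = gauss (of_real t) y x"
 using l2_fun_to_l2[OF gauss_in_L2[of "of_real t" y]] t by (simp add: gvec_eq)
 then show "AE x in lborel. l2_fun a x * cnj (l2_fun (gvec (1, of_real t, y)) x)
 = of_real (gauss_const TYPE('n)) * (of_real (heat t (x - y)) * l2_fun a x)"
 by eventually_elim (simp add: gauss_heat t)
 qed measurable
 finally show ?thesis by (simp add: heat_ev_def)
qed

lemma heat_ev_bound:
 fixes a :: "'n::finite l2"
 assumes t: "t > 0"
 shows "gauss_const TYPE('n) * norm (heat_ev t a y) <= 2 * norm (gvec (1, of_real t, y)) * norm a"
proof -
 have n: "norm (gvec (\<i>, of_real t, y)) = norm (gvec (1, of_real t, y))"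
 using cmul_gvec[of \<i> 1 "of_real t" y] norm_cmul[of \<i> "gvec (1, of_real t, y)"] by simp
 have "norm (of_real (gauss_const TYPE('n)) * heat_ev t a y)
 <= \<bar>inner a (gvec (1, of_real t, y))\<bar> + \<bar>inner a (gvec (\<i>, of_real t, y))\<bar>"
 unfolding heat_ev_inner[OF t] using cmod_le[of "Complex (inner a (gvec (1, of_real t, y))) (inner a (gvec (\<i>, of_real t, y)))"] by simp
 also have "... <= norm a * norm (gvec (1, of_real t, y)) + norm a * norm (gvec (\<i>, of_real t, y))"
 by (intro add_mono Cauchy_Schwarz_ineq2)
 finally show ?thesis unfolding n using gauss_const_pos[where 'n = 'n] by (simp add: norm_mult mult_ac)
qed

text \<open>Jensen's inequality for the probability density \<open>heat t\<close>, obtained from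
  Cauchy-Schwarz after splitting the kernel into two square roots.\<close>

lemma heat_ev_diff_pointwise:
 fixes a :: "'n::finite l2"
 assumes t: "t > 0"
 shows "ennreal ((norm (heat_ev t a y - l2_fun a y))\<^sup>2)
 <= (\<integral>\<^sup>+u. ennreal (heat t u) * ennreal ((norm (l2_fun a (u + y) - l2_fun a y))\<^sup>2) \<partial>lborel)"
proof -
 let ?d = "%u. l2_fun a (u + y) - l2_fun a y"
 have i1: "integrable lborel (%u. of_real (heat t u) * l2_fun a (u + y))"
 using in_L2_integrable_mult[OF heat_in_L2[OF t, of 0] in_L2_shift[OF in_L2_l2_fun, of a y]] by simp
 have i2: "integrable lborel (%u. of_real (heat t (u :: real ^ 'n)) * l2_fun a y)"
 by (intro integrable_mult_left integrable_of_real heat_integral t)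
 have "heat_ev t a y = (\<integral>u. of_real (heat t u) * l2_fun a (u + y) \<partial>lborel)"
 unfolding heat_ev_def by (subst integral_shift[where y = y]) simp_all
 moreover have "l2_fun a y = (\<integral>u. of_real (heat t (u :: real ^ 'n)) * l2_fun a y \<partial>lborel)"
 using heat_integral[OF t, where 'n = 'n] by simp
 ultimately have D: "heat_ev t a y - l2_fun a y = (\<integral>u. of_real (heat t u) * ?d u \<partial>lborel)"
 using Bochner_Integration.integral_diff[OF i1 i2] by (simp add: right_diff_distrib)
 have i: "integrable lborel (%u. of_real (heat t u) * ?d u)"
 using Bochner_Integration.integrable_diff[OF i1 i2] by (simp add: right_diff_distrib)
 have "ennreal (norm (heat_ev t a y - l2_fun a y)) <= (\<integral>\<^sup>+u. ennreal (norm (of_real (heat t u) * ?d u)) \<partial>lborel)"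
 unfolding D by (rule integral_norm_bound_ennreal[OF i])
 also have "... = (\<integral>\<^sup>+u. ennreal (sqrt (heat t u)) * ennreal (sqrt (heat t u) * norm (?d u)) \<partial>lborel)"
 by (intro nn_integral_cong) (simp add: norm_mult mult.assoc[symmetric] flip: ennreal_mult)
 finally have "(ennreal (norm (heat_ev t a y - l2_fun a y)))\<^sup>2
 <= (\<integral>\<^sup>+u. ennreal (sqrt (heat t u)) * ennreal (sqrt (heat t u) * norm (?d u)) \<partial>lborel)\<^sup>2"
 by (rule power_mono) simp
 also have "... <= (\<integral>\<^sup>+u. (ennreal (sqrt (heat t (u :: real ^ 'n))))\<^sup>2 \<partial>lborel) * (\<integral>\<^sup>+u. (ennreal (sqrt (heat t u) * norm (?d u)))\<^sup>2 \<partial>lborel)"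
 by (rule Cauchy_Schwarz_nn_integral) measurable
 also have "(\<integral>\<^sup>+u. (ennreal (sqrt (heat t (u::real ^ 'n))))\<^sup>2 \<partial>lborel) = 1"
 using heat_integral[OF t, where 'n = 'n] by (simp add: ennreal_power nn_integral_eq_integral)
 also have "(\<integral>\<^sup>+u. (ennreal (sqrt (heat t u) * norm (?d u)))\<^sup>2 \<partial>lborel) = (\<integral>\<^sup>+u. ennreal (heat t u) * ennreal ((norm (?d u))\<^sup>2) \<partial>lborel)"
 by (intro nn_integral_cong) (simp add: ennreal_power power_mult_distrib flip: ennreal_mult)
 finally show ?thesis by (simp add: ennreal_power)
qed

text \<open>Integrating the pointwise bound and exchanging the integrals leaves the mean of the
  squared translation error under the heat kernel, whose second moment is \<open>n * t\<close>. The
  two constants cover mere continuity of translates (small \<open>A\<close>) and Lipschitz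
  translates (\<open>A = 0\<close>).\<close>

lemma heat_ev_diff:
 fixes a :: "'n::finite l2"
 assumes t: "t > 0" and A: "A >= 0" and B: "B >= 0" and bd: "!!u. (norm (tr u a - a))\<^sup>2 <= A + B * (norm u)\<^sup>2"
 shows "in_L2 (heat_ev t a)" "(norm (to_l2 (heat_ev t a) - a))\<^sup>2 <= A + B * (real CARD('n) * t)"
proof -
 have tr2: "(\<integral>\<^sup>+y. ennreal ((norm (l2_fun a (u + y) - l2_fun a y))\<^sup>2) \<partial>lborel) = ennreal ((norm (tr u a - a))\<^sup>2)" for u
 proof -
 have L: "in_L2 (%y. l2_fun a (y + u) - l2_fun a y)" by (intro in_L2_diff in_L2_shift) simp_all
 have "tr u a - a = to_l2 (%y. l2_fun a (y + u) - l2_fun a y)"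
 using tr_to_l2[OF in_L2_l2_fun, of u a] by (simp add: to_l2_diff in_L2_shift)
 then show ?thesis using norm_to_l2[OF L] nn_integral_eq_integral[OF in_L2_integrable[OF L]] by (simp add: add.commute)
 qed
 have "(\<integral>\<^sup>+y. ennreal ((norm (heat_ev t a y - l2_fun a y))\<^sup>2) \<partial>lborel)
 <= (\<integral>\<^sup>+y. \<integral>\<^sup>+u. ennreal (heat t u) * ennreal ((norm (l2_fun a (u + y) - l2_fun a y))\<^sup>2) \<partial>lborel \<partial>lborel)"
 by (intro nn_integral_mono heat_ev_diff_pointwise t)
 also have "... = (\<integral>\<^sup>+u. \<integral>\<^sup>+y. ennreal (heat t u) * ennreal ((norm (l2_fun a (u + y) - l2_fun a y))\<^sup>2) \<partial>lborel \<partial>lborel)"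
 by (rule lborel_pair.Fubini') measurable
 also have "... = (\<integral>\<^sup>+u. ennreal (heat t u) * ennreal ((norm (tr u a - a))\<^sup>2) \<partial>lborel)"
 by (subst nn_integral_cmult) (measurable, simp add: tr2)
 also have "... <= (\<integral>\<^sup>+u. ennreal (A * heat t (u :: real ^ 'n) + B * (heat t u * (norm u)\<^sup>2)) \<partial>lborel)"
 proof (intro nn_integral_mono)
 fix u :: "real ^ 'n"
 have "heat t u * (norm (tr u a - a))\<^sup>2 <= heat t u * (A + B * (norm u)\<^sup>2)" by (intro mult_left_mono bd) simp
 then show "ennreal (heat t u) * ennreal ((norm (tr u a - a))\<^sup>2) <= ennreal (A * heat t u + B * (heat t u * (norm u)\<^sup>2))"
 by (simp add: algebra_simps ennreal_leI flip: ennreal_mult)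
 qed
 also have "... = ennreal (A + B * (real CARD('n) * t))"
 using heat_integral[OF t, where 'n = 'n] heat_second_moment[OF t, where 'n = 'n] A B
 by (subst nn_integral_eq_integral) auto
 finally have le: "(\<integral>\<^sup>+y. ennreal ((norm (heat_ev t a y - l2_fun a y))\<^sup>2) \<partial>lborel) <= ennreal (A + B * (real CARD('n) * t))" .
 then have "(\<integral>\<^sup>+y. ennreal ((norm (heat_ev t a y - l2_fun a y))\<^sup>2) \<partial>lborel) < \<infinity>"
 by (rule le_less_trans) simp
 then have D: "in_L2 (%y. heat_ev t a y - l2_fun a y)"
 unfolding in_L2_iff integrable_iff_bounded by simp
 show L: "in_L2 (heat_ev t a)" using in_L2_add[OF D in_L2_l2_fun, of a] by simp
 have "to_l2 (heat_ev t a) - a = to_l2 (%y. heat_ev t a y - l2_fun a y)" using L by (simp add: to_l2_diff)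
 then have "ennreal ((norm (to_l2 (heat_ev t a) - a))\<^sup>2) <= ennreal (A + B * (real CARD('n) * t))"
 using le norm_to_l2[OF D] nn_integral_eq_integral[OF in_L2_integrable[OF D]] by simp
 then show "(norm (to_l2 (heat_ev t a) - a))\<^sup>2 <= A + B * (real CARD('n) * t)"
 using A B t by (subst (asm) ennreal_le_iff) auto
qed

lemma heat_ev_in_L2: assumes "t > 0" shows "in_L2 (heat_ev t a)"
proof (rule heat_ev_diff(1)[OF assms, of "(2 * norm a)\<^sup>2" 0])
 fix u
 have "norm (tr u a - a) <= 2 * norm a" using norm_triangle_ineq4[of "tr u a" a] by simp
 then have "(norm (tr u a - a))\<^sup>2 <= (2 * norm a)\<^sup>2" by (intro power_mono) auto
 then show "(norm (tr u a - a))\<^sup>2 <= (2 * norm a)\<^sup>2 + 0 * (norm u)\<^sup>2" by simp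
qed auto

lemma heat_ev_tendsto:
 fixes a :: "'n::finite l2"
 shows "((%t. to_l2 (heat_ev t a)) \<longlongrightarrow> a) (at_right 0)"
proof (rule tendstoI)
 fix e :: real assume e: "e > 0"
 have c: "((%g. tr g a) \<longlongrightarrow> a) (at 0)" by (rule isometry_group.T_cont0[OF tr_isometry_group])
 define A where "A = e\<^sup>2 / 4"
 have A: "A > 0" using e by (simp add: A_def)
 obtain d where d: "d > 0" "!!u. u ~= 0 ==> norm u < d ==> norm (tr u a - a) < sqrt A"
 using tendstoD[OF c, of "sqrt A"] A unfolding eventually_at by (auto simp: dist_norm)
 \<comment> \<open>Chosen so that the trivial bound \<open>2 * norm a\<close> is absorbed as soon as
   \<open>norm u >= d\<close>.\<close>
 define B where "B = (2 * norm a)\<^sup>2 / d\<^sup>2"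
 have bd: "(norm (tr u a - a))\<^sup>2 <= A + B * (norm u)\<^sup>2" for u
 proof (cases "norm u < d")
 case True
 have "norm (tr u a - a) <= sqrt A" using d(2)[of u] True A by (cases "u = 0") (auto simp: wop_id)
 then have "(norm (tr u a - a))\<^sup>2 <= (sqrt A)\<^sup>2" by (intro power_mono) auto
 also have "(sqrt A)\<^sup>2 = A" using A by simp
 finally show ?thesis by (simp add: B_def add_increasing2)
 next
 case False
 have "norm (tr u a - a) <= 2 * norm a" using norm_triangle_ineq4[of "tr u a" a] by simp
 then have "(norm (tr u a - a))\<^sup>2 <= (2 * norm a)\<^sup>2" by (intro power_mono) auto
 also have "... = B * d\<^sup>2" using d(1) by (simp add: B_def)
 also have "... <= B * (norm u)\<^sup>2" using False d(1) by (intro mult_left_mono power_mono) (auto simp: B_def)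
 finally show ?thesis using A by linarith
 qed
 have B: "B >= 0" by (simp add: B_def)
 have "((%t. A + B * (real CARD('n) * t)) \<longlongrightarrow> A + B * (real CARD('n) * 0)) (at_right 0)" by (intro tendsto_intros)
 moreover have "A + B * (real CARD('n) * 0) < e\<^sup>2" using e by (simp add: A_def)
 ultimately have "eventually (%t. A + B * (real CARD('n) * t) < e\<^sup>2) (at_right 0)" by (rule order_tendstoD(2))
 moreover have "eventually (%t::real. t > 0) (at_right 0)" by (simp add: eventually_at_right_less)
 ultimately show "eventually (%t. dist (to_l2 (heat_ev t a)) a < e) (at_right 0)"
 proof eventually_elim
 case (elim t)
 have "(norm (to_l2 (heat_ev t a) - a))\<^sup>2 < e\<^sup>2"
 using heat_ev_diff(2)[OF elim(2) _ B bd] A elim(1) by simp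
 then show ?case using e by (simp add: dist_norm power_less_imp_less_base[where n = 2])
 qed
qed

text \<open>A vector orthogonal to all Gaussians of real variance has vanishing heat
  regularisations, and these converge back to it.\<close>

lemma gvec_total: "total_set (gvec ` {(c, z, b). z \<in> complex_of_real ` {0<..}} :: 'n::finite l2 set)"
proof (rule total_setI)
 fix a :: "'n l2" assume a: "!!s. s \<in> gvec ` {(c, z, b). z \<in> complex_of_real ` {0<..}} ==> inner a s = 0"
 have "to_l2 (heat_ev t a) = 0" if t: "t > 0" for t
 proof -
 have "inner a (gvec (c, of_real t, y)) = 0" for c y using t by (intro a) auto
 then have "of_real (gauss_const TYPE('n)) * heat_ev t a y = 0" for y
 unfolding heat_ev_inner[OF t] by (simp add: complex_eq_iff)
 then have "heat_ev t a = (%y. 0)" using gauss_const_pos[where 'n = 'n] by (auto simp: fun_eq_iff)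
 then show ?thesis by (simp add: zero_l2_def)
 qed
 then have "eventually (%t. to_l2 (heat_ev t a) = 0) (at_right 0)"
 by (intro eventually_mono[OF eventually_at_right_less[of "0::real"]])
 from tendsto_unique[OF _ heat_ev_tendsto tendsto_eventually[OF this]] show "a = 0" by simp
qed

lemma gvec_total': "total_set (range (gvec :: _ => 'n::finite l2))"
 by (rule total_set_mono[OF gvec_total]) (auto intro: subsetD[OF closure_subset] span_base)

section \<open>The free propagator\<close>

lemma csqrt_of_real_mult: assumes "r > 0" shows "csqrt (of_real r * z) = of_real (sqrt r) * csqrt z"
proof (rule csqrt_unique)
 show "(of_real (sqrt r) * csqrt z)\<^sup>2 = of_real r * z" using assms(1) by (simp add: power_mult_distrib flip: of_real_power)
 show "0 < Re (of_real (sqrt r) * csqrt z) \<or> Re (of_real (sqrt r) * csqrt z) = 0 & 0 <= Im (of_real (sqrt r) * csqrt z)"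
 using csqrt_principal[of z] assms by auto
qed

lemma norm_gauss:
 fixes b x :: "real ^ 'n"
 assumes z: "Re z > 0"
 shows "norm (gauss z b x) = exp (- (norm (x - b))\<^sup>2 * Re (1 / z) / 2) / sqrt (norm z) ^ CARD('n)"
proof -
 have "norm (gauss z b x) = (\<Prod>i\<in>UNIV. exp (- (x $ i - b $ i)\<^sup>2 * Re (1 / z) / 2) / sqrt (norm z))"
 unfolding gauss_def by (simp only: prod_norm[symmetric] norm_gauss1[OF z])
 also have "... = exp (\<Sum>i\<in>UNIV. - (x $ i - b $ i)\<^sup>2 * Re (1 / z) / 2) / sqrt (norm z) ^ CARD('n)"
 by (simp add: prod_dividef exp_sum)
 also have "(\<Sum>i\<in>UNIV. - (x $ i - b $ i)\<^sup>2 * Re (1 / z) / 2) = - (norm (x - b))\<^sup>2 * Re (1 / z) / 2"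
 unfolding power2_norm_eq_inner inner_vec_def
 by (simp add: sum_distrib_right sum_divide_distrib sum_negf power2_eq_square)
 finally show ?thesis .
qed

lemma gauss_tendsto:
 assumes z: "Re z > 0" and f: "(f \<longlongrightarrow> z) F"
 shows "((%t. gauss (f t) b x) \<longlongrightarrow> gauss z b x) F"
 unfolding gauss_def
 by (intro tendsto_prod isCont_tendsto_compose[OF _ f] DERIV_isCont[OF gauss1_deriv[OF z]])

text \<open>Free evolution for time \<open>s\<close> moves the variance \<open>z\<close> to
  \<open>z + \<i> * s\<close>, by the heat equation in complex time. The shift leaves the Gram
  matrix unchanged, so the formula extends from Gaussians to an isometry.\<close>

lemma schr_exists:
 "\<exists>V :: 'n::finite l2 => 'n l2. bounded_linear V & (\<forall>x. norm (V x) = norm x) &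
 (\<forall>c z b. Re z > 0 --> V (gvec (c, z, b)) = gvec (c, z + \<i> * of_real s, b))"
proof -
 define h :: "complex \<times> complex \<times> (real ^ 'n) => 'n l2" where
 "h = (%(c, z, b). if Re z > 0 then gvec (c, z + \<i> * of_real s, b) else 0)"
 have gram: "inner (gvec i) (gvec j) = inner (h i) (h j)" for i j :: "complex \<times> complex \<times> (real ^ 'n)"
 proof -
 obtain c z b where i: "i = (c, z, b)" by (cases i)
 obtain d w e where j: "j = (d, w, e)" by (cases j)
 show ?thesis
 proof (cases "Re z > 0 & Re w > 0")
 case True
 have "z + \<i> * of_real s + cnj (w + \<i> * of_real s) = z + cnj w" by (simp add: complex_eq_iff)
 then show ?thesis using True by (simp add: i j h_def gvec_inner)
 next
 case False then show ?thesis by (auto simp: i j h_def gvec_def)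
 qed
 qed
 obtain V where "bounded_linear V" "!!x. norm (V x) = norm x" "!!i. V (gvec i) = h i"
 using gram_isometry[OF gvec_total' gram] by blast
 then show ?thesis by (intro exI[of _ V]) (simp add: h_def)
qed

definition schr :: "real => 'n::finite l2 => 'n l2" where
 "schr s = (SOME V. bounded_linear V & (\<forall>x. norm (V x) = norm x) &
 (\<forall>c z b. Re z > 0 --> V (gvec (c, z, b)) = gvec (c, z + \<i> * of_real s, b)))"

lemma schr_bounded_linear: "bounded_linear (schr s)"
 and norm_schr [simp]: "norm (schr s x) = norm x"
 and schr_gvec: "Re z > 0 ==> schr s (gvec (c, z, b)) = gvec (c, z + \<i> * of_real s, b)"
 using someI_ex[OF schr_exists[of s]] unfolding schr_def[symmetric] by auto

definition gset :: "'n::finite l2 set" where "gset = gvec ` {(c, z, b). Re z > 0}"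

lemma gset_total: "total_set (gset :: 'n::finite l2 set)"
 unfolding gset_def
 by (rule total_set_mono[OF gvec_total]) (rule subset_trans[OF _ closure_subset], rule subset_trans[OF _ span_superset], auto)

lemma schr_tr: "schr s (tr y a) = tr y (schr s a)"
 by (rule total_set_linear_eq[OF gset_total, of "%a. schr s (tr y a)" "%a. tr y (schr s a)"])
 (auto simp: gset_def schr_gvec tr_gvec intro!: bounded_linear_compose[OF schr_bounded_linear wop_bounded_linear]
 bounded_linear_compose[OF wop_bounded_linear schr_bounded_linear])

lemma schr_cmul: "schr s (cmul d a) = cmul d (schr s a)"
 by (rule total_set_linear_eq[OF gset_total, of "%a. schr s (cmul d a)" "%a. cmul d (schr s a)"])
 (auto simp: gset_def schr_gvec cmul_gvec intro!: bounded_linear_compose[OF schr_bounded_linear cmul_bounded_linear]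
 bounded_linear_compose[OF cmul_bounded_linear schr_bounded_linear])

lemma schr_add: "schr (s + t) a = schr s (schr t a)"
 by (rule total_set_linear_eq[OF gset_total, of "schr (s + t)" "%a. schr s (schr t a)"])
 (auto simp: gset_def schr_gvec algebra_simps schr_bounded_linear intro!: bounded_linear_compose[OF schr_bounded_linear schr_bounded_linear])

lemma schr_0: "schr 0 a = a"
 by (rule total_set_linear_eq[OF gset_total, of "schr 0" "%a. a"])
 (auto simp: gset_def schr_gvec schr_bounded_linear bounded_linear_ident)

text \<open>For an isometry the squared norm of \<open>schr s a - a\<close> is
  \<open>2 * inner a a - 2 * inner (schr s a) a\<close>, so strong continuity on Gaussians reduces
  to continuity of an explicit Gram matrix entry.\<close>

lemma schr_isometry_group: "isometry_group (schr :: real => 'n::finite l2 => 'n l2)"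
proof (rule isometry_group.intro)
 fix x :: "'n l2"
 show "((%g. schr g x) \<longlongrightarrow> x) (at 0)"
 proof (rule total_set_tendsto[OF gset_total, where C = 1 and L = "%x. x"])
 fix a :: "'n l2" assume "a \<in> gset"
 then obtain c z b where a: "a = gvec (c, z, b)" and z: "Re z > 0" by (auto simp: gset_def)
 let ?k = "c * cnj c * of_real (gauss_const TYPE('n))"
 have "((%s. Re (?k * gauss (z + \<i> * of_real s + cnj z) b b)) \<longlongrightarrow> Re (?k * gauss (z + \<i> * of_real 0 + cnj z) b b)) (at 0)"
 by (intro tendsto_intros gauss_tendsto) (use z in auto)
 then have i: "((%s. inner (schr s a) a) \<longlongrightarrow> inner a a) (at 0)"
 using z by (simp add: a schr_gvec gvec_inner)
 have "((%s. 2 * inner a a - 2 * inner (schr s a) a) \<longlongrightarrow> 2 * inner a a - 2 * inner a a) (at 0)"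
 by (intro tendsto_intros i)
 moreover have "2 * inner a a - 2 * inner (schr s a) a = (norm (schr s a - a))\<^sup>2" for s
 using dot_norm_neg[of "schr s a" a] by (simp add: power2_norm_eq_inner[of a, symmetric] field_simps)
 ultimately have "((%s. (norm (schr s a - a))\<^sup>2) \<longlongrightarrow> 0) (at 0)" by simp
 then have "((%s. sqrt ((norm (schr s a - a))\<^sup>2)) \<longlongrightarrow> sqrt 0) (at 0)" by (rule tendsto_real_sqrt)
 then show "((%g. schr g a) \<longlongrightarrow> a) (at 0)" by (simp add: tendsto_norm_zero_iff LIM_zero_iff)
 next
 show "linear (schr g)" for g by (rule bounded_linear.linear[OF schr_bounded_linear])
 qed (simp_all add: bounded_linear_ident)
qed (auto simp: schr_bounded_linear schr_add schr_0)

text \<open>Translation in time and space. The two factors commute, so the pairs form one additive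
  group.\<close>

definition galilei :: "real \<times> (real ^ 'n) => 'n::finite l2 => 'n l2" where
 "galilei g a = schr (fst g) (tr (snd g) a)"

lemma galilei_isometry_group: "isometry_group (galilei :: real \<times> (real ^ 'n) => 'n::finite l2 => 'n l2)"
proof (rule isometry_group.intro)
 fix x :: "'n l2"
 have f: "((%g :: real \<times> (real ^ 'n). fst g) \<longlongrightarrow> 0) (at 0)" "((%g :: real \<times> (real ^ 'n). snd g) \<longlongrightarrow> 0) (at 0)"
 using tendsto_fst[OF tendsto_ident_at[of "0 :: real \<times> (real ^ 'n)" UNIV]] tendsto_snd[OF tendsto_ident_at[of "0 :: real \<times> (real ^ 'n)" UNIV]] by simp_all
 show "((%g. galilei g x) \<longlongrightarrow> x) (at 0)"
 unfolding galilei_def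
 using isometry_group.T_tendsto[OF schr_isometry_group isometry_group.T_tendsto[OF tr_isometry_group tendsto_const[of x] f(2)] f(1)]
 by (simp add: schr_0 wop_id)
next
 show "bounded_linear (galilei g :: 'n l2 => 'n l2)" for g
 proof -
 have "galilei g = (%a :: 'n l2. schr (fst g) (tr (snd g) a))" by (simp add: galilei_def fun_eq_iff)
 then show ?thesis by (simp add: bounded_linear_compose[OF schr_bounded_linear wop_bounded_linear])
 qed
qed (auto simp: galilei_def schr_add schr_tr tr_add schr_0 wop_id)

text \<open>Two regimes: a large time makes the amplitude small, like the inverse modulus of the
  variance to the power \<open>n / 2\<close>; for bounded time the spatial shift must be large, and
  the exponential decays.\<close>

lemma galilei_gauss_decay:
 fixes e b :: "real ^ 'n"
 assumes Z: "Re Z > 0"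
 shows "((%g. gauss (Z + \<i> * of_real (fst g)) e (b - snd g)) \<longlongrightarrow> 0) at_infinity"
 unfolding Lim_at_infinity
proof (intro allI impI)
 fix eps :: real assume e: "eps > 0"
 define a where "a = Re Z"
 have a: "a > 0" using Z by (simp add: a_def)
 \<comment> \<open>All but one of the \<open>n\<close> square root factors of the amplitude are
   bounded below through the real part of the variance; the remaining factor provides the decay in
   time.\<close>
 define m where "m = sqrt a ^ (CARD('n) - 1)"
 have m: "m > 0" using a by (simp add: m_def)
 have nrm: "norm (gauss (Z + \<i> * of_real s) e x)
 <= exp (- (norm (x - e))\<^sup>2 * (a / (norm (Z + \<i> * of_real s))\<^sup>2) / 2) / (m * sqrt (norm (Z + \<i> * of_real s)))"
 and M: "norm (Z + \<i> * of_real s) >= a" "norm (Z + \<i> * of_real s) >= \<bar>s\<bar> - norm Z" "norm (Z + \<i> * of_real s) <= norm Z + \<bar>s\<bar>" for s x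
 proof -
 let ?W = "Z + \<i> * of_real s"
 have R: "Re ?W = a" by (simp add: a_def)
 show 1: "norm ?W >= a" using complex_Re_le_cmod[of ?W] R by simp
 show "norm ?W >= \<bar>s\<bar> - norm Z" using norm_triangle_ineq2[of "\<i> * of_real s" "- Z"] by (simp add: norm_mult add.commute)
 show "norm ?W <= norm Z + \<bar>s\<bar>" using norm_triangle_ineq[of Z "\<i> * of_real s"] by (simp add: norm_mult)
 have "Re (1 / ?W) = a / (norm ?W)\<^sup>2" using R by (simp add: Re_divide cmod_power2)
 then have "norm (gauss ?W e x) = exp (- (norm (x - e))\<^sup>2 * (a / (norm ?W)\<^sup>2) / 2) / sqrt (norm ?W) ^ CARD('n)"
 using norm_gauss[of ?W e x] a R by simp
 also have "... <= exp (- (norm (x - e))\<^sup>2 * (a / (norm ?W)\<^sup>2) / 2) / (m * sqrt (norm ?W))"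
 proof (rule divide_left_mono)
 have "sqrt (norm ?W) ^ CARD('n) = sqrt (norm ?W) ^ (CARD('n) - 1) * sqrt (norm ?W)"
 by (metis card_gt_0_iff finite_UNIV_card_ge_0 finite power_minus_mult zero_less_card_finite)
 moreover have "m <= sqrt (norm ?W) ^ (CARD('n) - 1)" unfolding m_def using 1 a by (intro power_mono) auto
 ultimately show "m * sqrt (norm ?W) <= sqrt (norm ?W) ^ CARD('n)" by (simp add: mult_right_mono)
 show "0 < sqrt (norm ?W) ^ CARD('n) * (m * sqrt (norm ?W))" using 1 a m by (intro mult_pos_pos zero_less_power) auto
 qed simp
 finally show "norm (gauss ?W e x) <= exp (- (norm (x - e))\<^sup>2 * (a / (norm ?W)\<^sup>2) / 2) / (m * sqrt (norm ?W))" .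
 qed
 \<comment> \<open>Beyond this time the amplitude is at most \<open>eps / 2\<close>.\<close>
 define S where "S = norm Z + (2 / (m * eps))\<^sup>2"
 define M0 where "M0 = norm Z + S"
 have S0: "S >= 0" by (simp add: S_def)
 have M0: "M0 > 0" using Z S0 by (simp add: M0_def add_pos_nonneg Re_pos_nonpos)
 have "((%r :: real. exp (- (a / (2 * M0\<^sup>2)) * r) / (m * sqrt a)) \<longlongrightarrow> 0) at_top"
 using a M0 m by real_asymp
 then have "eventually (%r. exp (- (a / (2 * M0\<^sup>2)) * r) / (m * sqrt a) < eps) at_top"
 using e by (rule order_tendstoD(2))
 then obtain R0 where R0: "!!r. r >= R0 ==> exp (- (a / (2 * M0\<^sup>2)) * r) / (m * sqrt a) < eps"
 by (auto simp: eventually_at_top_linorder)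
 define R where "R = max R0 1"
 show "\<exists>B. \<forall>g. B <= norm g --> dist (gauss (Z + \<i> * of_real (fst g)) e (b - snd g)) 0 < eps"
 proof (intro exI[of _ "S + norm (b - e) + R"] allI impI)
 fix g :: "real \<times> (real ^ 'n)" assume g: "S + norm (b - e) + R <= norm g"
 obtain s y where gs: "g = (s, y)" by (cases g)
 let ?W = "Z + \<i> * of_real s"
 have Wp: "norm ?W > 0" using M(1)[of s] a by linarith
 show "dist (gauss (Z + \<i> * of_real (fst g)) e (b - snd g)) 0 < eps"
 proof (cases "\<bar>s\<bar> >= S")
 case True
 have "norm ?W >= (2 / (m * eps))\<^sup>2" using M(2)[of s] True by (simp add: S_def)
 then have "sqrt (norm ?W) >= 2 / (m * eps)" by (rule real_le_rsqrt)
 then have "m * sqrt (norm ?W) >= 2 / eps" using m e by (simp add: field_simps)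
 then have "1 / (m * sqrt (norm ?W)) <= eps / 2" using e m Wp by (simp add: field_simps)
 moreover have "exp (- (norm (b - y - e))\<^sup>2 * (a / (norm ?W)\<^sup>2) / 2) <= 1" using a by simp
 then have "exp (- (norm (b - y - e))\<^sup>2 * (a / (norm ?W)\<^sup>2) / 2) / (m * sqrt (norm ?W)) <= 1 / (m * sqrt (norm ?W))"
 using m Wp by (intro divide_right_mono) auto
 ultimately show ?thesis using nrm[of s "b - y"] e by (simp add: gs dist_norm)
 next
 case False
 have "norm g <= \<bar>s\<bar> + norm y" unfolding gs using norm_Pair_le[of s y] by simp
 then have "norm y >= norm (b - e) + R" using g False by linarith
 then have "norm (b - y - e) >= R" using norm_triangle_ineq2[of y "b - e"] by (simp add: norm_minus_commute algebra_simps)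
 then have "(norm (b - y - e))\<^sup>2 >= R\<^sup>2" by (intro power_mono) (auto simp: R_def)
 moreover have "R >= 1" by (simp add: R_def)
 then have "R\<^sup>2 >= R" using mult_left_mono[of 1 R R] by (simp add: power2_eq_square)
 moreover have "R >= R0" by (simp add: R_def)
 ultimately have r: "(norm (b - y - e))\<^sup>2 >= R0" by linarith
 have W: "norm ?W <= M0" using M(3)[of s] False by (simp add: M0_def)
 have "exp (- (norm (b - y - e))\<^sup>2 * (a / (norm ?W)\<^sup>2) / 2) / (m * sqrt (norm ?W))
 <= exp (- (a / (2 * M0\<^sup>2)) * (norm (b - y - e))\<^sup>2) / (m * sqrt a)"
 proof (rule frac_le)
 have "a / M0\<^sup>2 <= a / (norm ?W)\<^sup>2" using a W Wp by (intro divide_left_mono power_mono mult_pos_pos) auto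
 then have "(norm (b - y - e))\<^sup>2 * (a / M0\<^sup>2) <= (norm (b - y - e))\<^sup>2 * (a / (norm ?W)\<^sup>2)" by (intro mult_left_mono) auto
 then show "exp (- (norm (b - y - e))\<^sup>2 * (a / (norm ?W)\<^sup>2) / 2) <= exp (- (a / (2 * M0\<^sup>2)) * (norm (b - y - e))\<^sup>2)"
 by (simp add: field_simps)
 show "m * sqrt a <= m * sqrt (norm ?W)" using m M(1)[of s] by simp
 qed (use m a in auto)
 then show ?thesis using nrm[of s "b - y"] R0[OF r] by (simp add: gs dist_norm)
 qed
 qed
qed

text \<open>Two density arguments, one in each entry of the matrix coefficient, reduce the claim to
  a pair of Gaussians.\<close>

lemma galilei_mixing: "((%g. inner (galilei g x) (y :: 'n::finite l2)) \<longlongrightarrow> 0) at_infinity"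
proof -
 interpret G: isometry_group "galilei :: real \<times> (real ^ 'n) => 'n l2 => 'n l2" by (rule galilei_isometry_group)
 have 1: "((%g. inner (galilei g x) y) \<longlongrightarrow> 0) at_infinity" if xy: "x \<in> gset" "y \<in> gset" for x y :: "'n l2"
 proof -
 obtain c z b where x: "x = gvec (c, z, b)" and z: "Re z > 0" using xy(1) by (auto simp: gset_def)
 obtain d w e where y: "y = gvec (d, w, e)" and w: "Re w > 0" using xy(2) by (auto simp: gset_def)
 have "((%g. Re (c * cnj d * of_real (gauss_const TYPE('n)) * gauss (z + cnj w + \<i> * of_real (fst g)) e (b - snd g)))
 \<longlongrightarrow> Re (c * cnj d * of_real (gauss_const TYPE('n)) * 0)) at_infinity"
 by (intro tendsto_intros galilei_gauss_decay) (use z w in simp)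
 then show ?thesis using z w by (simp add: x y galilei_def tr_gvec schr_gvec gvec_inner add_ac)
 qed
 have 2: "((%g. inner (galilei g x) y) \<longlongrightarrow> 0) at_infinity" if "y \<in> gset" for x y :: "'n l2"
 proof (rule total_set_tendsto[OF gset_total, where A = "%g x. inner (galilei g x) y" and C = "norm y" and L = "%_. 0"])
 show "linear (%x. inner (galilei g x) y)" for g
 by (intro bounded_linear.linear bounded_linear_compose[OF bounded_linear_inner_left] G.T_blin)
 show "norm (inner (galilei g x) y) <= norm y * norm x" for g x
 using Cauchy_Schwarz_ineq2[of "galilei g x" y] by (simp add: mult.commute)
 qed (use 1 that in \<open>auto simp: bounded_linear_zero\<close>)
 show ?thesis
 proof (rule total_set_tendsto[OF gset_total, where A = "%g y. inner (galilei g x) y" and C = "norm x" and L = "%_. 0"])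
 show "linear (%y. inner (galilei g x) y)" for g
 by (intro bounded_linear.linear bounded_linear_inner_right)
 show "norm (inner (galilei g x) y) <= norm x * norm y" for g y
 using Cauchy_Schwarz_ineq2[of "galilei g x" y] by simp
 qed (use 2 in \<open>auto simp: bounded_linear_zero\<close>)
qed

lemma galilei_mixing_group: "mixing_group (galilei :: real \<times> (real ^ 'n) => 'n::finite l2 => 'n l2)"
 by (intro mixing_group.intro galilei_isometry_group mixing_group_axioms.intro galilei_mixing)

subsection \<open>Semiclassical scaling\<close>

text \<open>The unitary dilation by \<open>eps\<close>. It removes the semiclassical parameter from
  the equation, with time divided by \<open>eps\<close> as well.\<close>

definition scl :: "real => 'n::finite l2 => 'n l2" where
 "scl eps = wop (%_. of_real (sqrt (1 / eps) ^ CARD('n))) (1 / eps) 0"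

lemma scl_weight: "eps > 0 ==> iso_weight (%_ :: real ^ 'n. of_real (sqrt (1 / eps) ^ CARD('n))) (1 / eps)"
 by (simp add: iso_weight_def norm_power flip: power_mult) (simp add: power_mult[symmetric] mult.commute[of _ 2] power_mult)

lemma norm_scl [simp]: "eps > 0 ==> norm (scl eps a) = norm a"
 unfolding scl_def by (rule norm_wop[OF scl_weight])

lemma scl_bounded_linear: "eps > 0 ==> bounded_linear (scl eps)"
 unfolding scl_def by (rule wop_bounded_linear[OF scl_weight])

lemma scl_scl_inverse: "eps > 0 ==> scl eps (scl (1 / eps) a) = a"
proof -
 assume e: "eps > 0"
 have "sqrt (1 / eps) * sqrt eps = 1" using e by (simp add: real_sqrt_divide)
 then have "sqrt (1 / eps) ^ CARD('a) * sqrt eps ^ CARD('a) = 1" by (simp flip: power_mult_distrib)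
 then have "of_real (sqrt (1 / eps) ^ CARD('a)) * of_real (sqrt eps ^ CARD('a)) = (1::complex)"
 by (simp only: of_real_mult[symmetric] of_real_1)
 then show ?thesis using e wop_wop[OF scl_weight[of eps] scl_weight[of "1 / eps"], of 0 0 a] by (simp add: scl_def wop_id)
qed

lemma scl_gvec:
 fixes b :: "real ^ 'n"
 assumes e: "eps > 0" and z: "Re z > 0"
 shows "scl eps (gvec (c, z, b)) = gvec (of_real (sqrt eps ^ CARD('n)) * c, of_real (eps\<^sup>2) * z, eps *\<^sub>R b)"
proof -
 have g1: "gauss1 z (x / eps - b) = of_real eps * gauss1 (of_real (eps\<^sup>2) * z) (x - eps * b)" for x b :: real
 proof -
 have q: "csqrt (of_real (eps\<^sup>2) * z) = of_real eps * csqrt z"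
 using csqrt_of_real_mult[of "eps\<^sup>2" z] e by simp
 have "x / eps - b = (x - eps * b) / eps" using e by (simp add: field_simps)
 then have "(x / eps - b)\<^sup>2 = (x - eps * b)\<^sup>2 / eps\<^sup>2" by (simp add: power_divide)
 then show ?thesis unfolding gauss1_def q using e Re_pos_nonpos[OF z] by (simp add: mult.assoc mult.left_commute)
 qed
 have gx: "gauss z b ((1 / eps) *\<^sub>R x + 0) = of_real (eps ^ CARD('n)) * gauss (of_real (eps\<^sup>2) * z) (eps *\<^sub>R b) x" for x
 using g1[of "x $ i" "b $ i" for i] by (simp add: gauss_def prod.distrib divide_inverse mult.commute)
 have "sqrt (1 / eps) ^ CARD('n) * eps ^ CARD('n) = sqrt eps ^ CARD('n)"
 using e by (simp flip: power_mult_distrib) (simp add: real_sqrt_divide real_div_sqrt)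
 then have AB: "of_real (sqrt (1 / eps) ^ CARD('n)) * of_real (eps ^ CARD('n)) = (of_real (sqrt eps ^ CARD('n)) :: complex)"
 by (simp only: of_real_mult[symmetric])
 have gen: "A * (c * (B * g)) = C * c * g" if "A * B = C" for A B C g :: complex using that by (auto simp: mult_ac)
 have "wcomp (%_. of_real (sqrt (1 / eps) ^ CARD('n))) (1 / eps) 0 (%x. c * gauss z b x)
 = (%x. of_real (sqrt eps ^ CARD('n)) * c * gauss (of_real (eps\<^sup>2) * z) (eps *\<^sub>R b) x)"
 unfolding wcomp_def gx by (rule ext, rule gen[OF AB])
 then show ?thesis unfolding scl_def gvec_eq[OF z]
 by (subst wop_to_l2[OF scl_weight[OF e] in_L2_cmult[OF gauss_in_L2[OF z]]]) (use z e in \<open>simp add: gvec_eq\<close>)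
qed

lemma schr_scl:
 assumes e: "eps > 0" shows "schr (eps * t) (scl eps a) = scl eps (schr (t / eps) a)"
proof (rule total_set_linear_eq[OF gset_total, of "%a. schr (eps * t) (scl eps a)" "%a. scl eps (schr (t / eps) a)"])
 show "bounded_linear (%a. schr (eps * t) (scl eps a))" "bounded_linear (%a. scl eps (schr (t / eps) a))"
 using e by (auto intro!: bounded_linear_compose[OF schr_bounded_linear scl_bounded_linear] bounded_linear_compose[OF scl_bounded_linear schr_bounded_linear])
 fix a :: "'a l2" assume "a \<in> gset"
 then obtain c z b where a: "a = gvec (c, z, b)" and z: "Re z > 0" by (auto simp: gset_def)
 have "of_real (eps\<^sup>2) * z + \<i> * of_real (eps * t) = of_real (eps\<^sup>2) * (z + \<i> * of_real (t / eps))"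
 using e by (simp add: field_simps power2_eq_square)
 then show "schr (eps * t) (scl eps a) = scl eps (schr (t / eps) a)"
 using e z by (simp add: a scl_gvec schr_gvec)
qed

lemma tr_scl: "eps > 0 ==> tr y (scl eps a) = scl eps (tr (y /\<^sub>R eps) a)"
 unfolding scl_def wop_wop[OF iso_weight_1 scl_weight] wop_wop[OF scl_weight iso_weight_1] by (simp add: divide_inverse)

instance l2 :: (finite) banach ..

subsection \<open>Large time asymptotics\<close>

text \<open>Passage to the rays \<open>x = s * y\<close> with the quadratic phase of the backward
  free flow removed. \<open>qinv\<close> undoes it and, up to dilation and translation, has the
  shape of a quadratic profile.\<close>

definition qop :: "real => 'n::finite l2 => 'n l2" where
 "qop s = wop (%y. of_real (sqrt s ^ CARD('n)) * exp (\<i> * of_real (s * (norm y)\<^sup>2 / 2))) s 0"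

definition qinv :: "real => 'n::finite l2 => 'n l2" where
 "qinv s = wop (%y. of_real (sqrt (1 / s) ^ CARD('n)) * exp (- \<i> * of_real ((norm y)\<^sup>2 / (2 * s)))) (1 / s) 0"

lemma sqrt_power_sq: "r > 0 ==> (sqrt r ^ n)\<^sup>2 = r ^ n"
 by (simp add: power_mult[symmetric] mult.commute[of _ 2]) (simp add: power_mult)

lemma qop_weight: "s > 0 ==> iso_weight (%y :: real ^ 'n. of_real (sqrt s ^ CARD('n)) * exp (\<i> * of_real (s * (norm y)\<^sup>2 / 2))) s"
 unfolding iso_weight_def norm_mult power_mult_distrib by (simp add: norm_exp_eq_Re norm_power sqrt_power_sq)

lemma qinv_weight: "s > 0 ==> iso_weight (%y :: real ^ 'n. of_real (sqrt (1 / s) ^ CARD('n)) * exp (- \<i> * of_real ((norm y)\<^sup>2 / (2 * s)))) (1 / s)"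
 unfolding iso_weight_def norm_mult power_mult_distrib using sqrt_power_sq[of "1 / s" "CARD('n)"]
 by (simp add: norm_exp_eq_Re norm_power)

lemma qinv_qop:
 fixes a :: "'n::finite l2"
 assumes s: "s > 0" shows "qinv s (qop s a) = a"
proof -
 have "sqrt (1 / s) ^ CARD('n) * sqrt s ^ CARD('n) = 1"
 using s by (simp flip: power_mult_distrib) (simp add: real_sqrt_divide)
 then have AB: "of_real (sqrt (1 / s) ^ CARD('n)) * of_real (sqrt s ^ CARD('n)) = (1::complex)"
 by (simp only: of_real_mult[symmetric] of_real_1)
 have "A * E * (B * E') = 1" if "A * B = 1" "E * E' = 1" for A B E E' :: complex
 proof -
 have "A * E * (B * E') = (A * B) * (E * E')" by (simp add: mult_ac)
 then show ?thesis using that by simp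
 qed
 note gen = this[OF AB]
 have "exp (- \<i> * of_real ((norm x)\<^sup>2 / (2 * s))) * exp (\<i> * of_real (s * (norm ((1 / s) *\<^sub>R x + 0))\<^sup>2 / 2)) = 1" for x :: "real ^ 'n"
 proof -
 have "s * (norm ((1 / s) *\<^sub>R x + 0))\<^sup>2 / 2 = (norm x)\<^sup>2 / (2 * s)"
 using s by (simp add: power_divide power2_eq_square)
 then show ?thesis by (simp flip: exp_add)
 qed
 then have "(%x. of_real (sqrt (1 / s) ^ CARD('n)) * exp (- \<i> * of_real ((norm x)\<^sup>2 / (2 * s))) *
 (of_real (sqrt s ^ CARD('n)) * exp (\<i> * of_real (s * (norm ((1 / s) *\<^sub>R x + 0))\<^sup>2 / 2)))) = (%x :: real ^ 'n. 1)"
 by (intro ext gen)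
 then show ?thesis
 unfolding qinv_def qop_def wop_wop[OF qinv_weight[OF s] qop_weight[OF s]] using s by (simp add: wop_id)
qed

text \<open>One coordinate of \<open>qop s\<close> applied to a Gaussian evolved backwards,
  rewritten in \<open>r = 1 / s\<close>. In this form it is continuous up to \<open>r = 0\<close>,
  where it is the Fourier transform of the Gaussian up to constants and sign convention.\<close>

definition prof1 :: "real => real => real => real => complex" where
 "prof1 t b r y = exp (((\<i> * of_real (t * y\<^sup>2) + of_real (2 * b * y)) - of_real (b\<^sup>2 * r)) / (2 * (of_real (t * r) - \<i>)))
 / csqrt (of_real (t * r) - \<i>)"

lemma prof1_eq:
 assumes s: "s > 0" and t: "t > 0"
 shows "of_real (sqrt s) * exp (\<i> * of_real (s * y\<^sup>2 / 2)) * gauss1 (of_real t - \<i> * of_real s) (s * y - b) = prof1 t b (1 / s) y"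
proof -
 let ?w = "of_real (t * (1 / s)) - \<i>"
 have w: "of_real t - \<i> * of_real s = of_real s * ?w" using s by (simp add: field_simps)
 have w0: "?w ~= 0" using s t by (simp add: complex_eq_iff)
 have q: "csqrt (of_real t - \<i> * of_real s) = of_real (sqrt s) * csqrt ?w" unfolding w by (rule csqrt_of_real_mult[OF s])
 have e: "\<i> * of_real (s * y\<^sup>2 / 2) + (- of_real ((s * y - b)\<^sup>2) / (2 * (of_real t - \<i> * of_real s)))
 = ((\<i> * of_real (t * y\<^sup>2) + of_real (2 * b * y)) - of_real (b\<^sup>2 * (1 / s))) / (2 * ?w)"
 proof -
 have "\<i> * (S * Y\<^sup>2 / 2) + (- ((S * Y - B)\<^sup>2) / (2 * (S * W))) = ((\<i> * (TT * Y\<^sup>2) + 2 * B * Y) - B\<^sup>2 * (1 / S)) / (2 * W)"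
 if "S ~= 0" "W ~= 0" "S * W = TT - \<i> * S" for S Y B W TT :: complex
 proof -
 have "2 * (S * W) * (\<i> * (S * Y\<^sup>2 / 2) + (- ((S * Y - B)\<^sup>2) / (2 * (S * W)))) = \<i> * S * Y\<^sup>2 * (S * W) - (S * Y - B)\<^sup>2"
 using that(1,2) by (simp add: field_simps)
 also have "... = S * ((\<i> * (TT * Y\<^sup>2) + 2 * B * Y)) - B\<^sup>2"
 unfolding that(3) by (simp add: algebra_simps power2_eq_square)
 also have "... = 2 * (S * W) * (((\<i> * (TT * Y\<^sup>2) + 2 * B * Y) - B\<^sup>2 * (1 / S)) / (2 * W))"
 using that(1,2) by (simp add: field_simps)
 finally show ?thesis using that(1,2) by (subst (asm) mult_cancel_left) simp
 qed
 from this[of "of_real s" ?w "of_real t" "of_real y" "of_real b"] show ?thesis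
 using s w0 w by (simp only: w of_real_mult of_real_power of_real_diff of_real_divide of_real_numeral of_real_1 of_real_eq_0_iff) simp
 qed
 have "of_real (sqrt s) * exp (\<i> * of_real (s * y\<^sup>2 / 2)) * gauss1 (of_real t - \<i> * of_real s) (s * y - b)
 = exp (\<i> * of_real (s * y\<^sup>2 / 2) + (- of_real ((s * y - b)\<^sup>2) / (2 * (of_real t - \<i> * of_real s)))) / csqrt ?w"
 unfolding gauss1_def q exp_add using s by simp
 then show ?thesis unfolding e prof1_def by simp
qed

text \<open>A Gaussian bound independent of \<open>s >= 1\<close>, for dominated convergence. It
  rests on \<open>(s * y - b)^2 >= s^2 * y^2 / 2 - b^2\<close>: the factor \<open>s^2\<close>
  compensates the slow decay rate \<open>t / (t^2 + s^2)\<close>.\<close>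

lemma prof1_bound:
 assumes s: "s >= 1" and t: "t > 0"
 shows "norm (prof1 t b (1 / s) y) <= exp (t * b\<^sup>2 / 2) * exp (- y\<^sup>2 * (t / (4 * (t\<^sup>2 + 1))))"
proof -
 let ?z = "of_real t - \<i> * of_real s"
 have z: "Re ?z > 0" using t by simp
 have nz: "norm ?z >= s" using abs_Im_le_cmod[of ?z] s by simp
 have R: "Re (1 / ?z) = t / (t\<^sup>2 + s\<^sup>2)" by (simp add: Re_divide)
 have "norm (prof1 t b (1 / s) y) = sqrt s * (exp (- (s * y - b)\<^sup>2 * (t / (t\<^sup>2 + s\<^sup>2)) / 2) / sqrt (norm ?z))"
 using s t by (subst prof1_eq[symmetric]) (simp_all add: norm_mult norm_gauss1[OF z] R norm_exp_eq_Re)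
 also have "... = (sqrt s / sqrt (norm ?z)) * exp (- (s * y - b)\<^sup>2 * (t / (t\<^sup>2 + s\<^sup>2)) / 2)" by simp
 also have "... <= 1 * exp (t * b\<^sup>2 / 2 - y\<^sup>2 * (t / (4 * (t\<^sup>2 + 1))))"
 proof (rule mult_mono)
 show "sqrt s / sqrt (norm ?z) <= 1" using nz s by (simp add: divide_le_eq)
 have ts: "t\<^sup>2 + s\<^sup>2 <= s\<^sup>2 * (t\<^sup>2 + 1)" using s mult_right_mono[of 1 "s\<^sup>2" "t\<^sup>2"] by (simp add: algebra_simps one_le_power)
 have "2 * (s * y - b)\<^sup>2 + 2 * b\<^sup>2 - (s * y)\<^sup>2 = (s * y - 2 * b)\<^sup>2" by (simp add: power2_eq_square algebra_simps)
 then have sq: "(s * y - b)\<^sup>2 >= s\<^sup>2 * y\<^sup>2 / 2 - b\<^sup>2" using zero_le_power2[of "s * y - 2 * b"] unfolding power_mult_distrib by linarith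
 define kap where "kap = t / (t\<^sup>2 + s\<^sup>2)"
 have d0: "t\<^sup>2 + s\<^sup>2 > 0" using t by (simp add: add_pos_nonneg)
 have k: "kap >= 0" "kap <= t" "s\<^sup>2 * kap >= t / (t\<^sup>2 + 1)"
 proof -
 show "kap >= 0" using t d0 by (simp add: kap_def)
 have "1 <= t\<^sup>2 + s\<^sup>2" using s one_le_power[of s 2] zero_le_power2[of t] by linarith
 then show "kap <= t" unfolding kap_def using t d0 by (simp add: divide_le_eq)
 have "t / (t\<^sup>2 + 1) = s\<^sup>2 * t / (s\<^sup>2 * (t\<^sup>2 + 1))" using s by simp
 also have "... <= s\<^sup>2 * t / (t\<^sup>2 + s\<^sup>2)" using ts t d0 s by (intro divide_left_mono mult_pos_pos) (auto simp: add_pos_nonneg)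
 finally show "s\<^sup>2 * kap >= t / (t\<^sup>2 + 1)" by (simp add: kap_def)
 qed
 define X where "X = (s * y - b)\<^sup>2 * kap"
 define Y where "Y = y\<^sup>2 * (s\<^sup>2 * kap)"
 have "(s\<^sup>2 * y\<^sup>2 / 2 - b\<^sup>2) * kap <= X" unfolding X_def using sq k(1) by (rule mult_right_mono)
 moreover have "(s\<^sup>2 * y\<^sup>2 / 2 - b\<^sup>2) * kap = Y / 2 - b\<^sup>2 * kap" by (simp add: Y_def algebra_simps)
 ultimately have h1: "Y / 2 - b\<^sup>2 * kap <= X" by simp
 have h2: "b\<^sup>2 * kap <= b\<^sup>2 * t" using k(2) by (simp add: mult_left_mono)
 have h3: "y\<^sup>2 * (t / (t\<^sup>2 + 1)) <= Y" unfolding Y_def by (rule mult_left_mono[OF k(3)]) simp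
 have h4: "y\<^sup>2 * (t / (4 * (t\<^sup>2 + 1))) = y\<^sup>2 * (t / (t\<^sup>2 + 1)) / 4" by simp
 have "- X / 2 <= B2 / 2 - Z / 4" if "Y / 2 - B1 <= X" "B1 <= B2" "Z <= Y" for B1 B2 Z :: real
 using that by linarith
 from this[OF h1 h2 h3] have "- X / 2 <= b\<^sup>2 * t / 2 - y\<^sup>2 * (t / (4 * (t\<^sup>2 + 1)))" unfolding h4 .
 note fin = this
 have e1: "- (s * y - b)\<^sup>2 * kap = - X" by (simp add: X_def)
 have e2: "t * b\<^sup>2 = b\<^sup>2 * t" by (rule mult.commute)
 have "- (s * y - b)\<^sup>2 * kap / 2 <= t * b\<^sup>2 / 2 - y\<^sup>2 * (t / (4 * (t\<^sup>2 + 1)))" unfolding e1 e2 by (rule fin)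
 then show "exp (- (s * y - b)\<^sup>2 * (t / (t\<^sup>2 + s\<^sup>2)) / 2) <= exp (t * b\<^sup>2 / 2 - y\<^sup>2 * (t / (4 * (t\<^sup>2 + 1))))"
 unfolding kap_def by (rule exp_le_cancel_iff[THEN iffD2])
 qed auto
 also have "1 * exp (t * b\<^sup>2 / 2 - y\<^sup>2 * (t / (4 * (t\<^sup>2 + 1)))) = exp (t * b\<^sup>2 / 2) * exp (- y\<^sup>2 * (t / (4 * (t\<^sup>2 + 1))))"
 by (simp only: mult_1_left exp_add[symmetric] mult_minus_left diff_conv_add_uminus)
 finally show ?thesis .
qed

lemma prof1_tendsto: "((%s. prof1 t b (1 / s) y) \<longlongrightarrow> prof1 t b 0 y) at_top"
proof -
 have "isCont (%r. prof1 t b r y) 0"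
 unfolding prof1_def by (intro continuous_intros) (auto simp: complex_nonpos_Reals_iff)
 moreover have "((%s::real. 1 / s) \<longlongrightarrow> 0) at_top" by real_asymp
 ultimately show ?thesis by (rule isCont_tendsto_compose)
qed

lemma prof1_measurable [measurable]: "prof1 t b r \<in> borel_measurable borel"
 unfolding prof1_def by measurable

definition prof :: "complex => real => real ^ 'n => real => real ^ 'n => complex" where
 "prof c t b r y = c * (\<Prod>i\<in>UNIV. prof1 t (b $ i) r (y $ i))"

lemma prof_measurable [measurable]: "prof c t b r \<in> borel_measurable borel"
 unfolding prof_def by measurable

lemma prof_bound:
 fixes b :: "real ^ 'n"
 assumes t: "t > 0"
 obtains w where "integrable lborel w" "!!y. w y >= 0" "!!s y. s >= 1 ==> (norm (prof c t b (1 / s) y))\<^sup>2 <= w y"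
 "!!y. (norm (prof c t b 0 y))\<^sup>2 <= w y"
proof -
 define B where "B i y = (exp (t * (b $ i)\<^sup>2 / 2) * exp (- y\<^sup>2 * (t / (4 * (t\<^sup>2 + 1)))))\<^sup>2" for i and y :: real
 have "B i = (%y. (exp (t * (b $ i)\<^sup>2 / 2))\<^sup>2 * exp (- y\<^sup>2 * (2 * (t / (4 * (t\<^sup>2 + 1))))))" for i
 unfolding B_def power_mult_distrib exp_double[symmetric] by (simp add: algebra_simps)
 moreover have "2 * (t / (4 * (t\<^sup>2 + 1))) > 0" using t by (simp add: add_nonneg_pos)
 ultimately have Bi: "integrable lborel (B i)" for i
 by (simp only: integrable_mult_right[OF exp_quadratic_integrable])
 define w where "w y = (norm c)\<^sup>2 * (\<Prod>i\<in>UNIV. B i (y $ i))" for y :: "real ^ 'n"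
 have w1: "(norm (prof c t b (1 / s) y))\<^sup>2 <= w y" if "s >= 1" for s y
 proof -
 have "(norm (prof c t b (1 / s) y))\<^sup>2 = (norm c)\<^sup>2 * (\<Prod>i\<in>UNIV. (norm (prof1 t (b $ i) (1 / s) (y $ i)))\<^sup>2)"
 unfolding prof_def norm_mult power_mult_distrib prod_norm[symmetric] prod_power_distrib ..
 also have "... <= w y" unfolding w_def B_def
 by (intro mult_left_mono prod_mono conjI power_mono prof1_bound[OF that t]) auto
 finally show ?thesis .
 qed
 show ?thesis
 proof (rule that[of w])
 show "integrable lborel w" unfolding w_def by (intro integrable_mult_right integral_prod_coords(1)[where f = B] Bi)
 show "w y >= 0" for y unfolding w_def B_def by (intro mult_nonneg_nonneg prod_nonneg) auto
 show "!!s y. s >= 1 ==> (norm (prof c t b (1 / s) y))\<^sup>2 <= w y" by (rule w1)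
 show "(norm (prof c t b 0 y))\<^sup>2 <= w y" for y
 proof (rule tendsto_upperbound)
 show "((%s. (norm (prof c t b (1 / s) y))\<^sup>2) \<longlongrightarrow> (norm (prof c t b 0 y))\<^sup>2) at_top"
 unfolding prof_def by (intro tendsto_intros prof1_tendsto)
 show "\<forall>\<^sub>F s in at_top. (norm (prof c t b (1 / s) y))\<^sup>2 <= w y"
 using eventually_ge_at_top[of "1::real"] by eventually_elim (rule w1)
 qed simp
 qed
qed

lemma prof_in_L2: assumes "t > 0" shows "s >= 1 ==> in_L2 (prof c t b (1 / s))" "in_L2 (prof c t b 0)"
proof -
 obtain w where w: "integrable lborel w" "!!s y. s >= 1 ==> (norm (prof c t b (1 / s) y))\<^sup>2 <= w y"
 "!!y. (norm (prof c t b 0 y))\<^sup>2 <= w y" using prof_bound[OF assms] by metis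
 show "s >= 1 ==> in_L2 (prof c t b (1 / s))" by (rule in_L2_bound[OF _ w(1)]) (auto intro: w)
 show "in_L2 (prof c t b 0)" by (rule in_L2_bound[OF _ w(1)]) (auto intro: w)
qed

lemma qop_schr_gvec:
 fixes b :: "real ^ 'n"
 assumes s: "s >= 1" and t: "t > 0"
 shows "qop s (schr (- s) (gvec (c, of_real t, b))) = to_l2 (prof c t b (1 / s))"
proof -
 let ?z = "of_real t - \<i> * of_real s"
 have z: "Re ?z > 0" using t by simp
 have s0: "s > 0" using s by simp
 have "schr (- s) (gvec (c, of_real t, b)) = to_l2 (%x. c * gauss ?z b x)"
 using t gvec_eq[OF z, of c b] by (simp add: schr_gvec)
 then have "qop s (schr (- s) (gvec (c, of_real t, b)))
 = to_l2 (wcomp (%y. of_real (sqrt s ^ CARD('n)) * exp (\<i> * of_real (s * (norm y)\<^sup>2 / 2))) s 0 (%x. c * gauss ?z b x))"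
 unfolding qop_def by (simp only: wop_to_l2[OF qop_weight[OF s0] in_L2_cmult[OF gauss_in_L2[OF z]]])
 also have "wcomp (%y. of_real (sqrt s ^ CARD('n)) * exp (\<i> * of_real (s * (norm y)\<^sup>2 / 2))) s 0 (%x. c * gauss ?z b x) = prof c t b (1 / s)"
 proof
 fix y :: "real ^ 'n"
 have n: "\<i> * of_real (s * (norm y)\<^sup>2 / 2) = (\<Sum>i\<in>UNIV. \<i> * of_real (s * (y $ i)\<^sup>2 / 2))"
 unfolding power2_norm_eq_inner inner_vec_def
 by (simp add: sum_distrib_left sum_divide_distrib power2_eq_square)
 have "prof c t b (1 / s) y = c * (\<Prod>i\<in>UNIV. of_real (sqrt s) * exp (\<i> * of_real (s * (y $ i)\<^sup>2 / 2)) * gauss1 ?z (s * (y $ i) - b $ i))"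
 unfolding prof_def by (simp only: prof1_eq[OF s0 t])
 also have "... = of_real (sqrt s ^ CARD('n)) * exp (\<i> * of_real (s * (norm y)\<^sup>2 / 2)) * (c * gauss ?z b (s *\<^sub>R y + 0))"
 unfolding n exp_sum[OF finite] gauss_def by (simp add: prod.distrib mult_ac)
 finally show "wcomp (%y. of_real (sqrt s ^ CARD('n)) * exp (\<i> * of_real (s * (norm y)\<^sup>2 / 2))) s 0 (%x. c * gauss ?z b x) y = prof c t b (1 / s) y"
 by (simp only: wcomp_def)
 qed
 finally show ?thesis .
qed

text \<open>The \<open>max\<close> keeps the parameter in the range to which the dominating function
  applies.\<close>

lemma prof_l2_tendsto:
 fixes b :: "real ^ 'n"
 assumes t: "t > 0"
 shows "((%s. to_l2 (prof c t b (1 / max s 1))) \<longlongrightarrow> to_l2 (prof c t b 0)) at_top"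
proof -
 obtain w where w: "integrable lborel w" "!!y. w y >= 0" "!!s y. s >= 1 ==> (norm (prof c t b (1 / s) y))\<^sup>2 <= w y"
 "!!y. (norm (prof c t b 0 y))\<^sup>2 <= w y" using prof_bound[OF t] by metis
 have "((%s. \<integral>y. (norm (prof c t b (1 / max s 1) y - prof c t b 0 y))\<^sup>2 \<partial>lborel) \<longlongrightarrow> integral\<^sup>L lborel (%y :: real ^ 'n. 0)) at_top"
 proof (rule integral_dominated_convergence_at_top[where w = "%y. 4 * w y"])
 show "AE y in lborel. ((%s. (norm (prof c t b (1 / max s 1) y - prof c t b 0 y))\<^sup>2) \<longlongrightarrow> 0) at_top"
 proof (rule AE_I2)
 fix y
 have "((%s. (norm (prof c t b (1 / s) y - prof c t b 0 y))\<^sup>2) \<longlongrightarrow> (norm (prof c t b 0 y - prof c t b 0 y))\<^sup>2) at_top"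
 unfolding prof_def by (intro tendsto_intros prof1_tendsto)
 then have "((%s. (norm (prof c t b (1 / s) y - prof c t b 0 y))\<^sup>2) \<longlongrightarrow> 0) at_top" by simp
 then show "((%s. (norm (prof c t b (1 / max s 1) y - prof c t b 0 y))\<^sup>2) \<longlongrightarrow> 0) at_top"
 by (rule Lim_transform_eventually) (use eventually_ge_at_top[of "1::real"] in \<open>eventually_elim, simp add: max_def\<close>)
 qed
 show "\<forall>\<^sub>F s in at_top. AE y in lborel. norm ((norm (prof c t b (1 / max s 1) y - prof c t b 0 y))\<^sup>2) <= 4 * w y"
 proof (intro always_eventually allI AE_I2)
 fix s y
 let ?p = "prof c t b (1 / max s 1) y" and ?q = "prof c t b 0 y"
 have "(norm (?p - ?q))\<^sup>2 <= (norm ?p + norm ?q)\<^sup>2" by (intro power_mono norm_triangle_ineq4) simp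
 also have "... <= 2 * (norm ?p)\<^sup>2 + 2 * (norm ?q)\<^sup>2"
 using sum_squares_bound[of "norm ?p" "norm ?q"] by (simp add: power2_sum)
 also have "... <= 4 * w y" using w(3)[of "max s 1" y] w(4)[of y] by simp
 finally show "norm ((norm (?p - ?q))\<^sup>2) <= 4 * w y" by simp
 qed
 qed (use w(1) in auto)
 moreover have "(norm (to_l2 (prof c t b (1 / max s 1)) - to_l2 (prof c t b 0)))\<^sup>2
 = (\<integral>y. (norm (prof c t b (1 / max s 1) y - prof c t b 0 y))\<^sup>2 \<partial>lborel)" for s
 using prof_in_L2(1)[OF t, of "max s 1" c b] prof_in_L2(2)[OF t, of c b]
 by (simp add: norm_to_l2[OF in_L2_diff] flip: to_l2_diff)
 ultimately have "((%s. (norm (to_l2 (prof c t b (1 / max s 1)) - to_l2 (prof c t b 0)))\<^sup>2) \<longlongrightarrow> 0) at_top" by simp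
 then have "((%s. sqrt ((norm (to_l2 (prof c t b (1 / max s 1)) - to_l2 (prof c t b 0)))\<^sup>2)) \<longlongrightarrow> sqrt 0) at_top"
 by (rule tendsto_real_sqrt)
 then show ?thesis by (simp add: tendsto_norm_zero_iff LIM_zero_iff)
qed

lemma phase_weight: "iso_weight (%y :: real ^ 'n. exp (- \<i> * of_real (inner h y))) 1"
 by (simp add: iso_weight_def norm_exp_eq_Re)

text \<open>The large time limit of the backward evolution seen through \<open>qop\<close>, obtained
  by density from explicit Gaussians. It is the Fourier transform up to constants; what is retained
  is that it is isometric and turns translations into phases.\<close>

lemma scattering_profile:
 obtains F :: "'n::finite l2 => 'n l2" where "bounded_linear F" "!!a. norm (F a) = norm a"
 "!!a. ((%s. qop s (schr (- s) a)) \<longlongrightarrow> F a) at_top"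
 "!!h a. F (tr h a) = wop (%y. exp (- \<i> * of_real (inner h y))) 1 0 (F a)"
proof -
 define A :: "real => 'n l2 => 'n l2" where "A s a = qop (max s 1) (schr (- max s 1) a)" for s a
 have Abl: "bounded_linear (A s)" for s
 proof -
 have "bounded_linear (%a. qop (max s 1) (schr (- max s 1) a) :: 'n l2)"
 unfolding qop_def by (rule bounded_linear_compose[OF wop_bounded_linear[OF qop_weight] schr_bounded_linear]) simp
 then show ?thesis by (simp add: A_def[abs_def])
 qed
 have An: "norm (A s a) = norm a" for s a
 unfolding A_def qop_def by (subst norm_wop[OF qop_weight]) simp_all
 let ?S = "gvec ` {(c, z, b). z \<in> complex_of_real ` {0<..}} :: 'n l2 set"
 have Ag: "((%s. A s (gvec (c, of_real t, b))) \<longlongrightarrow> to_l2 (prof c t b 0)) at_top" if "t > 0" for c t b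
 using prof_l2_tendsto[OF that, of c b] that by (simp add: A_def qop_schr_gvec)
 have "\<exists>l. ((%s. A s a) \<longlongrightarrow> l) at_top" for a
 by (rule total_set_convergent[OF gvec_total, where C = 1 and A = A])
 (use Ag in \<open>auto simp: An intro: bounded_linear.linear[OF Abl]\<close>)
 then obtain F where F: "!!a. ((%s. A s a) \<longlongrightarrow> F a) at_top" by metis
 have Fn: "norm (F a) = norm a" for a
 using tendsto_norm[OF F[of a]] unfolding An by (simp add: tendsto_const_iff)
 have Fbl: "bounded_linear F"
 proof (rule bounded_linear_intro)
 show "F (a + b) = F a + F b" for a b
 using tendsto_unique[OF _ F[of "a + b"] tendsto_add[OF F[of a] F[of b], folded linear_add[OF bounded_linear.linear[OF Abl]]]] by simp
 show "F (r *\<^sub>R a) = r *\<^sub>R F a" for r a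
 using tendsto_unique[OF _ F[of "r *\<^sub>R a"] tendsto_scaleR[OF tendsto_const F[of a], of r, folded linear_scale[OF bounded_linear.linear[OF Abl]]]] by simp
 show "norm (F a) <= norm a * 1" for a by (simp add: Fn)
 qed
 have Fg: "F (gvec (c, of_real t, b)) = to_l2 (prof c t b 0)" if "t > 0" for c t b
 by (rule tendsto_unique[OF _ F Ag[OF that]]) simp
 show ?thesis
 proof (rule that[OF Fbl Fn])
 show "((%s. qop s (schr (- s) a)) \<longlongrightarrow> F a) at_top" for a
 by (rule Lim_transform_eventually[OF F]) (use eventually_ge_at_top[of "1::real"] in \<open>eventually_elim, simp add: A_def max_def\<close>)
 fix h :: "real ^ 'n" and a
 let ?e = "%y. exp (- \<i> * of_real (inner h y)) :: complex"
 show "F (tr h a) = wop ?e 1 0 (F a)"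
 proof (rule total_set_linear_eq[OF gvec_total, of "%a. F (tr h a)" "%a. wop ?e 1 0 (F a)"])
 show "bounded_linear (%a. F (tr h a))" by (rule bounded_linear_compose[OF Fbl wop_bounded_linear[OF iso_weight_1]])
 show "bounded_linear (%a. wop ?e 1 0 (F a))" by (rule bounded_linear_compose[OF wop_bounded_linear[OF phase_weight] Fbl])
 fix a assume "a \<in> ?S"
 then obtain c t b where a: "a = gvec (c, of_real t, b)" and t: "t > 0" by auto
 have "prof c t (b - h) 0 y = ?e y * prof c t b 0 y" for y
 proof -
 have "prof1 t (b' - h') 0 y' = exp (- \<i> * of_real (h' * y')) * prof1 t b' 0 y'" for b' h' y' :: real
 proof -
 have eq: "\<i> * of_real (t * y'\<^sup>2) + of_real (2 * (b' - h') * y') - of_real ((b' - h')\<^sup>2 * 0)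
 = (\<i> * of_real (t * y'\<^sup>2) + of_real (2 * b' * y') - of_real (b'\<^sup>2 * 0)) + (- \<i> * of_real (h' * y')) * (2 * (of_real (t * 0) - \<i>))"
 by (simp add: algebra_simps)
 have gen: "exp ((P + Q * D) / D) = exp Q * exp (P / D)" if "D ~= 0" for P Q D :: complex
 using that by (simp add: add_divide_distrib exp_add mult.commute)
 show ?thesis unfolding prof1_def eq by (subst gen) (simp_all only: times_divide_eq_right, simp)
 qed
 then have "prof c t (b - h) 0 y = c * ((\<Prod>i\<in>UNIV. exp (- \<i> * of_real (h $ i * y $ i))) * (\<Prod>i\<in>UNIV. prof1 t (b $ i) 0 (y $ i)))"
 unfolding prof_def prod.distrib[symmetric] by simp
 also have "(\<Prod>i\<in>UNIV. exp (- \<i> * of_real (h $ i * y $ i))) = ?e y"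
 unfolding exp_sum[OF finite, symmetric] inner_vec_def by (simp add: sum_negf sum_distrib_left)
 finally show ?thesis by (simp add: prof_def mult_ac)
 qed
 then have "wcomp ?e 1 0 (prof c t b 0) = prof c t (b - h) 0" by (simp add: wcomp_def fun_eq_iff)
 then show "F (tr h a) = wop ?e 1 0 (F a)"
 by (simp only: a tr_gvec Fg[OF t] wop_to_l2[OF phase_weight prof_in_L2(2)[OF t]])
 qed
 qed
qed

text \<open>Phase differences divided by \<open>eps\<close> tend to multiplication by a coordinate,
  so by Fatou's lemma a Lipschitz bound for modulations becomes a weight. Through the map of
  \<open>scattering_profile\<close> the hypothesis is a Lipschitz bound for translations.\<close>

lemma weighted_norm_le:
 fixes b :: "'n::finite l2"
 assumes N: "N >= 0" and bd: "!!i eps. eps > 0 ==>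
 norm (wop (%y. exp (- \<i> * of_real (inner (eps *\<^sub>R axis i 1) y))) 1 0 b - b) <= N * eps"
 shows "in_L2 (%y. norm y *\<^sub>R l2_fun b y)"
 "Lp_norm 2 (%y. norm y *\<^sub>R l2_fun b y) <= ennreal (sqrt (real CARD('n)) * N)"
proof -
 let ?f = "l2_fun b"
 have coord: "(\<integral>\<^sup>+y. ennreal ((y $ i)\<^sup>2 * (norm (?f y))\<^sup>2) \<partial>lborel) <= ennreal (N\<^sup>2)" for i
 proof -
 define eps where "eps k = 1 / real (Suc k)" for k
 have e: "eps k > 0" for k by (simp add: eps_def)
 have e0: "eps \<longlonglongrightarrow> 0" unfolding eps_def using LIMSEQ_inverse_real_of_nat by (simp add: inverse_eq_divide)
 define q where "q k y = (norm ((exp (- \<i> * of_real (y $ i) * of_real (eps k)) - 1) / of_real (eps k)))\<^sup>2 * (norm (?f y))\<^sup>2" for k y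
 have qN: "(\<integral>\<^sup>+y. ennreal (q k y) \<partial>lborel) <= ennreal (N\<^sup>2)" for k
 proof -
 let ?e = "%y. exp (- \<i> * of_real (inner (eps k *\<^sub>R axis i 1) y)) :: complex"
 have ee: "?e y = exp (- \<i> * of_real (y $ i) * of_real (eps k))" for y
 by (simp add: inner_axis' mult_ac)
 have L: "in_L2 (%y. wcomp ?e 1 0 ?f y - ?f y)" by (intro in_L2_diff wcomp_in_L2(1)[OF phase_weight]) simp_all
 have "wop ?e 1 0 b - b = to_l2 (%y. wcomp ?e 1 0 ?f y - ?f y)"
 by (subst to_l2_diff[OF wcomp_in_L2(1)[OF phase_weight in_L2_l2_fun] in_L2_l2_fun])
 (simp only: to_l2_l2_fun wop_def)
 then have "(norm (wop ?e 1 0 b - b))\<^sup>2 = (\<integral>y. (norm (wcomp ?e 1 0 ?f y - ?f y))\<^sup>2 \<partial>lborel)"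
 by (simp only: norm_to_l2[OF L])
 moreover have "(norm (wcomp ?e 1 0 ?f y - ?f y))\<^sup>2 = (eps k)\<^sup>2 * q k y" for y
 proof -
 have "wcomp ?e 1 0 ?f y - ?f y = (?e y - 1) * ?f y" by (simp add: wcomp_def algebra_simps)
 then show ?thesis unfolding q_def ee[symmetric] using e[of k] by (simp add: norm_mult norm_divide power_mult_distrib power_divide)
 qed
 moreover have "(norm (wop ?e 1 0 b - b))\<^sup>2 <= (N * eps k)\<^sup>2" by (rule power_mono[OF bd[OF e]]) simp
 ultimately have le: "(\<integral>y. (eps k)\<^sup>2 * q k y \<partial>lborel) <= (N * eps k)\<^sup>2" and i: "integrable lborel (%y. (eps k)\<^sup>2 * q k y)"
 using in_L2_integrable[OF L] by simp_all
 have i': "integrable lborel (q k)" using i e[of k] by simp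
 have "(eps k)\<^sup>2 * integral\<^sup>L lborel (q k) <= (eps k)\<^sup>2 * N\<^sup>2" using le by (simp add: power_mult_distrib mult.commute)
 then have "integral\<^sup>L lborel (q k) <= N\<^sup>2" using e[of k] by (simp add: mult_le_cancel_left_pos)
 then show ?thesis using i' by (subst nn_integral_eq_integral) (auto simp: q_def ennreal_leI)
 qed
 have lim: "(%k. q k y) \<longlonglongrightarrow> (y $ i)\<^sup>2 * (norm (?f y))\<^sup>2" for y
 proof -
 have "((%w. exp (- \<i> * of_real (y $ i) * w)) has_field_derivative (- \<i> * of_real (y $ i))) (at 0)"
 by (auto intro!: derivative_eq_intros)
 then have "((%h. (exp (- \<i> * of_real (y $ i) * h) - 1) / h) \<longlongrightarrow> - \<i> * of_real (y $ i)) (at 0)"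
 by (simp add: DERIV_def)
 moreover have "filterlim (%k. complex_of_real (eps k)) (at 0) sequentially"
 using tendsto_of_real[OF e0, where 'a = complex] e by (auto simp: filterlim_at less_imp_neq[symmetric])
 ultimately have "(%k. (exp (- \<i> * of_real (y $ i) * of_real (eps k)) - 1) / of_real (eps k)) \<longlonglongrightarrow> - \<i> * of_real (y $ i)"
 by (rule filterlim_compose)
 then have "(%k. q k y) \<longlonglongrightarrow> (norm (- \<i> * complex_of_real (y $ i)))\<^sup>2 * (norm (?f y))\<^sup>2"
 unfolding q_def by (intro tendsto_intros)
 then show ?thesis by (simp add: norm_mult)
 qed
 have "(\<integral>\<^sup>+y. ennreal ((y $ i)\<^sup>2 * (norm (?f y))\<^sup>2) \<partial>lborel) = (\<integral>\<^sup>+y. liminf (%k. ennreal (q k y)) \<partial>lborel)"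
 by (intro nn_integral_cong lim_imp_Liminf[symmetric] tendsto_ennrealI lim) simp
 also have "... <= liminf (%k. \<integral>\<^sup>+y. ennreal (q k y) \<partial>lborel)"
 unfolding q_def by (rule nn_integral_liminf) measurable
 also have "... <= ennreal (N\<^sup>2)"
 by (rule order_trans[OF Liminf_le_Limsup Limsup_bounded]) (simp_all add: qN)
 finally show ?thesis .
 qed
 have e: "ennreal ((norm (norm y *\<^sub>R ?f y))\<^sup>2) = (\<Sum>i\<in>UNIV. ennreal ((y $ i)\<^sup>2 * (norm (?f y))\<^sup>2))" for y
 proof -
 have "(norm (norm y *\<^sub>R ?f y))\<^sup>2 = (\<Sum>i\<in>UNIV. (y $ i)\<^sup>2 * (norm (?f y))\<^sup>2)"
 unfolding norm_scaleR power_mult_distrib abs_norm_cancel power2_norm_eq_inner[of y] inner_vec_def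
 by (simp add: sum_distrib_right power2_eq_square)
 then show ?thesis by (simp add: sum_ennreal)
 qed
 have "(\<integral>\<^sup>+y. ennreal ((norm (norm y *\<^sub>R ?f y))\<^sup>2) \<partial>lborel) = (\<Sum>i\<in>UNIV. \<integral>\<^sup>+y. ennreal ((y $ i)\<^sup>2 * (norm (?f y))\<^sup>2) \<partial>lborel)"
 unfolding e by (rule nn_integral_sum) measurable
 also have "... <= (\<Sum>i\<in>(UNIV :: 'n set). ennreal (N\<^sup>2))" by (intro sum_mono coord)
 also have "... = ennreal (real CARD('n) * N\<^sup>2)" by (simp add: ennreal_mult ennreal_of_nat_eq_real_of_nat)
 finally have le: "(\<integral>\<^sup>+y. ennreal ((norm (norm y *\<^sub>R ?f y))\<^sup>2) \<partial>lborel) <= ennreal (real CARD('n) * N\<^sup>2)" .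
 then have "(\<integral>\<^sup>+y. ennreal ((norm (norm y *\<^sub>R ?f y))\<^sup>2) \<partial>lborel) < \<infinity>" by (rule le_less_trans) simp
 then show L: "in_L2 (%y. norm y *\<^sub>R ?f y)" unfolding in_L2_iff integrable_iff_bounded by simp
 have "(\<integral>y. (norm (norm y *\<^sub>R ?f y))\<^sup>2 \<partial>lborel) <= real CARD('n) * N\<^sup>2"
 using le nn_integral_eq_integral[OF in_L2_integrable[OF L]] by (simp del: norm_scaleR)
 then have "sqrt (\<integral>y. (norm (norm y *\<^sub>R ?f y))\<^sup>2 \<partial>lborel) <= sqrt (real CARD('n) * N\<^sup>2)" by (rule real_sqrt_le_mono)
 also have "... = sqrt (real CARD('n)) * N" using N by (simp add: real_sqrt_mult)
 finally show "Lp_norm 2 (%y. norm y *\<^sub>R ?f y) <= ennreal (sqrt (real CARD('n)) * N)"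
 unfolding Lp_norm_2[OF L] by (rule ennreal_leI)
qed

text \<open>With \<open>t = eps * s\<close> and centre \<open>eps * y\<close>, a profile is a
  dilated and translated \<open>qinv\<close>: the amplitude splits into the two dilation factors,
  and the phase matches because the dilation by \<open>eps\<close> acts on it quadratically.\<close>

lemma quadratic_profile_l2:
 fixes y :: "real ^ 'n" and a :: "'n l2"
 assumes e: "eps > 0" and s: "s > 0"
 shows "in_L2 (quadratic_profile eps (eps * s) (eps *\<^sub>R y) (l2_fun a))"
 "to_l2 (quadratic_profile eps (eps * s) (eps *\<^sub>R y) (l2_fun a)) = scl eps (tr (- y) (qinv s a))"
proof -
 let ?A = "of_real (sqrt (1 / eps) ^ CARD('n)) :: complex" and ?B = "of_real (sqrt (1 / s) ^ CARD('n)) :: complex"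
 let ?q = "%x. ?B * exp (- \<i> * of_real ((norm x)\<^sup>2 / (2 * s)))"
 let ?g1 = "wcomp ?q (1 / s) 0 (l2_fun a)"
 let ?g2 = "wcomp (%_. 1) 1 (- y) ?g1"
 let ?g3 = "wcomp (%_. ?A) (1 / eps) 0 ?g2"
 have L1: "in_L2 ?g1" by (rule wcomp_in_L2(1)[OF qinv_weight[OF s]]) simp
 have L2: "in_L2 ?g2" by (rule wcomp_in_L2(1)[OF iso_weight_1 L1])
 have L3: "in_L2 ?g3" by (rule wcomp_in_L2(1)[OF scl_weight[OF e] L2])
 have eq: "to_l2 ?g3 = scl eps (tr (- y) (qinv s a))"
 unfolding scl_def qinv_def wop_def[of ?q]
 by (simp only: wop_to_l2[OF iso_weight_1 L1] wop_to_l2[OF scl_weight[OF e] L2])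
 have "quadratic_profile eps (eps * s) (eps *\<^sub>R y) (l2_fun a) = ?g3"
 proof
 fix x
 have v: "(1 / s) *\<^sub>R (1 *\<^sub>R ((1 / eps) *\<^sub>R x + 0) + - y) + 0 = (x - eps *\<^sub>R y) /\<^sub>R (eps * s)"
 using e s by (simp add: scaleR_diff_right divide_inverse mult.commute)
 have w: "1 *\<^sub>R ((1 / eps) *\<^sub>R x + 0) + - y = (1 / eps) *\<^sub>R (x - eps *\<^sub>R y)" using e by (simp add: scaleR_diff_right)
 have "(norm (1 *\<^sub>R ((1 / eps) *\<^sub>R x + 0) + - y))\<^sup>2 / (2 * s) = (norm (x - eps *\<^sub>R y))\<^sup>2 / (2 * eps * (eps * s))"
 unfolding w norm_scaleR power_mult_distrib using e by (simp add: power_divide power2_eq_square)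
 then have ex: "exp (- \<i> * of_real ((norm (1 *\<^sub>R ((1 / eps) *\<^sub>R x + 0) + - y))\<^sup>2 / (2 * s)))
 = exp (- \<i> * complex_of_real ((norm (x - eps *\<^sub>R y))\<^sup>2 / (2 * eps * (eps * s))))" by (simp only:)
 have "sqrt (1 / eps) ^ CARD('n) * sqrt (1 / s) ^ CARD('n) = 1 / (eps * s) powr (real CARD('n) / 2)"
 proof -
 have "sqrt (1 / eps) ^ CARD('n) * sqrt (1 / s) ^ CARD('n) = 1 / sqrt (eps * s) ^ CARD('n)"
 using e s by (simp add: real_sqrt_divide real_sqrt_mult power_mult_distrib power_one_over field_simps)
 also have "sqrt (eps * s) ^ CARD('n) = (eps * s) powr (real CARD('n) / 2)"
 using e s by (simp add: powr_half_sqrt[symmetric] powr_powr flip: powr_realpow)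
 finally show ?thesis .
 qed
 then have AB: "?A * ?B = of_real (1 / (eps * s) powr (real CARD('n) / 2))" by (simp only: of_real_mult[symmetric])
 show "quadratic_profile eps (eps * s) (eps *\<^sub>R y) (l2_fun a) x = ?g3 x"
 unfolding quadratic_profile_def wcomp_def v ex AB[symmetric] by (simp only: mult_ac mult_1_left mult_1_right)
 qed
 then show "in_L2 (quadratic_profile eps (eps * s) (eps *\<^sub>R y) (l2_fun a))"
 "to_l2 (quadratic_profile eps (eps * s) (eps *\<^sub>R y) (l2_fun a)) = scl eps (tr (- y) (qinv s a))"
 using L3 eq by simp_all
qed

section \<open>Test functions\<close>

subsection \<open>Smooth functions of one variable\<close>

text \<open>The witness is the sequence of successive derivatives. Smoothness can then be proved by
  coinduction, with a class stable under differentiation, rather than by formulas for higher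
  derivatives.\<close>

definition smooth1 :: "(real => complex) => bool" where
 "smooth1 g \<longleftrightarrow> (\<exists>d :: nat => real => complex. d 0 = g & (\<forall>k x. (d k has_vector_derivative d (Suc k) x) (at x)))"

lemma smooth1_coinduct:
 assumes step: "!!g. P g ==> \<exists>g'. P g' & (\<forall>x. (g has_vector_derivative g' x) (at x))" and g: "P g"
 shows "smooth1 g"
proof -
 obtain s where s: "!!g. P g ==> P (s g) & (\<forall>x. (g has_vector_derivative s g x) (at x))" using step by metis
 define d where "d k = (s ^^ k) g" for k
 have "P (d k)" for k by (induction k) (use g s in \<open>auto simp: d_def\<close>)
 then show ?thesis unfolding smooth1_def using s by (intro exI[of _ d]) (auto simp: d_def)
qed

lemma smooth1_deriv: assumes "smooth1 g" obtains g' where "smooth1 g'" "!!x. (g has_vector_derivative g' x) (at x)"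
proof -
 obtain d where d: "d 0 = g" "!!k x. (d k has_vector_derivative d (Suc k) x) (at x)" using assms by (auto simp: smooth1_def)
 have "smooth1 (d 1)" unfolding smooth1_def using d(2) by (intro exI[of _ "%k. d (Suc k)"]) auto
 then show ?thesis using that d(2)[of 0] d(1) by simp
qed

lemma smooth1_continuous: "smooth1 g ==> continuous_on A g"
 by (meson smooth1_deriv has_vector_derivative_continuous continuous_at_imp_continuous_on)

lemma smooth1_measurable: "smooth1 g ==> g \<in> borel_measurable borel"
 by (intro borel_measurable_continuous_onI smooth1_continuous)

text \<open>A class that contains the products and is stable under the Leibniz rule, to be used in
  the coinduction.\<close>

inductive smooth1_ring :: "(real => complex) => bool" where
 mult: "smooth1 f ==> smooth1 g ==> smooth1_ring (%x. f x * g x)"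
| add: "smooth1_ring f ==> smooth1_ring g ==> smooth1_ring (%x. f x + g x)"

lemma smooth1_mult: assumes "smooth1 f" "smooth1 g" shows "smooth1 (%x. f x * g x)"
proof (rule smooth1_coinduct[of smooth1_ring])
 show "smooth1_ring (%x. f x * g x)" by (rule smooth1_ring.mult) fact+
 fix h assume "smooth1_ring h"
 then show "\<exists>h'. smooth1_ring h' & (\<forall>x. (h has_vector_derivative h' x) (at x))"
 proof induction
 case (mult f g)
 obtain f' where f': "smooth1 f'" "!!x. (f has_vector_derivative f' x) (at x)" using smooth1_deriv[OF mult(1)] by blast
 obtain g' where g': "smooth1 g'" "!!x. (g has_vector_derivative g' x) (at x)" using smooth1_deriv[OF mult(2)] by blast
 show ?case
 by (intro exI[of _ "%x. f x * g' x + f' x * g x"] conjI allI smooth1_ring.add smooth1_ring.mult mult f' g' has_vector_derivative_mult)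
 next
 case (add f g)
 then obtain f' g' where "smooth1_ring f'" "!!x. (f has_vector_derivative f' x) (at x)"
 "smooth1_ring g'" "!!x. (g has_vector_derivative g' x) (at x)" by blast
 then show ?case by (intro exI[of _ "%x. f' x + g' x"] conjI allI smooth1_ring.add has_vector_derivative_add)
 qed
qed

lemma smooth1_entire: assumes "f holomorphic_on UNIV" shows "smooth1 (%x. f (of_real x))"
proof (rule smooth1_coinduct[of "%g. \<exists>f. f holomorphic_on UNIV & g = (%x. f (of_real x))"])
 fix g :: "real => complex" assume "\<exists>f. f holomorphic_on UNIV & g = (%x. f (of_real x))"
 then obtain f where f: "f holomorphic_on UNIV" "g = (%x. f (of_real x))" by blast
 have "(g has_vector_derivative deriv f (of_real x)) (at x)" for x
 using has_vector_derivative_real_field[OF holomorphic_derivI[OF f(1) open_UNIV UNIV_I]] by (simp add: f(2) comp_def)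
 moreover have "deriv f holomorphic_on UNIV" using f(1) by (intro holomorphic_deriv) auto
 ultimately show "\<exists>g'. (\<exists>f. f holomorphic_on UNIV & g' = (%x. f (of_real x))) & (\<forall>x. (g has_vector_derivative g' x) (at x))"
 by (intro exI[of _ "%x. deriv f (of_real x)"]) auto
qed (use assms in auto)

lemma smooth1_affine: assumes "smooth1 f" shows "smooth1 (%x. f (a * x + b))"
proof (rule smooth1_coinduct[of "%g. \<exists>f c. smooth1 f & g = (%x. of_real c * f (a * x + b))"])
 fix g :: "real => complex" assume "\<exists>f c. smooth1 f & g = (%x. of_real c * f (a * x + b))"
 then obtain f c where f: "smooth1 f" "g = (%x. of_real c * f (a * x + b))" by blast
 obtain f' where f': "smooth1 f'" "!!x. (f has_vector_derivative f' x) (at x)" using smooth1_deriv[OF f(1)] by blast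
 have fc: "((%x. f (a * x + b)) has_vector_derivative a *\<^sub>R f' (a * x + b)) (at x)" for x
 proof -
 have "((%x. a * x + b) has_vector_derivative a) (at x)"
 unfolding has_real_derivative_iff_has_vector_derivative[symmetric] by (auto intro!: derivative_eq_intros)
 from vector_diff_chain_at[OF this f'(2)] show ?thesis by (simp add: comp_def)
 qed
 have "(g has_vector_derivative of_real (c * a) * f' (a * x + b)) (at x)" for x
 unfolding f(2) using has_vector_derivative_mult_right[OF fc[of x], of "of_real c"]
 by (simp add: scaleR_conv_of_real mult_ac)
 then show "\<exists>g'. (\<exists>f c. smooth1 f & g' = (%x. of_real c * f (a * x + b))) & (\<forall>x. (g has_vector_derivative g' x) (at x))"
 using f'(1) by blast
next
 show "\<exists>fa c. smooth1 fa & (%x. f (a * x + b)) = (%x. of_real c * fa (a * x + b))"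
 using assms by (intro exI[of _ f] exI[of _ 1]) simp
qed

text \<open>The polynomial in \<open>1 / x\<close> records what differentiation puts in front of the
  exponential: it replaces \<open>p\<close> by \<open>X^2 * (p - p')\<close>, so the family is
  closed under derivatives.\<close>

definition flat_fun :: "real poly => real => real" where
 "flat_fun p x = (if x > 0 then poly p (1 / x) * exp (- (1 / x)) else 0)"

lemma poly_exp_decay: "((%y. poly p y * exp (- y)) \<longlongrightarrow> (0::real)) at_top"
proof -
 have "((%y. \<Sum>i\<le>degree p. coeff p i * (y ^ i / exp y)) \<longlongrightarrow> (\<Sum>i\<le>degree p. coeff p i * 0)) at_top"
 by (intro tendsto_intros tendsto_power_div_exp_0)
 then show ?thesis by (simp add: poly_altdef sum_distrib_right exp_minus divide_inverse mult.assoc)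
qed

lemma flat_fun_deriv: "(flat_fun p has_real_derivative flat_fun (pCons 0 (pCons 0 (p - pderiv p))) x) (at x)"
proof -
 consider "x > 0" | "x < 0" | "x = 0" by linarith
 then show ?thesis
 proof cases
 case 1
 have "((%x. poly p (1 / x) * exp (- (1 / x))) has_real_derivative
 (poly (pderiv p) (1 / x) * (- (1 / x\<^sup>2)) * exp (- (1 / x)) + exp (- (1 / x)) * (1 / x\<^sup>2) * poly p (1 / x))) (at x)"
 using 1 by (auto intro!: derivative_eq_intros DERIV_chain2[OF poly_DERIV] simp: power2_eq_square)
 moreover have "flat_fun (pCons 0 (pCons 0 (p - pderiv p))) x
 = poly (pderiv p) (1 / x) * (- (1 / x\<^sup>2)) * exp (- (1 / x)) + exp (- (1 / x)) * (1 / x\<^sup>2) * poly p (1 / x)"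
 using 1 by (simp add: flat_fun_def power2_eq_square algebra_simps)
 moreover have "eventually (%x. flat_fun p x = poly p (1 / x) * exp (- (1 / x))) (nhds x)"
 using eventually_nhds_in_open[of "{0<..}" x] 1 by (auto simp: flat_fun_def elim: eventually_mono)
 ultimately show ?thesis by (simp add: DERIV_cong_ev)
 next
 case 2
 have "eventually (%x. flat_fun p x = 0) (nhds x)"
 using eventually_nhds_in_open[of "{..<0}" x] 2 by (auto simp: flat_fun_def elim: eventually_mono)
 then show ?thesis using 2 by (subst DERIV_cong_ev[OF refl _ refl]) (auto simp: flat_fun_def)
 next
 case 3
 have "((%h. flat_fun p h / h) \<longlongrightarrow> 0) (at_right 0)"
 proof (subst filterlim_at_right_to_top)
 have "eventually (%y. poly (pCons 0 p) y * exp (- y) = flat_fun p (inverse y) / inverse y) at_top"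
 using eventually_gt_at_top[of "0::real"] by eventually_elim (simp add: flat_fun_def divide_inverse)
 then show "((%x. flat_fun p (inverse x) / inverse x) \<longlongrightarrow> 0) at_top"
 by (rule Lim_transform_eventually[OF poly_exp_decay])
 qed
 moreover have "((%h. flat_fun p h / h) \<longlongrightarrow> 0) (at_left 0)"
 by (rule tendsto_eventually) (auto simp: flat_fun_def eventually_at_filter)
 ultimately have "((%h. flat_fun p h / h) \<longlongrightarrow> 0) (at 0)" by (simp add: filterlim_split_at)
 then show ?thesis using 3 by (simp add: DERIV_def flat_fun_def)
 qed
qed

lemma smooth1_flat: "smooth1 (%x. of_real (flat_fun p x))"
proof (rule smooth1_coinduct[of "%g. \<exists>p. g = (%x. of_real (flat_fun p x))"])
 fix g :: "real => complex" assume "\<exists>p. g = (%x. of_real (flat_fun p x))"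
 then obtain p where g: "g = (%x. of_real (flat_fun p x))" by blast
 have "(g has_vector_derivative of_real (flat_fun (pCons 0 (pCons 0 (p - pderiv p))) x)) (at x)" for x
 unfolding g using has_vector_derivative_of_real[OF flat_fun_deriv] by blast
 then show "\<exists>g'. (\<exists>p. g' = (%x. of_real (flat_fun p x))) & (\<forall>x. (g has_vector_derivative g' x) (at x))" by blast
qed auto

text \<open>A product of two one-sided flat functions, vanishing outside \<open>]-1, 1[\<close>; the
  factor \<open>exp 2\<close> normalises its value at 0 to 1.\<close>

definition cutoff :: "real => complex" where
 "cutoff x = of_real (exp 2) * (of_real (flat_fun 1 (1 + x)) * of_real (flat_fun 1 (1 - x)))"

lemma cutoff_0: "cutoff 0 = 1"
 by (simp add: cutoff_def flat_fun_def flip: of_real_mult exp_add)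

lemma cutoff_support: "\<bar>x\<bar> >= 1 ==> cutoff x = 0"
 by (auto simp: cutoff_def flat_fun_def abs_if split: if_splits)

lemma cutoff_smooth: "smooth1 cutoff"
proof -
 have A: "smooth1 (%x. of_real (flat_fun 1 (1 * x + 1)) * of_real (flat_fun 1 ((-1) * x + 1)))"
 by (rule smooth1_mult[OF smooth1_affine[OF smooth1_flat] smooth1_affine[OF smooth1_flat]])
 have B: "smooth1 (%x. of_real (exp 2))" using smooth1_entire[of "%_. of_real (exp 2)"] by simp
 from smooth1_mult[OF B A] show ?thesis unfolding cutoff_def by (simp add: add.commute)
qed

text \<open>Continuity and compact support give the common bound. Two derivatives are what the
  Laplacian of a truncated Gaussian involves.\<close>

lemma cutoff_derivs:
 obtains d1 d2 C where "smooth1 d1" "smooth1 d2" "!!x. (cutoff has_vector_derivative d1 x) (at x)" "!!x. (d1 has_vector_derivative d2 x) (at x)"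
 "!!x. norm (cutoff x) <= C" "!!x. norm (d1 x) <= C" "!!x. norm (d2 x) <= C"
proof -
 have bdd: "\<exists>C. \<forall>x. norm (h x) <= C" if "continuous_on UNIV h" "!!x. \<bar>x\<bar> > 1 ==> h x = 0" for h :: "real => complex"
 proof -
 have "bounded (h ` {-1..1})" by (intro compact_imp_bounded compact_continuous_image continuous_on_subset[OF that(1)]) auto
 then obtain C where C: "!!x. x \<in> {-1..1} ==> norm (h x) <= C" unfolding bounded_iff by blast
 have "norm (h x) <= max C 0" for x
 proof (cases "\<bar>x\<bar> > 1")
 case False
 then have "x \<in> {-1..1}" by (auto simp: abs_le_iff not_less)
 then show ?thesis using C[of x] by (simp add: le_max_iff_disj)
 qed (use that(2)[of x] in simp)
 then show ?thesis by blast
 qed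
 have zero: "h' x = 0" if "!!x. (h has_vector_derivative h' x) (at x)" "!!x. \<bar>x\<bar> > 1 ==> h x = 0" "\<bar>x\<bar> > 1"
 for h h' :: "real => complex" and x
 proof -
 have "open {x::real. \<bar>x\<bar> > 1}" by (intro open_Collect_less continuous_intros)
 then have "((%x. 0) has_vector_derivative h' x) (at x)"
 by (rule has_vector_derivative_transform_within_open[OF that(1)]) (use that(2,3) in auto)
 then show ?thesis using vector_derivative_unique_at[OF _ has_vector_derivative_const] by blast
 qed
 obtain d1 where d1: "smooth1 d1" "!!x. (cutoff has_vector_derivative d1 x) (at x)" using smooth1_deriv[OF cutoff_smooth] by blast
 obtain d2 where d2: "smooth1 d2" "!!x. (d1 has_vector_derivative d2 x) (at x)" using smooth1_deriv[OF d1(1)] by blast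
 have z0: "\<bar>x\<bar> > 1 ==> cutoff x = 0" for x using cutoff_support by simp
 note z1 = zero[OF d1(2) z0]
 note z2 = zero[OF d2(2) z1]
 obtain C0 where C0: "!!x. norm (cutoff x) <= C0" using bdd[OF smooth1_continuous[OF cutoff_smooth] z0] by blast
 obtain C1 where C1: "!!x. norm (d1 x) <= C1" using bdd[OF smooth1_continuous[OF d1(1)] z1] by blast
 obtain C2 where C2: "!!x. norm (d2 x) <= C2" using bdd[OF smooth1_continuous[OF d2(1)] z2] by blast
 show ?thesis
 by (rule that[of d1 d2 "max C0 (max C1 C2)"])
 (use d1 d2 C0 C1 C2 in \<open>auto simp: le_max_iff_disj\<close>)
qed

subsection \<open>Tensor products\<close>

definition tens :: "('n::finite => real => complex) => real ^ 'n => complex" where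
 "tens g x = (\<Prod>i\<in>UNIV. g i (x $ i))"

lemma tens_has_derivative:
 fixes g g' :: "'n::finite => real => complex"
 assumes "!!i x. (g i has_vector_derivative g' i x) (at x)"
 shows "tens g differentiable (at x)" "partial_deriv j (tens g) x = tens (g(j := g' j)) x"
proof -
 have d: "((%x. g i (x $ i)) has_derivative (%h. (h $ i) *\<^sub>R g' i (x $ i))) (at x)" for i
 using diff_chain_at[OF bounded_linear.has_derivative[OF bounded_linear_vec_nth has_derivative_ident] assms[of i "x $ i", unfolded has_vector_derivative_def]]
 by (simp add: comp_def)
 have D: "(tens g has_derivative (%h. \<Sum>i\<in>UNIV. (h $ i) *\<^sub>R g' i (x $ i) * (\<Prod>j\<in>UNIV - {i}. g j (x $ j)))) (at x)"
 unfolding tens_def[abs_def] by (rule has_derivative_prod) (rule d)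
 then show "tens g differentiable (at x)" by (auto simp: differentiable_def)
 have "partial_deriv j (tens g) x = (\<Sum>i\<in>UNIV. (axis j 1 $ i) *\<^sub>R g' i (x $ i) * (\<Prod>j\<in>UNIV - {i}. g j (x $ j)))"
 unfolding partial_deriv_def frechet_derivative_at[OF D, symmetric] ..
 also have "... = (\<Sum>i\<in>UNIV. if i = j then g' j (x $ j) * (\<Prod>k\<in>UNIV - {j}. g k (x $ k)) else 0)"
 by (intro sum.cong) (auto simp: axis_def)
 also have "... = g' j (x $ j) * (\<Prod>k\<in>UNIV - {j}. g k (x $ k))" by simp
 also have "... = tens (g(j := g' j)) x"
 unfolding tens_def by (subst prod.remove[of UNIV j]) (auto intro!: arg_cong2[where f = "(*)"] prod.cong)
 finally show "partial_deriv j (tens g) x = tens (g(j := g' j)) x" .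
qed

lemma tens_smooth_derivs:
 assumes "!!i. smooth1 (g i)"
 shows "\<exists>g'. \<forall>i. smooth1 (g' i) & (\<forall>x. (g i has_vector_derivative g' i x) (at x))"
proof (rule choice, rule allI)
 fix i
 obtain h where "smooth1 h" "!!x. (g i has_vector_derivative h x) (at x)" using smooth1_deriv[OF assms[of i]] by blast
 then show "\<exists>h. smooth1 h & (\<forall>x. (g i has_vector_derivative h x) (at x))" by blast
qed

lemma tens_C_k: "(!!i. smooth1 (g i)) ==> C_k k (tens g)"
proof (induction k arbitrary: g)
 case 0
 then show ?case by (auto simp: tens_def intro!: continuous_intros continuous_on_compose2[OF smooth1_continuous[of _ UNIV]])
next
 case (Suc k)
 obtain g' where g': "!!i. smooth1 (g' i)" "!!i x. (g i has_vector_derivative g' i x) (at x)"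
 using tens_smooth_derivs[of g] Suc.prems by metis
 have pd: "partial_deriv j (tens g) = tens (g(j := g' j))" for j by (rule ext) (rule tens_has_derivative(2)[OF g'(2)])
 have ck: "C_k k (tens (g(j := g' j)))" for j by (rule Suc.IH) (simp add: Suc.prems g'(1))
 have "tens g differentiable_on UNIV"
 by (rule differentiable_at_imp_differentiable_on) (rule tens_has_derivative(1)[OF g'(2)])
 then show ?case unfolding C_k.simps(2) pd using ck by blast
qed

lemma tens_test:
 assumes "!!i. smooth1 (g i)" "!!i x. \<bar>x\<bar> >= R ==> g i x = 0"
 shows "test_function (tens g)"
proof -
 have "{x. tens g x ~= 0} \<subseteq> cbox (\<chi> i. - \<bar>R\<bar>) (\<chi> i. \<bar>R\<bar>)"
 proof
 fix x assume "x \<in> {x. tens g x ~= 0}"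
 then have "g i (x $ i) ~= 0" for i unfolding tens_def by auto
 then have "\<bar>x $ i\<bar> < R" for i using assms(2)[of "x $ i" i] by (meson not_less)
 then have "\<bar>x $ i\<bar> <= \<bar>R\<bar>" for i by (meson abs_ge_self less_imp_le order_trans)
 then show "x \<in> cbox (\<chi> i. - \<bar>R\<bar>) (\<chi> i. \<bar>R\<bar>)" by (auto simp: mem_box_cart abs_le_iff minus_le_iff)
 qed
 then have "closure {x. tens g x ~= 0} \<subseteq> cbox (\<chi> i. - \<bar>R\<bar>) (\<chi> i. \<bar>R\<bar>)"
 by (rule closure_minimal) (rule closed_cbox)
 then have "compact (closure {x. tens g x ~= 0})"
 by (meson bounded_cbox bounded_subset closed_closure compact_eq_bounded_closed)
 then show ?thesis unfolding test_function_def using tens_C_k[of g, OF assms(1)] by blast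
qed

lemma tens_l2_tendsto:
 fixes u :: "nat => 'n::finite => real => complex"
 assumes m: "!!k i. u k i \<in> borel_measurable borel" "!!i. v i \<in> borel_measurable borel"
 and B: "!!k i x. norm (u k i x) <= B i x" "!!i. integrable lborel (%x. (B i x)\<^sup>2)"
 and lim: "!!i x. (%k. u k i x) \<longlonglongrightarrow> v i x"
 shows "in_L2 (tens (u k))" "in_L2 (tens v)" "(%k. to_l2 (tens (u k))) \<longlonglongrightarrow> to_l2 (tens v)"
proof -
 have [measurable]: "u k i \<in> borel_measurable borel" "v i \<in> borel_measurable borel" for k i by (rule m)+
 have tm[measurable]: "tens (u k) \<in> borel_measurable borel" "tens v \<in> borel_measurable borel" for k unfolding tens_def by measurable
 define w where "w x = (\<Prod>i\<in>UNIV. (B i (x $ i))\<^sup>2)" for x :: "real ^ 'n"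
 have wi: "integrable lborel w" unfolding w_def by (rule integral_prod_coords(1)[where f = "%i x. (B i x)\<^sup>2", OF B(2)])
 have uw: "(norm (tens (u k) x))\<^sup>2 <= w x" for k x
 unfolding tens_def prod_norm[symmetric] prod_power_distrib w_def by (intro prod_mono conjI power_mono B) auto
 have tl: "(%k. tens (u k) x) \<longlonglongrightarrow> tens v x" for x unfolding tens_def by (intro tendsto_prod lim)
 have vw: "(norm (tens v x))\<^sup>2 <= w x" for x
 by (rule LIMSEQ_le_const2[OF tendsto_power[OF tendsto_norm[OF tl]]]) (use uw in auto)
 show L: "in_L2 (tens (u k))" "in_L2 (tens v)" for k
 by (rule in_L2_bound[OF _ wi]; (use uw vw in simp))+
 have "(%k. \<integral>x. (norm (tens (u k) x - tens v x))\<^sup>2 \<partial>lborel) \<longlonglongrightarrow> integral\<^sup>L lborel (%x :: real ^ 'n. 0)"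
 proof (rule integral_dominated_convergence[where w = "%x. 4 * w x"])
 show "AE x in lborel. (%k. (norm (tens (u k) x - tens v x))\<^sup>2) \<longlonglongrightarrow> 0"
 proof (rule AE_I2)
 fix x
 have "(%k. (norm (tens (u k) x - tens v x))\<^sup>2) \<longlonglongrightarrow> (norm (tens v x - tens v x))\<^sup>2" by (intro tendsto_intros tl)
 then show "(%k. (norm (tens (u k) x - tens v x))\<^sup>2) \<longlonglongrightarrow> 0" by simp
 qed
 show "AE x in lborel. norm ((norm (tens (u k) x - tens v x))\<^sup>2) <= 4 * w x" for k
 proof (rule AE_I2)
 fix x
 let ?p = "tens (u k) x" and ?q = "tens v x"
 have "(norm (?p - ?q))\<^sup>2 <= (norm ?p + norm ?q)\<^sup>2" by (intro power_mono norm_triangle_ineq4) simp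
 also have "... <= 2 * (norm ?p)\<^sup>2 + 2 * (norm ?q)\<^sup>2"
 using sum_squares_bound[of "norm ?p" "norm ?q"] by (simp add: power2_sum)
 also have "... <= 4 * w x" using uw[of k x] vw[of x] by simp
 finally show "norm ((norm (?p - ?q))\<^sup>2) <= 4 * w x" by simp
 qed
 qed (use wi in auto)
 moreover have "(norm (to_l2 (tens (u k)) - to_l2 (tens v)))\<^sup>2 = (\<integral>x. (norm (tens (u k) x - tens v x))\<^sup>2 \<partial>lborel)" for k
 using L by (simp add: norm_to_l2[OF in_L2_diff] flip: to_l2_diff)
 ultimately have "(%k. (norm (to_l2 (tens (u k)) - to_l2 (tens v)))\<^sup>2) \<longlonglongrightarrow> 0" by simp
 then have "(%k. sqrt ((norm (to_l2 (tens (u k)) - to_l2 (tens v)))\<^sup>2)) \<longlonglongrightarrow> sqrt 0" by (rule tendsto_real_sqrt)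
 then show "(%k. to_l2 (tens (u k))) \<longlonglongrightarrow> to_l2 (tens v)" by (simp add: tendsto_norm_zero_iff LIM_zero_iff)
qed

subsection \<open>Approximation of Gaussians by test functions\<close>

lemma gauss1_space_deriv:
 assumes z: "Re z > 0"
 shows "((%x. gauss1 z (x - b)) has_vector_derivative - (of_real (x - b) / z) * gauss1 z (x - b)) (at x)"
 "((%x. - (of_real (x - b) / z) * gauss1 z (x - b)) has_vector_derivative 2 * gauss1' z (x - b)) (at x)"
proof -
 note nz = Re_pos_nonpos[OF z]
 have g: "((%w. exp (- ((w - of_real b)\<^sup>2) / (2 * z)) / csqrt z) has_field_derivative
 - ((w - of_real b) / z) * (exp (- ((w - of_real b)\<^sup>2) / (2 * z)) / csqrt z)) (at w)" for w
 using nz by (auto intro!: derivative_eq_intros simp: field_simps)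
 have e: "gauss1 z (x - b) = exp (- ((of_real x - of_real b)\<^sup>2) / (2 * z)) / csqrt z" for x
 by (simp add: gauss1_def)
 show 1: "((%x. gauss1 z (x - b)) has_vector_derivative - (of_real (x - b) / z) * gauss1 z (x - b)) (at x)" for x
 using has_vector_derivative_real_field[OF g] unfolding e by (simp add: comp_def)
 have "((%x. complex_of_real (x - b)) has_vector_derivative 1) (at x)"
 using has_vector_derivative_of_real[of "%x. x - b" 1 "at x"] by (auto intro!: derivative_eq_intros)
 then have "((%x. - (of_real (x - b) / z)) has_vector_derivative - (1 / z)) (at x)"
 by (intro has_vector_derivative_minus has_vector_derivative_divide)
 from has_vector_derivative_mult[OF this 1]
 show "((%x. - (of_real (x - b) / z) * gauss1 z (x - b)) has_vector_derivative 2 * gauss1' z (x - b)) (at x)"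
 by (rule has_vector_derivative_eq_rhs) (use nz in \<open>simp add: gauss1'_def power2_eq_square field_simps\<close>)
qed

lemma gauss1_poly_bound:
 assumes z: "Re z > 0"
 obtains K q where "q > 0" "K >= 0" "!!x. norm (gauss1 z x) <= K * exp (- x\<^sup>2 * q)"
 "!!x. norm (- (of_real x / z) * gauss1 z x) <= K * exp (- x\<^sup>2 * q)" "!!x. norm (2 * gauss1' z x) <= K * exp (- x\<^sup>2 * q)"
proof -
 define q where "q = Re (1 / z) / 4"
 have q: "q > 0" using Re_inverse_pos[OF z] by (simp add: q_def)
 have zp: "norm z > 0" using Re_pos_nonpos[OF z] by simp
 define c where "c = 1 / sqrt (norm z)"
 have c: "c > 0" using zp by (simp add: c_def)
 have g: "norm (gauss1 z x) = c * exp (- x\<^sup>2 * q) * exp (- x\<^sup>2 * q)" for x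
 unfolding norm_gauss1[OF z] by (simp add: c_def q_def flip: exp_add)
 have pe: "(1 + x\<^sup>2) * exp (- x\<^sup>2 * q) <= 1 + 1 / q" for x
 proof -
 have "x\<^sup>2 * q <= exp (x\<^sup>2 * q)" using exp_ge_add_one_self[of "x\<^sup>2 * q"] by linarith
 then have "x\<^sup>2 * q * exp (- x\<^sup>2 * q) <= 1" by (simp add: exp_minus field_simps)
 then have "x\<^sup>2 * exp (- x\<^sup>2 * q) <= 1 / q" using q by (simp add: field_simps)
 moreover have "exp (- x\<^sup>2 * q) <= 1" using q by simp
 ultimately show ?thesis unfolding distrib_right by linarith
 qed
 define K where "K = c * (1 + 1 / q) * (1 + 1 / norm z + 1 / (norm z)\<^sup>2)"
 have key: "norm (p * gauss1 z x) <= K * exp (- x\<^sup>2 * q)" if p: "norm p <= (1 + x\<^sup>2) * m" "0 <= m" "m <= 1 + 1 / norm z + 1 / (norm z)\<^sup>2" for p x m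
 proof -
 have "norm (p * gauss1 z x) <= ((1 + x\<^sup>2) * m) * (c * exp (- x\<^sup>2 * q) * exp (- x\<^sup>2 * q))"
 unfolding norm_mult g using p c by (intro mult_right_mono) auto
 also have "... = ((1 + x\<^sup>2) * exp (- x\<^sup>2 * q)) * m * (c * exp (- x\<^sup>2 * q))" by (simp add: mult_ac)
 also have "... <= (1 + 1 / q) * (1 + 1 / norm z + 1 / (norm z)\<^sup>2) * (c * exp (- x\<^sup>2 * q))"
 using pe[of x] p q c by (intro mult_right_mono mult_mono) auto
 finally show ?thesis by (simp add: K_def mult_ac)
 qed
 have ax: "\<bar>x\<bar> <= 1 + x\<^sup>2" for x :: real
 using sum_squares_bound[of "\<bar>x\<bar>" 1] by (simp add: power2_eq_square) 
 show ?thesis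
 proof (rule that[of q K])
 show "q > 0" by fact
 show "K >= 0" using c q zp by (simp add: K_def add_nonneg_nonneg)
 show "norm (gauss1 z x) <= K * exp (- x\<^sup>2 * q)" for x using key[of 1 x 1] by simp
 show "norm (- (of_real x / z) * gauss1 z x) <= K * exp (- x\<^sup>2 * q)" for x
 proof (rule key[of _ _ "1 / norm z"])
 show "norm (- (of_real x / z)) <= (1 + x\<^sup>2) * (1 / norm z)"
 using divide_right_mono[OF ax[of x], of "norm z"] by (simp add: norm_divide)
 qed auto
 show "norm (2 * gauss1' z x) <= K * exp (- x\<^sup>2 * q)" for x
 proof -
 have e: "2 * gauss1' z x = (of_real (x\<^sup>2) / z\<^sup>2 - 1 / z) * gauss1 z x" by (simp add: gauss1'_def field_simps)
 show ?thesis unfolding e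
 proof (rule key[of _ _ "1 / norm z + 1 / (norm z)\<^sup>2"])
 have "norm (of_real (x\<^sup>2) / z\<^sup>2 - 1 / z) <= x\<^sup>2 / (norm z)\<^sup>2 + 1 / norm z"
 by (rule order_trans[OF norm_triangle_ineq4]) (simp add: norm_divide norm_power)
 also have "... <= (1 + x\<^sup>2) * (1 / norm z + 1 / (norm z)\<^sup>2)" by (simp add: algebra_simps add_divide_distrib)
 finally show "norm (of_real (x\<^sup>2) / z\<^sup>2 - 1 / z) <= (1 + x\<^sup>2) * (1 / norm z + 1 / (norm z)\<^sup>2)" .
 qed auto
 qed
 qed
qed

lemma laplacian_tens:
 assumes "!!i x. (u i has_vector_derivative u' i x) (at x)" "!!i x. (u' i has_vector_derivative u'' i x) (at x)"
 shows "laplacian (tens u) = (%x. \<Sum>j\<in>UNIV. tens (u(j := u'' j)) x)"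
proof
 fix x
 have "partial_deriv j (tens u) = tens (u(j := u' j))" for j
 by (rule ext) (rule tens_has_derivative(2)[OF assms(1)])
 moreover have "partial_deriv j (tens (u(j := u' j))) x = tens ((u(j := u' j))(j := (u'(j := u'' j)) j)) x" for j
 by (rule tens_has_derivative(2)) (use assms in \<open>auto simp: fun_upd_def\<close>)
 ultimately show "laplacian (tens u) x = (\<Sum>j\<in>UNIV. tens (u(j := u'' j)) x)"
 by (simp add: laplacian_def)
qed

definition ttest :: "('n::finite => real => complex) => bool" where
 "ttest g \<longleftrightarrow> (\<forall>i. smooth1 (g i)) & (\<exists>R. \<forall>i x. \<bar>x\<bar> >= R --> g i x = 0)"

lemma ttest_test: "ttest g ==> test_function (tens g)"
 unfolding ttest_def using tens_test[of g] by blast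

text \<open>Each coordinate factor is multiplied by a dilated cutoff. The point is that the
  Laplacians converge too, so that equations tested with compactly supported functions pass to
  Gaussians; for this the mere existence of the limit \<open>M\<close> is enough.\<close>

lemma gauss_test_approx:
 fixes b :: "real ^ 'n::finite"
 assumes z: "Re z > 0"
 obtains g M where "!!k :: nat. ttest (g k)" "!!k. in_L2 (tens (g k))" "!!k. in_L2 (laplacian (tens (g k)))"
 "(%k. to_l2 (tens (g k))) \<longlonglongrightarrow> to_l2 (gauss z b)" "(%k. to_l2 (laplacian (tens (g k)))) \<longlonglongrightarrow> M"
proof -
 obtain K q where Kq: "q > 0" "K >= 0" "!!x. norm (gauss1 z x) <= K * exp (- x\<^sup>2 * q)"
 "!!x. norm (- (of_real x / z) * gauss1 z x) <= K * exp (- x\<^sup>2 * q)" "!!x. norm (2 * gauss1' z x) <= K * exp (- x\<^sup>2 * q)"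
 using gauss1_poly_bound[OF z] by metis
 obtain d1 d2 C where sd: "smooth1 d1" "smooth1 d2" and d: "!!x. (cutoff has_vector_derivative d1 x) (at x)" "!!x. (d1 has_vector_derivative d2 x) (at x)"
 "!!x. norm (cutoff x) <= C" "!!x. norm (d1 x) <= C" "!!x. norm (d2 x) <= C" using cutoff_derivs by metis
 have C0: "C >= 0" using d(3)[of 0] norm_ge_zero order_trans by blast
 define G G1 G2 where "G i x = gauss1 z (x - b $ i)" and "G1 i x = - (of_real (x - b $ i) / z) * gauss1 z (x - b $ i)"
 and "G2 i x = 2 * gauss1' z (x - b $ i)" for i x
 have dG: "(G i has_vector_derivative G1 i x) (at x)" "(G1 i has_vector_derivative G2 i x) (at x)" for i x
 using gauss1_space_deriv[OF z] unfolding G_def[abs_def] G1_def[abs_def] G2_def by blast+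
 have sG: "smooth1 (G i)" for i
 proof -
 have "smooth1 (%x. exp (- ((of_real x - of_real (b $ i))\<^sup>2) / (2 * z)) / csqrt z)"
 by (rule smooth1_entire[of "%w. exp (- ((w - of_real (b $ i))\<^sup>2) / (2 * z)) / csqrt z"])
 (use Re_pos_nonpos[OF z] in \<open>auto intro!: holomorphic_intros\<close>)
 then show ?thesis by (simp add: G_def[abs_def] gauss1_def)
 qed
 define r where "r k = 1 / real (Suc k)" for k
 have r: "r k > 0" "r k <= 1" for k by (auto simp: r_def)
 have r0: "r \<longlonglongrightarrow> 0" unfolding r_def using LIMSEQ_inverse_real_of_nat by (simp add: inverse_eq_divide)
 have dc: "((%x. h (r k * x)) has_vector_derivative of_real (r k) * h' (r k * x)) (at x)"
 if "!!x. (h has_vector_derivative h' x) (at x)" for h h' :: "real => complex" and k x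
 proof -
 have "((%x. r k * x) has_vector_derivative r k) (at x)"
 unfolding has_real_derivative_iff_has_vector_derivative[symmetric] by (auto intro!: derivative_eq_intros)
 from vector_diff_chain_at[OF this that] show ?thesis by (simp add: comp_def scaleR_conv_of_real)
 qed
 \<comment> \<open>\<open>u1\<close> and \<open>u2\<close> are the first two derivatives of
   \<open>u\<close> by the product rule. Every derivative falling on the cutoff brings a factor
   \<open>r k\<close>, which tends to 0.\<close>
 define u u1 u2 where "u k i x = cutoff (r k * x) * G i x"
 and "u1 k i x = cutoff (r k * x) * G1 i x + (of_real (r k) * d1 (r k * x)) * G i x"
 and "u2 k i x = (cutoff (r k * x) * G2 i x + (of_real (r k) * d1 (r k * x)) * G1 i x)
 + ((of_real (r k) * d1 (r k * x)) * G1 i x + (of_real (r k) * (of_real (r k) * d2 (r k * x))) * G i x)" for k i x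
 have du: "(u k i has_vector_derivative u1 k i x) (at x)" for k i x
 unfolding u_def[abs_def] u1_def by (intro has_vector_derivative_mult dc[OF d(1)] dG)
 have du1: "(u1 k i has_vector_derivative u2 k i x) (at x)" for k i x
 unfolding u1_def[abs_def] u2_def
 by (intro has_vector_derivative_add has_vector_derivative_mult has_vector_derivative_mult_right dc[OF d(1)] dc[OF d(2)] dG)
 have su: "smooth1 (u k i)" for k i
 unfolding u_def[abs_def] using smooth1_mult[OF smooth1_affine[OF cutoff_smooth, of "r k" 0] sG[of i]] by simp
 have tt: "ttest (u k)" for k
 unfolding ttest_def
 proof (intro conjI exI[of _ "real (Suc k)"] allI impI su)
 fix i and x :: real assume x: "real (Suc k) <= \<bar>x\<bar>"
 then have "\<bar>r k * x\<bar> >= 1" by (simp add: r_def abs_mult field_simps)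
 then show "u k i x = 0" by (simp add: u_def cutoff_support)
 qed
 define E where "E i x = K * exp (- (x - b $ i)\<^sup>2 * q)" for i x
 have E: "E i x >= 0" "norm (G i x) <= E i x" "norm (G1 i x) <= E i x" "norm (G2 i x) <= E i x" for i x
 proof -
 show "E i x >= 0" using Kq(2) by (simp add: E_def)
 show "norm (G i x) <= E i x" unfolding E_def G_def by (rule Kq(3))
 show "norm (G1 i x) <= E i x" unfolding E_def G1_def by (rule Kq(4))
 show "norm (G2 i x) <= E i x" unfolding E_def G2_def by (rule Kq(5))
 qed
 \<comment> \<open>The factor 4 counts the products in \<open>u2\<close>, each bounded by
   \<open>C\<close> times the envelope \<open>E\<close>.\<close>
 define B where "B i x = (4 * C + 1) * E i x" for i x
 have B2: "integrable lborel (%x. (B i x)\<^sup>2)" for i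
 proof -
 have "integrable lborel (%x. ((4 * C + 1) * K)\<^sup>2 * exp (- (- b $ i + 1 * x)\<^sup>2 * (2 * q)))"
 using Kq(1) by (intro integrable_mult_right lborel_integrable_real_affine[OF exp_quadratic_integrable]) auto
 moreover have "(B i x)\<^sup>2 = ((4 * C + 1) * K)\<^sup>2 * exp (- (- b $ i + 1 * x)\<^sup>2 * (2 * q))" for x
 unfolding B_def E_def power_mult_distrib exp_double[symmetric] by (simp add: algebra_simps)
 ultimately show ?thesis by simp
 qed
 have rc: "norm (of_real (r k) * w) <= C" if "norm w <= C" for w :: complex and k
 using that r[of k] mult_mono[of "r k" 1 "norm w" C] by (simp add: norm_mult)
 have Bu: "norm (u k i x) <= B i x" for k i x
 proof -
 have "norm (u k i x) <= C * E i x" unfolding u_def norm_mult using d(3) E C0 by (intro mult_mono) auto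
 also have "... <= B i x" using C0 E(1)[of i x] by (simp add: B_def mult_right_mono)
 finally show ?thesis .
 qed
 have Bu2: "norm (u2 k i x) <= B i x" for k i x
 proof -
 have "norm (u2 k i x) <= (C * E i x + C * E i x) + (C * E i x + C * E i x)"
 unfolding u2_def by (intro norm_triangle_mono order_trans[OF norm_mult_ineq] mult_mono d E rc C0) auto
 also have "... <= B i x" using C0 E(1)[of i x] by (simp add: B_def algebra_simps)
 finally show ?thesis .
 qed
 have BG: "norm (G i x) <= B i x" for i x
 proof -
 have "1 * E i x <= (4 * C + 1) * E i x" using C0 E(1) by (intro mult_right_mono) auto
 then show ?thesis using E(2)[of i x] unfolding B_def by linarith
 qed
 have rx: "(%k. r k * x) \<longlonglongrightarrow> 0" for x using tendsto_mult_left_zero[OF r0, of x] .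
 have cont: "isCont h 0" if "!!x. (h has_vector_derivative h' x) (at x)" for h h' :: "real => complex"
 using has_vector_derivative_continuous[OF that[of 0]] .
 have lc: "(%k. cutoff (r k * x)) \<longlonglongrightarrow> 1" for x
 using isCont_tendsto_compose[OF cont[OF d(1)] rx] by (simp add: cutoff_0)
 have l1: "(%k. of_real (r k) * d1 (r k * x)) \<longlonglongrightarrow> 0" for x
 using tendsto_mult[OF tendsto_of_real[OF r0] isCont_tendsto_compose[OF cont[OF d(2)] rx]] by simp
 have l2: "(%k. of_real (r k) * (of_real (r k) * d2 (r k * x))) \<longlonglongrightarrow> 0" for x
 proof (rule tendsto_norm_zero_cancel)
 show "(%k. norm (of_real (r k) * (of_real (r k) * d2 (r k * x)))) \<longlonglongrightarrow> 0"
 proof (rule Lim_null_comparison)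
 show "\<forall>\<^sub>F k in sequentially. norm (norm (of_real (r k) * (of_real (r k) * d2 (r k * x)))) <= r k * C"
 using rc[OF d(5)] by (intro always_eventually allI)
 (simp add: norm_mult abs_of_pos[OF r(1)] mult_left_mono less_imp_le[OF r(1)])
 show "(%k. r k * C) \<longlonglongrightarrow> 0" using tendsto_mult_left_zero[OF r0] .
 qed
 qed
 have lu: "(%k. u k i x) \<longlonglongrightarrow> G i x" for i x
 unfolding u_def using tendsto_mult[OF lc tendsto_const[of "G i x"]] by simp
 have lu2: "(%k. u2 k i x) \<longlonglongrightarrow> G2 i x" for i x
 proof -
 have "(%k. u2 k i x) \<longlonglongrightarrow> (1 * G2 i x + 0 * G1 i x) + (0 * G1 i x + 0 * G i x)"
 unfolding u2_def by (intro tendsto_intros lc l1 l2)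
 then show ?thesis by simp
 qed
 have mG: "G i \<in> borel_measurable borel" "G2 i \<in> borel_measurable borel" for i
 unfolding G_def[abs_def] G2_def[abs_def] by measurable
 have mu: "u k i \<in> borel_measurable borel" for k i by (rule smooth1_measurable[OF su])
 have mu2: "u2 k i \<in> borel_measurable borel" for k i
 proof -
 have cm: "h \<in> borel_measurable borel" if "!!x. (h has_vector_derivative h' x) (at x)" for h h' :: "real => complex"
 by (intro borel_measurable_continuous_onI continuous_at_imp_continuous_on ballI has_vector_derivative_continuous[OF that])
 have [measurable]: "d2 \<in> borel_measurable borel" "d1 \<in> borel_measurable borel" "cutoff \<in> borel_measurable borel"
 "G i \<in> borel_measurable borel" "G1 i \<in> borel_measurable borel" "G2 i \<in> borel_measurable borel"
 proof -
 show "d1 \<in> borel_measurable borel" "cutoff \<in> borel_measurable borel" "G1 i \<in> borel_measurable borel" by (rule cm, rule d dG)+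
 show "d2 \<in> borel_measurable borel" by (rule smooth1_measurable[OF sd(2)])
 qed (rule mG)+
 show ?thesis unfolding u2_def[abs_def] by measurable
 qed
 note T = tens_l2_tendsto[of u G B, OF mu mG(1) Bu B2 lu]
 have gG: "tens G = gauss z b" by (simp add: tens_def gauss_def G_def fun_eq_iff)
 have T2: "in_L2 (tens ((u k)(j := u2 k j)))" "in_L2 (tens (G(j := G2 j)))"
 "(%k. to_l2 (tens ((u k)(j := u2 k j)))) \<longlonglongrightarrow> to_l2 (tens (G(j := G2 j)))" for k j
 by (rule tens_l2_tendsto[of "%k. (u k)(j := u2 k j)" "G(j := G2 j)" B, OF _ _ _ B2];
 use mu mu2 mG Bu Bu2 lu lu2 in \<open>simp add: fun_upd_def\<close>)+
 have lap: "laplacian (tens (u k)) = (%x. \<Sum>j\<in>UNIV. tens ((u k)(j := u2 k j)) x)" for k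
 by (rule laplacian_tens[OF du du1])
 have sumL: "in_L2 (%x. \<Sum>j\<in>UNIV. tens ((u k)(j := u2 k j)) x)"
 "to_l2 (%x. \<Sum>j\<in>UNIV. tens ((u k)(j := u2 k j)) x) = (\<Sum>j\<in>UNIV. to_l2 (tens ((u k)(j := u2 k j))))" for k
 using to_l2_sum[of UNIV "%j. tens ((u k)(j := u2 k j))"] T2(1) by auto
 show ?thesis
 proof (rule that[of u "\<Sum>j\<in>UNIV. to_l2 (tens (G(j := G2 j)))"])
 show "(%k. to_l2 (laplacian (tens (u k)))) \<longlonglongrightarrow> (\<Sum>j\<in>UNIV. to_l2 (tens (G(j := G2 j))))"
 unfolding lap sumL(2) by (intro tendsto_sum T2(3))
 qed (use tt T gG lap sumL(1) in auto)
qed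

subsection \<open>General test functions\<close>

lemma compact_image_bound:
 fixes f :: "'a::topological_space => 'b::real_normed_vector"
 assumes "compact K" "continuous_on K f"
 shows "\<exists>C>0. \<forall>x\<in>K. norm (f x) <= C"
 using compact_imp_bounded[OF compact_continuous_image[OF assms(2,1)]] unfolding bounded_pos by blast

lemma test_function_partial:
 fixes phi :: "real ^ 'n => complex"
 assumes "test_function phi"
 shows "test_function (partial_deriv i phi)" "phi differentiable (at x)" "continuous_on UNIV phi"
proof -
 have C: "C_k k phi" for k using assms by (simp add: test_function_def)
 have "phi differentiable_on UNIV" using C[of "Suc 0"] unfolding C_k.simps by blast
 then show "phi differentiable (at x)" by (simp add: differentiable_on_def)
 show c: "continuous_on UNIV phi" using C[of 0] by simp
 have Cp: "C_k k (partial_deriv i phi)" for k using C[of "Suc k"] by simp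
 let ?S = "closure {x. phi x ~= 0}"
 have "{x. partial_deriv i phi x ~= 0} \<subseteq> ?S"
 proof (rule ccontr)
 assume "\<not> ?thesis"
 then obtain x where x: "partial_deriv i phi x ~= 0" "x \<in> - ?S" by auto
 have "(phi has_derivative (%h. 0)) (at x)"
 proof (rule has_derivative_transform_within_open[of "%x. 0" _ _ _ "- ?S"])
 show "!!y. y \<in> - ?S ==> 0 = phi y" using closure_subset[of "{x. phi x ~= 0}"] by auto
 qed (use x in auto)
 then have "partial_deriv i phi x = 0" unfolding partial_deriv_def using frechet_derivative_at by metis
 then show False using x by simp
 qed
 then have "closure {x. partial_deriv i phi x ~= 0} \<subseteq> ?S" by (rule closure_minimal) simp
 moreover have "compact ?S" using assms by (simp add: test_function_def)
 ultimately have "compact (closure {x. partial_deriv i phi x ~= 0})"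
 by (metis bounded_subset closed_closure compact_eq_bounded_closed)
 then show "test_function (partial_deriv i phi)" using Cp by (simp add: test_function_def)
qed

lemma test_function_bounds:
 fixes phi :: "real ^ 'n => complex"
 assumes "test_function phi"
 obtains R C where "R > 0" "C >= 0" "!!x. norm (phi x) <= C" "!!x. norm x > R ==> phi x = 0"
proof -
 let ?S = "closure {x. phi x ~= 0}"
 have S: "compact ?S" using assms by (simp add: test_function_def)
 obtain R where R: "R > 0" "!!x. x \<in> ?S ==> norm x <= R" using compact_imp_bounded[OF S] by (auto simp: bounded_pos)
 have out: "phi x = 0" if "x \<notin> ?S" for x using that closure_subset[of "{x. phi x ~= 0}"] by auto
 obtain C where C: "C > 0" "!!x. x \<in> ?S ==> norm (phi x) <= C"
 using compact_image_bound[OF S continuous_on_subset[OF test_function_partial(3)[OF assms] subset_UNIV]] by blast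
 show ?thesis
 proof (rule that[of R C])
 show "norm (phi x) <= C" for x using C out[of x] by (cases "x \<in> ?S") auto
 show "phi x = 0" if "norm x > R" for x using R(2)[of x] out[of x] that by force
 qed (use R C in auto)
qed

lemma integrable_indicator_cball: "integrable lborel (%x :: real ^ 'n. C * indicator (cball 0 R) x :: real)"
 using emeasure_lborel_cball_finite[of "0 :: real ^ 'n" R] by (intro integrable_mult_right integrable_real_indicator) auto

lemma test_function_L2:
 fixes phi :: "real ^ 'n => complex"
 assumes t: "test_function phi"
 shows "in_L2 phi" "integrable lborel phi" "in_L2 (partial_deriv i phi)" "in_L2 (laplacian phi)" "phi \<in> borel_measurable borel"
proof -
 have *: "in_L2 phi & integrable lborel phi & phi \<in> borel_measurable borel" if tf: "test_function phi" for phi :: "real ^ 'n => complex"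
 proof -
 obtain R C where RC: "R > 0" "C >= 0" "!!x. norm (phi x) <= C" "!!x. norm x > R ==> phi x = 0"
 using test_function_bounds[OF tf] by metis
 have m: "phi \<in> borel_measurable borel" by (intro borel_measurable_continuous_onI test_function_partial(3)[OF tf])
 have "in_L2 phi"
 proof (rule in_L2_bound[OF m integrable_indicator_cball[of "C\<^sup>2" R]])
 show "(norm (phi x))\<^sup>2 <= C\<^sup>2 * indicator (cball 0 R) x" for x
 using RC(3)[of x] RC(4)[of x] by (cases "norm x > R") (auto intro: power_mono)
 qed
 moreover have "integrable lborel phi"
 proof (rule Bochner_Integration.integrable_bound[OF integrable_indicator_cball[of C R]])
 show "AE x in lborel. norm (phi x) <= norm (C * indicator (cball 0 R) x)"
 proof (rule AE_I2)
 fix x show "norm (phi x) <= norm (C * indicator (cball 0 R) x)"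
 using RC(2) RC(3)[of x] RC(4)[of x] by (cases "norm x > R") auto
 qed
 qed (use m in simp)
 ultimately show ?thesis using m by blast
 qed
 show "in_L2 phi" "integrable lborel phi" "in_L2 (partial_deriv i phi)" "phi \<in> borel_measurable borel"
 using *[OF t] *[OF test_function_partial(1)[OF t]] by blast+
 have "in_L2 (partial_deriv i (partial_deriv i phi))" for i
 using *[OF test_function_partial(1)[OF test_function_partial(1)[OF t]]] by blast
 then show "in_L2 (laplacian phi)"
 using to_l2_sum[of UNIV "%i. partial_deriv i (partial_deriv i phi)"] by (simp add: laplacian_def[abs_def])
qed

lemma has_derivative_partial_line:
 fixes w :: "real ^ 'n => complex"
 assumes "!!x. w differentiable (at x)"
 shows "((%h. w (x + h *\<^sub>R axis i 1)) has_vector_derivative partial_deriv i w (x + h *\<^sub>R axis i 1)) (at h)"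
proof -
 have 1: "(w has_derivative frechet_derivative w (at (x + h *\<^sub>R axis i 1))) (at (x + h *\<^sub>R axis i 1))"
 using assms frechet_derivative_works by blast
 have 2: "((%h. x + h *\<^sub>R axis i 1) has_derivative (%k. k *\<^sub>R axis i 1)) (at h)"
 by (auto intro!: derivative_eq_intros)
 have "linear (frechet_derivative w (at (x + h *\<^sub>R axis i 1)))" using 1 by (rule has_derivative_linear)
 then show ?thesis
 using diff_chain_at[OF 2 1] unfolding has_vector_derivative_def partial_deriv_def by (simp add: comp_def linear_scale)
qed

lemma integral_partial_zero:
 fixes w :: "real ^ 'n => complex"
 assumes dw: "!!x. w differentiable (at x)" and cw: "continuous_on UNIV (partial_deriv i w)"
 and sw: "!!x. norm x > R ==> w x = 0" and sp: "!!x. norm x > R ==> partial_deriv i w x = 0"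
 shows "(\<integral>x. partial_deriv i w x \<partial>lborel) = 0"
proof -
 let ?p = "partial_deriv i w"
 have cw': "continuous_on UNIV w" using dw differentiable_imp_continuous_within by (auto simp: continuous_on_eq_continuous_at)
 have mw[measurable]: "w \<in> borel_measurable borel" "?p \<in> borel_measurable borel"
 using cw cw' by (auto intro: borel_measurable_continuous_onI)
 have bdd: "\<exists>C\<ge>0. \<forall>x. norm (f x) <= C * indicator (cball 0 R) x" if f: "continuous_on UNIV f" "!!x. norm x > R ==> f x = 0" for f :: "real ^ 'n => complex"
 proof -
 obtain C where "C > 0" "!!x. x \<in> cball 0 R ==> norm (f x) <= C"
 using compact_image_bound[OF compact_cball continuous_on_subset[OF f(1) subset_UNIV]] by blast
 then show ?thesis using f(2) by (intro exI[of _ C]) (auto simp: indicator_def)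
 qed
 obtain C where C: "C >= 0" "!!x. norm (?p x) <= C * indicator (cball 0 R) x" using bdd[OF cw sp] by blast
 obtain C' where C': "!!x. norm (w x) <= C' * indicator (cball 0 R) x" using bdd[OF cw' sw] by blast
 have iw: "integrable lborel w"
 by (rule Bochner_Integration.integrable_bound[OF integrable_indicator_cball[of C' R]]) (use C' in \<open>auto intro!: AE_I2 order_trans[OF C' abs_ge_self]\<close>)
 have ip: "integrable lborel ?p"
 by (rule Bochner_Integration.integrable_bound[OF integrable_indicator_cball[of C R]]) (use C in \<open>auto intro!: AE_I2 order_trans[OF C(2) abs_ge_self]\<close>)
 have ish: "integrable lborel (%x. w (x + y))" for y
 proof -
 have "integrable (distr lborel borel ((+) y)) w" using iw by (simp add: lborel_distr_plus)
 then show ?thesis by (subst (asm) integrable_distr_eq) (auto simp: add.commute)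
 qed
 \<comment> \<open>The translates of \<open>w\<close> all have the same integral.\<close>
 have main: "(\<integral>x. L (?p x) \<partial>lborel) = 0" if L: "bounded_linear L" "!!z. \<bar>L z\<bar> <= norm z" for L :: "complex => real"
 proof -
 interpret L: bounded_linear L by fact
 have "((%h. \<integral>x. L (w (x + h *\<^sub>R axis i 1)) \<partial>lborel) has_field_derivative (\<integral>x. L (?p (x + 0 *\<^sub>R axis i 1)) \<partial>lborel)) (at 0)"
 proof (rule has_field_derivative_integral[where r = 1 and B = "%x. C * indicator (cball 0 (R + 1)) x"])
 show "integrable lborel (%x. L (w (x + h *\<^sub>R axis i 1)))" for h
 by (rule integrable_bounded_linear[OF L(1) ish])
 show "((%h. L (w (x + h *\<^sub>R axis i 1))) has_field_derivative L (?p (x + h *\<^sub>R axis i 1))) (at h)" for h x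
 using L.has_vector_derivative[OF has_derivative_partial_line[OF dw]] by (simp add: has_real_derivative_iff_has_vector_derivative)
 show "norm (L (?p (x + h *\<^sub>R axis i 1))) <= C * indicator (cball 0 (R + 1)) x" if "h \<in> ball 0 1" for h x
 proof -
 have "norm x <= norm (x + h *\<^sub>R axis i 1) + norm (h *\<^sub>R axis i 1 :: real ^ 'n)" using norm_triangle_ineq4[of "x + h *\<^sub>R axis i 1" "h *\<^sub>R axis i 1"] by simp
 also have "norm (h *\<^sub>R axis i 1 :: real ^ 'n) <= 1" using that by (simp add: norm_axis_1)
 finally have "norm (x + h *\<^sub>R axis i 1) <= R ==> norm x <= R + 1" by simp
 then have "(indicator (cball 0 R) (x + h *\<^sub>R axis i 1) :: real) <= indicator (cball 0 (R + 1)) x" by (auto simp: indicator_def)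
 then have "C * indicator (cball 0 R) (x + h *\<^sub>R axis i 1) <= C * indicator (cball 0 (R + 1)) x" by (rule mult_left_mono[OF _ C(1)])
 then show ?thesis using C(2)[of "x + h *\<^sub>R axis i 1"] L(2)[of "?p (x + h *\<^sub>R axis i 1)"] by simp
 qed
 show "(%x. L (?p (x + 0 *\<^sub>R axis i 1))) \<in> borel_measurable lborel"
 using borel_measurable_continuous_onI[OF L.continuous_on[OF cw]] by simp
 qed (use integrable_indicator_cball in auto)
 moreover have "(%h. \<integral>x. L (w (x + h *\<^sub>R axis i 1)) \<partial>lborel) = (%h. \<integral>x. L (w x) \<partial>lborel)"
 using borel_measurable_continuous_onI[OF L.continuous_on[OF cw']] by (intro ext integral_shift[symmetric]) simp
 ultimately have "((%h::real. \<integral>x. L (w x) \<partial>lborel) has_field_derivative (\<integral>x. L (?p x) \<partial>lborel)) (at 0)" by simp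
 then show ?thesis using DERIV_unique DERIV_const by blast
 qed
 have "Re (\<integral>x. ?p x \<partial>lborel) = 0" using main[OF bounded_linear_Re abs_Re_le_cmod] integral_Re[OF ip] by simp
 moreover have "Im (\<integral>x. ?p x \<partial>lborel) = 0" using main[OF bounded_linear_Im abs_Im_le_cmod] integral_Im[OF ip] by simp
 ultimately show ?thesis by (simp add: complex_eq_iff)
qed

lemma integrable_continuous_test:
 fixes f g :: "real ^ 'n => complex"
 assumes f: "continuous_on UNIV f" and g: "test_function g"
 shows "integrable lborel (%x. f x * g x)"
proof -
 obtain R C where RC: "R > 0" "C >= 0" "!!x. norm (g x) <= C" "!!x. norm x > R ==> g x = 0" using test_function_bounds[OF g] by metis
 obtain K where K: "K > 0" "!!x. x \<in> cball 0 R ==> norm (f x) <= K"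
 using compact_image_bound[OF compact_cball continuous_on_subset[OF f subset_UNIV]] by blast
 have m: "(%x. f x * g x) \<in> borel_measurable borel"
 by (intro borel_measurable_continuous_onI continuous_intros f test_function_partial(3)[OF g])
 show ?thesis
 proof (rule Bochner_Integration.integrable_bound[OF integrable_indicator_cball[of "K * C" R]])
 show "AE x in lborel. norm (f x * g x) <= norm (K * C * indicator (cball 0 R) x)"
 proof (rule AE_I2)
 fix x show "norm (f x * g x) <= norm (K * C * indicator (cball 0 R) x)"
 using RC K(1) K(2)[of x] by (cases "norm x > R") (auto simp: norm_mult abs_mult intro!: mult_mono)
 qed
 qed (use m in simp)
qed

lemma integration_by_parts:
 fixes u phi :: "real ^ 'n => complex"
 assumes du: "!!x. u differentiable (at x)" and cu: "continuous_on UNIV (partial_deriv i u)" and t: "test_function phi"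
 shows "(\<integral>x. partial_deriv i u x * phi x \<partial>lborel) = - (\<integral>x. u x * partial_deriv i phi x \<partial>lborel)"
proof -
 let ?w = "%x. u x * phi x"
 have cu': "continuous_on UNIV u" using du differentiable_imp_continuous_within by (auto simp: continuous_on_eq_continuous_at)
 note dp = test_function_partial(2)[OF t] and cp = test_function_partial(3)[OF t] and cpp = test_function_partial(3)[OF test_function_partial(1)[OF t]]
 have pd: "partial_deriv i ?w x = partial_deriv i u x * phi x + u x * partial_deriv i phi x" for x
 proof -
 have "(u has_derivative frechet_derivative u (at x)) (at x)" "(phi has_derivative frechet_derivative phi (at x)) (at x)"
 using du dp frechet_derivative_works by blast+
 from has_derivative_mult[OF this] show ?thesis
 unfolding partial_deriv_def by (simp add: frechet_derivative_at[symmetric])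
 qed
 obtain R1 where R1: "!!x. norm x > R1 ==> phi x = 0" using test_function_bounds[OF t] by metis
 obtain R2 where R2: "!!x. norm x > R2 ==> partial_deriv i phi x = 0" using test_function_bounds[OF test_function_partial(1)[OF t]] by metis
 have z: "(\<integral>x. partial_deriv i ?w x \<partial>lborel) = 0"
 proof (rule integral_partial_zero[where R = "max R1 R2"])
 show "?w differentiable (at x)" for x using du dp by (rule differentiable_mult)
 show "continuous_on UNIV (partial_deriv i ?w)" unfolding pd[abs_def] by (intro continuous_intros cu cu' cp cpp)
 qed (use R1 R2 in \<open>auto simp: pd\<close>)
 note int = integrable_continuous_test
 show ?thesis
 using z Bochner_Integration.integral_add[OF int[OF cu t] int[OF cu' test_function_partial(1)[OF t]]]
 unfolding pd by (simp add: add_eq_0_iff)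
qed

section \<open>Identification of the free propagator\<close>

text \<open>The equation is tested by the bilinear integral of \<open>v\<close> times
  \<open>f\<close>; conjugating \<open>f\<close> turns it into a scalar product.\<close>

definition cj :: "(real ^ 'n => complex) => 'n::finite l2" where
 "cj f = to_l2 (%x. cnj (f x))"

lemma pairing:
 assumes v: "in_L2 v" and f: "in_L2 f"
 shows "(\<integral>x. v x * f x \<partial>lborel) = Complex (inner (to_l2 v) (cj f)) (inner (to_l2 v) (cmul \<i> (cj f)))"
proof -
 have "(\<integral>x. v x * f x \<partial>lborel) = (\<integral>x. l2_fun (to_l2 v) x * cnj (l2_fun (cj f) x) \<partial>lborel)"
 proof (rule integral_cong_AE)
 show "AE x in lborel. v x * f x = l2_fun (to_l2 v) x * cnj (l2_fun (cj f) x)"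
 using l2_fun_to_l2[OF v] l2_fun_to_l2[OF in_L2_cnj[OF f]] unfolding cj_def by eventually_elim simp
 qed (use v f in measurable)
 then show ?thesis by (simp add: complex_inner_l2_fun)
qed

lemma inner_cmul_cj:
 assumes v: "in_L2 v" and f: "in_L2 f"
 shows "inner (to_l2 v) (cmul c (cj f)) = Re (cnj c * (\<integral>x. v x * f x \<partial>lborel))"
proof -
 have "inner (to_l2 v) (cmul c (cj f)) = inner (to_l2 (%x. cnj c * v x)) (cj f)"
 using inner_cmul_left[of "cnj c" "to_l2 v" "cj f"] v by (simp add: cmul_to_l2)
 also have "... = Re (\<integral>x. cnj c * v x * f x \<partial>lborel)"
 using pairing[OF in_L2_cmult[OF v] f, of "cnj c"] by simp
 finally show ?thesis by (simp add: mult.assoc)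
qed

lemma cj_tendsto:
 assumes L: "!!k. in_L2 (f k)" and lim: "(%k :: nat. to_l2 (f k)) \<longlonglongrightarrow> a"
 obtains a' where "(%k. cj (f k)) \<longlonglongrightarrow> a'" "!!g. in_L2 g ==> a = to_l2 g ==> a' = cj g"
proof -
 have iso: "norm (cj f - cj g) = norm (to_l2 f - to_l2 g)" if "in_L2 f" "in_L2 g" for f g :: "real ^ 'a => complex"
 proof (rule power2_eq_imp_eq)
 have "cj f - cj g = to_l2 (%x. cnj (f x - g x))" using that by (simp add: cj_def to_l2_diff[symmetric] in_L2_cnj)
 moreover have "to_l2 f - to_l2 g = to_l2 (%x. f x - g x)" using that by (simp add: to_l2_diff)
 ultimately show "(norm (cj f - cj g))\<^sup>2 = (norm (to_l2 f - to_l2 g))\<^sup>2"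
 using that by (simp add: norm_to_l2 in_L2_diff in_L2_cnj del: complex_cnj_diff)
 qed auto
 have lim': "(%k. cj (f k)) \<longlonglongrightarrow> cj (l2_fun a)"
 proof (rule LIM_zero_cancel, rule tendsto_norm_zero_cancel)
 have "(%k. norm (to_l2 (f k) - a)) \<longlonglongrightarrow> 0" using lim by (simp add: LIM_zero tendsto_norm_zero)
 then show "(%k. norm (cj (f k) - cj (l2_fun a))) \<longlonglongrightarrow> 0" using iso[OF L in_L2_l2_fun] by simp
 qed
 show ?thesis
 proof (rule that[OF lim'])
 fix g assume "in_L2 g" "a = to_l2 g"
 then have "norm (cj (l2_fun a) - cj g) = 0" using iso[OF in_L2_l2_fun] by simp
 then show "cj (l2_fun a) = cj g" by simp
 qed
qed

subsection \<open>Test functions lie in the domain of the generator\<close>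

lemma tens_laplacian_by_parts:
 fixes u :: "'n::finite => real => complex"
 assumes u: "!!i. smooth1 (u i)" and t: "test_function phi"
 shows "(\<integral>x. laplacian (tens u) x * phi x \<partial>lborel) = (\<integral>x. tens u x * laplacian phi x \<partial>lborel)"
proof -
 obtain u' where u': "!!i. smooth1 (u' i)" "!!i x. (u i has_vector_derivative u' i x) (at x)" using tens_smooth_derivs[of u] u by metis
 obtain u'' where u'': "!!i. smooth1 (u'' i)" "!!i x. (u' i has_vector_derivative u'' i x) (at x)" using tens_smooth_derivs[of u'] u'(1) by metis
 have p1: "partial_deriv j (tens u) = tens (u(j := u' j))" for j by (rule ext) (rule tens_has_derivative(2)[OF u'(2)])
 have d2: "((u(j := u' j)) i has_vector_derivative (u'(j := u'' j)) i x) (at x)" for i j x using u'(2) u''(2) by (auto simp: fun_upd_def)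
 have p2: "partial_deriv j (tens (u(j := u' j))) = tens (u(j := u'' j))" for j
 by (rule ext) (use tens_has_derivative(2)[where g = "u(j := u' j)" and g' = "u'(j := u'' j)" and j = j, OF d2[where j = j]] in simp)
 have c: "continuous_on UNIV (tens v)" if "!!i. smooth1 (v i)" for v :: "'n => real => complex" using tens_C_k[of v 0] that by simp
 have c0: "continuous_on UNIV (tens u)" by (rule c[OF u])
 have c1: "continuous_on UNIV (tens (u(j := u' j)))" for j by (rule c) (simp add: u u'(1))
 have c2: "continuous_on UNIV (tens (u(j := u'' j)))" for j by (rule c) (simp add: u u''(1))
 note tp = test_function_partial(1)[OF t] and tpp = test_function_partial(1)[OF test_function_partial(1)[OF t]]
 have "(\<integral>x. tens (u(j := u'' j)) x * phi x \<partial>lborel) = (\<integral>x. tens u x * partial_deriv j (partial_deriv j phi) x \<partial>lborel)" for j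
 proof -
 have "(\<integral>x. tens (u(j := u'' j)) x * phi x \<partial>lborel) = - (\<integral>x. tens (u(j := u' j)) x * partial_deriv j phi x \<partial>lborel)"
 using integration_by_parts[of "tens (u(j := u' j))" j phi, OF tens_has_derivative(1)[OF d2] _ t] c2 by (simp add: p2)
 also have "(\<integral>x. tens (u(j := u' j)) x * partial_deriv j phi x \<partial>lborel) = - (\<integral>x. tens u x * partial_deriv j (partial_deriv j phi) x \<partial>lborel)"
 using integration_by_parts[of "tens u" j "partial_deriv j phi", OF tens_has_derivative(1)[OF u'(2)] _ tp] c1 by (simp add: p1)
 finally show ?thesis by (simp only: minus_minus)
 qed
 then have "(\<Sum>j\<in>UNIV. \<integral>x. tens (u(j := u'' j)) x * phi x \<partial>lborel) = (\<Sum>j\<in>UNIV. \<integral>x. tens u x * partial_deriv j (partial_deriv j phi) x \<partial>lborel)"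
 by simp
 moreover have "(\<Sum>j\<in>UNIV. \<integral>x. tens (u(j := u'' j)) x * phi x \<partial>lborel) = (\<integral>x. laplacian (tens u) x * phi x \<partial>lborel)"
 unfolding laplacian_def p1 p2 sum_distrib_right
 by (rule Bochner_Integration.integral_sum[symmetric]) (rule integrable_continuous_test[OF c2 t])
 moreover have "(\<Sum>j\<in>UNIV. \<integral>x. tens u x * partial_deriv j (partial_deriv j phi) x \<partial>lborel) = (\<integral>x. tens u x * laplacian phi x \<partial>lborel)"
 unfolding laplacian_def sum_distrib_left
 by (rule Bochner_Integration.integral_sum[symmetric]) (rule integrable_continuous_test[OF c0 tpp])
 ultimately show ?thesis by simp
qed

text \<open>The derivative of a Gaussian in its variance is half its Laplacian, which is moved to
  \<open>phi\<close> by parts. As the derivative is complex, it may be taken in the imaginary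
  direction, which is time.\<close>

lemma gauss_pairing_deriv:
 fixes b :: "real ^ 'n::finite"
 assumes z0: "Re z0 > 0" and t: "test_function phi"
 shows "((%z. \<integral>x. gauss z b x * phi x \<partial>lborel) has_field_derivative (1 / 2) * (\<integral>x. gauss z0 b x * laplacian phi x \<partial>lborel)) (at z0)"
proof -
 define gz where "gz z x = (\<Sum>i\<in>UNIV. gauss1' z (x $ i - b $ i) * (\<Prod>j\<in>UNIV - {i}. gauss1 z (x $ j - b $ j)))" for z and x :: "real ^ 'n"
 define \<rho> where "\<rho> = Re z0 / 2"
 have \<rho>: "\<rho> > 0" using z0 by (simp add: \<rho>_def)
 have pos: "Re z > 0" "norm z >= \<rho>" if "z \<in> ball z0 \<rho>" for z
 proof -
 show "Re z > 0" using gauss1'_bounded(1)[OF z0] that by (simp add: \<rho>_def)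
 have "norm z0 <= norm (z0 - z) + norm z" using norm_triangle_sub[of z0 z] by (simp add: add.commute)
 moreover have "norm (z0 - z) < \<rho>" using that by (simp add: dist_norm)
 ultimately show "norm z >= \<rho>" using complex_Re_le_cmod[of z0] by (simp add: \<rho>_def)
 qed
 obtain K where K: "!!z x. z \<in> ball z0 \<rho> ==> norm (gauss1' z x) <= K"
 using gauss1'_bounded(2)[OF z0, of z0] z0 unfolding \<rho>_def by (metis centre_in_ball half_gt_zero)
 define K2 where "K2 = 1 / sqrt \<rho>"
 have K2: "norm (gauss1 z x) <= K2" if "z \<in> ball z0 \<rho>" for z x
 using gauss1_bounded[OF pos(1)[OF that], of x] pos(2)[OF that] \<rho> frac_le[of 1 1 "sqrt \<rho>" "sqrt (norm z)"] by (simp add: K2_def)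
 have K0: "K >= 0" using K[of z0 0] \<rho> norm_ge_zero order_trans by (metis centre_in_ball)
 define C where "C = (\<Sum>i\<in>(UNIV :: 'n set). K * (\<Prod>j\<in>UNIV - {i}. K2))"
 have "((%z. \<integral>x. gauss z b x * phi x \<partial>lborel) has_field_derivative (\<integral>x. gz z0 x * phi x \<partial>lborel)) (at z0)"
 proof (rule has_field_derivative_integral[where r = \<rho> and B = "%x. C * norm (phi x)"])
 show "integrable lborel (%x. gauss z b x * phi x)" if "z \<in> ball z0 \<rho>" for z
 by (rule in_L2_integrable_mult[OF gauss_in_L2[OF pos(1)[OF that]] test_function_L2(1)[OF t]])
 show "(%x. gz z0 x * phi x) \<in> borel_measurable lborel" unfolding gz_def using test_function_L2(5)[OF t] by measurable
 show "((%z. gauss z b x * phi x) has_field_derivative gz z x * phi x) (at z)" if "z \<in> ball z0 \<rho>" for z x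
 unfolding gauss_def gz_def by (intro DERIV_cmult_right has_field_derivative_prod gauss1_deriv pos(1)[OF that])
 show "norm (gz z x * phi x) <= C * norm (phi x)" if "z \<in> ball z0 \<rho>" for z x
 proof -
 have "norm (gz z x) <= (\<Sum>i\<in>UNIV. norm (gauss1' z (x $ i - b $ i) * (\<Prod>j\<in>UNIV - {i}. gauss1 z (x $ j - b $ j))))"
 unfolding gz_def by (rule norm_sum)
 also have "... <= C" unfolding C_def norm_mult prod_norm[symmetric]
 using K[OF that] K2[OF that] K0 by (intro sum_mono mult_mono prod_mono conjI prod_nonneg) auto
 finally show ?thesis by (simp add: norm_mult mult_right_mono)
 qed
 show "integrable lborel (%x. C * norm (phi x))" using test_function_L2(2)[OF t] by simp
 qed (fact \<rho>)
 also have "(\<integral>x. gz z0 x * phi x \<partial>lborel) = (1 / 2) * (\<integral>x. gauss z0 b x * laplacian phi x \<partial>lborel)"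
 proof -
 define G G1 G2 where "G i x = gauss1 z0 (x - b $ i)" and "G1 i x = - (of_real (x - b $ i) / z0) * gauss1 z0 (x - b $ i)"
 and "G2 i x = 2 * gauss1' z0 (x - b $ i)" for i x
 have dG: "(G i has_vector_derivative G1 i x) (at x)" "(G1 i has_vector_derivative G2 i x) (at x)" for i x
 using gauss1_space_deriv[OF z0] unfolding G_def[abs_def] G1_def[abs_def] G2_def by blast+
 have sG: "smooth1 (G i)" for i
 proof -
 have "smooth1 (%x. exp (- ((of_real x - of_real (b $ i))\<^sup>2) / (2 * z0)) / csqrt z0)"
 by (rule smooth1_entire[of "%w. exp (- ((w - of_real (b $ i))\<^sup>2) / (2 * z0)) / csqrt z0"])
 (use Re_pos_nonpos[OF z0] in \<open>auto intro!: holomorphic_intros\<close>)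
 then show ?thesis by (simp add: G_def[abs_def] gauss1_def)
 qed
 have tG: "tens G = gauss z0 b" by (simp add: tens_def gauss_def G_def fun_eq_iff)
 have "laplacian (tens G) x = 2 * gz z0 x" for x
 proof -
 have "tens (G(j := G2 j)) x = 2 * (gauss1' z0 (x $ j - b $ j) * (\<Prod>k\<in>UNIV - {j}. gauss1 z0 (x $ k - b $ k)))" for j
 unfolding tens_def by (subst prod.remove[of UNIV j]) (auto simp: G2_def G_def intro!: prod.cong)
 then show ?thesis by (simp add: laplacian_tens[OF dG] gz_def sum_distrib_left)
 qed
 then have "(\<integral>x. 2 * gz z0 x * phi x \<partial>lborel) = (\<integral>x. gauss z0 b x * laplacian phi x \<partial>lborel)"
 using tens_laplacian_by_parts[of G, OF sG t] by (simp add: tG)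
 then show ?thesis by (simp add: mult.assoc) (simp add: mult.commute)
 qed
 finally show ?thesis .
qed

text \<open>Pairing with Gaussians reduces the derivative to \<open>gauss_pairing_deriv\<close>, and
  \<open>group_generator\<close> upgrades the resulting weak derivative to a strong one.\<close>

lemma schr_test_deriv:
 fixes phi :: "real ^ 'n::finite => complex"
 assumes t: "test_function phi"
 shows "((%s. schr s (cj phi)) has_vector_derivative schr s (cmul (\<i> / 2) (cj (laplacian phi)))) (at s)"
proof (rule group_generator[OF schr_isometry_group gset_total])
 interpret S: isometry_group "schr :: real => 'n l2 => 'n l2" by (rule schr_isometry_group)
 note L = test_function_L2(1)[OF t] and LL = test_function_L2(4)[OF t]
 fix f :: "'n l2" and s assume "f \<in> gset"
 then obtain c z b where f: "f = gvec (c, z, b)" and z: "Re z > 0" by (auto simp: gset_def)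
 define J where "J z = (\<integral>x. gauss z b x * phi x \<partial>lborel)" for z
 have zs: "Re (z - \<i> * of_real s) > 0" for s using z by simp
 have sh: "inner f (schr s a) = inner (to_l2 (%x. c * gauss (z - \<i> * of_real s) b x)) a" for s a
 using S.T_adjoint[of "- s" f a] z gvec_eq[OF zs, of c s b] by (simp add: f schr_gvec)
 note Lg = in_L2_cmult[OF gauss_in_L2[OF zs], of c _ b]
 have e1: "inner f (schr s (cj phi)) = Re (c * J (z - \<i> * of_real s))" for s
 unfolding sh using inner_cmul_cj[OF Lg L, of s 1] by (simp add: J_def mult.assoc)
 have e2: "inner f (schr s (cmul (\<i> / 2) (cj (laplacian phi)))) = Re (c * (- \<i> * ((1 / 2) * (\<integral>x. gauss (z - \<i> * of_real s) b x * laplacian phi x \<partial>lborel))))" for s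
 unfolding sh using inner_cmul_cj[OF Lg LL, of s "\<i> / 2"] by (simp add: mult.assoc mult.left_commute)
 have "((%s. z - \<i> * complex_of_real s) has_vector_derivative - \<i>) (at s)"
 by (rule has_vector_derivative_eq_rhs, (rule has_vector_derivative_diff has_vector_derivative_const has_vector_derivative_mult_right has_vector_derivative_of_real has_vector_derivative_id DERIV_ident)+) simp
 from field_vector_diff_chain_at[OF this gauss_pairing_deriv[OF zs t, of b s, folded J_def]]
 have "((%s. J (z - \<i> * of_real s)) has_vector_derivative - \<i> * ((1 / 2) * (\<integral>x. gauss (z - \<i> * of_real s) b x * laplacian phi x \<partial>lborel))) (at s)"
 by (simp add: comp_def)
 from bounded_linear.has_vector_derivative[OF bounded_linear_Re has_vector_derivative_mult_right[OF this, of c]]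
 show "((%s. inner f (schr s (cj phi))) has_real_derivative inner f (schr s (cmul (\<i> / 2) (cj (laplacian phi))))) (at s)"
 unfolding e1 e2 by (simp add: has_real_derivative_iff_has_vector_derivative)
qed

subsection \<open>Uniqueness of weak solutions\<close>

definition weak_sol :: "real => (real => 'n::finite l2) => bool" where
 "weak_sol eps V \<longleftrightarrow> (\<forall>s. (V \<longlongrightarrow> V s) (at s)) &
 (\<forall>phi c t. test_function phi --> ((%s. inner (V s) (cmul c (cj phi))) has_real_derivative
 inner (V t) (cmul c (cmul (- \<i> * of_real (eps / 2)) (cj (laplacian phi))))) (at t))"

text \<open>On a unit ball in time \<open>V\<close> is bounded, hence the derivatives converge
  uniformly there and the limit may be differentiated.\<close>

lemma inner_deriv_closed:
 fixes V :: "real => 'h::real_inner"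
 assumes V: "!!s. (V \<longlongrightarrow> V s) (at s)" and lim: "p \<longlonglongrightarrow> psi" "q \<longlonglongrightarrow> \<xi>"
 and der: "!!k :: nat. !!t. ((%s. inner (V s) (p k)) has_real_derivative inner (V t) (q k)) (at t)"
 shows "((%s. inner (V s) psi) has_real_derivative inner (V t) \<xi>) (at t)"
proof -
 have "continuous_on (cball t 1) V" using V by (auto simp: continuous_on_def intro: tendsto_within_subset)
 then obtain M where M: "M > 0" "!!s. s \<in> cball t 1 ==> norm (V s) <= M" using compact_image_bound[OF compact_cball] by blast
 let ?S = "ball t 1"
 have "\<exists>g. \<forall>s\<in>?S. (%k. inner (V s) (p k)) \<longlonglongrightarrow> g s & (g has_derivative (%h. h * inner (V s) \<xi>)) (at s within ?S)"
 proof (rule has_derivative_sequence)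
 show "((%s. inner (V s) (p k)) has_derivative (%h. h * inner (V s) (q k))) (at s within ?S)" for k s
 using has_derivative_at_withinI[OF der[where t = s and k = k, unfolded has_field_derivative_def]]
 by (simp only: mult.commute[of _ "inner (V s) (q k)"])
 show "(%k. inner (V t) (p k)) \<longlonglongrightarrow> inner (V t) psi" by (intro tendsto_intros lim)
 fix e :: real assume e: "e > 0"
 have "eventually (%k. norm (q k - \<xi>) < e / M) sequentially"
 using tendstoD[OF lim(2), of "e / M"] e M by (simp add: dist_norm)
 then show "\<forall>\<^sub>F k in sequentially. \<forall>s\<in>?S. \<forall>h. norm (h * inner (V s) (q k) - h * inner (V s) \<xi>) <= e * norm h"
 proof eventually_elim
 case (elim k)
 show ?case
 proof (intro ballI allI)
 fix s h assume s: "s \<in> ?S"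
 have "\<bar>inner (V s) (q k - \<xi>)\<bar> <= norm (V s) * norm (q k - \<xi>)" by (rule Cauchy_Schwarz_ineq2)
 also have "... <= M * (e / M)" using M s elim by (intro mult_mono) auto
 also have "... = e" using M by simp
 finally have "\<bar>h\<bar> * \<bar>inner (V s) (q k - \<xi>)\<bar> <= \<bar>h\<bar> * e" by (intro mult_left_mono) auto
 then show "norm (h * inner (V s) (q k) - h * inner (V s) \<xi>) <= e * norm h"
 by (simp add: inner_diff_right abs_mult mult.commute flip: right_diff_distrib)
 qed
 qed
 qed auto
 then obtain g where g: "!!s. s \<in> ?S ==> (%k. inner (V s) (p k)) \<longlonglongrightarrow> g s"
 "(g has_derivative (%h. h * inner (V t) \<xi>)) (at t within ?S)" by force
 have "g s = inner (V s) psi" if "s \<in> ?S" for s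
 by (rule LIMSEQ_unique[OF g(1)[OF that]]) (intro tendsto_intros lim)
 note gs = this
 have "(g has_derivative (%h. h * inner (V t) \<xi>)) (at t)"
 using g(2) unfolding at_within_open[OF centre_in_ball[THEN iffD2, OF zero_less_one] open_ball] .
 from has_derivative_transform_within_open[OF this open_ball centre_in_ball[THEN iffD2, OF zero_less_one] gs]
 have "((%s. inner (V s) psi) has_derivative (%h. h * inner (V t) \<xi>)) (at t)" .
 then show ?thesis unfolding has_field_derivative_def by (simp only: mult.commute[of _ "inner (V t) \<xi>"])
qed

text \<open>The vector \<xi> does not depend on the solution \<open>V\<close>, so it can be
  identified afterwards by inserting solutions that are known explicitly.\<close>

lemma weak_sol_gauss:
 fixes b :: "real ^ 'n::finite"
 assumes z: "Re z > 0"
 obtains \<xi> :: "'n l2" where "!!V t. weak_sol eps V ==> ((%s. inner (V s) (gvec (c, z, b))) has_real_derivative inner (V t) \<xi>) (at t)"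
proof -
 have z': "Re (cnj z) > 0" using z by simp
 obtain g M where g: "!!k :: nat. ttest (g k)" "!!k. in_L2 (tens (g k))" "!!k. in_L2 (laplacian (tens (g k)))"
 "(%k. to_l2 (tens (g k))) \<longlonglongrightarrow> to_l2 (gauss (cnj z) b)" "(%k. to_l2 (laplacian (tens (g k)))) \<longlonglongrightarrow> M"
 using gauss_test_approx[OF z', of b] by metis
 obtain M1 where M1: "(%k. cj (tens (g k))) \<longlonglongrightarrow> M1" "!!h. in_L2 h ==> to_l2 (gauss (cnj z) b) = to_l2 h ==> M1 = cj h"
 using cj_tendsto[of "%k. tens (g k)", OF g(2,4)] by blast
 obtain M2 where M2: "(%k. cj (laplacian (tens (g k)))) \<longlonglongrightarrow> M2"
 using cj_tendsto[of "%k. laplacian (tens (g k))", OF g(3,5)] by blast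
 have "M1 = to_l2 (gauss z b)" using M1(2)[OF gauss_in_L2[OF z'] refl] z' by (simp add: cj_def cnj_gauss)
 then have c1: "cmul c M1 = gvec (c, z, b)" using z by (simp add: gvec_eq cmul_to_l2 gauss_in_L2)
 note bt = bounded_linear.tendsto[OF cmul_bounded_linear]
 show ?thesis
 proof (rule that[of "cmul c (cmul (- \<i> * of_real (eps / 2)) M2)"])
 fix V :: "real => 'n l2" and t assume V: "weak_sol eps V"
 show "((%s. inner (V s) (gvec (c, z, b))) has_real_derivative inner (V t) (cmul c (cmul (- \<i> * of_real (eps / 2)) M2))) (at t)"
 unfolding c1[symmetric]
 proof (rule inner_deriv_closed[OF _ bt[OF M1(1)] bt[OF bt[OF M2]]])
 show "(V \<longlongrightarrow> V s) (at s)" for s using V by (simp add: weak_sol_def)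
 show "((%s. inner (V s) (cmul c (cj (tens (g k))))) has_real_derivative inner (V t) (cmul c (cmul (- \<i> * of_real (eps / 2)) (cj (laplacian (tens (g k))))))) (at t)" for k t
 using V ttest_test[OF g(1)] unfolding weak_sol_def by blast
 qed
 qed
qed

lemma weak_sol_schr: "weak_sol eps (%t. schr (eps * t) (a :: 'n::finite l2))"
 unfolding weak_sol_def
proof (intro conjI allI impI)
 interpret S: isometry_group "schr :: real => 'n l2 => 'n l2" by (rule schr_isometry_group)
 show "((%t. schr (eps * t) a) \<longlongrightarrow> schr (eps * s) a) (at s)" for s
 by (intro S.T_tendsto tendsto_intros)
 fix phi :: "real ^ 'n => complex" and c t assume t: "test_function phi"
 have "((%s. (- eps) * s) has_vector_derivative - eps) (at t)"
 unfolding has_real_derivative_iff_has_vector_derivative[symmetric] by (auto intro!: derivative_eq_intros)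
 from vector_diff_chain_at[OF this schr_test_deriv[OF t]]
 have "((%s. schr (- eps * s) (cj phi)) has_vector_derivative (- eps) *\<^sub>R schr (- eps * t) (cmul (\<i> / 2) (cj (laplacian phi)))) (at t)"
 by (simp add: comp_def)
 from bounded_linear.has_vector_derivative[OF bounded_linear_compose[OF bounded_linear_inner_right[of a] cmul_bounded_linear[of c]] this]
 have d: "((%s. inner a (cmul c (schr (- eps * s) (cj phi)))) has_real_derivative
 inner a (cmul c ((- eps) *\<^sub>R schr (- eps * t) (cmul (\<i> / 2) (cj (laplacian phi)))))) (at t)"
 by (simp add: has_real_derivative_iff_has_vector_derivative)
 have e: "inner (schr (eps * s) a) (cmul c x) = inner a (cmul c (schr (- eps * s) x))" for s x
 using S.T_adjoint[of "eps * s" a "cmul c x"] by (simp add: schr_cmul)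
 have "cmul (- \<i> * of_real (eps / 2)) x = (- eps) *\<^sub>R cmul (\<i> / 2) x" for x :: "'n l2"
 by (simp only: cmul_of_real[symmetric] cmul_cmul) (simp add: mult.commute)
 then show "((%s. inner (schr (eps * s) a) (cmul c (cj phi))) has_real_derivative
 inner (schr (eps * t) a) (cmul c (cmul (- \<i> * of_real (eps / 2)) (cj (laplacian phi))))) (at t)"
 using d unfolding e by (simp only: S.T_simps)
qed

lemma total_set_zero:
 fixes x :: "'a::real_inner"
 assumes "total_set S" "!!s. s \<in> S ==> inner x s = 0"
 shows "x = 0"
proof -
 have "inner x y = 0" if "y \<in> span S" for y
 using that by (induction rule: span_induct_alt) (auto simp: inner_simps assms(2))
 then have "norm x <= 0" by (intro total_set_norm_le[OF assms(1)]) auto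
 then show ?thesis by simp
qed

lemma has_vector_derivative_quotient:
 assumes "(f has_vector_derivative f') (at t)"
 shows "((%h. (f (t + h) - f t) /\<^sub>R h) \<longlongrightarrow> f') (at 0)"
proof (rule LIM_zero_cancel, rule tendsto_norm_zero_cancel)
 have "((%h. norm (f (t + h) - f t - h *\<^sub>R f') / norm h) \<longlongrightarrow> 0) (at 0)"
 using assms by (simp add: has_vector_derivative_def has_derivative_at)
 then show "((%h. norm ((f (t + h) - f t) /\<^sub>R h - f')) \<longlongrightarrow> 0) (at 0)"
 proof (rule Lim_transform_eventually)
 have "norm (f (t + h) - f t - h *\<^sub>R f') / norm h = norm ((f (t + h) - f t) /\<^sub>R h - f')" if "h ~= 0" for h
 proof -
 have "(f (t + h) - f t) /\<^sub>R h - f' = (f (t + h) - f t - h *\<^sub>R f') /\<^sub>R h"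
 using that by (simp add: scaleR_diff_right)
 then show ?thesis by (simp add: divide_inverse mult.commute)
 qed
 then show "\<forall>\<^sub>F h in at 0. norm (f (t + h) - f t - h *\<^sub>R f') / norm h = norm ((f (t + h) - f t) /\<^sub>R h - f')"
 by (simp add: eventually_at_filter)
 qed
qed

text \<open>For a Gaussian \<open>psi\<close> the pairing of \<open>V s\<close> with
  \<open>schr (eps * s) psi\<close> has derivative zero, since the two generators cancel. The flow
  maps Gaussians to Gaussians, so they can serve as moving test vectors, and they are total.\<close>

lemma weak_sol_unique:
 fixes V :: "real => 'n::finite l2"
 assumes V: "weak_sol eps V" shows "V t = schr (eps * t) (V 0)"
proof -
 interpret S: isometry_group "schr :: real => 'n l2 => 'n l2" by (rule schr_isometry_group)
 let ?T = "%t. schr (- eps * t) :: 'n l2 => 'n l2"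
 have Tg: "isometry_group ?T"
 proof (rule isometry_group.intro)
 show "((%t. schr (- eps * t) x) \<longlongrightarrow> x) (at 0)" for x :: "'n l2"
 using S.T_tendsto[OF tendsto_const[of x] tendsto_mult_right_zero[OF tendsto_ident_at[of 0 UNIV], of "- eps"]] by simp
 show "schr (- eps * (s + t)) x = schr (- eps * s) (schr (- eps * t) x)" for s t and x :: "'n l2"
 by (simp only: distrib_left schr_add)
 qed (auto simp: schr_bounded_linear schr_0)
 have const: "inner (V t) (schr (eps * t) psi) = inner (V 0) psi" if psi: "psi \<in> gset" for psi t
 proof -
 obtain c z b where p: "psi = gvec (c, z, b)" and z: "Re z > 0" using psi by (auto simp: gset_def)
 obtain \<xi> where \<xi>: "!!V t. weak_sol eps V ==> ((%s. inner (V s) psi) has_real_derivative inner (V t) \<xi>) (at t)"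
 using weak_sol_gauss[OF z, of eps c b] unfolding p by metis
 have adj: "inner (schr (eps * t) f) g = inner f (schr (- eps * t) g)" for t and f g :: "'n l2"
 using S.T_adjoint[of "eps * t" f g] by simp
 have sd: "((%t. schr (- eps * t) psi) has_vector_derivative schr (- eps * t) \<xi>) (at t)" for t
 proof (rule group_generator[OF Tg gset_total])
 fix f s
 show "((%s. inner f (schr (- eps * s) psi)) has_real_derivative inner f (schr (- eps * s) \<xi>)) (at s)"
 using \<xi>[OF weak_sol_schr[of eps f], of s] unfolding adj .
 qed
 have sd': "((%t. schr (eps * t) psi) has_vector_derivative - schr (eps * t) \<xi>) (at t)" for t
 proof -
 have "((%s::real. - s) has_vector_derivative - 1) (at t)"
 unfolding has_real_derivative_iff_has_vector_derivative[symmetric] by (auto intro!: derivative_eq_intros)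
 from vector_diff_chain_at[OF this sd] show ?thesis by (simp add: comp_def)
 qed
 have wd: "((%s. inner (V s) (schr (eps * t) psi)) has_real_derivative inner (V t) (schr (eps * t) \<xi>)) (at t)" for t
 proof -
 have z': "Re (z + \<i> * of_real (eps * t)) > 0" using z by simp
 have pt: "schr (eps * t) psi = gvec (c, z + \<i> * of_real (eps * t), b)" using z by (simp add: p schr_gvec)
 obtain \<xi>' where \<xi>': "!!V s. weak_sol eps V ==> ((%s. inner (V s) (schr (eps * t) psi)) has_real_derivative inner (V s) \<xi>') (at s)"
 using weak_sol_gauss[OF z', of eps c b] unfolding pt by metis
 \<comment> \<open>\<xi>' is the vector attached to the moved Gaussian. Differentiating one pairing
   at time 0 along an arbitrary free evolution in two ways shows that it is the moved \<xi>.\<close>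
 have "inner f \<xi>' = inner f (schr (eps * t) \<xi>)" for f
 proof -
 have 1: "((%s. inner (schr (eps * s) f) (schr (eps * t) psi)) has_real_derivative inner f \<xi>') (at 0)"
 using \<xi>'[OF weak_sol_schr[of eps f], of 0] by (simp add: schr_0)
 have "inner (schr (eps * s) f) (schr (eps * t) psi) = inner (schr (eps * s) (schr (- eps * t) f)) psi" for s
 using S.T_adjoint[of "- (eps * t)" "schr (eps * s) f" psi] by (simp add: S.T_commute)
 then have 2: "((%s. inner (schr (eps * s) f) (schr (eps * t) psi)) has_real_derivative inner (schr (- eps * t) f) \<xi>) (at 0)"
 using \<xi>[OF weak_sol_schr[of eps "schr (- eps * t) f"], of 0] by (simp add: schr_0)
 show ?thesis using DERIV_unique[OF 1 2] S.T_adjoint[of "- (eps * t)" f \<xi>] by simp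
 qed
 then have "\<xi>' = schr (eps * t) \<xi>" by (metis vector_eq_ldot)
 then show ?thesis using \<xi>'[OF V, of t] by simp
 qed
 have "((%s. inner (V s) (schr (eps * s) psi)) has_real_derivative 0) (at t)" for t
 unfolding DERIV_def
 proof -
 let ?p = "schr (eps * t) psi"
 have V0: "((%h. V (t + h)) \<longlongrightarrow> V t) (at 0)"
 using V LIM_offset_zero_iff[of t V "V t"] by (simp add: weak_sol_def)
 have 1: "((%h. (inner (V (t + h)) ?p - inner (V t) ?p) / h) \<longlongrightarrow> inner (V t) (schr (eps * t) \<xi>)) (at 0)"
 using wd[of t] by (simp add: DERIV_def)
 have "((%h. (schr (eps * (t + h)) psi - ?p) /\<^sub>R h) \<longlongrightarrow> - schr (eps * t) \<xi>) (at 0)"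
 using has_vector_derivative_quotient[OF sd'[of t]] .
 from tendsto_add[OF 1 tendsto_inner[OF V0 this]]
 have "((%h. (inner (V (t + h)) ?p - inner (V t) ?p) / h + inner (V (t + h)) ((schr (eps * (t + h)) psi - ?p) /\<^sub>R h)) \<longlongrightarrow> 0) (at 0)"
 by simp
 then show "((%h. (inner (V (t + h)) (schr (eps * (t + h)) psi) - inner (V t) (schr (eps * t) psi)) / h) \<longlongrightarrow> 0) (at 0)"
 by (rule Lim_transform_eventually) (auto simp: eventually_at_filter inner_diff_right field_simps)
 qed
 then have "inner (V t) (schr (eps * t) psi) = inner (V 0) (schr (eps * 0) psi)"
 by (intro DERIV_isconst_all) auto
 then show ?thesis by (simp add: schr_0)
 qed
 have "schr (- (eps * t)) (V t) - V 0 = 0"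
 by (rule total_set_zero[OF gset_total]) (use const S.T_adjoint[of "- (eps * t)" "V t"] in \<open>simp add: inner_diff_left\<close>)
 then have "schr (eps * t) (schr (- (eps * t)) (V t)) = schr (eps * t) (V 0)" by simp
 then show ?thesis by simp
qed

subsection \<open>The propagator\<close>

lemma solution_weak_sol:
 fixes v :: "real => real ^ 'n::finite => complex"
 assumes e: "eps > 0" and v: "free_schroedinger_solution eps u v"
 shows "weak_sol eps (%t. to_l2 (v t))"
proof -
 have L: "in_L2 (v t)" for t using v by (simp add: free_schroedinger_solution_def)
 show ?thesis
 unfolding weak_sol_def
 proof (intro conjI allI impI)
 fix s
 have "((%t. Lp_norm 2 (%x. v t x - v s x)) \<longlongrightarrow> 0) (at s)" using v by (simp add: free_schroedinger_solution_def)
 moreover have "Lp_norm 2 (%x. v t x - v s x) = ennreal (norm (to_l2 (v t) - to_l2 (v s)))" for t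
 using Lp_norm_to_l2[OF in_L2_diff[OF L L]] by (simp add: to_l2_diff L)
 ultimately have "((%t. ennreal (norm (to_l2 (v t) - to_l2 (v s)))) \<longlongrightarrow> ennreal 0) (at s)" by simp
 then have "((%t. norm (to_l2 (v t) - to_l2 (v s))) \<longlongrightarrow> 0) (at s)" by (subst (asm) tendsto_ennreal_iff) auto
 then show "((%t. to_l2 (v t)) \<longlongrightarrow> to_l2 (v s)) (at s)" by (simp add: tendsto_norm_zero_iff LIM_zero_iff)
 next
 fix phi :: "real ^ 'n => complex" and c t assume t: "test_function phi"
 let ?L = "\<integral>x. v t x * laplacian phi x \<partial>lborel"
 obtain D where D: "((%s. \<integral>x. v s x * phi x \<partial>lborel) has_vector_derivative D) (at t)"
 "\<i> * complex_of_real eps * D + complex_of_real (eps\<^sup>2 / 2) * ?L = 0"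
 using v t unfolding free_schroedinger_solution_def by blast
 have D': "D = \<i> * of_real (eps / 2) * ?L"
 proof -
 have "\<i> * complex_of_real eps * (D - \<i> * of_real (eps / 2) * ?L) = \<i> * complex_of_real eps * D + complex_of_real (eps\<^sup>2 / 2) * ?L"
 by (simp add: algebra_simps power2_eq_square)
 then show ?thesis using D(2) e by simp
 qed
 have "((%s. Re (cnj c * (\<integral>x. v s x * phi x \<partial>lborel))) has_vector_derivative Re (cnj c * D)) (at t)"
 by (intro bounded_linear.has_vector_derivative[OF bounded_linear_Re] has_vector_derivative_mult_right D(1))
 moreover have "inner (to_l2 (v t)) (cmul c (cmul (- \<i> * of_real (eps / 2)) (cj (laplacian phi)))) = Re (cnj c * D)"
 using inner_cmul_cj[OF L test_function_L2(4)[OF t], of t "c * (- \<i> * of_real (eps / 2))"] unfolding D' cmul_cmul by (simp add: mult.assoc)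
 ultimately show "((%s. inner (to_l2 (v s)) (cmul c (cj phi))) has_real_derivative
 inner (to_l2 (v t)) (cmul c (cmul (- \<i> * of_real (eps / 2)) (cj (laplacian phi))))) (at t)"
 by (simp only: inner_cmul_cj[OF L test_function_L2(1)[OF t]] has_real_derivative_iff_has_vector_derivative)
 qed
qed

lemma solution_exists:
 fixes u :: "real ^ 'n::finite => complex"
 assumes u: "in_L2 u"
 shows "free_schroedinger_solution eps u (%t. l2_fun (schr (eps * t) (to_l2 u)))"
 unfolding free_schroedinger_solution_def
proof (intro conjI allI impI)
 interpret S: isometry_group "schr :: real => 'n l2 => 'n l2" by (rule schr_isometry_group)
 let ?V = "%t. schr (eps * t) (to_l2 u)"
 show "in_L2 (l2_fun (?V t))" for t by simp
 show "AE x in lborel. l2_fun (?V 0) x = u x" using l2_fun_to_l2[OF u] by (simp add: schr_0)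
 fix s
 have "((%t. ?V t) \<longlongrightarrow> ?V s) (at s)" by (intro S.T_tendsto tendsto_intros)
 then have "((%t. ennreal (norm (?V t - ?V s))) \<longlongrightarrow> ennreal 0) (at s)"
 by (intro tendsto_ennrealI tendsto_norm_zero LIM_zero)
 moreover have "Lp_norm 2 (%x. l2_fun (?V t) x - l2_fun (?V s) x) = ennreal (norm (?V t - ?V s))" for t
 using Lp_norm_to_l2[OF in_L2_diff[OF in_L2_l2_fun in_L2_l2_fun]] by (simp add: to_l2_diff)
 ultimately show "((%t. Lp_norm 2 (%x. l2_fun (?V t) x - l2_fun (?V s) x)) \<longlongrightarrow> 0) (at s)" by simp
next
 let ?V = "%t. schr (eps * t) (to_l2 u)"
 fix phi :: "real ^ 'n => complex" and t assume t: "test_function phi"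
 let ?L = "\<integral>x. l2_fun (?V t) x * laplacian phi x \<partial>lborel"
 let ?D = "\<i> * of_real (eps / 2) * ?L"
 have d: "((%s. Re (cnj c * (\<integral>x. l2_fun (?V s) x * phi x \<partial>lborel))) has_real_derivative Re (cnj c * ?D)) (at t)" for c
 proof -
 have 1: "((%s. inner (?V s) (cmul c (cj phi))) has_real_derivative
 inner (?V t) (cmul c (cmul (- \<i> * of_real (eps / 2)) (cj (laplacian phi))))) (at t)"
 using weak_sol_schr[of eps "to_l2 u"] t unfolding weak_sol_def by blast
 have 2: "inner (?V s) (cmul c (cj phi)) = Re (cnj c * (\<integral>x. l2_fun (?V s) x * phi x \<partial>lborel))" for s
 using inner_cmul_cj[OF in_L2_l2_fun test_function_L2(1)[OF t], of "?V s" c] by simp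
 have 3: "inner (?V t) (cmul c (cmul (- \<i> * of_real (eps / 2)) (cj (laplacian phi)))) = Re (cnj c * ?D)"
 using inner_cmul_cj[OF in_L2_l2_fun test_function_L2(4)[OF t], of "?V t" "c * (- \<i> * of_real (eps / 2))"]
 unfolding cmul_cmul by (simp add: mult.assoc)
 show ?thesis using 1 unfolding 2 3 .
 qed
 have "((%s. \<integral>x. l2_fun (?V s) x * phi x \<partial>lborel) has_vector_derivative ?D) (at t)"
 using d[of 1] d[of "\<i>"] by (simp add: has_vector_derivative_complex_iff has_real_derivative_iff_has_vector_derivative)
 moreover have "\<i> * complex_of_real eps * ?D + complex_of_real (eps\<^sup>2 / 2) * ?L = 0"
 by (simp add: power2_eq_square algebra_simps)
 ultimately show "\<exists>D. ((%s. \<integral>x. l2_fun (?V s) x * phi x \<partial>lborel) has_vector_derivative D) (at t) &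
 \<i> * complex_of_real eps * D + complex_of_real (eps\<^sup>2 / 2) * ?L = 0" by blast
qed

text \<open>Existence makes the chosen function a solution, and uniqueness of weak solutions
  identifies its class with the rescaled unitary flow.\<close>

lemma free_propagator_eq:
 fixes u :: "real ^ 'n::finite => complex"
 assumes u: "in_L2 u" and e: "eps > 0"
 shows "in_L2 (free_propagator eps t u)" "to_l2 (free_propagator eps t u) = schr (eps * t) (to_l2 u)"
proof -
 define v where "v = (SOME v. free_schroedinger_solution eps u v)"
 have v: "free_schroedinger_solution eps u v" unfolding v_def using solution_exists[OF u] by (rule someI[where P = "free_schroedinger_solution eps u"])
 have vt: "free_propagator eps t u = v t" for t by (simp add: free_propagator_def v_def)
 show "in_L2 (free_propagator eps t u)" using v by (simp add: vt free_schroedinger_solution_def)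
 have "to_l2 (v 0) = to_l2 u" by (rule to_l2_cong) (use v in \<open>simp add: free_schroedinger_solution_def\<close>)
 then show "to_l2 (free_propagator eps t u) = schr (eps * t) (to_l2 u)"
 using weak_sol_unique[OF solution_weak_sol[OF e v], of t] by (simp add: vt)
qed

section \<open>Weak derivatives and difference quotients\<close>

lemma partial_deriv_shift:
 fixes phi :: "real ^ 'n => complex"
 assumes "!!x. phi differentiable (at x)"
 shows "(%x. phi (x + y)) differentiable (at x)"
 "partial_deriv i (%x. phi (x + y)) = (%x. partial_deriv i phi (x + y))"
proof -
 have d: "((%x. phi (x + y)) has_derivative frechet_derivative phi (at (x + y))) (at x)" for x
 proof -
 have "((%x. x + y) has_derivative (%h. h)) (at x)" by (auto intro!: derivative_eq_intros)
 moreover have "(phi has_derivative frechet_derivative phi (at (x + y))) (at (x + y))"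
 using assms frechet_derivative_works by blast
 ultimately show ?thesis by (rule has_derivative_compose)
 qed
 then show "(%x. phi (x + y)) differentiable (at x)" unfolding differentiable_def by blast
 show "partial_deriv i (%x. phi (x + y)) = (%x. partial_deriv i phi (x + y))"
 unfolding partial_deriv_def by (rule ext) (simp add: frechet_derivative_at[OF d, symmetric])
qed

lemma C_k_shift:
 fixes phi :: "real ^ 'n => complex"
 shows "C_k k phi ==> C_k k (%x. phi (x + y))"
proof (induction k arbitrary: phi)
 case 0
 then show ?case by (auto intro!: continuous_intros continuous_on_compose2[of UNIV phi])
next
 case (Suc k)
 then have d: "phi differentiable (at x)" for x by (simp add: differentiable_on_def)
 show ?case using Suc partial_deriv_shift[OF d] by (simp add: differentiable_on_def)
qed

lemma test_function_shift:
 fixes phi :: "real ^ 'n => complex"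
 assumes t: "test_function phi"
 shows "test_function (%x. phi (x + y))"
proof -
 obtain R C where R: "!!x. norm x > R ==> phi x = 0" using test_function_bounds[OF t] by metis
 have "x \<in> cball 0 (R + norm y)" if x: "phi (x + y) ~= 0" for x
 proof -
 have "norm (x + y) <= R" using R[of "x + y"] x by force
 then show ?thesis using norm_triangle_ineq4[of "x + y" y] by simp
 qed
 then have "bounded {x. phi (x + y) ~= 0}" by (intro bounded_subset[OF bounded_cball]) blast
 then show ?thesis using t C_k_shift unfolding test_function_def by (auto simp: compact_closure)
qed

lemma quotient_has_vector_derivative:
 assumes "((%h. (f h - f 0) /\<^sub>R h) \<longlongrightarrow> f') (at 0)"
 shows "(f has_vector_derivative f') (at 0)"
proof -
 have "((%h. norm ((f h - f 0) /\<^sub>R h - f')) \<longlongrightarrow> 0) (at 0)"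
 by (rule tendsto_norm_zero) (rule LIM_zero[OF assms])
 then have "((%h. norm (f h - f 0 - h *\<^sub>R f') / norm h) \<longlongrightarrow> 0) (at 0)"
 proof (rule Lim_transform_eventually)
 have "norm ((f h - f 0) /\<^sub>R h - f') = norm (f h - f 0 - h *\<^sub>R f') / norm h" if "h ~= 0" for h
 proof -
 have "(f h - f 0) /\<^sub>R h - f' = (f h - f 0 - h *\<^sub>R f') /\<^sub>R h"
 using that by (simp add: scaleR_diff_right)
 then show ?thesis by (simp add: divide_inverse mult.commute)
 qed
 then show "\<forall>\<^sub>F h in at 0. norm ((f h - f 0) /\<^sub>R h - f') = norm (f h - f 0 - h *\<^sub>R f') / norm h"
 by (simp add: eventually_at_filter)
 qed
 then show ?thesis unfolding has_vector_derivative_def has_derivative_at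
 by (simp add: bounded_linear_scaleR_left)
qed

text \<open>The difference quotients converge pointwise. For increments of size at most 1 the
  Lipschitz constant \<open>C\<close> and the ball of radius \<open>R + 1\<close> dominate them,
  which gives convergence in norm.\<close>

lemma test_function_quotient:
 fixes phi :: "real ^ 'n::finite => complex"
 assumes t: "test_function phi"
 shows "((%h. tr (h *\<^sub>R axis i 1) (cj phi)) has_vector_derivative cj (partial_deriv i phi)) (at 0)"
proof -
 let ?d = "partial_deriv i phi"
 obtain R C where R: "R > 0" "!!x. norm x > R ==> phi x = 0" using test_function_bounds[OF t] by metis
 obtain R' C where C: "C >= 0" "!!x. norm (?d x) <= C" using test_function_bounds[OF test_function_partial(1)[OF t]] by metis
 note L = test_function_L2(1)[OF t] and Ld = test_function_L2(3)[OF t, of i]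
 have der: "((%h. phi (x + h *\<^sub>R axis i 1)) has_vector_derivative ?d (x + h *\<^sub>R axis i 1)) (at h)" for x h
 by (rule has_derivative_partial_line) (rule test_function_partial(2)[OF t])
 define q where "q h x = (phi (x + h *\<^sub>R axis i 1) - phi x) /\<^sub>R h - ?d x" for h x
 have Lq: "in_L2 (q h)" for h unfolding q_def by (intro in_L2_diff in_L2_scaleR in_L2_shift L Ld)
 have eq: "(tr (h *\<^sub>R axis i 1) (cj phi) - cj phi) /\<^sub>R h - cj ?d = cj (q h)" for h
 proof -
 let ?y = "h *\<^sub>R axis i 1"
 note L1 = in_L2_cnj[OF L] and L2 = in_L2_cnj[OF in_L2_shift[OF L]] and L3 = in_L2_cnj[OF Ld]
 have 1: "tr ?y (cj phi) = to_l2 (%x. cnj (phi (x + ?y)))" unfolding cj_def by (rule tr_to_l2[OF L1])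
 have 2: "(%x. cnj (q h x)) = (%x. (cnj (phi (x + ?y)) - cnj (phi x)) /\<^sub>R h - cnj (?d x))"
 unfolding q_def by (simp only: complex_cnj_diff complex_cnj_scaleR)
 show ?thesis unfolding 1 unfolding cj_def 2
 by (simp only: to_l2_diff to_l2_scaleR in_L2_diff in_L2_scaleR L1 L2 L3)
 qed
 have lip: "norm (phi (x + h *\<^sub>R axis i 1) - phi x) <= C * \<bar>h\<bar>" for x h
 proof -
 have "norm (phi (x + h *\<^sub>R axis i 1) - phi (x + 0 *\<^sub>R axis i 1)) <= C * norm (h - 0)"
 proof (rule differentiable_bound[where S = UNIV and f' = "%h k. k *\<^sub>R ?d (x + h *\<^sub>R axis i 1)"])
 show "((%h. phi (x + h *\<^sub>R axis i 1)) has_derivative (%k. k *\<^sub>R ?d (x + h *\<^sub>R axis i 1))) (at h within UNIV)" for h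
 using der by (simp add: has_vector_derivative_def)
 show "onorm (%k. k *\<^sub>R ?d (x + h *\<^sub>R axis i 1)) <= C" for h
 proof (rule onorm_bound[OF C(1)])
 show "norm (k *\<^sub>R ?d (x + h *\<^sub>R axis i 1)) <= C * norm k" for k
 using mult_right_mono[OF C(2), of "\<bar>k\<bar>"] by (simp add: mult.commute)
 qed
 qed auto
 then show ?thesis by simp
 qed
 have bd: "(norm (q h x))\<^sup>2 <= (2 * C)\<^sup>2 * indicator (cball 0 (R + 1)) x" if h: "\<bar>h\<bar> <= 1" for h x
 proof (cases "norm x <= R + 1")
 case True
 have "norm (q h x) <= norm ((phi (x + h *\<^sub>R axis i 1) - phi x) /\<^sub>R h) + norm (?d x)" unfolding q_def by (rule norm_triangle_ineq4)
 also have "norm ((phi (x + h *\<^sub>R axis i 1) - phi x) /\<^sub>R h) <= C"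
 unfolding norm_scaleR using lip[of x h] C(1) by (cases "h = 0") (auto simp: divide_simps mult.commute)
 finally have "norm (q h x) <= 2 * C" using C(2)[of x] by simp
 then show ?thesis using True power_mono[of "norm (q h x)" "2 * C" 2] by (simp add: power_mult_distrib)
 next
 case False
 have "norm (x + h *\<^sub>R axis i 1) > R"
 proof -
 have "norm x <= norm (x + h *\<^sub>R axis i 1) + norm (h *\<^sub>R axis i (1::real) :: real ^ 'n)" using norm_triangle_ineq4[of "x + h *\<^sub>R axis i 1" "h *\<^sub>R axis i 1"] by simp
 then show ?thesis using False h by simp
 qed
 moreover have "?d x = 0"
 proof -
 have "((%h. phi (x + h *\<^sub>R axis i 1)) has_vector_derivative 0) (at 0)"
 proof (rule has_vector_derivative_transform_within_open[OF has_vector_derivative_const[of 0], where S = "ball 0 1"])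
 fix k :: real assume "k \<in> ball 0 1"
 then have "norm (x + k *\<^sub>R axis i 1) > R" using False norm_triangle_ineq4[of "x + k *\<^sub>R axis i 1" "k *\<^sub>R axis i 1"] by simp
 then show "0 = phi (x + k *\<^sub>R axis i 1)" using R(2) by simp
 qed auto
 from vector_derivative_unique_at[OF this der] show ?thesis by simp
 qed
 ultimately have "q h x = 0" using R False by (simp add: q_def)
 then show ?thesis by simp
 qed
 have "((%h. cj (q h)) \<longlongrightarrow> 0) (at 0)"
 unfolding tendsto_at_iff_sequentially comp_def
 proof (intro allI impI)
 fix X' :: "nat => real" assume X0': "\<forall>k. X' k \<in> UNIV - {0}" and X': "X' \<longlonglongrightarrow> 0"
 obtain k0 where k0: "!!k. k >= k0 ==> \<bar>X' k\<bar> <= 1"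
 using tendstoD[OF X', of 1] by (auto simp: eventually_sequentially) (metis less_imp_le)
 define X where "X k = X' (k + k0)" for k
 have X0: "\<forall>k. X k \<in> UNIV - {0}" and X: "X \<longlonglongrightarrow> 0" and X1: "!!k. \<bar>X k\<bar> <= 1"
 using X0' LIMSEQ_ignore_initial_segment[OF X', of k0] k0 by (auto simp: X_def[abs_def])
 have "(%k. \<integral>x. (norm (q (X k) x))\<^sup>2 \<partial>lborel) \<longlonglongrightarrow> (\<integral>x. 0 \<partial>(lborel :: (real ^ 'n) measure))"
 proof (rule integral_dominated_convergence[where w = "%x. (2 * C)\<^sup>2 * indicator (cball 0 (R + 1)) x"])
 show "AE x in lborel. (%k. (norm (q (X k) x))\<^sup>2) \<longlonglongrightarrow> 0"
 proof (rule AE_I2)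
 fix x
 have "((%h. q h x) \<longlongrightarrow> 0) (at 0)"
 using LIM_zero[OF has_vector_derivative_quotient[OF der[of x 0]]] by (simp add: q_def)
 then have "(%k. q (X k) x) \<longlonglongrightarrow> 0" using X X0 unfolding tendsto_at_iff_sequentially comp_def by blast
 from tendsto_power[OF tendsto_norm[OF this], of 2] show "(%k. (norm (q (X k) x))\<^sup>2) \<longlonglongrightarrow> 0" by simp
 qed
 show "AE x in lborel. norm ((norm (q (X k) x))\<^sup>2) <= (2 * C)\<^sup>2 * indicator (cball 0 (R + 1)) x" for k
 using bd[OF X1] by (intro AE_I2) (simp only: real_norm_def abs_power2)
 show "(%x. (norm (q (X k) x))\<^sup>2) \<in> borel_measurable lborel" for k using in_L2_integrable[OF Lq] by (rule borel_measurable_integrable)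
 show "integrable lborel (%x :: real ^ 'n. (2 * C)\<^sup>2 * indicator (cball 0 (R + 1)) x :: real)" by (rule integrable_indicator_cball)
 qed simp
 then have "(%k. (norm (cj (q (X k))))\<^sup>2) \<longlonglongrightarrow> 0" by (simp add: cj_def norm_to_l2 in_L2_cnj Lq)
 from tendsto_real_sqrt[OF this] have "(%k. norm (cj (q (X k)))) \<longlonglongrightarrow> 0" by simp
 then have "(%k. cj (q (X' (k + k0)))) \<longlonglongrightarrow> 0" unfolding X_def by (rule tendsto_norm_zero_cancel)
 then show "(%k. cj (q (X' k))) \<longlonglongrightarrow> 0" by (rule LIMSEQ_offset)
 qed
 then have 1: "((%h. (tr (h *\<^sub>R axis i 1) (cj phi) - cj phi) /\<^sub>R h) \<longlongrightarrow> cj ?d) (at 0)"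
 unfolding eq[symmetric] by (rule LIM_zero_cancel)
 interpret S: isometry_group "tr :: real ^ 'n => 'n l2 => 'n l2" by (rule tr_isometry_group)
 show ?thesis by (rule quotient_has_vector_derivative) (use 1 in simp)
qed

text \<open>The strong partial derivative, taken as the generator of a translation group. In this
  form it passes through any bounded operator commuting with translations, in particular through the
  free flow.\<close>

definition gder :: "'n => 'n::finite l2 => 'n l2 => bool" where
 "gder i a G \<longleftrightarrow> ((%h. tr (h *\<^sub>R axis i 1) a) has_vector_derivative G) (at 0)"

lemma tr_line_group: "isometry_group (%h. tr (h *\<^sub>R y) :: 'n::finite l2 => 'n l2)"
proof -
 interpret S: isometry_group "tr :: real ^ 'n => 'n l2 => 'n l2" by (rule tr_isometry_group)
 show ?thesis
 proof (rule isometry_group.intro)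
 show "((%h. tr (h *\<^sub>R y) x) \<longlongrightarrow> x) (at 0)" for x :: "'n l2"
 using S.T_tendsto[OF tendsto_const[of x] tendsto_scaleR[OF tendsto_ident_at tendsto_const], of y 0 UNIV] by simp
 qed (auto simp: S.T_blin scaleR_add_left S.T_add)
qed

lemma gder_at:
 assumes "gder i a G"
 shows "((%h. tr (h *\<^sub>R axis i 1) a) has_vector_derivative tr (h *\<^sub>R axis i 1) G) (at h)"
proof -
 interpret L: isometry_group "%h. tr (h *\<^sub>R axis i 1) :: 'a l2 => 'a l2" by (rule tr_line_group)
 have "((%s. s - h) has_vector_derivative 1) (at h)"
 unfolding has_real_derivative_iff_has_vector_derivative[symmetric] by (auto intro!: derivative_eq_intros)
 from vector_diff_chain_at[OF this, of "%s. tr (s *\<^sub>R axis i 1) a" G] assms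
 have "((%s. tr ((s - h) *\<^sub>R axis i 1) a) has_vector_derivative G) (at h)" by (simp add: gder_def comp_def)
 from bounded_linear.has_vector_derivative[OF L.T_blin[of h] this]
 show ?thesis by (simp add: L.T_add[symmetric])
qed

lemma gder_bound:
 assumes "gder i a G"
 shows "norm (tr (h *\<^sub>R axis i 1) a - a) <= norm G * \<bar>h\<bar>"
proof -
 interpret L: isometry_group "%h. tr (h *\<^sub>R axis i 1) :: 'a l2 => 'a l2" by (rule tr_line_group)
 have "norm (tr (h *\<^sub>R axis i 1) a - tr (0 *\<^sub>R axis i 1) a) <= norm G * norm (h - 0)"
 proof (rule differentiable_bound[where S = UNIV and f' = "%h k. k *\<^sub>R tr (h *\<^sub>R axis i 1) G"])
 show "((%h. tr (h *\<^sub>R axis i 1) a) has_derivative (%k. k *\<^sub>R tr (h *\<^sub>R axis i 1) G)) (at h within UNIV)" for h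
 using gder_at[OF assms] by (simp add: has_vector_derivative_def)
 show "onorm (%k. k *\<^sub>R tr (h *\<^sub>R axis i 1) G) <= norm G" for h
 by (rule onorm_bound) (auto simp: mult.commute)
 qed auto
 then show ?thesis by (simp only: L.T_0) simp
qed

lemma gder_linear:
 assumes "gder i a G" "bounded_linear D" "!!y x. D (tr y x) = tr y (D x)"
 shows "gder i (D a) (D G)"
 using bounded_linear.has_vector_derivative[OF assms(2) assms(1)[unfolded gder_def]] by (simp add: gder_def assms(3))

lemma gder_sum:
 assumes "!!j. j \<in> I ==> gder i (a j) (G j)"
 shows "gder i (\<Sum>j\<in>I. a j) (\<Sum>j\<in>I. G j)"
proof -
 interpret L: isometry_group "%h. tr (h *\<^sub>R axis i 1) :: 'b l2 => 'b l2" by (rule tr_line_group)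
 show ?thesis using has_vector_derivative_sum[of I, OF assms[unfolded gder_def]] by (simp add: gder_def linear_sum[OF L.T_linear])
qed

lemma gder_scl:
 assumes e: "eps > 0" and a: "gder i a G"
 shows "gder i (scl eps a) (scl eps G /\<^sub>R eps)"
proof -
 have "((%h. h / eps) has_vector_derivative (1 / eps)) (at 0)"
 unfolding has_real_derivative_iff_has_vector_derivative[symmetric] using e by (auto intro!: derivative_eq_intros)
 from vector_diff_chain_at[OF this, of "%s. tr (s *\<^sub>R axis i 1) a" G] a
 have "((%h. tr ((h / eps) *\<^sub>R axis i 1) a) has_vector_derivative (1 / eps) *\<^sub>R G) (at 0)" by (simp add: gder_def comp_def)
 from bounded_linear.has_vector_derivative[OF scl_bounded_linear[OF e] this]
 show ?thesis using e by (simp add: gder_def tr_scl linear_cmul[OF bounded_linear.linear[OF scl_bounded_linear]] divide_inverse mult.commute)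
qed

lemma gder_adjoint:
 assumes "gder i a G" "gder i b H"
 shows "inner G b = - inner a H"
proof -
 interpret L: isometry_group "%h. tr (h *\<^sub>R axis i 1) :: 'a l2 => 'a l2" by (rule tr_line_group)
 have 1: "((%h. inner (tr (h *\<^sub>R axis i 1) a) b) has_real_derivative inner G b) (at 0)"
 using bounded_linear.has_vector_derivative[OF bounded_linear_inner_left assms(1)[unfolded gder_def]]
 by (simp add: has_real_derivative_iff_has_vector_derivative)
 have "((%h::real. - h) has_vector_derivative - 1) (at 0)"
 unfolding has_real_derivative_iff_has_vector_derivative[symmetric] by (auto intro!: derivative_eq_intros)
 from vector_diff_chain_at[OF this, of "%s. tr (s *\<^sub>R axis i 1) b" H] assms(2)
 have "((%h. tr ((- h) *\<^sub>R axis i 1) b) has_vector_derivative - H) (at 0)" by (simp add: gder_def comp_def)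
 from bounded_linear.has_vector_derivative[OF bounded_linear_inner_right[of a] this]
 have "((%h. inner a (tr ((- h) *\<^sub>R axis i 1) b)) has_real_derivative - inner a H) (at 0)"
 by (simp add: has_real_derivative_iff_has_vector_derivative)
 then have 2: "((%h. inner (tr (h *\<^sub>R axis i 1) a) b) has_real_derivative - inner a H) (at 0)"
 by (simp only: L.T_adjoint)
 show ?thesis by (rule DERIV_unique[OF 1 2])
qed

definition tvec :: "'n::finite l2 set" where
 "tvec = {cmul c (cj phi) | c phi. test_function phi}"

lemma tvec_total: "total_set (tvec :: 'n::finite l2 set)"
proof (rule total_set_mono[OF gset_total], rule subsetI)
 fix x :: "'n l2" assume "x \<in> gset"
 then obtain c z b where x: "x = gvec (c, z, b)" and z: "Re z > 0" by (auto simp: gset_def)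
 have z': "Re (cnj z) > 0" using z by simp
 obtain g M where g: "!!k :: nat. ttest (g k)" "!!k. in_L2 (tens (g k))" "(%k. to_l2 (tens (g k))) \<longlonglongrightarrow> to_l2 (gauss (cnj z) b)"
 using gauss_test_approx[OF z', of b] by metis
 obtain M1 where M1: "(%k. cj (tens (g k))) \<longlonglongrightarrow> M1" "!!h. in_L2 h ==> to_l2 (gauss (cnj z) b) = to_l2 h ==> M1 = cj h"
 using cj_tendsto[of "%k. tens (g k)", OF g(2,3)] by blast
 have "M1 = to_l2 (gauss z b)" using M1(2)[OF gauss_in_L2[OF z'] refl] z' by (simp add: cj_def cnj_gauss)
 then have "cmul c M1 = x" using z by (simp add: x gvec_eq cmul_to_l2 gauss_in_L2)
 then have "(%k. cmul c (cj (tens (g k)))) \<longlonglongrightarrow> x"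
 using bounded_linear.tendsto[OF cmul_bounded_linear M1(1), of c] by simp
 moreover have "cmul c (cj (tens (g k))) \<in> span tvec" for k
 using ttest_test[OF g(1)] by (intro span_base) (auto simp: tvec_def)
 ultimately show "x \<in> closure (span tvec)" unfolding closure_sequential
 by (intro exI[of _ "%k. cmul c (cj (tens (g k)))"]) auto
qed

lemma gder_test:
 fixes phi :: "real ^ 'n::finite => complex"
 shows "test_function phi ==> gder i (cmul c (cj phi)) (cmul c (cj (partial_deriv i phi)))"
 by (rule gder_linear[OF _ cmul_bounded_linear])
 (auto simp: gder_def test_function_quotient cmul_wop iso_weight_1)

text \<open>Integration by parts against all translates of a test vector is a weak derivative of the
  whole orbit; \<open>group_generator\<close> makes it strong because test functions are
  total.\<close>

lemma gderI:
 fixes a :: "'n::finite l2"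
 assumes "!!psi psi' s. psi \<in> tvec ==> gder i psi psi' ==> inner G (tr (s *\<^sub>R axis i 1) psi) = - inner a (tr (s *\<^sub>R axis i 1) psi')"
 shows "gder i a G"
proof -
 interpret L: isometry_group "%h. tr (h *\<^sub>R axis i 1) :: 'n l2 => 'n l2" by (rule tr_line_group)
 have "((%s. tr (s *\<^sub>R axis i 1) a) has_vector_derivative tr (0 *\<^sub>R axis i 1) G) (at 0)"
 proof (rule group_generator[OF tr_line_group tvec_total])
 fix f :: "'n l2" and s assume f: "f \<in> tvec"
 then obtain f' where f': "gder i f f'" using gder_test unfolding tvec_def by blast
 have "((%h::real. - h) has_vector_derivative - 1) (at s)"
 unfolding has_real_derivative_iff_has_vector_derivative[symmetric] by (auto intro!: derivative_eq_intros)
 from vector_diff_chain_at[OF this, of "%s. tr (s *\<^sub>R axis i 1) f"] gder_at[OF f', of "- s"]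
 have "((%h. tr ((- h) *\<^sub>R axis i 1) f) has_vector_derivative - tr ((- s) *\<^sub>R axis i 1) f') (at s)" by (simp add: comp_def)
 from bounded_linear.has_vector_derivative[OF bounded_linear_inner_left[of a] this]
 have "((%h. inner (tr ((- h) *\<^sub>R axis i 1) f) a) has_real_derivative - inner (tr ((- s) *\<^sub>R axis i 1) f') a) (at s)"
 by (simp add: has_real_derivative_iff_has_vector_derivative)
 moreover have "inner (tr ((- h) *\<^sub>R axis i 1) f) a = inner f (tr (h *\<^sub>R axis i 1) a)" for h
 using L.T_adjoint[of "- h" f a] by simp
 moreover have "- inner (tr ((- s) *\<^sub>R axis i 1) f') a = inner f (tr (s *\<^sub>R axis i 1) G)"
 using assms[OF f f', of "- s"] L.T_adjoint[of "- s" f G] by (metis inner_commute minus_minus)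
 ultimately show "((%s. inner f (tr (s *\<^sub>R axis i 1) a)) has_real_derivative inner f (tr (s *\<^sub>R axis i 1) G)) (at s)" by simp
 qed
 then show ?thesis by (simp only: gder_def L.T_0)
qed

lemma L2_gradient_gder:
 fixes f :: "real ^ 'n::finite => complex" and G :: "real ^ 'n => complex ^ 'n"
 assumes f: "in_L2 f" and G: "has_L2_gradient f G"
 shows "in_L2 (%x. G x $ i)" "gder i (to_l2 f) (to_l2 (%x. G x $ i))"
proof -
 have LG: "in_L2 G" using G by (simp add: has_L2_gradient_def)
 then have [measurable]: "G \<in> borel_measurable borel" by (simp add: in_L2_iff)
 show Li: "in_L2 (%x. G x $ i)"
 proof (rule in_L2_bound[OF _ in_L2_integrable[OF LG]])
 have "(%v :: complex ^ 'n. v $ i) \<in> borel_measurable borel"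
 by (rule borel_measurable_continuous_onI) (intro continuous_intros)
 then show "(%x. G x $ i) \<in> borel_measurable borel" by measurable
 show "(norm (G x $ i))\<^sup>2 <= (norm (G x))\<^sup>2" for x
 by (intro power_mono Finite_Cartesian_Product.norm_nth_le norm_ge_zero)
 qed
 show "gder i (to_l2 f) (to_l2 (%x. G x $ i))"
 proof (rule gderI)
 fix psi psi' :: "'n l2" and s assume "psi \<in> tvec" and d: "gder i psi psi'"
 then obtain c phi where psi: "psi = cmul c (cj phi)" and t: "test_function phi" by (auto simp: tvec_def)
 let ?y = "s *\<^sub>R axis i 1 :: real ^ 'n"
 define phis where "phis = (%x. phi (x + ?y))"
 have ts: "test_function phis" unfolding phis_def by (rule test_function_shift[OF t])
 have ps: "partial_deriv i phis = (%x. partial_deriv i phi (x + ?y))"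
 unfolding phis_def by (rule partial_deriv_shift(2)) (rule test_function_partial(2)[OF t])
 have psi': "psi' = cmul c (cj (partial_deriv i phi))"
 using d gder_test[OF t] unfolding gder_def psi by (rule vector_derivative_unique_at)
 have e: "tr ?y (cmul c (cj h)) = cmul c (cj (%x. h (x + ?y)))" if "in_L2 h" for h
 using that by (simp add: cmul_wop iso_weight_1 cj_def tr_to_l2 in_L2_cnj)
 have i: "(\<integral>x. f x * partial_deriv i phis x \<partial>lborel) = - (\<integral>x. (G x $ i) * phis x \<partial>lborel)"
 using G ts by (simp add: has_L2_gradient_def)
 have "inner (to_l2 (%x. G x $ i)) (tr ?y psi) = Re (cnj c * (\<integral>x. (G x $ i) * phis x \<partial>lborel))"
 unfolding psi e[OF test_function_L2(1)[OF t]] by (simp only: phis_def[symmetric] inner_cmul_cj[OF Li test_function_L2(1)[OF ts]])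
 also have "... = - Re (cnj c * (\<integral>x. f x * partial_deriv i phis x \<partial>lborel))" unfolding i by simp
 also have "... = - inner (to_l2 f) (tr ?y psi')"
 unfolding psi' e[OF test_function_L2(3)[OF t]] ps[symmetric] by (simp only: inner_cmul_cj[OF f test_function_L2(3)[OF ts]])
 finally show "inner (to_l2 (%x. G x $ i)) (tr ?y psi) = - inner (to_l2 f) (tr ?y psi')" .
 qed
qed

text \<open>The components of the chosen weak gradient are again translation derivatives, and those
  are unique; hence they equal \<open>G i\<close>, which fixes the norm.\<close>

lemma gder_L2_gradient:
 fixes f :: "real ^ 'n::finite => complex"
 assumes f: "in_L2 f" and G: "!!i. gder i (to_l2 f) (G i)"
 shows "in_H1 f" "Lp_norm 2 (%x. eps *\<^sub>R weak_gradient f x) = ennreal (\<bar>eps\<bar> * sqrt (\<Sum>i\<in>UNIV. (norm (G i))\<^sup>2))"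
proof -
 define H where "H x = (\<chi> i. l2_fun (G i) x)" for x
 have [measurable]: "H \<in> borel_measurable borel"
 proof (subst borel_measurable_euclidean_space, rule ballI)
 fix b :: "complex ^ 'n" assume "b \<in> Basis"
 then obtain i c where b: "b = axis i c" by (auto simp: Basis_vec_def)
 have "l2_fun (G i) \<in> borel_measurable borel" using in_L2_l2_fun by (auto simp: in_L2_iff)
 then show "(%x. inner (H x) b) \<in> borel_measurable borel" by (simp add: b inner_axis H_def)
 qed
 have nv: "(norm (v :: complex ^ 'n))\<^sup>2 = (\<Sum>i\<in>UNIV. (norm (v $ i))\<^sup>2)" for v
 by (simp add: norm_vec_def L2_set_def sum_nonneg)
 have "integrable lborel (%x. (norm (H x))\<^sup>2)"
 unfolding nv H_def by (simp add: in_L2_integrable)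
 then have LH: "in_L2 H" by (simp add: in_L2_iff)
 have H: "has_L2_gradient f H"
 unfolding has_L2_gradient_def
 proof (intro conjI allI impI LH)
 fix phi :: "real ^ 'n => complex" and i assume t: "test_function phi"
 have "inner (to_l2 f) (cmul c (cj (partial_deriv i phi))) = - inner (G i) (cmul c (cj phi))" for c
 using gder_adjoint[OF G gder_test[OF t]] by simp
 then have "Re (cnj c * (\<integral>x. f x * partial_deriv i phi x \<partial>lborel)) = - Re (cnj c * (\<integral>x. l2_fun (G i) x * phi x \<partial>lborel))" for c
 using inner_cmul_cj[OF f test_function_L2(3)[OF t]] inner_cmul_cj[OF in_L2_l2_fun test_function_L2(1)[OF t], of "G i"] by simp
 from this[of 1] this[of "\<i>"] show "(\<integral>x. f x * partial_deriv i phi x \<partial>lborel) = - (\<integral>x. H x $ i * phi x \<partial>lborel)"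
 by (simp add: H_def complex_eq_iff)
 qed
 then show "in_H1 f" using f unfolding in_H1_def by blast
 let ?W = "weak_gradient f"
 have W: "has_L2_gradient f ?W" unfolding weak_gradient_def using H by (rule someI[where P = "has_L2_gradient f"])
 have LW: "in_L2 ?W" using W by (simp add: has_L2_gradient_def)
 have W_i: "to_l2 (%x. ?W x $ i) = G i" for i
 using L2_gradient_gder(2)[OF f W] G unfolding gder_def by (rule vector_derivative_unique_at)
 have "(\<integral>x. (norm (eps *\<^sub>R ?W x))\<^sup>2 \<partial>lborel) = (\<integral>x. eps\<^sup>2 * (\<Sum>i\<in>UNIV. (norm (?W x $ i))\<^sup>2) \<partial>lborel)"
 by (simp add: power_mult_distrib nv)
 also have "... = eps\<^sup>2 * (\<Sum>i\<in>UNIV. (norm (G i))\<^sup>2)"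
 by (simp add: Bochner_Integration.integral_sum in_L2_integrable L2_gradient_gder(1)[OF f W] norm_to_l2 flip: W_i)
 finally have *: "(\<integral>x. (norm (eps *\<^sub>R ?W x))\<^sup>2 \<partial>lborel) = eps\<^sup>2 * (\<Sum>i\<in>UNIV. (norm (G i))\<^sup>2)" .
 have "in_L2 (%x. eps *\<^sub>R ?W x)" using LW by (auto simp: in_L2_iff power_mult_distrib)
 then show "Lp_norm 2 (%x. eps *\<^sub>R ?W x) = ennreal (\<bar>eps\<bar> * sqrt (\<Sum>i\<in>UNIV. (norm (G i))\<^sup>2))"
 by (simp only: Lp_norm_2 * real_sqrt_mult real_sqrt_abs)
qed

lemma in_H1_gder:
 fixes f :: "real ^ 'n::finite => complex"
 assumes f: "in_H1 f" and e: "eps > 0" and M: "H1_eps_norm eps f <= ennreal M" "M >= 0"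
 obtains G where "!!i. gder i (to_l2 f) (G i)" "!!i. eps * norm (G i) <= M" "norm (to_l2 f) <= M"
proof -
 obtain H where H: "has_L2_gradient f H" and L: "in_L2 f" using f by (auto simp: in_H1_def)
 define G where "G i = to_l2 (%x. H x $ i)" for i
 have G: "gder i (to_l2 f) (G i)" for i unfolding G_def by (rule L2_gradient_gder(2)[OF L H])
 have "ennreal (eps * sqrt (\<Sum>i\<in>UNIV. (norm (G i))\<^sup>2)) <= H1_eps_norm eps f"
 unfolding H1_eps_norm_def gder_L2_gradient(2)[OF L G] using e by simp
 also note M(1)
 finally have 1: "eps * sqrt (\<Sum>i\<in>UNIV. (norm (G i))\<^sup>2) <= M" using M(2) by (simp add: ennreal_le_iff)
 have "ennreal (norm (to_l2 f)) <= H1_eps_norm eps f"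
 unfolding H1_eps_norm_def Lp_norm_to_l2[OF L] by simp
 also note M(1)
 finally have 2: "norm (to_l2 f) <= M" using M(2) by (simp add: ennreal_le_iff)
 have "eps * norm (G i) <= M" for i
 proof -
 have "norm (G i) <= sqrt (\<Sum>i\<in>UNIV. (norm (G i))\<^sup>2)"
 by (rule real_le_rsqrt) (rule member_le_sum[of i UNIV "%i. (norm (G i))\<^sup>2"], auto)
 then have "eps * norm (G i) <= eps * sqrt (\<Sum>i\<in>UNIV. (norm (G i))\<^sup>2)" using e by simp
 then show ?thesis using 1 by linarith
 qed
 then show ?thesis using that[OF G _ 2] by blast
qed

text \<open>Bounded difference quotients have a weak limit along an ultrafilter; it satisfies
  integration by parts and is therefore the derivative. Profiles acquire their derivatives this way,
  from bounds on translation differences alone.\<close>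

lemma quotient_gder:
 fixes a :: "'n::finite l2"
 assumes "!!h. norm (tr (h *\<^sub>R axis i 1) a - a) <= C * \<bar>h\<bar>"
 obtains G where "gder i a G" "norm G <= C"
proof -
 interpret L: isometry_group "%h. tr (h *\<^sub>R axis i 1) :: 'n l2 => 'n l2" by (rule tr_line_group)
 obtain U :: "nat filter" where U: "U <= sequentially" "ultra U" by (rule ultrafilter_exists[OF sequentially_bot])
 define X where "X k = inverse (real (Suc k))" for k
 have X0: "X \<longlonglongrightarrow> 0" "!!k. X k > 0" using LIMSEQ_inverse_real_of_nat by (auto simp: X_def[abs_def])
 define Q where "Q k = (tr (X k *\<^sub>R axis i 1) a - a) /\<^sub>R X k" for k
 have "norm (Q k) <= C" for k using assms[of "X k"] X0(2)[of k] by (simp add: Q_def divide_simps)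
 then obtain G where G: "wconv U Q G" "norm G <= C" using ultra_weak_limit[OF U(2) always_eventually[OF allI], of Q C] by blast
 have "gder i a G"
 proof (rule gderI)
 fix psi psi' :: "'n l2" and s assume d: "gder i psi psi'"
 let ?p = "tr (s *\<^sub>R axis i 1) psi"
 have "((%h::real. - h) has_vector_derivative - 1) (at 0)"
 unfolding has_real_derivative_iff_has_vector_derivative[symmetric] by (auto intro!: derivative_eq_intros)
 from vector_diff_chain_at[OF this, of "%s. tr (s *\<^sub>R axis i 1) psi" psi'] d
 have "((%h. tr ((- h) *\<^sub>R axis i 1) psi) has_vector_derivative - psi') (at 0)" by (simp add: gder_def comp_def)
 from has_vector_derivative_quotient[OF this]
 have "((%h. (tr ((- h) *\<^sub>R axis i 1) psi - psi) /\<^sub>R h) \<longlongrightarrow> - psi') (at 0)" by (simp only: add_0 minus_zero L.T_0)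
 then have 1: "(%k. (tr ((- X k) *\<^sub>R axis i 1) psi - psi) /\<^sub>R X k) \<longlonglongrightarrow> - psi'"
 by (rule tendsto_at_iff_sequentially[THEN iffD1, unfolded comp_def, rule_format, of _ _ _ _ X]) (use X0 less_imp_neq[OF X0(2)] in auto)
 have "inner (Q k) ?p = inner a (tr (s *\<^sub>R axis i 1) ((tr ((- X k) *\<^sub>R axis i 1) psi - psi) /\<^sub>R X k))" for k
 proof -
 have "inner (Q k) ?p = (inner a (tr ((- X k) *\<^sub>R axis i 1) ?p) - inner a ?p) / X k"
 using L.T_adjoint[of "X k" a ?p] by (simp add: Q_def inner_diff_left divide_inverse mult.commute)
 also have "tr ((- X k) *\<^sub>R axis i 1) ?p = tr (s *\<^sub>R axis i 1) (tr ((- X k) *\<^sub>R axis i 1) psi)"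
 by (rule L.T_commute)
 finally show ?thesis
 by (simp add: linear_diff[OF L.T_linear] linear_cmul[OF L.T_linear] inner_diff_right divide_inverse mult.commute)
 qed
 then have "(%k. inner (Q k) ?p) \<longlonglongrightarrow> inner a (tr (s *\<^sub>R axis i 1) (- psi'))"
 using tendsto_inner[OF tendsto_const bounded_linear.tendsto[OF L.T_blin 1]] by simp
 then have "((%k. inner (Q k) ?p) \<longlongrightarrow> inner a (tr (s *\<^sub>R axis i 1) (- psi'))) U"
 using U(1) by (rule tendsto_mono[rotated])
 moreover have "((%k. inner (Q k) ?p) \<longlongrightarrow> inner G ?p) U" by (rule wconvD[OF G(1)])
 ultimately have "inner G ?p = inner a (tr (s *\<^sub>R axis i 1) (- psi'))"
 using tendsto_unique[OF ultra_not_bot[OF U(2)]] by blast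
 then show "inner G ?p = - inner a (tr (s *\<^sub>R axis i 1) psi')" by (simp add: linear_neg[OF L.T_linear])
 qed
 then show ?thesis using that G(2) by blast
qed

text \<open>The shift is decomposed into moves along the axes; the factor \<open>n\<close> is the
  price of bounding every component of \<open>u\<close> by its norm.\<close>

lemma gder_lipschitz:
 fixes a :: "'n::finite l2"
 assumes "!!i. gder i a (G i)" "!!i. norm (G i) <= C"
 shows "norm (tr u a - a) <= real CARD('n) * C * norm u"
proof -
 interpret S: isometry_group "tr :: real ^ 'n => 'n l2 => 'n l2" by (rule tr_isometry_group)
 have "norm (tr (\<Sum>i\<in>I. u $ i *\<^sub>R axis i 1) a - a) <= (\<Sum>i\<in>I. C * norm u)" if "finite I" for I
 using that
 proof (induction I)
 case (insert j I)
 let ?v = "\<Sum>i\<in>I. u $ i *\<^sub>R axis i 1 :: real ^ 'n"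
 have "tr (u $ j *\<^sub>R axis j 1 + ?v) a - a = tr (u $ j *\<^sub>R axis j 1) (tr ?v a - a) + (tr (u $ j *\<^sub>R axis j 1) a - a)"
 by (simp add: S.T_add linear_diff[OF S.T_linear])
 then have "norm (tr (u $ j *\<^sub>R axis j 1 + ?v) a - a) <= norm (tr ?v a - a) + norm (tr (u $ j *\<^sub>R axis j 1) a - a)"
 by (subst \<open>_ = _ + _\<close>, intro order_trans[OF norm_triangle_ineq]) simp
 also have "norm (tr (u $ j *\<^sub>R axis j 1) a - a) <= norm (G j) * \<bar>u $ j\<bar>" by (rule gder_bound[OF assms(1)])
 also have "... <= C * norm u" using assms(2) norm_ge_zero[of "G j"] component_le_norm_cart[of u j]
 by (intro mult_mono) (auto intro: order_trans[OF norm_ge_zero assms(2)])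
 finally show ?case using insert by (simp add: distrib_right)
 qed simp
 from this[OF finite[of UNIV]] have "norm (tr (\<Sum>i\<in>UNIV. u $ i *\<^sub>R axis i 1) a - a) <= real CARD('n) * C * norm u" by simp
 then show ?thesis using basis_expansion[of u] by (simp add: scalar_mult_eq_scaleR)
qed

section \<open>Interpolation along the heat semigroup\<close>

lemma heat_ev_bounded_linear:
 assumes t: "t > 0"
 shows "bounded_linear (%a :: 'n::finite l2. heat_ev t a y)"
proof -
 define gc where "gc = gauss_const TYPE('n)"
 have gc: "gc > 0" by (simp add: gc_def gauss_const_pos)
 have e: "heat_ev t a y = Complex (inner a (gvec (1, of_real t, y))) (inner a (gvec (\<i>, of_real t, y))) / of_real gc" for a :: "'n l2"
 using heat_ev_inner[OF t, of a y] gc unfolding gc_def[symmetric] by (simp add: field_simps)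
 show ?thesis
 proof (rule bounded_linear_intro[where K = "2 * norm (gvec (1, of_real t, y) :: 'n l2) / gc"])
 show "heat_ev t (a + b) y = heat_ev t a y + heat_ev t b y" for a b :: "'n l2"
 unfolding e add_divide_distrib[symmetric] by (simp add: inner_add_left complex_eq_iff)
 show "heat_ev t (r *\<^sub>R a) y = r *\<^sub>R heat_ev t a y" for r and a :: "'n l2"
 unfolding e by (simp add: complex_eq_iff)
 show "norm (heat_ev t a y) <= norm a * (2 * norm (gvec (1, of_real t, y) :: 'n l2) / gc)" for a :: "'n l2"
 using heat_ev_bound[OF t, of a y] gc unfolding gc_def[symmetric] by (simp add: field_simps)
 qed
qed

definition heat_op :: "real => 'n::finite l2 => 'n l2" where
 "heat_op t a = to_l2 (heat_ev t a)"

lemma norm_heat_op_diff: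
 fixes a :: "'n::finite l2"
 assumes t: "t > 0" and N: "N >= 0" "!!u. norm (tr u a - a) <= N * norm u"
 shows "norm (heat_op t a - a) <= N * sqrt (real CARD('n) * t)"
proof -
 have b: "(norm (tr u a - a))\<^sup>2 <= 0 + N\<^sup>2 * (norm u)\<^sup>2" for u
 using power_mono[OF N(2)[of u], of 2] by (simp add: power_mult_distrib)
 have "(norm (heat_op t a - a))\<^sup>2 <= 0 + N\<^sup>2 * (real CARD('n) * t)"
 unfolding heat_op_def by (rule heat_ev_diff(2)[where A = 0 and B = "N\<^sup>2" and t = t and a = a]) (use t b in auto)
 then have "norm (heat_op t a - a) <= sqrt (N\<^sup>2 * (real CARD('n) * t))" by (simp add: real_le_rsqrt)
 then show ?thesis using N(1) by (simp add: real_sqrt_mult)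
qed

text \<open>The crude bound \<open>2 * norm a\<close> for translation differences controls the
  smoothing error, hence the constant 3.\<close>

lemma norm_heat_op:
 fixes a :: "'n::finite l2"
 assumes t: "t > 0"
 shows "norm (heat_op t a) <= 3 * norm a"
proof -
 interpret S: isometry_group "tr :: real ^ 'n => 'n l2 => 'n l2" by (rule tr_isometry_group)
 have "norm (tr u a - a) <= 2 * norm a" for u using norm_triangle_ineq4[of "tr u a" a] by simp
 then have b: "(norm (tr u a - a))\<^sup>2 <= (2 * norm a)\<^sup>2 + 0 * (norm u)\<^sup>2" for u
 using power_mono[of "norm (tr u a - a)" "2 * norm a" 2] by simp
 have "(norm (heat_op t a - a))\<^sup>2 <= (2 * norm a)\<^sup>2 + 0 * (real CARD('n) * t)"
 unfolding heat_op_def by (rule heat_ev_diff(2)[where A = "(2 * norm a)\<^sup>2" and B = 0 and t = t and a = a]) (use t b in auto)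
 then have "norm (heat_op t a - a) <= 2 * norm a" using power2_le_imp_le[of "norm (heat_op t a - a)" "2 * norm a"] by simp
 then show ?thesis using norm_triangle_sub[of "heat_op t a" a] by simp
qed

lemma heat_op_bounded_linear:
 assumes t: "t > 0"
 shows "bounded_linear (heat_op t :: 'n::finite l2 => 'n l2)"
proof -
 have l: "linear (%a :: 'n l2. heat_ev t a y)" for y by (rule bounded_linear.linear[OF heat_ev_bounded_linear[OF t]])
 have "heat_ev t (a + b) = (%y. heat_ev t a y + heat_ev t b y)" "heat_ev t (r *\<^sub>R a) = (%y. r *\<^sub>R heat_ev t a y)" for a b :: "'n l2" and r
 using linear_add[OF l] linear_cmul[OF l] by (auto intro!: ext)
 then show ?thesis
 using norm_heat_op[OF t] unfolding heat_op_def
 by (intro bounded_linear_intro[where K = 3]) (simp_all add: to_l2_add to_l2_scaleR heat_ev_in_L2 t mult.commute)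
qed

lemma heat_ev_gvec:
 fixes b y :: "real ^ 'n::finite"
 assumes t: "t > 0" and z: "Re z > 0"
 shows "heat_ev t (gvec (c, z, b)) y = c * gauss (z + of_real t) b y"
proof -
 let ?gc = "complex_of_real (gauss_const TYPE('n))"
 have "?gc * heat_ev t (gvec (c, z, b)) y = (\<integral>x. gauss (of_real t) y x * l2_fun (gvec (c, z, b)) x \<partial>lborel)"
 unfolding heat_ev_def gauss_heat[OF t] by (simp add: mult.assoc)
 also have "... = (\<integral>x. c * (gauss (of_real t) y x * gauss z b x) \<partial>lborel)"
 proof (rule integral_cong_AE)
 show "AE x in lborel. gauss (of_real t) y x * l2_fun (gvec (c, z, b)) x = c * (gauss (of_real t) y x * gauss z b x)"
 using l2_fun_to_l2[OF in_L2_cmult[OF gauss_in_L2[OF z], of c b]] unfolding gvec_eq[OF z] by eventually_elim simp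
 qed simp_all
 also have "... = c * (?gc * gauss (of_real t + z) b y)" using gauss_mult_integral[of "of_real t" z y b] t z by simp
 finally have "?gc * heat_ev t (gvec (c, z, b)) y = ?gc * (c * gauss (z + of_real t) b y)" by (simp add: add.commute mult.left_commute)
 moreover have "?gc ~= 0" using gauss_const_pos[where 'n = 'n] by simp
 ultimately show ?thesis by simp
qed

lemma heat_op_gvec: "t > 0 ==> Re z > 0 ==> heat_op t (gvec (c, z, b)) = gvec (c, z + of_real t, b)"
 unfolding heat_op_def heat_ev_gvec[THEN ext] by (subst gvec_eq) auto

text \<open>By density from Gaussians, on which smoothing adds to the variance. It allows the
  difference of two heat times to be written as smoothing of a vector that is already small.\<close>

lemma heat_ev_semigroup:
 fixes a :: "'n::finite l2"
 assumes s: "s > 0" and t: "t > 0"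
 shows "heat_ev s (heat_op t a) y = heat_ev (t + s) a y"
proof (rule total_set_linear_eq[OF gset_total, of "%a. heat_ev s (heat_op t a) y" "%a. heat_ev (t + s) a y"])
 show "bounded_linear (%a :: 'n l2. heat_ev s (heat_op t a) y)"
 by (rule bounded_linear_compose[OF heat_ev_bounded_linear[OF s] heat_op_bounded_linear[OF t]])
 show "bounded_linear (%a :: 'n l2. heat_ev (t + s) a y)" using s t by (intro heat_ev_bounded_linear) auto
 fix g :: "'n l2" assume "g \<in> gset"
 then obtain c z b where g: "g = gvec (c, z, b)" and z: "Re z > 0" by (auto simp: gset_def)
 have z': "Re (z + of_real t) > 0" using z t by simp
 show "heat_ev s (heat_op t g) y = heat_ev (t + s) g y"
 using s t by (simp add: g heat_op_gvec[OF t z] heat_ev_gvec[OF s z'] heat_ev_gvec[OF _ z] add.assoc)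
qed

text \<open>The power \<open>- n / 4\<close> is that of the norm of the Gaussian paired with, read
  off from its own Gram matrix entry.\<close>

lemma heat_ev_sup:
 obtains C where "C > 0" "!!t (a :: 'n::finite l2) y. t > 0 ==> norm (heat_ev t a y) <= C * t powr (- real CARD('n) / 4) * norm a"
proof -
 define gc where "gc = gauss_const TYPE('n)"
 have gc: "gc > 0" by (simp add: gc_def gauss_const_pos)
 show ?thesis
 proof (rule that[of "2 / sqrt gc"])
 show "2 / sqrt gc > 0" using gc by simp
 fix t :: real and a :: "'n l2" and y :: "real ^ 'n" assume t: "t > 0"
 let ?g = "gvec (1, of_real t, y) :: 'n l2"
 have "(norm ?g)\<^sup>2 = gc * Re (gauss (of_real t + of_real t) y y)"
 using gvec_inner[of "of_real t" "of_real t" 1 y 1 y] t by (simp add: power2_norm_eq_inner gc_def)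
 note g1 = this
 have "Re (gauss (of_real t + of_real t) y y) <= norm (gauss (of_real t + of_real t) y y)" by (rule complex_Re_le_cmod)
 also have "norm (gauss (of_real t + of_real t) y y) = 1 / sqrt (2 * t) ^ CARD('n)"
 using t by (subst norm_gauss) (auto simp: norm_mult simp flip: of_real_add)
 also have "... <= 1 / sqrt t ^ CARD('n)" using t by (intro divide_left_mono power_mono mult_pos_pos zero_less_power) auto
 also have "1 / sqrt t ^ CARD('n) = (t powr (- real CARD('n) / 4))\<^sup>2"
 proof -
 have 1: "sqrt t ^ CARD('n) = t powr (real CARD('n) / 2)"
 using t by (simp add: powr_half_sqrt[symmetric] powr_realpow[symmetric] powr_powr)
 have 2: "(t powr (- real CARD('n) / 4))\<^sup>2 = t powr (- (real CARD('n) / 2))"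
 unfolding power2_eq_square powr_add[symmetric] by simp
 show ?thesis unfolding 1 2 powr_minus_divide ..
 qed
 finally have "gc * Re (gauss (of_real t + of_real t) y y) <= gc * (t powr (- real CARD('n) / 4))\<^sup>2"
 using gc by (intro mult_left_mono) auto
 then have "(norm ?g)\<^sup>2 <= gc * (t powr (- real CARD('n) / 4))\<^sup>2" unfolding g1 .
 from real_le_rsqrt[OF this] have "norm ?g <= sqrt gc * t powr (- real CARD('n) / 4)"
 by (simp add: real_sqrt_mult)
 then have 1: "2 * norm ?g * norm a <= 2 * (sqrt gc * t powr (- real CARD('n) / 4)) * norm a"
 by (intro mult_right_mono) auto
 have "gc * norm (heat_ev t a y) <= 2 * norm ?g * norm a" unfolding gc_def by (rule heat_ev_bound[OF t])
 also note 1
 also have "2 * (sqrt gc * t powr (- real CARD('n) / 4)) * norm a = (gc / sqrt gc) * (2 * t powr (- real CARD('n) / 4) * norm a)"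
 using real_div_sqrt[of gc] gc by simp
 also have "... = gc * (2 / sqrt gc * t powr (- real CARD('n) / 4) * norm a)" by simp
 finally show "norm (heat_ev t a y) <= 2 / sqrt gc * t powr (- real CARD('n) / 4) * norm a" by (simp only: mult_le_cancel_left_pos[OF gc])
 qed
qed

text \<open>A triangle inequality for powers with a free weight: for \<open>th\<close> near 1 the
  second summand, later the tail of the telescoping sum, is hardly enlarged.\<close>

lemma powr_add_le:
 fixes x y th p :: real
 assumes x: "x >= 0" and y: "y >= 0" and p: "p > 0" and l: "0 < th" "th < 1"
 shows "(x + y) powr p <= (1 - th) powr (- p) * x powr p + th powr (- p) * y powr p"
proof (cases "y >= th * (x + y)")
 case True
 then have "x + y <= y / th" using l by (simp add: field_simps)
 then have "(x + y) powr p <= (y / th) powr p" using x y p by (intro powr_mono2) auto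
 also have "... = th powr (- p) * y powr p" using y l by (simp add: powr_divide powr_minus_divide)
 finally show ?thesis using x by (simp add: add_increasing)
next
 case False
 then have "x + y <= x / (1 - th)" using l by (simp add: field_simps)
 then have "(x + y) powr p <= (x / (1 - th)) powr p" using x y p by (intro powr_mono2) auto
 also have "... = (1 - th) powr (- p) * x powr p" using x l by (simp add: powr_divide powr_minus_divide)
 finally show ?thesis using y by (simp add: add_increasing2)
qed

section \<open>Integrals of p-th powers and the dyadic telescoping sum\<close>

definition Ip :: "real => (real ^ 'n::finite => complex) => ennreal" where
 "Ip p f = (\<integral>\<^sup>+x. ennreal (norm (f x) powr p) \<partial>lborel)"

lemma Ip_cong_AE: "AE x in lborel. norm (f x) = norm (g x) ==> Ip p f = Ip p g"
 unfolding Ip_def by (rule nn_integral_cong_AE) auto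

lemma Ip_add_le:
 assumes p: "p > 0" and l: "0 < th" "th < 1" and f: "f \<in> borel_measurable borel" and g: "g \<in> borel_measurable borel"
 shows "Ip p (%x. f x + g x) <= ennreal ((1 - th) powr (- p)) * Ip p f + ennreal (th powr (- p)) * Ip p g"
proof -
 note [measurable] = f g
 have "Ip p (%x. f x + g x) <= (\<integral>\<^sup>+x. ennreal ((1 - th) powr (- p)) * ennreal (norm (f x) powr p) + ennreal (th powr (- p)) * ennreal (norm (g x) powr p) \<partial>lborel)"
 unfolding Ip_def
 proof (rule nn_integral_mono)
 fix x
 have "norm (f x + g x) powr p <= (norm (f x) + norm (g x)) powr p" using p by (intro powr_mono2 norm_triangle_ineq) auto
 also have "... <= (1 - th) powr (- p) * norm (f x) powr p + th powr (- p) * norm (g x) powr p"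
 by (intro powr_add_le p l) auto
 finally show "ennreal (norm (f x + g x) powr p) <= ennreal ((1 - th) powr (- p)) * ennreal (norm (f x) powr p) + ennreal (th powr (- p)) * ennreal (norm (g x) powr p)"
 by (simp add: ennreal_mult[symmetric] ennreal_plus[symmetric] ennreal_leI del: ennreal_plus)
 qed
 also have "... = ennreal ((1 - th) powr (- p)) * Ip p f + ennreal (th powr (- p)) * Ip p g"
 unfolding Ip_def by (simp add: nn_integral_add nn_integral_cmult)
 finally show ?thesis .
qed

lemma Ip_sup_bound:
 assumes f: "in_L2 f" and s: "!!x. norm (f x) <= s" and p: "p > 2"
 shows "Ip p f <= ennreal (s powr (p - 2) * (norm (to_l2 f))\<^sup>2)"
proof -
 have "Ip p f <= (\<integral>\<^sup>+x. ennreal (s powr (p - 2) * (norm (f x))\<^sup>2) \<partial>lborel)"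
 unfolding Ip_def
 proof (intro nn_integral_mono ennreal_leI)
 fix x
 have "norm (f x) powr p = norm (f x) powr (p - 2) * norm (f x) powr 2" using powr_add[of "norm (f x)" "p - 2" 2] by (simp only: diff_add_cancel)
 also have "... <= s powr (p - 2) * (norm (f x))\<^sup>2"
 using s[of x] p by (intro mult_mono powr_mono2) auto
 finally show "norm (f x) powr p <= s powr (p - 2) * (norm (f x))\<^sup>2" .
 qed
 also have "... = ennreal (s powr (p - 2) * (norm (to_l2 f))\<^sup>2)"
 using in_L2_integrable[OF f] by (subst nn_integral_eq_integral) (auto simp: norm_to_l2[OF f])
 finally show ?thesis .
qed

text \<open>A dyadic block is smoothing applied to \<open>heat_op t a - a\<close>, whose norm is of
  order \<open>N * sqrt t\<close>. Interpolating between its supremum, of order \<open>t\<close> to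
  the power \<open>1/2 - n/4\<close>, and its square integral, of order \<open>t\<close>, gives the
  power \<open>dl\<close>. As \<open>dl > 0\<close>, halving \<open>t\<close> gains more than the
  weighted triangle inequality loses.\<close>

lemma heat_telescope:
 assumes \<sigma>: "\<sigma> > 0" and dl: "dl = \<sigma> + 1 - real CARD('n::finite) * \<sigma> / 2" "dl > 0"
 obtains C where "C >= 0" "!!(a :: 'n l2) N t m. N > 0 ==> t > 0 ==> (!!u. norm (tr u a - a) <= N * norm u) ==>
 Ip (2 * \<sigma> + 2) (%y. heat_ev (t / 2 ^ m) a y - heat_ev t a y) <= ennreal (C * (N powr (2 * \<sigma> + 2) * t powr dl))"
proof -
 define p where "p = 2 * \<sigma> + 2"
 define n where "n = real CARD('n)"
 have n: "n > 0" by (simp add: n_def)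
 have p: "p > 2" using \<sigma> by (simp add: p_def)
 obtain C1 where C1: "C1 > 0" "!!t (a :: 'n l2) y. t > 0 ==> norm (heat_ev t a y) <= C1 * t powr (- n / 4) * norm a"
 unfolding n_def by (rule heat_ev_sup) blast
 define C2 where "C2 = (C1 * sqrt n) powr (p - 2) * (9 * n)"
 have C2: "C2 >= 0" using n by (simp add: C2_def)
 have one: "Ip p (%y. heat_ev (2 * t) a y - heat_ev t a y) <= ennreal (C2 * (N powr p * t powr dl))"
 if N: "N > 0" and t: "t > 0" and a: "!!u. norm (tr u a - a) <= N * norm u" for a :: "'n l2" and N t
 proof -
 have d1: "norm (heat_op t a - a) <= N * sqrt (n * t)" and d2: "norm (heat_op (2 * t) a - a) <= N * sqrt (n * (2 * t))"
 unfolding n_def using t N by (auto intro!: norm_heat_op_diff a)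
 have eq: "heat_ev (2 * t) a y - heat_ev t a y = heat_ev t (heat_op t a - a) y" for y
 using heat_ev_semigroup[OF t t, of a y] linear_diff[OF bounded_linear.linear[OF heat_ev_bounded_linear[OF t]], of "heat_op t a" a y] by simp
 let ?s = "C1 * t powr (- n / 4) * (N * sqrt (n * t))"
 have L: "in_L2 (%y. heat_ev (2 * t) a y - heat_ev t a y)" using t by (intro in_L2_diff heat_ev_in_L2) auto
 have s: "norm (heat_ev (2 * t) a y - heat_ev t a y) <= ?s" for y
 unfolding eq by (rule order_trans[OF C1(2)[OF t] mult_left_mono[OF d1]]) (use C1(1) in simp)
 have "norm (to_l2 (%y. heat_ev (2 * t) a y - heat_ev t a y)) = norm ((heat_op (2 * t) a - a) - (heat_op t a - a))"
 using t by (simp add: to_l2_diff heat_ev_in_L2 heat_op_def)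
 also have "... <= norm (heat_op (2 * t) a - a) + norm (heat_op t a - a)" by (rule norm_triangle_ineq4)
 also have "... <= N * (sqrt 2 * sqrt (n * t)) + N * sqrt (n * t)"
 using d1 d2 by (simp add: real_sqrt_mult mult.left_commute)
 also have "... <= N * (2 * sqrt (n * t)) + N * sqrt (n * t)"
 using N t n sqrt2_less_2 by (intro add_right_mono mult_left_mono mult_right_mono) auto
 finally have "(norm (to_l2 (%y. heat_ev (2 * t) a y - heat_ev t a y)))\<^sup>2 <= (3 * N * sqrt (n * t))\<^sup>2"
 by (intro power_mono) (auto simp: algebra_simps)
 also have "... = 9 * N\<^sup>2 * (n * t)" using n t by (simp add: power_mult_distrib)
 finally have l: "(norm (to_l2 (%y. heat_ev (2 * t) a y - heat_ev t a y)))\<^sup>2 <= 9 * N\<^sup>2 * (n * t)" .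
 have "Ip p (%y. heat_ev (2 * t) a y - heat_ev t a y) <= ennreal (?s powr (p - 2) * (norm (to_l2 (%y. heat_ev (2 * t) a y - heat_ev t a y)))\<^sup>2)"
 by (rule Ip_sup_bound[OF L s p])
 also have "... <= ennreal (?s powr (p - 2) * (9 * N\<^sup>2 * (n * t)))"
 by (intro ennreal_leI mult_left_mono l) auto
 finally have b: "Ip p (%y. heat_ev (2 * t) a y - heat_ev t a y) <= ennreal (?s powr (p - 2) * (9 * N\<^sup>2 * (n * t)))" .
 have "?s powr (p - 2) * (9 * N\<^sup>2 * (n * t)) = C2 * (N powr p * t powr dl)"
 proof -
 have "?s = (C1 * sqrt n) * N * t powr (1 / 2 - n / 4)"
 proof -
 have "t powr (1 / 2 - n / 4) = sqrt t * t powr (- n / 4)"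
 using t by (simp add: powr_half_sqrt[symmetric] powr_add[symmetric])
 then show ?thesis by (simp add: real_sqrt_mult)
 qed
 note se = this
 have "?s powr (p - 2) = (C1 * sqrt n) powr (p - 2) * N powr (p - 2) * t powr ((1 / 2 - n / 4) * (p - 2))"
 unfolding se using C1(1) n N t by (simp add: powr_mult powr_powr)
 moreover have "N powr p = N powr (p - 2) * N\<^sup>2" using N by (simp add: powr_diff)
 moreover have "t powr dl = t powr ((1 / 2 - n / 4) * (p - 2)) * t"
 proof -
 have "dl = (1 / 2 - n / 4) * (p - 2) + 1" by (simp add: dl(1) p_def n_def[symmetric] algebra_simps)
 then show ?thesis using t by (simp add: powr_add)
 qed
 ultimately show ?thesis by (simp only: C2_def mult_ac)
 qed
 with b show ?thesis by (simp only:)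
 qed
 \<comment> \<open>Chosen so that the loss \<open>th powr (- p) = 2 powr (dl / 2)\<close> consumes
   only half of the exponent gained by halving \<open>t\<close>, leaving the ratio
   \<open>q < 1\<close>.\<close>
 define th :: real where "th = 2 powr (- dl / (2 * p))"
 have th: "0 < th" "th < 1" using dl(2) p by (auto simp: th_def powr_less_one)
 define A where "A = (1 - th) powr (- p)"
 define q :: real where "q = 2 powr (- dl / 2)"
 have q: "0 < q" "q < 1" using dl(2) by (auto simp: q_def powr_less_one)
 have Bq: "th powr (- p) * (t / 2) powr dl = q * t powr dl" if "t > 0" for t
 proof -
 have "th powr (- p) = 2 powr (dl / 2)" using p by (simp add: th_def powr_powr)
 moreover have "(t / 2) powr dl = 2 powr (- dl) * t powr dl" using that by (simp add: powr_divide powr_minus_divide)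
 moreover have "q = 2 powr (dl / 2) * 2 powr (- dl)" by (simp add: q_def flip: powr_add)
 ultimately show ?thesis by simp
 qed
 \<comment> \<open>The fixed point of the recursion \<open>C = A * C2 + q * C\<close>, so that one
   constant works for all \<open>m\<close>.\<close>
 define C where "C = A * C2 / (1 - q)"
 have C: "C >= 0" "C * (1 - q) = A * C2" using C2 q by (auto simp: C_def A_def)
 have "Ip p (%y. heat_ev (t / 2 ^ m) a y - heat_ev t a y) <= ennreal (C * (N powr p * t powr dl))"
 if N: "N > 0" and t: "t > 0" and a: "!!u. norm (tr u a - a) <= N * norm u" for a :: "'n l2" and N t m
 using t
 proof (induction m arbitrary: t)
 case 0
 then show ?case by (simp add: Ip_def)
 next
 case (Suc m)
 then have t2: "t / 2 > 0" by simp
 have h: "(t / 2) powr dl <= t powr dl" using Suc.prems dl(2) by (intro powr_mono2) auto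
 let ?f = "%y. heat_ev (2 * (t / 2)) a y - heat_ev (t / 2) a y" and ?g = "%y. heat_ev (t / 2 / 2 ^ m) a y - heat_ev (t / 2) a y"
 have e: "heat_ev (t / 2 ^ Suc m) a y - heat_ev t a y = - ?f y + ?g y" for y by simp
 have n: "Ip p (%y. - ?f y) = Ip p ?f" unfolding Ip_def norm_minus_cancel ..
 have "Ip p (%y. heat_ev (t / 2 ^ Suc m) a y - heat_ev t a y) <= ennreal ((1 - th) powr (- p)) * Ip p (%y. - ?f y) + ennreal (th powr (- p)) * Ip p ?g"
 unfolding e by (rule Ip_add_le) (use p th in auto)
 also have "... <= ennreal A * ennreal (C2 * (N powr p * (t / 2) powr dl)) + ennreal (th powr (- p)) * ennreal (C * (N powr p * (t / 2) powr dl))"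
 unfolding n A_def by (intro add_mono mult_left_mono one[OF N t2 a] Suc.IH[OF t2]) auto
 also have "... = ennreal (A * C2 * (N powr p * (t / 2) powr dl) + C * N powr p * (th powr (- p) * (t / 2) powr dl))"
 using C2 C by (simp add: ennreal_mult[symmetric] ennreal_plus[symmetric] A_def mult_ac del: ennreal_plus)
 also have "... <= ennreal (C * (N powr p * t powr dl))"
 proof (rule ennreal_leI)
 have "A * C2 * (N powr p * (t / 2) powr dl) <= A * C2 * (N powr p * t powr dl)"
 using C2 h by (intro mult_left_mono) (auto simp: A_def)
 moreover have "C * N powr p * (th powr (- p) * (t / 2) powr dl) = C * q * (N powr p * t powr dl)"
 unfolding Bq[OF Suc.prems] by simp
 moreover have "A * C2 * (N powr p * t powr dl) + C * q * (N powr p * t powr dl) = C * (N powr p * t powr dl)"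
 unfolding C(2)[symmetric] by (simp add: algebra_simps)
 ultimately show "A * C2 * (N powr p * (t / 2) powr dl) + C * N powr p * (th powr (- p) * (t / 2) powr dl) <= C * (N powr p * t powr dl)" by linarith
 qed
 finally show ?case .
 qed
 then show ?thesis using that[OF C(1)] unfolding p_def by blast
qed

text \<open>Lower semicontinuity under norm convergence, by Fatou's lemma along an almost everywhere
  convergent subsequence.\<close>

lemma Ip_fatou:
 assumes X: "X \<longlonglongrightarrow> (a :: 'n::finite l2)" and b: "!!k :: nat. Ip p (%x. l2_fun (X k) x) <= B" and p: "p > 0"
 shows "Ip p (l2_fun a) <= B"
proof -
 obtain r :: "nat => nat" where r: "AE x in lborel. (%k. l2_fun (X (r k)) x) \<longlonglongrightarrow> l2_fun a x"
 using l2_tendsto_AE_subseq[OF X] by blast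
 have [measurable]: "l2_fun c \<in> borel_measurable borel" for c :: "'n l2" using in_L2_l2_fun by (auto simp: in_L2_iff)
 have "Ip p (l2_fun a) = (\<integral>\<^sup>+x. liminf (%k. ennreal (norm (l2_fun (X (r k)) x) powr p)) \<partial>lborel)"
 unfolding Ip_def
 proof (rule nn_integral_cong_AE)
 show "AE x in lborel. ennreal (norm (l2_fun a x) powr p) = liminf (%k. ennreal (norm (l2_fun (X (r k)) x) powr p))"
 using r
 proof eventually_elim
 case (elim x)
 have "(%k. ennreal (norm (l2_fun (X (r k)) x) powr p)) \<longlonglongrightarrow> ennreal (norm (l2_fun a x) powr p)"
 using p by (intro tendsto_ennrealI tendsto_powr2 tendsto_norm elim tendsto_const) auto
 from lim_imp_Liminf[OF sequentially_bot this] show ?case by (rule sym)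
 qed
 qed
 also have "... <= liminf (%k. Ip p (l2_fun (X (r k))))" unfolding Ip_def by (rule nn_integral_liminf) measurable
 also have "... <= B" using b by (intro Liminf_le always_eventually allI) auto
 finally show ?thesis .
qed

text \<open>A refined Sobolev inequality: the function is split into its heat regularisation and the
  rest, a limit of dyadic sums. For fixed \<open>N\<close> the first term is made small by the
  choice of \<open>t\<close>, so what remains to be controlled is the supremum of the
  regularisation.\<close>

lemma Ip_heat_bound:
 assumes \<sigma>: "\<sigma> > 0" and dl: "dl = \<sigma> + 1 - real CARD('n::finite) * \<sigma> / 2" "dl > 0"
 obtains C where "C >= 0" "!!(a :: 'n l2) N t s. N > 0 ==> t > 0 ==> s >= 0 ==> (!!u. norm (tr u a - a) <= N * norm u) ==>
 (!!y. norm (heat_ev t a y) <= s) ==>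
 Ip (2 * \<sigma> + 2) (l2_fun a) <= ennreal (C * (N powr (2 * \<sigma> + 2) * t powr dl + s powr (2 * \<sigma>) * (norm a)\<^sup>2))"
proof -
 define p where "p = 2 * \<sigma> + 2"
 have p: "p > 2" "2 * \<sigma> = p - 2" using \<sigma> by (auto simp: p_def)
 obtain C1 where C1: "C1 >= 0" "!!(a :: 'n l2) N t m. N > 0 ==> t > 0 ==> (!!u. norm (tr u a - a) <= N * norm u) ==>
 Ip p (%y. heat_ev (t / 2 ^ m) a y - heat_ev t a y) <= ennreal (C1 * (N powr p * t powr dl))"
 using heat_telescope[OF \<sigma> dl] unfolding p_def by blast
 \<comment> \<open>Both parts get weight 1/2 in the triangle inequality; the 9 below is the square
   of the constant in \<open>norm_heat_op\<close>.\<close>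
 define K :: real where "K = (1 / 2) powr (- p)"
 show ?thesis
 proof (rule that[of "K * C1 + K * 9"])
 show "K * C1 + K * 9 >= 0" using C1 by (simp add: K_def)
 fix a :: "'n l2" and N t s :: real
 assume N: "N > 0" and t: "t > 0" and s: "s >= 0" and a: "!!u. norm (tr u a - a) <= N * norm u"
 and sup: "!!y. norm (heat_ev t a y) <= s"
 have [measurable]: "l2_fun c \<in> borel_measurable borel" for c :: "'n l2" using in_L2_l2_fun by (auto simp: in_L2_iff)
 have tm: "t / 2 ^ m > 0" for m using t by simp
 have lim0: "filterlim (%m. t / 2 ^ m) (at_right 0) sequentially"
 using tm tendsto_mult[OF tendsto_const[of t] LIMSEQ_inverse_realpow_zero[of 2]]
 by (auto simp: filterlim_at divide_inverse)
 have lim: "(%m. heat_op (t / 2 ^ m) a - heat_op t a) \<longlonglongrightarrow> a - heat_op t a"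
 unfolding heat_op_def by (intro tendsto_diff tendsto_const filterlim_compose[OF heat_ev_tendsto lim0])
 have 1: "Ip p (l2_fun (a - heat_op t a)) <= ennreal (C1 * (N powr p * t powr dl))"
 proof (rule Ip_fatou[OF lim])
 fix m
 have "heat_op (t / 2 ^ m) a - heat_op t a = to_l2 (%y. heat_ev (t / 2 ^ m) a y - heat_ev t a y)"
 using tm t by (simp add: heat_op_def to_l2_diff heat_ev_in_L2)
 then have "AE x in lborel. l2_fun (heat_op (t / 2 ^ m) a - heat_op t a) x = heat_ev (t / 2 ^ m) a x - heat_ev t a x"
 using l2_fun_to_l2[OF in_L2_diff[OF heat_ev_in_L2[OF tm] heat_ev_in_L2[OF t]], of m a a] by simp
 then have "Ip p (%x. l2_fun (heat_op (t / 2 ^ m) a - heat_op t a) x) = Ip p (%y. heat_ev (t / 2 ^ m) a y - heat_ev t a y)"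
 by (intro Ip_cong_AE) auto
 also have "... <= ennreal (C1 * (N powr p * t powr dl))" by (rule C1(2)[OF N t a])
 finally show "Ip p (%x. l2_fun (heat_op (t / 2 ^ m) a - heat_op t a) x) <= ennreal (C1 * (N powr p * t powr dl))" .
 qed (use p in simp)
 have "Ip p (heat_ev t a) <= ennreal (s powr (p - 2) * (norm (heat_op t a))\<^sup>2)"
 unfolding heat_op_def by (rule Ip_sup_bound[OF heat_ev_in_L2[OF t] sup p(1)])
 also have "... <= ennreal (s powr (p - 2) * (9 * (norm a)\<^sup>2))"
 using power_mono[OF norm_heat_op[OF t, of a], of 2] by (intro ennreal_leI mult_left_mono) (auto simp: power_mult_distrib)
 finally have 2: "Ip p (heat_ev t a) <= ennreal (s powr (p - 2) * (9 * (norm a)\<^sup>2))" .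
 have "AE x in lborel. l2_fun a x = l2_fun (a - heat_op t a) x + heat_ev t a x"
 using l2_fun_diff[of a "heat_op t a"] l2_fun_to_l2[OF heat_ev_in_L2[OF t, of a]] unfolding heat_op_def
 by eventually_elim simp
 then have "Ip p (l2_fun a) = Ip p (%x. l2_fun (a - heat_op t a) x + heat_ev t a x)" by (intro Ip_cong_AE) auto
 also have "... <= ennreal ((1 - 1 / 2) powr (- p)) * Ip p (l2_fun (a - heat_op t a)) + ennreal ((1 / 2) powr (- p)) * Ip p (heat_ev t a)"
 using p by (intro Ip_add_le) auto
 also have "... <= ennreal K * ennreal (C1 * (N powr p * t powr dl)) + ennreal K * ennreal (s powr (p - 2) * (9 * (norm a)\<^sup>2))"
 using 1 2 by (intro add_mono mult_mono) (auto simp: K_def)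
 also have "... = ennreal (K * C1 * (N powr p * t powr dl) + K * 9 * (s powr (p - 2) * (norm a)\<^sup>2))"
 using C1(1) by (simp add: ennreal_mult[symmetric] ennreal_plus[symmetric] K_def mult_ac del: ennreal_plus)
 also have "... <= ennreal ((K * C1 + K * 9) * (N powr p * t powr dl + s powr (p - 2) * (norm a)\<^sup>2))"
 using C1(1) by (intro ennreal_leI) (simp add: distrib_left distrib_right K_def)
 finally show "Ip (2 * \<sigma> + 2) (l2_fun a) <= ennreal ((K * C1 + K * 9) * (N powr (2 * \<sigma> + 2) * t powr dl + s powr (2 * \<sigma>) * (norm a)\<^sup>2))"
 unfolding p(2) using p_def by simp
 qed
qed

section \<open>Weak limits and the \<open>L\<^sup>p\<close> norm\<close>

lemma Lp_norm_powr: "p > 0 ==> ennreal_powr (Lp_norm p f) p = Ip p f"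
 by (cases "Ip p f") (auto simp: Lp_norm_def Ip_def ennreal_powr_def powr_powr)

lemma Ip_tr: 
 fixes a :: "'n::finite l2"
 shows "Ip p (l2_fun (tr y a)) = Ip p (l2_fun a)"
proof -
 have "AE x in lborel. l2_fun (tr y a) x = 1 * l2_fun a (1 *\<^sub>R x + y)" by (rule l2_fun_wop) simp
 then have "Ip p (l2_fun (tr y a)) = Ip p (%x. l2_fun a (1 *\<^sub>R x + y))" by (intro Ip_cong_AE) auto
 also have "... = Ip p (l2_fun a)"
 unfolding Ip_def by (subst nn_integral_affine[of "%x. ennreal (norm (l2_fun a x) powr p)" 1 y]) auto
 finally show ?thesis .
qed

text \<open>The weight \<open>eps powr (n * \<sigma>)\<close> in the hypotheses is exactly the
  effect of the dilation, so the rescaled problem carries no weight.\<close>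

lemma Ip_scl:
 fixes f :: "real ^ 'n::finite => complex"
 assumes f: "in_L2 f" and e: "eps > 0"
 shows "Ip (2 * \<sigma> + 2) (l2_fun (scl (1 / eps) (to_l2 f))) = ennreal (eps powr (real CARD('n) * \<sigma>)) * Ip (2 * \<sigma> + 2) f"
proof -
 let ?p = "2 * \<sigma> + 2" and ?n = "real CARD('n)"
 have [measurable]: "f \<in> borel_measurable borel" using f by (simp add: in_L2_iff)
 have e': "1 / eps > 0" using e by simp
 have 1: "AE x in lborel. l2_fun (scl (1 / eps) (to_l2 f)) x = of_real (sqrt eps ^ CARD('n)) * l2_fun (to_l2 f) (eps *\<^sub>R x + 0)"
 using l2_fun_wop[OF scl_weight[OF e'], of 0 "to_l2 f"] by (simp add: scl_def)
 have 2: "AE x in lborel. l2_fun (to_l2 f) (eps *\<^sub>R x + 0) = f (eps *\<^sub>R x + 0)"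
 by (rule AE_lborel_affine[OF l2_fun_to_l2[OF f]]) (use e in simp)
 have se: "sqrt eps ^ CARD('n) = eps powr (?n / 2)" using e by (simp add: powr_half_sqrt[symmetric] powr_realpow[symmetric] powr_powr)
 have "Ip ?p (l2_fun (scl (1 / eps) (to_l2 f))) = Ip ?p (%x. of_real (sqrt eps ^ CARD('n)) * f (eps *\<^sub>R x + 0))"
 by (rule Ip_cong_AE) (use 1 2 in eventually_elim, simp)
 also have "... = (\<integral>\<^sup>+x. ennreal (eps powr (?n / 2 * ?p)) * ennreal (norm (f (eps *\<^sub>R x + 0)) powr ?p) \<partial>lborel)"
 unfolding Ip_def se using e by (simp add: norm_mult powr_mult powr_powr ennreal_mult)
 also have "... = ennreal (eps powr (?n / 2 * ?p)) * (\<integral>\<^sup>+x. ennreal (norm (f (eps *\<^sub>R x + 0)) powr ?p) \<partial>lborel)"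
 by (rule nn_integral_cmult) measurable
 also have "eps powr (?n / 2 * ?p) = eps powr (?n * \<sigma>) * eps ^ CARD('n)"
 proof -
 have "?n / 2 * ?p = ?n * \<sigma> + ?n" by (simp add: algebra_simps)
 then show ?thesis by (simp only: powr_add powr_realpow[OF e])
 qed
 also have "ennreal (eps powr (?n * \<sigma>) * eps ^ CARD('n)) * (\<integral>\<^sup>+x. ennreal (norm (f (eps *\<^sub>R x + 0)) powr ?p) \<partial>lborel)
 = ennreal (eps powr (?n * \<sigma>)) * Ip ?p f"
 unfolding Ip_def using e
 by (subst nn_integral_affine[of "%x. ennreal (norm (f x) powr ?p)" eps 0]) (auto simp: ennreal_mult mult.assoc)
 finally show ?thesis .
qed

lemma Lp_eps_norm_le:
 fixes f :: "real ^ 'n::finite => complex"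
 assumes f: "in_L2 f" and e: "eps > 0" and \<sigma>: "\<sigma> > 0" and B: "B >= 0"
 and le: "Ip (2 * \<sigma> + 2) (l2_fun (scl (1 / eps) (to_l2 f))) <= ennreal B"
 shows "Lp_eps_norm \<sigma> eps f <= ennreal (B powr (1 / (2 * \<sigma> + 2)))"
proof -
 let ?p = "2 * \<sigma> + 2" and ?n = "real CARD('n)"
 have le': "ennreal (eps powr (?n * \<sigma>)) * Ip ?p f <= ennreal B" using le unfolding Ip_scl[OF f e] .
 have "Ip ?p f ~= \<infinity>" using le' e by (auto simp: ennreal_mult_top top_unique)
 then obtain x where x: "Ip ?p f = ennreal x" "x >= 0" by (cases "Ip ?p f") auto
 have le2: "eps powr (?n * \<sigma>) * x <= B" using le' x B by (simp add: ennreal_mult[symmetric] ennreal_le_iff)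
 have "Lp_eps_norm \<sigma> eps f = ennreal (eps powr (?n * \<sigma> / ?p) * x powr (1 / ?p))"
 using x unfolding Lp_eps_norm_def Lp_norm_def Ip_def[symmetric] by (simp add: ennreal_powr_def ennreal_mult)
 also have "eps powr (?n * \<sigma> / ?p) * x powr (1 / ?p) = (eps powr (?n * \<sigma>) * x) powr (1 / ?p)"
 using x e by (simp add: powr_mult powr_powr)
 also have "ennreal ... <= ennreal (B powr (1 / ?p))" using le2 x \<sigma> by (intro ennreal_leI powr_mono2) auto
 finally show ?thesis .
qed

lemma heat_ev_wconv:
 fixes f :: "'n::finite l2"
 assumes t: "t > 0" and w: "wconv U x f"
 shows "((%k. heat_ev t (x k) y) \<longlongrightarrow> heat_ev t f y) U"
proof -
 have e: "heat_ev t a y = Complex (inner a (gvec (1, of_real t, y))) (inner a (gvec (\<i>, of_real t, y))) / of_real (gauss_const TYPE('n))" for a :: "'n l2"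
 using heat_ev_inner[OF t, of a y] gauss_const_pos[where 'n = 'n] by (simp add: field_simps)
 have "((%k. Complex (inner (x k) (gvec (1, of_real t, y))) (inner (x k) (gvec (\<i>, of_real t, y)))) \<longlongrightarrow>
 Complex (inner f (gvec (1, of_real t, y))) (inner f (gvec (\<i>, of_real t, y)))) U"
 by (intro tendsto_Complex wconvD[OF w])
 then show ?thesis unfolding e using gauss_const_pos[where 'n = 'n] by (intro tendsto_divide tendsto_const) auto
qed

lemma heat_ev_tr:
 fixes a :: "'n::finite l2"
 assumes t: "t > 0"
 shows "heat_ev t (tr y a) 0 = heat_ev t a y"
proof -
 interpret S: isometry_group "tr :: real ^ 'n => 'n l2 => 'n l2" by (rule tr_isometry_group)
 have "complex_of_real (gauss_const TYPE('n)) * heat_ev t (tr y a) 0 = of_real (gauss_const TYPE('n)) * heat_ev t a y"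
 unfolding heat_ev_inner[OF t] by (simp add: S.T_adjoint tr_gvec)
 then show ?thesis using gauss_const_pos[where 'n = 'n] by simp
qed

lemma heat_bounded:
 assumes t: "t > 0"
 obtains K where "K > 0" "!!x :: real ^ 'n::finite. heat t x <= K"
proof -
 have "heat t x <= (1 / (sqrt (2 * pi * t)) :: real) ^ CARD('n) + 1" for x :: "real ^ 'n"
 proof -
 have "heat t x <= (\<Prod>i\<in>(UNIV :: 'n set). 1 / sqrt (2 * pi * t))"
 unfolding heat_def using t by (intro prod_mono) (auto simp: normal_density_def divide_simps)
 then show ?thesis by simp
 qed
 moreover have "(1 / (sqrt (2 * pi * t)) :: real) ^ CARD('n) + 1 > 0" using t by (simp add: add_nonneg_pos)
 ultimately show ?thesis using that by blast
qed

text \<open>Values are split at the level \<open>eta\<close>: small ones contribute at most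
  \<open>eta\<close> because the kernel has mass 1; large ones are at most
  \<open>eta powr (1 - p)\<close> times their \<open>p\<close>-th power, and the kernel is
  bounded.\<close>

lemma heat_ev_Ip:
 assumes t: "t > 0" and p: "p > 1"
 obtains K where "K > 0" "!!(a :: 'n::finite l2) B eta y. B >= 0 ==> eta > 0 ==> Ip p (l2_fun a) <= ennreal B ==>
 norm (heat_ev t a y) <= eta + K * eta powr (1 - p) * B"
proof -
 obtain K where K: "K > 0" "!!x :: real ^ 'n. heat t x <= K" using heat_bounded[OF t] by blast
 show ?thesis
 proof (rule that[OF K(1)])
 fix a :: "'n l2" and B eta :: real and y :: "real ^ 'n"
 assume B: "B >= 0" and eta: "eta > 0" and I: "Ip p (l2_fun a) <= ennreal B"
 have i: "integrable lborel (%x. complex_of_real (heat t (x - y)) * l2_fun a x)"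
 by (rule in_L2_integrable_mult[OF heat_in_L2[OF t] in_L2_l2_fun])
 have hm: "(%x. heat t (x - y)) \<in> borel_measurable borel"
 proof -
 have "Re \<in> borel_measurable borel" by (rule borel_measurable_continuous_onI) (intro continuous_intros)
 from measurable_compose[OF _ this, of "%x. complex_of_real (heat t (x - y))" borel] show ?thesis
 using heat_in_L2[OF t, of y] by (simp add: in_L2_iff)
 qed
 have hi: "(\<integral>\<^sup>+x. ennreal (heat t (x - y)) \<partial>lborel) = 1"
 proof -
 have "(\<integral>\<^sup>+x. ennreal (heat t x) \<partial>(lborel :: (real ^ 'n) measure)) = 1"
 using heat_integral[OF t, where 'n = 'n] by (subst nn_integral_eq_integral) auto
 moreover have "(\<integral>\<^sup>+x. ennreal (heat t x) \<partial>(lborel :: (real ^ 'n) measure)) = (\<integral>\<^sup>+x. ennreal (heat t (x - y)) \<partial>lborel)"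
 using nn_integral_affine[of "%x. ennreal (heat t x)" 1 "- y"] measurable_compose[OF _ hm, of "%x. x + y" borel] by simp
 ultimately show ?thesis by simp
 qed
 have "ennreal (norm (heat_ev t a y)) <= (\<integral>\<^sup>+x. ennreal (norm (complex_of_real (heat t (x - y)) * l2_fun a x)) \<partial>lborel)"
 unfolding heat_ev_def by (rule integral_norm_bound_ennreal[OF i])
 also have "... <= (\<integral>\<^sup>+x. ennreal eta * ennreal (heat t (x - y)) + ennreal (K * eta powr (1 - p)) * ennreal (norm (l2_fun a x) powr p) \<partial>lborel)"
 proof (rule nn_integral_mono)
 fix x
 let ?A = "norm (l2_fun a x)"
 have "heat t (x - y) * ?A <= eta * heat t (x - y) + K * eta powr (1 - p) * ?A powr p"
 proof (cases "?A <= eta")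
 case True
 have "heat t (x - y) * ?A <= eta * heat t (x - y)"
 using mult_right_mono[OF True heat_nonneg[of t "x - y"]] by (simp only: mult.commute)
 then show ?thesis using K(1) by (simp add: add_increasing2)
 next
 case False
 then have A: "?A > eta" by simp
 have "?A = ?A powr (1 - p) * ?A powr p" using A eta by (simp flip: powr_add)
 also have "... <= eta powr (1 - p) * ?A powr p" using A eta p by (intro mult_right_mono powr_mono2') auto
 finally have "heat t (x - y) * ?A <= K * (eta powr (1 - p) * ?A powr p)" using K by (intro mult_mono) auto
 then show ?thesis using eta by (simp add: add_increasing mult.assoc)
 qed
 then have "norm (complex_of_real (heat t (x - y)) * l2_fun a x) <= eta * heat t (x - y) + K * eta powr (1 - p) * ?A powr p"
 by (simp add: norm_mult)
 then show "ennreal (norm (complex_of_real (heat t (x - y)) * l2_fun a x)) <= ennreal eta * ennreal (heat t (x - y)) + ennreal (K * eta powr (1 - p)) * ennreal (?A powr p)"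
 using eta K(1) by (simp add: ennreal_mult[symmetric] ennreal_plus[symmetric] ennreal_leI del: ennreal_plus)
 qed
 also have "... = ennreal eta + ennreal (K * eta powr (1 - p)) * Ip p (l2_fun a)"
 unfolding Ip_def using hm by (simp add: nn_integral_add nn_integral_cmult hi)
 also have "... <= ennreal eta + ennreal (K * eta powr (1 - p)) * ennreal B" by (intro add_mono mult_left_mono I) auto
 also have "... = ennreal (eta + K * eta powr (1 - p) * B)"
 using eta K(1) B by (simp add: ennreal_mult[symmetric] ennreal_plus[symmetric] del: ennreal_plus)
 finally show "norm (heat_ev t a y) <= eta + K * eta powr (1 - p) * B"
 using eta K(1) B by (subst (asm) ennreal_le_iff) auto
 qed
qed

text \<open>By \<open>heat_ev_Ip\<close> the heat regularisations become small, they pass to weak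
  limits, and a vector all of whose regularisations vanish is 0.\<close>

lemma Ip_weak_zero:
 fixes x :: "'k => 'n::finite l2"
 assumes p: "p > 1" and w: "wconv U x g" and U: "U ~= bot"
 and I: "!!eta. eta > 0 ==> eventually (%k. Ip p (l2_fun (x k)) <= ennreal eta) U"
 shows "g = 0"
proof -
 have z: "heat_ev t g y = 0" if t: "t > 0" for t y
 proof -
 obtain K where K: "K > 0" "!!(a :: 'n l2) B eta y. B >= 0 ==> eta > 0 ==> Ip p (l2_fun a) <= ennreal B ==>
 norm (heat_ev t a y) <= eta + K * eta powr (1 - p) * B" using heat_ev_Ip[OF t p] by blast
 have "norm (heat_ev t g y) <= 2 * eta" if eta: "eta > 0" for eta
 proof (rule tendsto_upperbound[OF tendsto_norm[OF heat_ev_wconv[OF t w]] _ U])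
 \<comment> \<open>Makes the two terms of \<open>heat_ev_Ip\<close> equal.\<close>
 let ?B = "eta / (K * eta powr (1 - p))"
 have B: "?B > 0" using eta K by simp
 show "\<forall>\<^sub>F k in U. norm (heat_ev t (x k) y) <= 2 * eta"
 using I[OF B]
 proof eventually_elim
 case (elim k)
 have "norm (heat_ev t (x k) y) <= eta + K * eta powr (1 - p) * ?B" using B eta elim by (intro K(2)) auto
 then show ?case using K eta by simp
 qed
 qed
 from this[of "norm (heat_ev t g y) / 4"] show ?thesis by (cases "heat_ev t g y = 0") auto
 qed
 have "((%t. to_l2 (heat_ev t g)) \<longlongrightarrow> 0) (at_right 0)"
 proof (rule Lim_transform_eventually[OF tendsto_const])
 have "to_l2 (heat_ev t g) = 0" if "t > 0" for t
 proof -
 have "heat_ev t g = (%_. 0)" using z[OF that] by auto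
 then show ?thesis using to_l2_scaleR[OF in_L2_0, of 0] by simp
 qed
 then show "\<forall>\<^sub>F t in at_right 0. 0 = to_l2 (heat_ev t g)" by (auto simp: eventually_at_filter)
 qed
 then show ?thesis using heat_ev_tendsto[of g] tendsto_unique[OF trivial_limit_at_right_real] by blast
qed

lemma inner_wconv_tendsto:
 assumes w: "wconv U x f" and y: "(y \<longlongrightarrow> z) U" and B: "!!k. norm (x k) <= B"
 shows "((%k. inner (x k) (y k)) \<longlongrightarrow> inner f z) U"
proof -
 have "((%k. inner (x k) (y k - z)) \<longlongrightarrow> 0) U"
 proof (rule tendsto_norm_zero_cancel, rule tendsto_sandwich[where f = "%_. 0" and h = "%k. B * norm (y k - z)"])
 show "((%k. B * norm (y k - z)) \<longlongrightarrow> 0) U" using tendsto_mult_right_zero[OF tendsto_norm_zero[OF LIM_zero[OF y]]] .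
 show "\<forall>\<^sub>F k in U. norm (inner (x k) (y k - z)) <= B * norm (y k - z)"
 using B by (intro always_eventually allI order_trans[OF Cauchy_Schwarz_ineq2[folded real_norm_def] mult_right_mono]) auto
 qed auto
 from tendsto_add[OF this wconvD[OF w, of z]] show ?thesis by (simp add: inner_diff_right)
qed

text \<open>Every set of the ultrafilter contains arbitrarily large indices, so stage
  \<open>k\<close> can realise \<open>P k\<close> beyond all earlier indices. This is the passage
  from the ultrafilter back to ordinary limits.\<close>

lemma ultra_subsequence:
 fixes P :: "nat => nat => bool"
 assumes U: "U <= sequentially" "U ~= bot" and P: "!!q. eventually (P q) U"
 obtains r :: "nat => nat" where "strict_mono r" "!!k. P k (r k)"
proof -
 have ex: "\<exists>m>m'. P q m" for q m'
 proof -
 have "eventually (%m. m > m') U" using U(1) eventually_gt_at_top[of m'] by (auto simp: le_filter_def)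
 then have "eventually (%m. m > m' & P q m) U" using P by (rule eventually_conj)
 then show ?thesis using U(2) eventually_happens by blast
 qed
 have "\<exists>r. \<forall>k. P k (r k) & r k < r (Suc k)"
 by (rule dependent_nat_choice[of P "%_ a b. a < b"]) (use ex in blast)+
 then show ?thesis using that by (auto simp: strict_mono_Suc_iff)
qed

section \<open>Profiles of a bounded sequence\<close>

lemma small_powr:
 fixes K a c :: real
 assumes "K >= 0" "a > 0" "c > 0"
 obtains t where "t > 0" "K * t powr a <= c"
proof (rule that[of "(c / (K + 1)) powr (1 / a)"])
 have pos: "c / (K + 1) > 0" using assms by simp
 show "(c / (K + 1)) powr (1 / a) > 0" using assms by simp
 have "c ~= 0" "K + 1 ~= 0" using assms by auto
 then have "((c / (K + 1)) powr (1 / a)) powr a = c / (K + 1)" using pos assms by (simp add: powr_powr)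
 moreover have "K * (c / (K + 1)) <= c" using assms by (simp add: field_simps)
 ultimately show "K * ((c / (K + 1)) powr (1 / a)) powr a <= c" by (simp only:)
qed

lemma quotient_lipschitz:
 fixes a :: "'n::finite l2"
 assumes q: "!!i h. norm (tr (h *\<^sub>R axis i 1) a - a) <= C * \<bar>h\<bar>"
 shows "norm (tr u a - a) <= real CARD('n) * C * norm u"
proof -
 have "\<exists>G. gder i a G & norm G <= C" for i using quotient_gder[of i a C, OF q] by blast
 then obtain G where "!!i. gder i a (G i)" "!!i. norm (G i) <= C" by metis
 then show ?thesis by (rule gder_lipschitz)
qed

lemma galilei_tr: "galilei g (tr y a) = tr y (galilei g a)"
proof -
 interpret R: isometry_group "tr :: real ^ 'a => 'a l2 => 'a l2" by (rule tr_isometry_group)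
 show ?thesis unfolding galilei_def by (subst R.T_commute) (simp only: schr_tr)
qed

lemma norm_tr_galilei_diff: "norm (tr y (galilei g a) - galilei g a) = norm (tr y a - a)"
proof -
 interpret G: isometry_group "galilei :: real \<times> (real ^ 'a) => 'a l2 => 'a l2" by (rule galilei_isometry_group)
 have "tr y (galilei g a) - galilei g a = galilei g (tr y a - a)"
 unfolding galilei_tr[symmetric] linear_diff[OF G.T_linear] ..
 then show ?thesis by (simp only: G.T_norm)
qed

lemma norm_tr_schr_diff: "norm (tr y (schr s a) - schr s a) = norm (tr y a - a)"
proof -
 interpret R: isometry_group "tr :: real ^ 'a => 'a l2 => 'a l2" by (rule tr_isometry_group)
 have "galilei (s, 0) a = schr s a" unfolding galilei_def fst_conv snd_conv R.T_0 ..
 then show ?thesis using norm_tr_galilei_diff[of y "(s, 0)" a] by (simp only:)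
qed

lemma heat_ev_galilei: "t > 0 ==> heat_ev t (galilei (s, y) a) 0 = heat_ev t (schr s a) y"
 by (simp add: galilei_def schr_tr heat_ev_tr)

text \<open>Nonnegative times that do not tend to infinity converge along \<open>U\<close> and can
  be undone in the limit. What is left are translates of the data, whose weak limits vanish by the
  smallness at time zero.\<close>

lemma weak_limit_escapes:
 fixes w :: "nat => 'n::finite l2"
 assumes U: "ultra U" "U <= sequentially" and p: "p > 1" and M: "!!k. norm (w k) <= M"
 and w0: "!!eta. eta > 0 ==> \<forall>\<^sub>F k in sequentially. Ip p (l2_fun (w k)) <= ennreal eta"
 and g: "!!k. fst (g k) >= 0" and f: "wconv U (%k. galilei (g k) (w k)) f" "f ~= 0"
 shows "filterlim (%k. fst (g k)) at_top U"
proof (rule ccontr)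
 interpret S: isometry_group "schr :: real => 'n l2 => 'n l2" by (rule schr_isometry_group)
 interpret R: isometry_group "tr :: real ^ 'n => 'n l2 => 'n l2" by (rule tr_isometry_group)
 assume "\<not> filterlim (%k. fst (g k)) at_top U"
 then obtain Z where "\<not> eventually (%k. Z <= fst (g k)) U" by (auto simp: filterlim_at_top)
 then have "eventually (%k. norm (fst (g k)) <= Z) U"
 by (rule eventually_mono[OF ultra_not[OF U(1)]]) (use g in auto)
 from ultra_bounded_limit[OF U(1) this] obtain s where s: "((%k. fst (g k)) \<longlongrightarrow> s) U" by blast
 have "wconv U (%k. tr (snd (g k)) (w k)) (schr (- s) f)"
 unfolding wconv_def
 proof
 fix e
 have "((%k. inner (galilei (g k) (w k)) (schr (fst (g k)) e)) \<longlongrightarrow> inner f (schr s e)) U"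
 by (rule inner_wconv_tendsto[OF f(1) S.T_tendsto[OF tendsto_const s], of M]) (use M in \<open>simp add: galilei_def\<close>)
 moreover have "inner (galilei (g k) (w k)) (schr (fst (g k)) e) = inner (tr (snd (g k)) (w k)) e" for k
 unfolding galilei_def S.T_inner ..
 moreover have "inner f (schr s e) = inner (schr (- s) f) e" using S.T_adjoint[of "- s" f e] by simp
 ultimately show "((%k. inner (tr (snd (g k)) (w k)) e) \<longlongrightarrow> inner (schr (- s) f) e) U" by simp
 qed
 then have "schr (- s) f = 0"
 proof (rule Ip_weak_zero[OF p _ ultra_not_bot[OF U(1)]])
 fix eta :: real assume "eta > 0"
 then show "eventually (%k. Ip p (l2_fun (tr (snd (g k)) (w k))) <= ennreal eta) U"
 unfolding Ip_tr using w0 U(2) by (auto simp: le_filter_def)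
 qed
 then have "norm f = 0" using S.T_norm[of "- s" f] by simp
 then show False using f(2) by simp
qed

text \<open>A regularised value is controlled by two Gaussian pairings, so a weak bound uniform over
  parameters becomes a uniform bound after smoothing.\<close>

lemma heat_ev_inner_bound:
 fixes a :: "'n::finite l2"
 assumes t: "t > 0"
 obtains E where "E >= 0" "!!(a :: 'n l2) kap. (!!e. e \<in> {gvec (1, of_real t, 0), gvec (\<i>, of_real t, 0)} ==> \<bar>inner a e\<bar> <= kap * norm e) ==>
 norm (heat_ev t a 0) <= kap * E"
proof -
 define gc where "gc = gauss_const TYPE('n)"
 have gc: "gc > 0" by (simp add: gc_def gauss_const_pos)
 let ?e = "gvec (1, of_real t, 0) :: 'n l2" and ?e' = "gvec (\<i>, of_real t, 0) :: 'n l2"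
 show ?thesis
 proof (rule that[of "(norm ?e + norm ?e') / gc"])
 show "(norm ?e + norm ?e') / gc >= 0" using gc by simp
 fix a :: "'n l2" and kap
 assume h: "!!e. e \<in> {?e, ?e'} ==> \<bar>inner a e\<bar> <= kap * norm e"
 have "gc * norm (heat_ev t a 0) = norm (Complex (inner a ?e) (inner a ?e'))"
 using arg_cong[OF heat_ev_inner[OF t, of a 0], of norm] gc unfolding gc_def[symmetric] by (simp add: norm_mult)
 also have "... <= \<bar>inner a ?e\<bar> + \<bar>inner a ?e'\<bar>" using cmod_le[of "Complex (inner a ?e) (inner a ?e')"] by simp
 also have "... <= kap * norm ?e + kap * norm ?e'" by (intro add_mono h) auto
 finally show "norm (heat_ev t a 0) <= kap * ((norm ?e + norm ?e') / gc)" using gc by (simp add: field_simps)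
 qed
qed

text \<open>The hypotheses are those of the main result after rescaling, with the large norm
  attained at the times \<open>s k\<close>. The conclusions indexed by \<open>q\<close> hold at the
  index \<open>r q\<close> for all profile indices up to \<open>q\<close>. The derivatives
  \<open>H j i\<close> are carried along because their partial sums need the same bounds.\<close>

theorem profile_core:
 fixes w :: "nat => 'n::finite l2" and M \<sigma> c :: real
 assumes \<sigma>: "\<sigma> > 0" and dl: "dl = \<sigma> + 1 - real CARD('n) * \<sigma> / 2" "dl > 0" and M: "M > 0"
 and wM: "!!k. norm (w k) <= M"
 and wD: "!!k i h. norm (tr (h *\<^sub>R axis i 1) (w k) - w k) <= M * \<bar>h\<bar>"
 and w0': "\<forall>eta>0. \<forall>\<^sub>F k in sequentially. Ip (2 * \<sigma> + 2) (l2_fun (w k)) <= ennreal eta"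
 and s: "!!k. s k >= 0" and c: "c > 0" "!!k. Ip (2 * \<sigma> + 2) (l2_fun (schr (s k) (w k))) > ennreal c"
 shows "\<exists>(r :: nat => nat) (g :: nat => nat => real \<times> (real ^ 'n)) f H. strict_mono r & (\<forall>k. fst (g 0 k) = s k) &
 (\<forall>j. norm (f j) <= M) & f 0 ~= 0 & (\<forall>j i. gder i (f j) (H j i) & norm (H j i) <= M) &
 (\<forall>q. (\<forall>i\<in>{..q}. \<forall>j\<in>{..q}. i ~= j --> real q <= norm (g i (r q) - g j (r q))) &
 (\<forall>j\<in>{..q}. max 1 (real q) <= fst (g j (r q))) &
 (\<forall>l\<in>{..q}. norm (\<Sum>j<l. galilei (- g j (r q)) (f j)) <= M + 1 &
 (\<forall>i. norm (\<Sum>j<l. galilei (- g j (r q)) (H j i)) <= M + 1))) &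
 (\<forall>\<beta>>0. \<forall>\<^sub>F l in sequentially. \<forall>\<^sub>F k in sequentially. \<forall>u\<ge>0.
 Ip (2 * \<sigma> + 2) (l2_fun (schr u (w (r k) - (\<Sum>j<l. galilei (- g j (r k)) (f j))))) <= ennreal \<beta>)"
proof -
 interpret G: mixing_group "galilei :: real \<times> (real ^ 'n) => 'n l2 => 'n l2" by (rule galilei_mixing_group)
 interpret S: isometry_group "schr :: real => 'n l2 => 'n l2" by (rule schr_isometry_group)
 interpret R: isometry_group "tr :: real ^ 'n => 'n l2 => 'n l2" by (rule tr_isometry_group)
 let ?p = "2 * \<sigma> + 2" and ?n = "real CARD('n)"
 have p: "?p > 1" using \<sigma> by simp
 have w0: "\<forall>\<^sub>F k in sequentially. Ip ?p (l2_fun (w k)) <= ennreal eta" if "eta > 0" for eta using w0' that by blast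
 \<comment> \<open>The data have norm and Lipschitz constants at most \<open>M\<close>, the partial
   sums of profiles at most \<open>M + 1\<close>, so remainders are covered by
   \<open>2 * M + 1\<close>; the factor \<open>n\<close> is that of
   \<open>quotient_lipschitz\<close>.\<close>
 define N where "N = ?n * (2 * M + 1)"
 have N: "N > 0" using M by (simp add: N_def)
 obtain CI where CI: "CI >= 0" "!!(a :: 'n l2) N t s. N > 0 ==> t > 0 ==> s >= 0 ==> (!!u. norm (tr u a - a) <= N * norm u) ==>
 (!!y. norm (heat_ev t a y) <= s) ==> Ip ?p (l2_fun a) <= ennreal (CI * (N powr ?p * t powr dl + s powr (2 * \<sigma>) * (norm a)\<^sup>2))"
 using Ip_heat_bound[OF \<sigma> dl] by blast
 have bound: "Ip ?p (l2_fun (schr u a)) <= ennreal \<beta>"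
 if a: "!!i h. norm (tr (h *\<^sub>R axis i 1) a - a) <= (2 * M + 1) * \<bar>h\<bar>" "norm a <= 2 * M + 1"
 and ht: "!!y. norm (heat_ev t (schr u a) y) <= s'" and t: "t > 0" and s': "s' >= 0"
 and b1: "(CI * N powr ?p) * t powr dl <= \<beta> / 2" and b2: "(CI * (2 * M + 1)\<^sup>2) * s' powr (2 * \<sigma>) <= \<beta> / 2"
 for a :: "'n l2" and u t s' \<beta>
 proof -
 have "norm (tr v (schr u a) - schr u a) <= N * norm v" for v
 unfolding norm_tr_schr_diff N_def by (rule quotient_lipschitz[OF a(1)])
 then have "Ip ?p (l2_fun (schr u a)) <= ennreal (CI * (N powr ?p * t powr dl + s' powr (2 * \<sigma>) * (norm (schr u a))\<^sup>2))"
 by (rule CI(2)[OF N t s' _ ht])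
 also have "... <= ennreal \<beta>"
 proof (rule ennreal_leI)
 have "(norm a)\<^sup>2 <= (2 * M + 1)\<^sup>2" using a(2) by (intro power_mono) auto
 then have "CI * (s' powr (2 * \<sigma>) * (norm a)\<^sup>2) <= CI * (s' powr (2 * \<sigma>) * (2 * M + 1)\<^sup>2)"
 using CI(1) by (intro mult_left_mono) auto
 then show "CI * (N powr ?p * t powr dl + s' powr (2 * \<sigma>) * (norm (schr u a))\<^sup>2) <= \<beta>"
 using b1 b2 by (simp add: distrib_left mult_ac)
 qed
 finally show ?thesis .
 qed
 \<comment> \<open>Heat time and level are taken so small that regularisations below
   \<open>s'\<close> everywhere would contradict the lower bound \<open>c\<close>; hence the points
   \<open>y k\<close> below exist.\<close>
 obtain t where t: "t > 0" "(CI * N powr ?p) * t powr dl <= c / 2" using small_powr[of "CI * N powr ?p" dl "c / 2"] CI(1) dl(2) c(1) by auto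
 obtain s' where s': "s' > 0" "(CI * (2 * M + 1)\<^sup>2) * s' powr (2 * \<sigma>) <= c / 2" using small_powr[of "CI * (2 * M + 1)\<^sup>2" "2 * \<sigma>" "c / 2"] CI(1) \<sigma> c(1) by auto
 have "\<exists>y. norm (heat_ev t (schr (s k) (w k)) y) > s'" for k
 proof (rule ccontr)
 assume "\<not> ?thesis"
 then have h: "norm (heat_ev t (schr (s k) (w k)) y) <= s'" for y by (simp add: not_less)
 have "M * \<bar>h\<bar> <= (2 * M + 1) * \<bar>h\<bar>" for h using M by (intro mult_right_mono) auto
 then have "Ip ?p (l2_fun (schr (s k) (w k))) <= ennreal c"
 using wM[of k] M by (intro bound[OF order_trans[OF wD] _ h t(1) less_imp_le[OF s'(1)] t(2) s'(2)]) auto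
 then show False using c(2)[of k] by simp
 qed
 then obtain y where y: "!!k. norm (heat_ev t (schr (s k) (w k)) (y k)) > s'" by metis
 \<comment> \<open>The imposed parameters: the prescribed time and a point where the regularisation
   is large. The large value survives in the weak limit and makes \<open>f0\<close> nonzero.\<close>
 define g0 where "g0 k = (s k, y k)" for k
 obtain U :: "nat filter" where U: "U <= sequentially" "ultra U" by (rule ultrafilter_exists[OF sequentially_bot])
 note nb = ultra_not_bot[OF U(2)]
 obtain f0 where f0: "wconv U (%k. galilei (g0 k) (w k)) f0"
 using ultra_weak_limit[OF U(2) always_eventually[OF allI], of "%k. galilei (g0 k) (w k)" M] wM by auto
 have f0n: "f0 ~= 0"
 proof
 assume "f0 = 0"
 have "norm (heat_ev t f0 0) >= s'"
 proof (rule tendsto_lowerbound[OF tendsto_norm[OF heat_ev_wconv[OF t(1) f0]] _ nb])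
 show "\<forall>\<^sub>F k in U. s' <= norm (heat_ev t (galilei (g0 k) (w k)) 0)"
 using less_imp_le[OF y] by (intro always_eventually allI) (simp add: g0_def heat_ev_galilei[OF t(1)])
 qed
 moreover have "heat_ev t (0 :: 'n l2) 0 = 0" by (rule linear_0[OF bounded_linear.linear[OF heat_ev_bounded_linear[OF t(1)]]])
 ultimately show False using s'(1) unfolding \<open>f0 = 0\<close> by simp
 qed
 define A where "A = {g :: real \<times> (real ^ 'n). fst g >= 0}"
 have dummy: "\<exists>d\<in>A. fst d >= R & (\<forall>x\<in>F. norm (d - x) >= R)" if F: "finite F" for F :: "(real \<times> (real ^ 'n)) set" and R
 proof -
 define q where "q = \<bar>R\<bar> + (\<Sum>x\<in>F. norm x)"
 have q: "q >= \<bar>R\<bar>" by (simp add: q_def sum_nonneg)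
 have "norm ((q, 0 :: real ^ 'n) - x) >= R" if x: "x \<in> F" for x
 proof -
 have "norm x <= (\<Sum>x\<in>F. norm x)" using F x by (intro member_le_sum) auto
 moreover have "norm (q, 0 :: real ^ 'n) - norm x <= norm ((q, 0) - x)" by (rule norm_triangle_ineq2)
 moreover have "norm (q, 0 :: real ^ 'n) = q" using q by (simp add: norm_Pair)
 ultimately show ?thesis unfolding q_def by linarith
 qed
 then show ?thesis using q by (intro bexI[of _ "(q, 0)"]) (auto simp: A_def)
 qed
 have esc: "filterlim (%k. fst (g k)) at_top U"
 if "!!k. g k \<in> A" "wconv U (%k. galilei (g k) (w k)) f" "f ~= 0" for g f
 using weak_limit_escapes[OF U(2,1) p wM w0 _ that(2,3)] that(1) by (simp add: A_def)
 have g0A: "g0 k \<in> A" for k using s by (simp add: A_def g0_def)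

 \<comment> \<open>Extraction along the ultrafilter and bounds for profiles and partial sums\<close>
 obtain g f where gf: "g 0 = g0" "f 0 = f0" "!!j k. g j k \<in> A"
 "!!j. wconv U (%k. galilei (g j k) (w k)) (f j)"
 "!!i j. i ~= j ==> filterlim (%k. g i k - g j k) at_infinity U"
 "!!j. filterlim (%k. fst (g j k)) at_top U"
 "!!l e kap. l > 0 ==> kap > 0 ==>
 eventually (%k. \<forall>d\<in>A. \<bar>inner (galilei d (G.remainder w g f l k)) e\<bar> <= (2 * norm (f l) + kap) * norm e) U"
 "f \<longlonglongrightarrow> 0"
 proof (rule G.profile_decomposition[where lev = fst and A = A, OF U(2,1) wM dummy esc g0A f0 f0n])
 fix g f assume a: "g 0 = g0" "f 0 = f0" "!!j k. g j k \<in> A"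
 "!!j. wconv U (%k. galilei (g j k) (w k)) (f j)"
 "!!i j. i ~= j ==> filterlim (%k. g i k - g j k) at_infinity U"
 "!!j. filterlim (%k. fst (g j k)) at_top U"
 "!!l e kap. l > 0 ==> kap > 0 ==>
 eventually (%k. \<forall>d\<in>A. \<bar>inner (galilei d (G.remainder w g f l k)) e\<bar> <= (2 * norm (f l) + kap) * norm e) U"
 "f \<longlonglongrightarrow> 0"
 show ?thesis by (rule that[OF a])
 qed
 have sumf: "(\<Sum>j<l. (norm (f j))\<^sup>2) <= M\<^sup>2" for l
 by (rule G.bessel_profiles[where D = "%x. x" and l = l and g = g and w = w and F = U]) (use gf(4,5) wM nb in \<open>auto simp: bounded_linear_ident\<close>)
 \<comment> \<open>Bessel's inequality for translation differences; dividing by \<open>h\<close> and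
   letting \<open>h\<close> tend to 0 yields it for the derivatives \<open>H\<close>.\<close>
 have sumD: "(\<Sum>j<l. (norm (tr (h *\<^sub>R axis i 1) (f j) - f j))\<^sup>2) <= (M * \<bar>h\<bar>)\<^sup>2" for l h i
 proof (rule G.bessel_profiles[where D = "%x. tr (h *\<^sub>R axis i 1) x - x" and l = l, OF gf(5) gf(4)])
 show "bounded_linear (%x :: 'n l2. tr (h *\<^sub>R axis i 1) x - x)" by (intro bounded_linear_sub R.T_blin bounded_linear_ident)
 show "tr (h *\<^sub>R axis i 1) (galilei g x) - galilei g x = galilei g (tr (h *\<^sub>R axis i 1) x - x)" for g and x :: "'n l2"
 unfolding galilei_tr[symmetric] linear_diff[OF G.T_linear] ..
 qed (use wD nb in auto)
 have sq: "norm (x j) <= B" if b: "(\<Sum>j<Suc j. (norm (x j))\<^sup>2) <= B\<^sup>2" and B: "B >= 0" for x :: "nat => 'n l2" and j B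
 proof -
 have "(norm (x j))\<^sup>2 <= (\<Sum>j<Suc j. (norm (x j))\<^sup>2)" by (rule member_le_sum) auto
 then have "(norm (x j))\<^sup>2 <= B\<^sup>2" using b by linarith
 then show ?thesis using B by (rule power2_le_imp_le)
 qed
 have fM: "norm (f j) <= M" for j using sq[of f j M, OF sumf] M by simp
 have ex: "\<exists>G. gder i (f j) G & norm G <= M" for i j
 proof -
 have "norm (tr (h *\<^sub>R axis i 1) (f j) - f j) <= M * \<bar>h\<bar>" for h
 using sq[of "%j. tr (h *\<^sub>R axis i 1) (f j) - f j" j "M * \<bar>h\<bar>", OF sumD] M by simp
 from quotient_gder[of i "f j" M, OF this] show ?thesis by blast
 qed
 define H where "H j i = (SOME G. gder i (f j) G & norm G <= M)" for j i
 have H: "gder i (f j) (H j i)" "norm (H j i) <= M" for i j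
 using someI_ex[OF ex[of i j]] unfolding H_def by blast+
 have sumH: "(\<Sum>j<l. (norm (H j i))\<^sup>2) <= M\<^sup>2" for l i
 proof (rule tendsto_upperbound)
 have "((%h. (tr (h *\<^sub>R axis i 1) (f j) - f j) /\<^sub>R h) \<longlongrightarrow> H j i) (at 0)" for j
 using has_vector_derivative_quotient[OF H(1)[unfolded gder_def, of i j]] by (simp only: add_0 scaleR_zero_left R.T_0)
 then show "((%h. \<Sum>j<l. (norm ((tr (h *\<^sub>R axis i 1) (f j) - f j) /\<^sub>R h))\<^sup>2) \<longlongrightarrow> (\<Sum>j<l. (norm (H j i))\<^sup>2)) (at 0)"
 by (intro tendsto_sum tendsto_power tendsto_norm)
 have "(\<Sum>j<l. (norm ((tr (h *\<^sub>R axis i 1) (f j) - f j) /\<^sub>R h))\<^sup>2) <= M\<^sup>2" if "h ~= 0" for h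
 proof -
 have "(\<Sum>j<l. (norm ((tr (h *\<^sub>R axis i 1) (f j) - f j) /\<^sub>R h))\<^sup>2) = (\<Sum>j<l. (norm (tr (h *\<^sub>R axis i 1) (f j) - f j))\<^sup>2) / h\<^sup>2"
 unfolding norm_scaleR power_mult_distrib sum_divide_distrib by (simp add: divide_inverse mult.commute power_inverse)
 also have "... <= (M * \<bar>h\<bar>)\<^sup>2 / h\<^sup>2" by (intro divide_right_mono sumD) auto
 also have "... = M\<^sup>2" using that by (simp add: power_mult_distrib)
 finally show ?thesis .
 qed
 then show "\<forall>\<^sub>F h in at 0. (\<Sum>j<l. (norm ((tr (h *\<^sub>R axis i 1) (f j) - f j) /\<^sub>R h))\<^sup>2) <= M\<^sup>2"
 by (simp add: eventually_at_filter)
 qed simp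
 \<comment> \<open>Pythagoras holds only in the limit along \<open>U\<close>, hence the margin
   \<open>M + 1\<close>.\<close>
 have evb: "\<forall>\<^sub>F k in U. norm (\<Sum>j<l. galilei (- g j k) (x j)) <= M + 1" if b: "(\<Sum>j<l. (norm (x j))\<^sup>2) <= M\<^sup>2" for x :: "nat => 'n l2" and l
 proof -
 have lim: "((%k. (norm (\<Sum>j<l. galilei (- g j k) (x j)))\<^sup>2) \<longlongrightarrow> (\<Sum>j<l. (norm (x j))\<^sup>2)) U"
 by (rule G.orthogonal_sum_norm) (rule gf(5))
 have "M\<^sup>2 < (M + 1)\<^sup>2" using M by (intro power_strict_mono) auto
 then have "(\<Sum>j<l. (norm (x j))\<^sup>2) < (M + 1)\<^sup>2" using b by linarith
 from order_tendstoD(2)[OF lim this] show ?thesis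
 proof (rule eventually_mono)
 fix k assume h: "(norm (\<Sum>j<l. galilei (- g j k) (x j)))\<^sup>2 < (M + 1)\<^sup>2"
 show "norm (\<Sum>j<l. galilei (- g j k) (x j)) <= M + 1"
 by (rule power2_le_imp_le[OF less_imp_le[OF h]]) (use M in linarith)
 qed
 qed
 \<comment> \<open>A countable set of heat times accumulating at 0, so that one subsequence can
   serve every smoothing scale.\<close>
 define tm where "tm m = inverse (real (Suc m))" for m
 have tm: "tm m > 0" for m by (simp add: tm_def)
 have "\<exists>E\<ge>0. \<forall>(a :: 'n l2) kap. (\<forall>e\<in>{gvec (1, of_real (tm m), 0), gvec (\<i>, of_real (tm m), 0)}. \<bar>inner a e\<bar> <= kap * norm e) --> norm (heat_ev (tm m) a 0) <= kap * E" for m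
 using heat_ev_inner_bound[OF tm[of m]] by metis
 then obtain E where E: "!!m. E m >= 0" "!!m (a :: 'n l2) kap. (!!e. e \<in> {gvec (1, of_real (tm m), 0), gvec (\<i>, of_real (tm m), 0)} ==> \<bar>inner a e\<bar> <= kap * norm e) ==>
 norm (heat_ev (tm m) a 0) <= kap * E m" by metis
 \<comment> \<open>The term \<open>1 / (l + 1)\<close> is the value given to \<open>kap\<close> in
   the uniform estimate, so that \<open>S l m\<close> tends to 0 as \<open>l\<close> grows.\<close>
 define S where "S l m = (2 * norm (f l) + inverse (real (Suc l))) * E m" for l m
 define Q where "Q l m k \<longleftrightarrow> (\<forall>u\<ge>0. \<forall>y. norm (heat_ev (tm m) (schr u (w k - (\<Sum>j<l. galilei (- g j k) (f j)))) y) <= S l m)" for l m k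
 have Q: "\<forall>\<^sub>F k in U. Q l m k" if l: "l > 0" for l m
 proof -
 have k: "inverse (real (Suc l)) > 0" by simp
 have "\<forall>\<^sub>F k in U. (\<forall>d\<in>A. \<bar>inner (galilei d (G.remainder w g f l k)) (gvec (1, of_real (tm m), 0))\<bar> <= (2 * norm (f l) + inverse (real (Suc l))) * norm (gvec (1, of_real (tm m), 0) :: 'n l2)) &
 (\<forall>d\<in>A. \<bar>inner (galilei d (G.remainder w g f l k)) (gvec (\<i>, of_real (tm m), 0))\<bar> <= (2 * norm (f l) + inverse (real (Suc l))) * norm (gvec (\<i>, of_real (tm m), 0) :: 'n l2))"
 by (intro eventually_conj gf(7)[OF l k])
 then show ?thesis
 proof eventually_elim
 case (elim k)
 show ?case unfolding Q_def
 proof (intro allI impI)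
 fix u y assume "u >= (0::real)"
 then have "(u, y) \<in> A" by (simp add: A_def)
 then have "norm (heat_ev (tm m) (galilei (u, y) (G.remainder w g f l k)) 0) <= (2 * norm (f l) + inverse (real (Suc l))) * E m"
 using elim by (intro E(2)) blast
 then show "norm (heat_ev (tm m) (schr u (w k - (\<Sum>j<l. galilei (- g j k) (f j)))) y) <= S l m"
 by (simp add: heat_ev_galilei[OF tm] S_def G.remainder_def)
 qed
 qed
 qed
 \<comment> \<open>All that is asked of the subsequence at stage \<open>q\<close>. Only finitely
   many indices are involved, so this is an event of the ultrafilter.\<close>
 define P where "P q k \<longleftrightarrow> (\<forall>i\<in>{..q}. \<forall>j\<in>{..q}. i ~= j --> real q <= norm (g i k - g j k)) &
 (\<forall>j\<in>{..q}. max 1 (real q) <= fst (g j k)) &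
 (\<forall>l\<in>{..q}. norm (\<Sum>j<l. galilei (- g j k) (f j)) <= M + 1 & (\<forall>i. norm (\<Sum>j<l. galilei (- g j k) (H j i)) <= M + 1)) &
 (\<forall>l\<in>{..q}. \<forall>m\<in>{..q}. l > 0 --> Q l m k)" for q k
 have evP: "\<forall>\<^sub>F k in U. P q k" for q
 proof -
 have i1: "\<forall>\<^sub>F k in U. i ~= j --> real q <= norm (g i k - g j k)" for i j
 proof (cases "i = j")
 case False
 from filterlim_at_infinity_imp_norm_at_top[OF gf(5)[OF False]]
 have "\<forall>\<^sub>F k in U. real q <= norm (g i k - g j k)" unfolding filterlim_at_top by (rule spec)
 then show ?thesis by (rule eventually_mono) blast
 qed simp
 have i2: "\<forall>\<^sub>F k in U. max 1 (real q) <= fst (g j k)" for j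
 using gf(6)[of j] unfolding filterlim_at_top by (rule spec)
 have i3: "\<forall>\<^sub>F k in U. \<forall>i. norm (\<Sum>j<l. galilei (- g j k) (H j i)) <= M + 1" for l
 by (rule eventually_all_finite) (rule evb[OF sumH])
 have i4: "\<forall>\<^sub>F k in U. 0 < l --> Q l m k" for l m
 using Q[of l m] by (cases "l > 0") (auto elim: eventually_mono)
 have e1: "\<forall>\<^sub>F k in U. \<forall>i\<in>{..q}. \<forall>j\<in>{..q}. i ~= j --> real q <= norm (g i k - g j k)"
 by (rule eventually_ball_finite[OF finite_atMost], rule ballI, rule eventually_ball_finite[OF finite_atMost], rule ballI, rule i1)
 have e2: "\<forall>\<^sub>F k in U. \<forall>j\<in>{..q}. max 1 (real q) <= fst (g j k)"
 by (rule eventually_ball_finite[OF finite_atMost], rule ballI, rule i2)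
 have e3: "\<forall>\<^sub>F k in U. \<forall>l\<in>{..q}. norm (\<Sum>j<l. galilei (- g j k) (f j)) <= M + 1 & (\<forall>i. norm (\<Sum>j<l. galilei (- g j k) (H j i)) <= M + 1)"
 by (rule eventually_ball_finite[OF finite_atMost], rule ballI, rule eventually_conj[OF evb[OF sumf] i3])
 have e4: "\<forall>\<^sub>F k in U. \<forall>l\<in>{..q}. \<forall>m\<in>{..q}. 0 < l --> Q l m k"
 by (rule eventually_ball_finite[OF finite_atMost], rule ballI, rule eventually_ball_finite[OF finite_atMost], rule ballI, rule i4)
 show ?thesis unfolding P_def by (rule eventually_conj[OF e1 eventually_conj[OF e2 eventually_conj[OF e3 e4]]])
 qed
 obtain r :: "nat => nat" where r: "strict_mono r" "!!k. P k (r k)"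
 by (rule ultra_subsequence[of U P, OF U(1) nb evP]) (rule that)

 \<comment> \<open>Smallness of the remainders along the subsequence\<close>
 have rem: "\<forall>\<^sub>F l in sequentially. \<forall>\<^sub>F k in sequentially. \<forall>u\<ge>0.
 Ip ?p (l2_fun (schr u (w (r k) - (\<Sum>j<l. galilei (- g j (r k)) (f j))))) <= ennreal \<beta>" if \<beta>: "\<beta> > 0" for \<beta>
 proof -
 obtain t where t: "t > 0" "(CI * N powr ?p) * t powr dl <= \<beta> / 2" using small_powr[of "CI * N powr ?p" dl "\<beta> / 2"] CI(1) dl(2) \<beta> by auto
 obtain s' where s': "s' > 0" "(CI * (2 * M + 1)\<^sup>2) * s' powr (2 * \<sigma>) <= \<beta> / 2" using small_powr[of "CI * (2 * M + 1)\<^sup>2" "2 * \<sigma>" "\<beta> / 2"] CI(1) \<sigma> \<beta> by auto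
 obtain m where m: "tm m < t" unfolding tm_def using reals_Archimedean[OF t(1)] by blast
 have "(CI * N powr ?p) * tm m powr dl <= (CI * N powr ?p) * t powr dl"
 using CI(1) m tm[of m] dl(2) by (intro mult_left_mono powr_mono2) auto
 then have tb: "(CI * N powr ?p) * tm m powr dl <= \<beta> / 2" using t(2) by linarith
 have "(%l. S l m) \<longlonglongrightarrow> (2 * 0 + 0) * E m"
 unfolding S_def by (intro tendsto_intros tendsto_norm_zero gf(8) LIMSEQ_inverse_real_of_nat)
 then have "\<forall>\<^sub>F l in sequentially. S l m < s'" using s'(1) by (intro order_tendstoD(2)) auto
 then have "\<forall>\<^sub>F l in sequentially. S l m < s' & l > 0" using eventually_gt_at_top[of 0] by (rule eventually_conj)
 then show ?thesis
 proof eventually_elim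
 case (elim l)
 have "\<forall>\<^sub>F k in sequentially. k >= max l m" by (rule eventually_ge_at_top)
 then show ?case
 proof eventually_elim
 case (elim k)
 let ?\<Psi> = "\<Sum>j<l. galilei (- g j (r k)) (f j)"
 have Pk: "P k (r k)" by (rule r(2))
 have lk: "l \<in> {..k}" "m \<in> {..k}" using elim by auto
 have b: "norm ?\<Psi> <= M + 1" "!!i. norm (\<Sum>j<l. galilei (- g j (r k)) (H j i)) <= M + 1" "Q l m (r k)"
 using Pk lk \<open>S l m < s' & l > 0\<close> unfolding P_def by blast+
 have gd: "gder i ?\<Psi> (\<Sum>j<l. galilei (- g j (r k)) (H j i))" for i
 by (intro gder_sum gder_linear[OF H(1)] G.T_blin galilei_tr)
 show ?case
 proof (rule allI, rule impI)
 fix u :: real assume u: "u >= 0"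
 have D: "norm (tr (h *\<^sub>R axis i 1) (w (r k) - ?\<Psi>) - (w (r k) - ?\<Psi>)) <= (2 * M + 1) * \<bar>h\<bar>" for i h
 proof -
 have "tr (h *\<^sub>R axis i 1) (w (r k) - ?\<Psi>) - (w (r k) - ?\<Psi>) = (tr (h *\<^sub>R axis i 1) (w (r k)) - w (r k)) - (tr (h *\<^sub>R axis i 1) ?\<Psi> - ?\<Psi>)"
 unfolding linear_diff[OF R.T_linear] by simp
 then have "norm (tr (h *\<^sub>R axis i 1) (w (r k) - ?\<Psi>) - (w (r k) - ?\<Psi>)) <= norm (tr (h *\<^sub>R axis i 1) (w (r k)) - w (r k)) + norm (tr (h *\<^sub>R axis i 1) ?\<Psi> - ?\<Psi>)"
 by (simp only: norm_triangle_ineq4)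
 also have "... <= M * \<bar>h\<bar> + (M + 1) * \<bar>h\<bar>"
 by (intro add_mono wD order_trans[OF gder_bound[OF gd] mult_right_mono[OF b(2)]]) auto
 finally show ?thesis by (simp add: algebra_simps)
 qed
 have D2: "norm (w (r k) - ?\<Psi>) <= 2 * M + 1" using norm_triangle_ineq4[of "w (r k)" ?\<Psi>] wM[of "r k"] b(1) by linarith
 have D3: "norm (heat_ev (tm m) (schr u (w (r k) - ?\<Psi>)) y) <= s'" for y
 using b(3) u \<open>S l m < s' & l > 0\<close> unfolding Q_def by (meson less_imp_le order_trans)
 show "Ip ?p (l2_fun (schr u (w (r k) - ?\<Psi>))) <= ennreal \<beta>"
 by (rule bound[where t = "tm m" and s' = s', OF D D2 D3 tm less_imp_le[OF s'(1)] tb s'(2)])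
 qed
 qed
 qed
 qed
 show ?thesis
 proof (rule exI[of _ r], rule exI[of _ g], rule exI[of _ f], rule exI[of _ H], intro conjI)
 show "strict_mono r" by (rule r(1))
 show "\<forall>k. fst (g 0 k) = s k" by (simp add: gf(1) g0_def)
 show "\<forall>j. norm (f j) <= M" using fM by blast
 show "f 0 ~= 0" using gf(2) f0n by simp
 show "\<forall>j i. gder i (f j) (H j i) & norm (H j i) <= M" using H by blast
 show "\<forall>q. (\<forall>i\<in>{..q}. \<forall>j\<in>{..q}. i ~= j --> real q <= norm (g i (r q) - g j (r q))) &
 (\<forall>j\<in>{..q}. max 1 (real q) <= fst (g j (r q))) &
 (\<forall>l\<in>{..q}. norm (\<Sum>j<l. galilei (- g j (r q)) (f j)) <= M + 1 &
 (\<forall>i. norm (\<Sum>j<l. galilei (- g j (r q)) (H j i)) <= M + 1))"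
 proof
 fix q
 from r(2)[of q, unfolded P_def] show "(\<forall>i\<in>{..q}. \<forall>j\<in>{..q}. i ~= j --> real q <= norm (g i (r q) - g j (r q))) &
 (\<forall>j\<in>{..q}. max 1 (real q) <= fst (g j (r q))) &
 (\<forall>l\<in>{..q}. norm (\<Sum>j<l. galilei (- g j (r q)) (f j)) <= M + 1 &
 (\<forall>i. norm (\<Sum>j<l. galilei (- g j (r q)) (H j i)) <= M + 1))"
 by (elim conjE) (intro conjI; assumption)
 qed
 show "\<forall>\<beta>>0. \<forall>\<^sub>F l in sequentially. \<forall>\<^sub>F k in sequentially. \<forall>u\<ge>0.
 Ip ?p (l2_fun (schr u (w (r k) - (\<Sum>j<l. galilei (- g j (r k)) (f j))))) <= ennreal \<beta>"
 by (intro allI impI rem)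
 qed
qed

section \<open>The profile decomposition\<close>

lemma limsup_ereal_top:
 assumes "!!q :: nat. \<forall>\<^sub>F k in sequentially. real q <= h k"
 shows "limsup (%k. ereal (h k)) = \<infinity>"
proof -
 have "(%k. ereal (h k)) \<longlonglongrightarrow> \<infinity>"
 unfolding tendsto_PInfty
 proof
 fix x
 obtain q :: nat where "x < real q" using reals_Archimedean2 by blast
 then show "\<forall>\<^sub>F k in sequentially. ereal x < ereal (h k)" by (intro eventually_mono[OF assms[of q]]) auto
 qed
 from lim_imp_Limsup[OF sequentially_bot this] show ?thesis .
qed

lemma ennreal_tendsto_0I:
 fixes X :: "nat => ennreal"
 assumes "!!eps. eps > 0 ==> \<forall>\<^sub>F l in sequentially. X l <= ennreal eps"
 shows "X \<longlonglongrightarrow> 0"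
proof (rule order_tendstoI)
 fix a :: ennreal assume "0 < a"
 then obtain b where b: "0 < b" "b < a" using dense by blast
 then have "b ~= \<infinity>" by auto
 then obtain eps where e: "b = ennreal eps" "eps >= 0" by (cases b) auto
 then have "eps > 0" using b(1) by (auto simp: less_le)
 then show "\<forall>\<^sub>F l in sequentially. X l < a"
 by (intro eventually_mono[OF assms[of eps]]) (use b(2) e in auto)
qed simp

lemma ennreal_powr_measurable [measurable]: "(%x. ennreal_powr x q) \<in> borel_measurable borel"
 unfolding ennreal_powr_def by measurable

text \<open>Sublevel sets in time are closed, by strong continuity of the flow and Fatou's lemma.
  The essential supremum demands this measurability.\<close>

lemma Ip_schr_measurable:
 fixes a :: "'n::finite l2"
 assumes p: "p > 0"
 shows "(%s. Ip p (l2_fun (schr (eps * s) a))) \<in> borel_measurable borel"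
proof (rule borel_measurableI_le)
 interpret S: isometry_group "schr :: real => 'n l2 => 'n l2" by (rule schr_isometry_group)
 fix y :: ennreal
 have "closed {s. Ip p (l2_fun (schr (eps * s) a)) <= y}"
 unfolding closed_sequential_limits
 proof (intro allI impI, elim conjE)
 fix x l assume x: "\<forall>k :: nat. x k \<in> {s. Ip p (l2_fun (schr (eps * s) a)) <= y}" and l: "x \<longlonglongrightarrow> l"
 have "(%k. schr (eps * x k) a) \<longlonglongrightarrow> schr (eps * l) a" by (intro S.T_tendsto tendsto_intros l)
 then have "Ip p (l2_fun (schr (eps * l) a)) <= y" by (rule Ip_fatou) (use x p in auto)
 then show "l \<in> {s. Ip p (l2_fun (schr (eps * s) a)) <= y}" by simp
 qed
 then show "{s \<in> space borel. Ip p (l2_fun (schr (eps * s) a)) <= y} \<in> sets borel" by simp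
qed

lemma esssup_propagator_le:
 fixes f :: "real ^ 'n::finite => complex"
 assumes f: "in_L2 f" and e: "eps > 0" and \<sigma>: "\<sigma> > 0" and B: "B >= 0" and fa: "to_l2 f = scl eps a"
 and le: "!!u. u >= 0 ==> Ip (2 * \<sigma> + 2) (l2_fun (schr u a)) <= ennreal B"
 shows "esssup (restrict_space lborel {0..}) (%s. Lp_eps_norm \<sigma> eps (free_propagator eps s f)) <= ennreal (B powr (1 / (2 * \<sigma> + 2)))"
proof (rule esssup_I)
 note P = free_propagator_eq[OF f e]
 have J: "Ip (2 * \<sigma> + 2) (free_propagator eps s f) = Ip (2 * \<sigma> + 2) (l2_fun (schr (eps * s) (to_l2 f)))" for s
 using l2_fun_to_l2[OF P(1)[of s]] unfolding P(2) by (intro Ip_cong_AE) auto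
 have "(%s. ennreal_powr (Ip (2 * \<sigma> + 2) (l2_fun (schr (eps * s) (to_l2 f)))) (1 / (2 * \<sigma> + 2))) \<in> borel_measurable borel"
 proof (rule measurable_compose[OF _ ennreal_powr_measurable])
 show "(%s. Ip (2 * \<sigma> + 2) (l2_fun (schr (eps * s) (to_l2 f)))) \<in> borel_measurable borel"
 by (rule Ip_schr_measurable) (use \<sigma> in simp)
 qed
 then have "(%s. Lp_eps_norm \<sigma> eps (free_propagator eps s f)) \<in> borel_measurable borel"
 unfolding Lp_eps_norm_def Lp_norm_def Ip_def[symmetric] J by measurable
 then show "(%s. Lp_eps_norm \<sigma> eps (free_propagator eps s f)) \<in> borel_measurable (restrict_space lborel {0..})"
 by (intro measurable_restrict_space1) simp
 have "Lp_eps_norm \<sigma> eps (free_propagator eps s f) <= ennreal (B powr (1 / (2 * \<sigma> + 2)))" if s: "s >= 0" for s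
 proof (rule Lp_eps_norm_le[OF P(1) e \<sigma> B])
 have "scl (1 / eps) (to_l2 (free_propagator eps s f)) = schr (s / eps) a"
 using scl_scl_inverse[of "1 / eps" "schr (s / eps) a"] e by (simp add: P(2) fa schr_scl)
 then show "Ip (2 * \<sigma> + 2) (l2_fun (scl (1 / eps) (to_l2 (free_propagator eps s f)))) <= ennreal B"
 using le[of "s / eps"] s e by simp
 qed
 then show "AE s in restrict_space lborel {0..}. Lp_eps_norm \<sigma> eps (free_propagator eps s f) <= ennreal (B powr (1 / (2 * \<sigma> + 2)))"
 by (intro AE_I2) (simp add: space_restrict_space)
qed

lemma qinv_diff:
 fixes a b :: "'n::finite l2"
 assumes s: "s > 0"
 shows "norm (a - qinv s b) = norm (qop s a - b)"
proof -
 have l: "linear (qinv s :: 'n l2 => 'n l2)" unfolding qinv_def by (rule bounded_linear.linear[OF wop_bounded_linear[OF qinv_weight[OF s]]])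
 have "norm (qinv s (qop s a - b)) = norm (qop s a - b)" unfolding qinv_def by (rule norm_wop[OF qinv_weight[OF s]])
 then show ?thesis by (simp add: linear_diff[OF l] qinv_qop[OF s])
qed

theorem theorem1p2:
  fixes \<sigma> T :: real
    and u0 :: "real \<Rightarrow> real ^ 'n \<Rightarrow> complex"
    and v :: "real \<Rightarrow> real \<Rightarrow> real ^ 'n \<Rightarrow> complex"
  assumes "\<sigma> > 2 / real CARD('n)"
    and "CARD('n) \<ge> 3 \<Longrightarrow> \<sigma> < 2 / (real CARD('n) - 2)"
    and "T > 0"
    and "\<And>\<epsilon>. 0 < \<epsilon> \<Longrightarrow> \<epsilon> \<le> 1 \<Longrightarrow> in_H1 (u0 \<epsilon>)"
    and "(SUP \<epsilon>\<in>{0<..1}. H1_eps_norm \<epsilon> (u0 \<epsilon>)) < \<infinity>"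
    and "Limsup (at_right 0) (\<lambda>\<epsilon>. ennreal (\<epsilon> powr (real CARD('n) * \<sigma>))
           * ennreal_powr (Lp_norm (2 * \<sigma> + 2) (u0 \<epsilon>)) (2 * \<sigma> + 2)) = 0"
    and "\<And>\<epsilon> t. 0 < \<epsilon> \<Longrightarrow> \<epsilon> \<le> 1 \<Longrightarrow> v \<epsilon> t = free_propagator \<epsilon> t (u0 \<epsilon>)"
    and "Limsup (at_right 0) (\<lambda>\<epsilon>. SUP t\<in>{0..T}. ennreal (\<epsilon> powr (real CARD('n) * \<sigma>))
           * ennreal_powr (Lp_norm (2 * \<sigma> + 2) (v \<epsilon> t)) (2 * \<sigma> + 2)) > 0"
  shows "\<exists>(e :: nat \<Rightarrow> real) (t :: nat \<Rightarrow> nat \<Rightarrow> real) (x :: nat \<Rightarrow> nat \<Rightarrow> real ^ 'n)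
      (\<Psi> :: nat \<Rightarrow> nat \<Rightarrow> real ^ 'n \<Rightarrow> complex) (r :: nat \<Rightarrow> nat \<Rightarrow> real ^ 'n \<Rightarrow> complex)
      (\<phi> :: nat \<Rightarrow> real ^ 'n \<Rightarrow> complex).
    (\<forall>k. 0 < e k \<and> e k \<le> 1) \<and> e \<longlonglongrightarrow> 0 \<and>
    (\<forall>j k. t j k > 0) \<and>
    orthogonal_family e (\<lambda>j k. (t j k, x j k)) \<and>
    (\<forall>l k. in_H1 (\<Psi> l k)) \<and>
    (SUP l. limsup (\<lambda>k. H1_eps_norm (e k) (\<Psi> l k))) < \<infinity> \<and>
    (\<forall>j. in_L2 (\<phi> j) \<and> in_L2 (\<lambda>y. norm y *\<^sub>R \<phi> j y)) \<and>
    (SUP j. Lp_norm 2 (\<phi> j) + Lp_norm 2 (\<lambda>y. norm y *\<^sub>R \<phi> j y)) < \<infinity> \<and>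
    (\<exists>j. \<not> (AE y in lborel. \<phi> j y = 0)) \<and>
    (\<forall>l k. AE y in lborel. u0 (e k) y = \<Psi> l k y + r l k y) \<and>
    (\<lambda>l. limsup (\<lambda>k. esssup (restrict_space lborel {0..})
        (\<lambda>s. Lp_eps_norm \<sigma> (e k) (free_propagator (e k) s (r l k))))) \<longlonglongrightarrow> 0 \<and>
    (\<forall>l. (\<lambda>k. Lp_norm 2 (\<lambda>y. \<Psi> l k y
        - (\<Sum>j\<le>l. quadratic_profile (e k) (t j k) (x j k) (\<phi> j) y))) \<longlonglongrightarrow> 0) \<and>
    (\<forall>j. limsup (\<lambda>k. ereal (t j k / e k)) = \<infinity>) \<and>
    (\<exists>j. limsup (\<lambda>k. ereal (t j k)) \<in> {0..ereal T})"
proof -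

 \<comment> \<open>Constants and the rescaled sequence of data\<close>
 let ?p = "2 * \<sigma> + 2" and ?n = "real CARD('n)"
 have n: "?n > 0" by simp
 have \<sigma>: "\<sigma> > 0" using assms(1) n by (meson divide_pos_pos less_trans zero_less_numeral)
 define dl where "dl = \<sigma> + 1 - ?n * \<sigma> / 2"
 \<comment> \<open>The subcritical condition: for \<open>n >= 3\<close> it is the upper bound on
   \<sigma>, for \<open>n <= 2\<close> it follows from \<open>\<sigma> > 0\<close>.\<close>
 have dl: "dl > 0"
 proof (cases "CARD('n) >= 3")
 case True
 then have "\<sigma> * (?n - 2) < 2" using assms(2) by (simp add: field_simps)
 then show ?thesis by (simp add: dl_def algebra_simps)
 next
 case False
 then have "?n <= 2" by simp
 then have "?n * \<sigma> <= 2 * \<sigma>" using \<sigma> by (intro mult_right_mono) auto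
 then show ?thesis by (simp add: dl_def)
 qed
 have p: "?p > 0" using \<sigma> by simp
 define M where "M = enn2real (SUP eps\<in>{0<..1}. H1_eps_norm eps (u0 eps)) + 1"
 have M: "M > 0" by (simp add: M_def add_nonneg_pos)
 have MH: "H1_eps_norm eps (u0 eps) <= ennreal M" if "0 < eps" "eps <= 1" for eps
 proof -
 have "H1_eps_norm eps (u0 eps) <= (SUP eps\<in>{0<..1}. H1_eps_norm eps (u0 eps))" using that by (intro SUP_upper) auto
 also have "... = ennreal (enn2real (SUP eps\<in>{0<..1}. H1_eps_norm eps (u0 eps)))" using assms(5) by simp
 also have "... <= ennreal M" by (intro ennreal_leI) (simp add: M_def)
 finally show ?thesis .
 qed
 have L: "in_L2 (u0 eps)" if "0 < eps" "eps <= 1" for eps using assms(4)[OF that] by (simp add: in_H1_def)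
 let ?F = "%eps. SUP t\<in>{0..T}. ennreal (eps powr (?n * \<sigma>)) * ennreal_powr (Lp_norm ?p (v eps t)) ?p"
 \<comment> \<open>A positive limit superior gives a level exceeded for arbitrarily small
   parameters, whence the sequence \<open>e0\<close> and the times \<tau> in
   \<open>[0, T]\<close>.\<close>
 obtain c where c: "c > 0" "\<not> eventually (%eps. ?F eps <= ennreal c) (at_right 0)"
 proof -
 obtain b where b: "0 < b" "b < Limsup (at_right 0) ?F" using dense[OF assms(8)] by blast
 then have "b ~= \<infinity>" by auto
 then obtain c where c: "b = ennreal c" "c >= 0" by (cases b) auto
 show ?thesis
 proof (rule that[of c])
 show "c > 0" using b(1) c by (auto simp: less_le)
 show "\<not> eventually (%eps. ?F eps <= ennreal c) (at_right 0)"
 using Limsup_bounded[of ?F "ennreal c" "at_right 0"] b(2) c(1) by auto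
 qed
 qed
 have "\<exists>eps t. 0 < eps & eps < inverse (real (Suc k)) & 0 <= t & t <= T & ennreal c < ennreal (eps powr (?n * \<sigma>)) * Ip ?p (v eps t)" for k
 proof -
 have "inverse (real (Suc k)) > 0" by simp
 then obtain eps where "0 < eps" "eps < inverse (real (Suc k))" "\<not> ?F eps <= ennreal c"
 using c(2) unfolding eventually_at_right_field by blast
 then obtain t where "t \<in> {0..T}" "ennreal c < ennreal (eps powr (?n * \<sigma>)) * Ip ?p (v eps t)"
 unfolding not_le less_SUP_iff Lp_norm_powr[OF p] by blast
 then show ?thesis using \<open>0 < eps\<close> \<open>eps < inverse (real (Suc k))\<close> unfolding atLeastAtMost_iff by blast
 qed
 then obtain e0 \<tau> where e0: "!!k. 0 < e0 k" "!!k. e0 k < inverse (real (Suc k))" and \<tau>: "!!k. 0 <= \<tau> k" "!!k. \<tau> k <= T"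
 and big: "!!k. ennreal c < ennreal (e0 k powr (?n * \<sigma>)) * Ip ?p (v (e0 k) (\<tau> k))" by metis
 have e1: "e0 k <= 1" for k using e0(2)[of k] by (rule order_trans[OF less_imp_le]) (simp add: field_simps)
 have e0lim: "e0 \<longlonglongrightarrow> 0"
 by (rule tendsto_sandwich[OF _ _ tendsto_const LIMSEQ_inverse_real_of_nat]) (use e0 less_imp_le in \<open>auto intro!: always_eventually\<close>)
 \<comment> \<open>The data in the frame where the semiclassical parameter is 1; the time
   \<open>\<tau> k\<close> becomes \<open>\<tau> k / e0 k\<close>.\<close>
 define w where "w k = scl (1 / e0 k) (to_l2 (u0 (e0 k)))" for k
 have e': "1 / e0 k > 0" for k using e0(1)[of k] by simp
 have w1: "norm (w k) <= M & norm (tr (h *\<^sub>R axis i 1) (w k) - w k) <= M * \<bar>h\<bar>" for k i h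
 proof -
 obtain G where G: "!!i. gder i (to_l2 (u0 (e0 k))) (G i)" "!!i. e0 k * norm (G i) <= M" "norm (to_l2 (u0 (e0 k))) <= M"
 using in_H1_gder[OF assms(4)[OF e0(1) e1] e0(1) MH[OF e0(1) e1] less_imp_le[OF M]] by blast
 have "norm (scl (1 / e0 k) (G i) /\<^sub>R (1 / e0 k)) <= M" using G(2)[of i] e0(1)[of k] e'[of k] by simp
 from order_trans[OF gder_bound[OF gder_scl[OF e' G(1)]] mult_right_mono[OF this]]
 show ?thesis using G(3) e'[of k] by (simp add: w_def)
 qed
 have w0: "\<forall>\<^sub>F k in sequentially. Ip ?p (l2_fun (w k)) <= ennreal eta" if eta: "eta > 0" for eta
 proof -
 have "Limsup (at_right 0) (%eps. ennreal (eps powr (?n * \<sigma>)) * ennreal_powr (Lp_norm ?p (u0 eps)) ?p) < ennreal eta"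
 unfolding assms(6) using eta by simp
 then have "\<forall>\<^sub>F eps in at_right 0. ennreal (eps powr (?n * \<sigma>)) * Ip ?p (u0 eps) < ennreal eta"
 unfolding Lp_norm_powr[OF p] by (rule Limsup_lessD)
 moreover have "filterlim e0 (at_right 0) sequentially"
 using e0lim e0(1) less_imp_neq[OF e0(1), symmetric] by (simp add: filterlim_at)
 ultimately have "\<forall>\<^sub>F k in sequentially. ennreal (e0 k powr (?n * \<sigma>)) * Ip ?p (u0 (e0 k)) < ennreal eta"
 by (rule eventually_compose_filterlim)
 then show ?thesis
 by eventually_elim (simp add: w_def Ip_scl[OF L[OF e0(1) e1] e0(1)])
 qed
 have big': "Ip ?p (l2_fun (schr (\<tau> k / e0 k) (w k))) > ennreal c" for k
 proof -
 have vk: "v (e0 k) (\<tau> k) = free_propagator (e0 k) (\<tau> k) (u0 (e0 k))" by (rule assms(7)[OF e0(1) e1])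
 have Pk: "in_L2 (v (e0 k) (\<tau> k))" "to_l2 (v (e0 k) (\<tau> k)) = schr (e0 k * \<tau> k) (to_l2 (u0 (e0 k)))"
 unfolding vk by (rule free_propagator_eq[OF L[OF e0(1) e1] e0(1)])+
 have "schr (\<tau> k / e0 k) (w k) = scl (1 / e0 k) (to_l2 (v (e0 k) (\<tau> k)))"
 using schr_scl[OF e'[of k], of "\<tau> k" "to_l2 (u0 (e0 k))"] by (simp add: w_def Pk(2) mult.commute)
 then show ?thesis using big[of k] by (simp add: Ip_scl[OF Pk(1) e0(1)])
 qed
 have s0: "\<tau> k / e0 k >= 0" for k using \<tau>(1)[of k] e0(1)[of k] by simp
 have w0': "\<forall>eta>0. \<forall>\<^sub>F k in sequentially. Ip ?p (l2_fun (w k)) <= ennreal eta" using w0 by blast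

 \<comment> \<open>Profiles and the choice of the witnesses\<close>
 obtain r :: "nat => nat" and g :: "nat => nat => real \<times> (real ^ 'n)" and f H where r: "strict_mono r"
 and g0': "\<forall>k. fst (g 0 k) = \<tau> k / e0 k" and fM': "\<forall>j. norm (f j) <= M" and fn: "f 0 ~= 0"
 and H': "\<forall>j i. gder i (f j) (H j i) & norm (H j i) <= M"
 and Q: "\<forall>q. (\<forall>i\<in>{..q}. \<forall>j\<in>{..q}. i ~= j --> real q <= norm (g i (r q) - g j (r q))) &
 (\<forall>j\<in>{..q}. max 1 (real q) <= fst (g j (r q))) &
 (\<forall>l\<in>{..q}. norm (\<Sum>j<l. galilei (- g j (r q)) (f j)) <= M + 1 &
 (\<forall>i. norm (\<Sum>j<l. galilei (- g j (r q)) (H j i)) <= M + 1))"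
 and rem': "\<forall>\<beta>>0. \<forall>\<^sub>F l in sequentially. \<forall>\<^sub>F k in sequentially. \<forall>u\<ge>0.
 Ip ?p (l2_fun (schr u (w (r k) - (\<Sum>j<l. galilei (- g j (r k)) (f j))))) <= ennreal \<beta>"
 using profile_core[OF \<sigma> dl_def dl M, of w "%k. \<tau> k / e0 k" c, OF w1[THEN conjunct1] w1[THEN conjunct2] w0' s0 c(1) big']
 by (elim exE conjE) (rule that)
 have g0: "fst (g 0 k) = \<tau> k / e0 k" and fM: "norm (f j) <= M" and H: "gder i (f j) (H j i)" "norm (H j i) <= M" for i j k
 using g0' fM' H' by blast+
 have orth: "real q <= norm (g i (r q) - g j (r q))" if "i \<in> {..q}" "j \<in> {..q}" "i ~= j" for i j q using Q that by blast
 have fst: "max 1 (real q) <= fst (g j (r q))" if "j \<in> {..q}" for j q using Q that by blast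
 have \<Psi>M: "norm (\<Sum>j<l. galilei (- g j (r q)) (f j)) <= M + 1"
 and \<Psi>H: "norm (\<Sum>j<l. galilei (- g j (r q)) (H j i)) <= M + 1" if "l \<in> {..q}" for l q i using Q that by blast+
 have rem: "\<forall>\<^sub>F l in sequentially. \<forall>\<^sub>F k in sequentially. \<forall>u\<ge>0.
 Ip ?p (l2_fun (schr u (w (r k) - (\<Sum>j<l. galilei (- g j (r k)) (f j))))) <= ennreal \<beta>" if "\<beta> > 0" for \<beta>
 using rem' that by blast
 interpret G: isometry_group "galilei :: real \<times> (real ^ 'n) => 'n l2 => 'n l2" by (rule galilei_isometry_group)
 interpret R: isometry_group "tr :: real ^ 'n => 'n l2 => 'n l2" by (rule tr_isometry_group)
 obtain F :: "'n l2 => 'n l2" where F: "bounded_linear F" "!!a. norm (F a) = norm a"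
 "!!a. ((%s. qop s (schr (- s) a)) \<longlongrightarrow> F a) at_top"
 "!!h a. F (tr h a) = wop (%y. exp (- \<i> * of_real (inner h y))) 1 0 (F a)"
 using scattering_profile by blast
 define e where "e k = e0 (r k)" for k
 \<comment> \<open>At stage \<open>k\<close> the parameters are controlled for \<open>j <= k\<close>
   only. The default 1 keeps all times positive and is invisible to limits in
   \<open>k\<close>.\<close>
 define s where "s j k = (if j <= k then fst (g j (r k)) else 1)" for j k
 define t where "t j k = e k * s j k" for j k
 define x where "x j k = e k *\<^sub>R snd (g j (r k))" for j k
 define phi where "phi j = l2_fun (F (f j))" for j
 \<comment> \<open>The sum includes \<open>j = l\<close>, whereas the extraction uses
   \<open>j < l\<close>; the shift by one is made up for when the remainder limit is taken.\<close>
 define P where "P l k = (\<Sum>j<Suc l. galilei (- g j (r k)) (f j))" for l k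
 define \<Psi> where "\<Psi> l k = l2_fun (scl (e k) (P l k))" for l k
 define \<rho> where "\<rho> l k y = u0 (e k) y - \<Psi> l k y" for l k y
 have e: "e k > 0" "e k <= 1" for k by (auto simp: e_def e0(1) e1)
 have elim: "e \<longlonglongrightarrow> 0" unfolding e_def using LIMSEQ_subseq_LIMSEQ[OF e0lim r] by (simp add: comp_def)
 have s: "s j k > 0" for j k using fst[of j k] by (auto simp: s_def)
 have sg: "s j k = fst (g j (r k))" "real k <= s j k" if "j <= k" for j k using fst[of j k] that by (auto simp: s_def)
 have sq: "\<forall>\<^sub>F k in sequentially. real q <= s j k" for j and q :: nat
 using eventually_ge_at_top[of "max j q"] by eventually_elim (rule order_trans[OF _ sg(2)], auto)
 have stop: "filterlim (s j) at_top sequentially" for j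
 unfolding filterlim_at_top
 proof
 fix Z
 obtain q :: nat where "Z < real q" using reals_Archimedean2 by blast
 then show "\<forall>\<^sub>F k in sequentially. Z <= s j k" by (intro eventually_mono[OF sq[of q j]]) auto
 qed
 have te: "t j k / e k = s j k" for j k using e(1)[of k] by (simp add: t_def)

 \<comment> \<open>Verification of the conclusions\<close>
 have orthogonal: "orthogonal_family e (%j k. (t j k, x j k))"
 unfolding orthogonal_family_def
 proof (intro allI impI limsup_ereal_top)
 fix i j q :: nat assume ij: "i ~= j"
 show "\<forall>\<^sub>F k in sequentially. real q <= norm ((t i k, x i k) - (t j k, x j k)) / e k"
 using eventually_ge_at_top[of "max (max i j) q"]
 proof eventually_elim
 case (elim k)
 have "(t i k, x i k) - (t j k, x j k) = e k *\<^sub>R (g i (r k) - g j (r k))"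
 using elim by (simp add: t_def x_def sg prod_eq_iff algebra_simps)
 then have "norm ((t i k, x i k) - (t j k, x j k)) / e k = norm (g i (r k) - g j (r k))" using e(1)[of k] by simp
 moreover have "real k <= norm (g i (r k) - g j (r k))" using elim ij by (intro orth) auto
 ultimately show ?case using elim by simp
 qed
 qed
 have gd: "gder i (scl (e k) (P l k)) (scl (e k) (\<Sum>j<Suc l. galilei (- g j (r k)) (H j i)) /\<^sub>R e k)" for i l k
 unfolding P_def by (intro gder_scl e gder_sum gder_linear[OF H(1)] G.T_blin galilei_tr)
 note H1 = gder_L2_gradient[OF in_L2_l2_fun, unfolded to_l2_l2_fun, OF gd, folded \<Psi>_def]
 \<comment> \<open>\<open>M + 1\<close> bounds the norm and each of the \<open>n\<close> scaled
   partial derivatives.\<close>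
 define B where "B = (M + 1) + sqrt (?n * (M + 1)\<^sup>2)"
 have H1b: "H1_eps_norm (e k) (\<Psi> l k) <= ennreal B" if k: "k >= Suc l" for l k
 proof -
 have lk: "Suc l \<in> {..k}" using k by simp
 have "Lp_norm 2 (\<Psi> l k) = ennreal (norm (P l k))"
 unfolding \<Psi>_def using Lp_norm_to_l2[OF in_L2_l2_fun[of "scl (e k) (P l k)"]] e(1)[of k] by simp
 also have "... <= ennreal (M + 1)" unfolding P_def by (intro ennreal_leI \<Psi>M lk)
 finally have 1: "Lp_norm 2 (\<Psi> l k) <= ennreal (M + 1)" .
 have "\<bar>e k\<bar> * sqrt (\<Sum>i\<in>UNIV. (norm (scl (e k) (\<Sum>j<Suc l. galilei (- g j (r k)) (H j i)) /\<^sub>R e k))\<^sup>2)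
 = sqrt (\<Sum>i\<in>UNIV. (norm (\<Sum>j<Suc l. galilei (- g j (r k)) (H j i)))\<^sup>2)"
 proof -
 have eqS: "(\<Sum>i\<in>UNIV. (norm (scl (e k) (\<Sum>j<Suc l. galilei (- g j (r k)) (H j i)) /\<^sub>R e k))\<^sup>2)
 = (inverse (e k))\<^sup>2 * (\<Sum>i\<in>UNIV. (norm (\<Sum>j<Suc l. galilei (- g j (r k)) (H j i)))\<^sup>2)"
 unfolding norm_scaleR norm_scl[OF e(1)] power_mult_distrib sum_distrib_left[symmetric] using abs_of_pos[OF e(1)[of k]] by (simp only: abs_inverse)
 show ?thesis
 unfolding eqS real_sqrt_mult real_sqrt_abs abs_inverse abs_of_pos[OF e(1)] mult.assoc[symmetric]
 right_inverse[OF less_imp_neq[OF e(1), symmetric]] by (rule mult_1_left)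
 qed
 also have "... <= sqrt (\<Sum>i\<in>(UNIV :: 'n set). (M + 1)\<^sup>2)"
 by (intro real_sqrt_le_mono sum_mono power_mono \<Psi>H lk) auto
 finally have "Lp_norm 2 (%y. e k *\<^sub>R weak_gradient (\<Psi> l k) y) <= ennreal (sqrt (?n * (M + 1)\<^sup>2))"
 unfolding H1(2) by (intro ennreal_leI) simp
 with 1 have "H1_eps_norm (e k) (\<Psi> l k) <= ennreal (M + 1) + ennreal (sqrt (?n * (M + 1)\<^sup>2))"
 unfolding H1_eps_norm_def by (rule add_mono)
 then show ?thesis using M by (simp add: B_def ennreal_plus)
 qed
 have "limsup (%k. H1_eps_norm (e k) (\<Psi> l k)) <= ennreal B" for l
 by (rule Limsup_bounded) (rule eventually_mono[OF eventually_ge_at_top[of "Suc l"]], rule H1b)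
 then have H1sup: "(SUP l. limsup (%k. H1_eps_norm (e k) (\<Psi> l k))) < \<infinity>"
 by (rule le_less_trans[OF SUP_least, of _ _ "ennreal B"]) auto
 have phi1: "in_L2 (phi j)" "Lp_norm 2 (phi j) <= ennreal M" for j
 using Lp_norm_to_l2[OF in_L2_l2_fun[of "F (f j)"]] fM[of j] by (auto simp: phi_def F(2) intro: ennreal_leI)
 have phi2: "in_L2 (%y. norm y *\<^sub>R phi j y)" "Lp_norm 2 (%y. norm y *\<^sub>R phi j y) <= ennreal (sqrt ?n * M)" for j
 proof -
 \<comment> \<open>\<open>F\<close> turns the phase into a translation of \<open>f j\<close>, so the
   derivative bound on the profile becomes the hypothesis of
   \<open>weighted_norm_le\<close>.\<close>
 have bd: "norm (wop (%y. exp (- \<i> * of_real (inner (eta *\<^sub>R axis i 1) y))) 1 0 (F (f j)) - F (f j)) <= M * eta" if eta: "eta > 0" for i eta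
 proof -
 have "norm (wop (%y. exp (- \<i> * of_real (inner (eta *\<^sub>R axis i 1) y))) 1 0 (F (f j)) - F (f j)) = norm (tr (eta *\<^sub>R axis i 1) (f j) - f j)"
 unfolding F(4)[symmetric] linear_diff[OF bounded_linear.linear[OF F(1)], symmetric] F(2) ..
 also have "... <= norm (H j i) * \<bar>eta\<bar>" by (rule gder_bound[OF H(1)])
 also have "... <= M * eta" using H(2) eta by (auto intro: mult_right_mono)
 finally show ?thesis .
 qed
 show "in_L2 (%y. norm y *\<^sub>R phi j y)" "Lp_norm 2 (%y. norm y *\<^sub>R phi j y) <= ennreal (sqrt ?n * M)"
 unfolding phi_def using weighted_norm_le[OF less_imp_le[OF M] bd] by blast+
 qed
 have phisup: "(SUP j. Lp_norm 2 (phi j) + Lp_norm 2 (%y. norm y *\<^sub>R phi j y)) < \<infinity>"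
 by (rule le_less_trans[OF SUP_least, of _ _ "ennreal M + ennreal (sqrt ?n * M)"]) (auto intro!: add_mono phi1 phi2)
 have phin: "\<not> (AE y in lborel. phi 0 y = 0)"
 proof
 assume "AE y in lborel. phi 0 y = 0"
 then have "Lp_norm 2 (phi 0) = Lp_norm 2 (%_ :: real ^ 'n. 0 :: complex)" by (intro Lp_norm_cong_AE) auto
 then have "ennreal (norm (F (f 0))) = ennreal 0"
 using Lp_norm_to_l2[OF in_L2_l2_fun[of "F (f 0)"]] by (simp add: phi_def Lp_norm_2)
 then show False using fn by (simp add: F(2))
 qed
 have remL: "in_L2 (\<rho> l k)" "to_l2 (\<rho> l k) = scl (e k) (w (r k) - P l k)" for l k
 proof -
 have ue: "in_L2 (u0 (e k))" by (rule L[OF e])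
 show "in_L2 (\<rho> l k)" unfolding \<rho>_def \<Psi>_def by (intro in_L2_diff ue in_L2_l2_fun)
 show "to_l2 (\<rho> l k) = scl (e k) (w (r k) - P l k)"
 using scl_scl_inverse[OF e(1)[of k], of "to_l2 (u0 (e k))"]
 unfolding \<rho>_def \<Psi>_def by (simp add: to_l2_diff ue linear_diff[OF bounded_linear.linear[OF scl_bounded_linear[OF e(1)]]] w_def e_def[symmetric])
 qed
 have remlim: "(%l. limsup (%k. esssup (restrict_space lborel {0..}) (%s. Lp_eps_norm \<sigma> (e k) (free_propagator (e k) s (\<rho> l k))))) \<longlonglongrightarrow> 0"
 proof (rule ennreal_tendsto_0I)
 fix eta :: real assume eta: "eta > 0"
 \<comment> \<open>Inverts the root taken in \<open>esssup_propagator_le\<close>.\<close>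
 define \<beta> where "\<beta> = eta powr ?p"
 have \<beta>: "\<beta> > 0" "\<beta> powr (1 / ?p) = eta" using eta p by (auto simp: \<beta>_def powr_powr)
 from rem[OF \<beta>(1)] have "\<forall>\<^sub>F l in sequentially. \<forall>\<^sub>F k in sequentially. \<forall>u\<ge>0. Ip ?p (l2_fun (schr u (w (r k) - P l k))) <= ennreal \<beta>"
 unfolding P_def by (subst (asm) eventually_sequentially_Suc[symmetric])
 then show "\<forall>\<^sub>F l in sequentially. limsup (%k. esssup (restrict_space lborel {0..}) (%s. Lp_eps_norm \<sigma> (e k) (free_propagator (e k) s (\<rho> l k)))) <= ennreal eta"
 proof eventually_elim
 case (elim l)
 show ?case
 proof (rule Limsup_bounded)
 show "\<forall>\<^sub>F k in sequentially. esssup (restrict_space lborel {0..}) (%s. Lp_eps_norm \<sigma> (e k) (free_propagator (e k) s (\<rho> l k))) <= ennreal eta"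
 using elim
 proof eventually_elim
 case (elim k)
 show ?case
 using esssup_propagator_le[OF remL(1) e(1) \<sigma> less_imp_le[OF \<beta>(1)] remL(2)] elim \<beta>(2) by simp
 qed
 qed
 qed
 qed
 have prof: "(%k. Lp_norm 2 (%y. \<Psi> l k y - (\<Sum>j\<le>l. quadratic_profile (e k) (t j k) (x j k) (phi j) y))) \<longlonglongrightarrow> 0" for l
 proof -
 \<comment> \<open>The difference between the moved profile and its large time form. Isometry
   reduces it to the distance between \<open>qop\<close> of the backward evolution and its limit
   under \<open>F\<close>, and the times \<open>s j k\<close> diverge.\<close>
 define d where "d j k = galilei (- g j (r k)) (f j) - tr (- snd (g j (r k))) (qinv (s j k) (F (f j)))" for j k
 have d0: "(%k. norm (d j k)) \<longlonglongrightarrow> 0" for j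
 proof (rule Lim_transform_eventually)
 have "(%k. qop (s j k) (schr (- s j k) (f j))) \<longlonglongrightarrow> F (f j)" by (rule filterlim_compose[OF F(3) stop])
 then show "(%k. norm (qop (s j k) (schr (- s j k) (f j)) - F (f j))) \<longlonglongrightarrow> 0" by (intro tendsto_norm_zero LIM_zero)
 show "\<forall>\<^sub>F k in sequentially. norm (qop (s j k) (schr (- s j k) (f j)) - F (f j)) = norm (d j k)"
 using eventually_ge_at_top[of j]
 proof eventually_elim
 case (elim k)
 have "d j k = tr (- snd (g j (r k))) (schr (- s j k) (f j) - qinv (s j k) (F (f j)))"
 using elim by (simp only: d_def galilei_def sg(1) fst_uminus snd_uminus schr_tr linear_diff[OF R.T_linear])
 then show ?case by (simp only: R.T_norm qinv_diff[OF s])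
 qed
 qed
 have "Lp_norm 2 (%y. \<Psi> l k y - (\<Sum>j\<le>l. quadratic_profile (e k) (t j k) (x j k) (phi j) y)) <= ennreal (\<Sum>j<Suc l. norm (d j k))" for k
 proof -
 note q = quadratic_profile_l2[OF e(1)[of k] s]
 have qs: "in_L2 (%y. \<Sum>j\<le>l. quadratic_profile (e k) (t j k) (x j k) (phi j) y) &
 to_l2 (%y. \<Sum>j\<le>l. quadratic_profile (e k) (t j k) (x j k) (phi j) y) = (\<Sum>j\<le>l. to_l2 (quadratic_profile (e k) (t j k) (x j k) (phi j)))"
 by (rule to_l2_sum) (auto simp: t_def x_def phi_def q)
 have "Lp_norm 2 (%y. \<Psi> l k y - (\<Sum>j\<le>l. quadratic_profile (e k) (t j k) (x j k) (phi j) y))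
 = ennreal (norm (scl (e k) (P l k) - (\<Sum>j\<le>l. scl (e k) (tr (- snd (g j (r k))) (qinv (s j k) (F (f j)))))))"
 unfolding \<Psi>_def using qs by (subst Lp_norm_to_l2) (auto simp: in_L2_diff to_l2_diff t_def x_def phi_def q)
 also have "scl (e k) (P l k) - (\<Sum>j\<le>l. scl (e k) (tr (- snd (g j (r k))) (qinv (s j k) (F (f j))))) = scl (e k) (\<Sum>j<Suc l. d j k)"
 unfolding P_def d_def lessThan_Suc_atMost sum_subtractf linear_diff[OF bounded_linear.linear[OF scl_bounded_linear[OF e(1)]]]
 linear_sum[OF bounded_linear.linear[OF scl_bounded_linear[OF e(1)]]] ..
 also have "norm (scl (e k) (\<Sum>j<Suc l. d j k)) = norm (\<Sum>j<Suc l. d j k)" by (rule norm_scl[OF e(1)])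
 finally show ?thesis using norm_sum[of "%j. d j k" "{..<Suc l}"] by (simp only: ennreal_leI)
 qed
 moreover have "(%k. ennreal (\<Sum>j<Suc l. norm (d j k))) \<longlonglongrightarrow> ennreal (\<Sum>j<Suc l. 0)"
 by (intro tendsto_ennrealI tendsto_sum d0)
 ultimately have lim: "(%k. ennreal (\<Sum>j<Suc l. norm (d j k))) \<longlonglongrightarrow> 0"
 and le: "!!k. Lp_norm 2 (%y. \<Psi> l k y - (\<Sum>j\<le>l. quadratic_profile (e k) (t j k) (x j k) (phi j) y)) <= ennreal (\<Sum>j<Suc l. norm (d j k))"
 by (simp_all only: sum.neutral_const ennreal_0)
 show ?thesis
 proof (rule tendsto_sandwich[where f = "%_. 0" and h = "%k. ennreal (\<Sum>j<Suc l. norm (d j k))"])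
 show "\<forall>\<^sub>F k in sequentially. 0 <= Lp_norm 2 (%y. \<Psi> l k y - (\<Sum>j\<le>l. quadratic_profile (e k) (t j k) (x j k) (phi j) y))"
 by (intro always_eventually allI zero_le)
 show "\<forall>\<^sub>F k in sequentially. Lp_norm 2 (%y. \<Psi> l k y - (\<Sum>j\<le>l. quadratic_profile (e k) (t j k) (x j k) (phi j) y)) <= ennreal (\<Sum>j<Suc l. norm (d j k))"
 by (intro always_eventually allI le)
 qed (rule tendsto_const, rule lim)
 qed
 \<comment> \<open>The imposed first profile keeps the original time, which lies in
   \<open>[0, T]\<close>.\<close>
 have t0: "t 0 k = \<tau> (r k)" for k using e(1)[of k] by (simp add: t_def s_def g0 e_def)
 have "0 <= limsup (%k. ereal (t 0 k))" by (rule le_Limsup[OF sequentially_bot]) (simp add: t0 \<tau>(1))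
 moreover have "limsup (%k. ereal (t 0 k)) <= ereal T" by (rule Limsup_bounded) (simp add: t0 \<tau>(2))
 ultimately have t0T: "limsup (%k. ereal (t 0 k)) \<in> {0..ereal T}" by simp
 show ?thesis
 proof (rule exI[of _ e], rule exI[of _ t], rule exI[of _ x], rule exI[of _ \<Psi>], rule exI[of _ \<rho>], rule exI[of _ phi], intro conjI)
 show "\<forall>k. 0 < e k & e k <= 1" using e by blast
 show "\<forall>j k. t j k > 0" using e s by (simp add: t_def)
 show "\<forall>l k. in_H1 (\<Psi> l k)" using H1(1) by blast
 show "\<forall>j. in_L2 (phi j) & in_L2 (%y. norm y *\<^sub>R phi j y)" using phi1 phi2 by blast
 show "\<exists>j. \<not> (AE y in lborel. phi j y = 0)" using phin by blast
 show "\<forall>l k. AE y in lborel. u0 (e k) y = \<Psi> l k y + \<rho> l k y" by (simp add: \<rho>_def)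
 show "\<forall>l. (%k. Lp_norm 2 (%y. \<Psi> l k y - (\<Sum>j\<le>l. quadratic_profile (e k) (t j k) (x j k) (phi j) y))) \<longlonglongrightarrow> 0" using prof by blast
 show "\<forall>j. limsup (%k. ereal (t j k / e k)) = \<infinity>" unfolding te by (intro allI limsup_ereal_top sq)
 show "\<exists>j. limsup (%k. ereal (t j k)) \<in> {0..ereal T}" using t0T by blast
 qed (fact elim orthogonal H1sup phisup remlim)+
qed

end
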